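(* Let $(\mathcal Q,d,\mathcal E)$ be as in the context. For every $\varepsilon>0$ let $q_\varepsilon\in \mathrm{AC}([0,T];\mathcal Q)$ satisfy $$\frac{\mathrm d}{\mathrm dt}\mathcal E(t,q_\varepsilon(t))\le \partial_t\mathcal E(t,q_\varepsilon(t))-\psi_\varepsilon\big(|q_\varepsilon'|(t)\big)-\psi_\varepsilon^*\big(|\partial_q\mathcal E|(t,q_\varepsilon(t))\big)\quad\text{for a.a. }t\in(0,T),$$ where $\psi_\varepsilon(\nu)=\nu+\frac{\varepsilon}{2}\nu^2$ and $\psi_\varepsilon^*(\xi)=\frac1{2\varepsilon}\big((\xi-1)^+\big)^2$ for $\nu,\xi\ge 0$. Choose nondecreasing surjective parametrizations $\hat t_\varepsilon\in \mathrm{AC}([s_0,s_1];[t_{0,\varepsilon},T])$ and let $\hat q_\varepsilon(s)=q_\varepsilon(\hat t_\varepsilon(s))$. Suppose that there exist $q_0\in\mathcal Q$ and $m\in L^1(s_0,s_1)$ such that, as $\varepsilon\searrow0$, $$t_{0,\varepsilon}=\hat t_\varepsilon(s_0)\to 0,\qquad \hat q_\varepsilon(s_0)=q_\varepsilon(t_{0,\varepsilon})\to q_0,\qquad m_\varepsilon:=\hat t_\varepsilon'+|\hat q_\varepsilon'|\rightharpoonup m\ \text{ weakly in }L^1(s_0,s_1).$$ Then there exist a subsequence $(\hat t_{\varepsilon_k},\hat q_{\varepsilon_k})_{k\in\mathbb N}$ with $\varepsilon_k\searrow0$ and $(\hat t,\hat q)\in \mathrm{AC}([s_0,s_1];[0,T]\times\mathcal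 Q)$ such that $(\hat t(s_0),\hat q(s_0))=(0,q_0)$ and, as $k\to\infty$, $$(\hat t_{\varepsilon_k},\hat q_{\varepsilon_k})\to(\hat t,\hat q)\ \text{ in } C^0([s_0,s_1];[0,T]\times\mathcal Q),$$ $$(\hat t_{\varepsilon_k}',|\hat q_{\varepsilon_k}'|)\rightharpoonup(\hat t',|\hat q'|)\ \text{ weakly in }L^1([s_0,s_1];\mathbb R^2),\qquad \int_{t_{0,\varepsilon_k}}^T|q_{\varepsilon_k}'|(t)\,\mathrm dt\to\int_{s_0}^{s_1}|\hat q'|(s)\,\mathrm ds.$$ The limit $(\hat t,\hat q)$ is a degenerate parametrized metric solution of $(\mathcal Q,d,\mathcal E)$, and it is nondegenerate (i.e. it is a parametrized metric solution) if $m(s)>0$ for a.a. $s\in(s_0,s_1)$.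
   Context: Setting. $T>0$; $\mathcal Q$ is a finite-dimensional smooth manifold; $\mathcal Q_T:=[0,T]\times\mathcal Q$; $\mathcal E\in C^1(\mathcal Q_T)$ is real-valued, with differential $\mathrm D_q\mathcal E(t,q)\in \mathrm T_q^*\mathcal Q$ in $q$. $\mathcal R_1:\mathrm T\mathcal Q\to[0,\infty)$ is continuous and $\mathcal R_1(q,\cdot)$ is a norm on $\mathrm T_q\mathcal Q$ for every $q$. The distance $d:\mathcal Q\times\mathcal Q\to[0,\infty)$ is $d(q_0,q_1)=\min\{\int_0^1\mathcal R_1(y(s),y'(s))\,\mathrm ds:\ y\in \mathrm{AC}([0,1],\mathcal Q),\ y(0)=q_0,\ y(1)=q_1\}$, and $(\mathcal Q,d)$ is assumed complete. For an absolutely continuous curve $q$, $|q'|(t):=\mathcal R_1(q(t),q'(t))$. The local slope is $|\partial_q\mathcal E|(t,q):=\sup_{v\in \mathrm T_q\mathcal Q\setminus\{0\}}\frac{\langle \mathrm D_q\mathcal E(t,q),v\rangle}{\mathcal R_1(q,v)}$. $(\cdot)^+$ is the positive part. Parametrized metric solutions. Let $\Xi\subset[0,\infty)^3$ be the union of $\{(\alpha,0,\xi):\alpha\ge0,\ \xi\in[0,1)\}$, $\{(\alpha,\nu,1):\alpha>0,\ \nu\ge0\}$ and $\{(0,\nu,\xi):\nu\ge0,\ \xi\ge1\}$. Let $M:[0,\infty)^3\to[0,\infty]$ be any function which is lower semicontinuous, satisfies $M(\gamma\alpha,\gamma\nu,\xi)=\gamma M(\alpha,\nu,\xi)$ for all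 $\alpha,\nu,\xi,\gamma\ge0$, $M(\alpha,\nu,\xi)\ge\nu\xi$ for all $\alpha,\nu,\xi\ge 0$, and $M(\alpha,\nu,\xi)=\nu\xi\iff(\alpha,\nu,\xi)\in\Xi$ (e.g. $M_0(\alpha,\nu,\xi)=\nu+\nu(\xi-1)^+$ if $\alpha=0$; for $\alpha>0$, $M_0=\nu$ if $\xi\le1$ and $M_0=\infty$ if $\xi>1$). The notions below do not depend on the choice of $M$. An absolutely continuous curve $(\hat t,\hat q):(s_0,s_1)\to\mathcal Q_T$ is a parametrized metric solution of $(\mathcal Q,d,\mathcal E)$ if (a) $\hat t$ is nondecreasing; (b) $\hat t'(s)+|\hat q'|(s)>0$ for a.a. $s$; (c) $\frac{\mathrm d}{\mathrm ds}\mathcal E(\hat t(s),\hat q(s))-\partial_t\mathcal E(\hat t(s),\hat q(s))\hat t'(s)\le -M\big(\hat t'(s),|\hat q'|(s),|\partial_q\mathcal E|(\hat t(s),\hat q(s))\big)$ for a.a. $s$. If only (a) and (c) are required, it is called a degenerate parametrized metric solution (nondegenerate means that (b) holds as well). *)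

theory Defs
  imports "HOL-Analysis.Analysis"
begin

section \<open>Smooth manifolds and tangent vectors\<close>

text \<open>
  The manifold is a whole Hausdorff, second countable type \<open>'q\<close> with a smooth atlas, modelled on a
  Euclidean space \<open>'e\<close>. A chart is a pair \<open>(U, \<phi>)\<close>; the values of \<open>\<phi>\<close> outside \<open>U\<close> are irrelevant.
\<close>

type_synonym ('q, 'e) chart = "'q set \<times> ('q \<Rightarrow> 'e)"

abbreviation chart_dom :: "('q, 'e) chart \<Rightarrow> 'q set" where
  "chart_dom \<equiv> fst"

abbreviation chart_map :: "('q, 'e) chart \<Rightarrow> 'q \<Rightarrow> 'e" where
  "chart_map \<equiv> snd"

definition chart_img :: "('q, 'e) chart \<Rightarrow> 'e set" where
  "chart_img c = chart_map c ` chart_dom c"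

definition chart_inv :: "('q, 'e) chart \<Rightarrow> 'e \<Rightarrow> 'q" where
  "chart_inv c = inv_into (chart_dom c) (chart_map c)"

definition transition :: "('q, 'e) chart \<Rightarrow> ('q, 'e) chart \<Rightarrow> 'e \<Rightarrow> 'e" where
  "transition c c' = chart_map c' \<circ> chart_inv c"

text \<open>Intended for open \<open>S\<close>: \<open>f\<close> is of class \<open>C\<^sup>k\<close> on \<open>S\<close>.\<close>

primrec Ck_on :: "nat \<Rightarrow> 'a::euclidean_space set \<Rightarrow> ('a \<Rightarrow> 'b::euclidean_space) \<Rightarrow> bool" where
  "Ck_on 0 S f \<longleftrightarrow> continuous_on S f"
| "Ck_on (Suc k) S f \<longleftrightarrow>
     (\<forall>x\<in>S. f differentiable (at x)) \<and> (\<forall>v. Ck_on k S (\<lambda>x. frechet_derivative f (at x) v))"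

definition smooth_atlas ::
  "('q::{second_countable_topology,t2_space}, 'e::euclidean_space) chart set \<Rightarrow> bool" where
  "smooth_atlas A \<longleftrightarrow>
     (\<Union>c\<in>A. chart_dom c) = UNIV \<and>
     (\<forall>c\<in>A. open (chart_dom c) \<and> open (chart_img c) \<and>
        homeomorphism (chart_dom c) (chart_img c) (chart_map c) (chart_inv c)) \<and>
     (\<forall>c\<in>A. \<forall>c'\<in>A. \<forall>k.
        Ck_on k (chart_map c ` (chart_dom c \<inter> chart_dom c')) (transition c c'))"

definition charts_at :: "('q, 'e) chart set \<Rightarrow> 'q \<Rightarrow> ('q, 'e) chart set" where
  "charts_at A q = {c \<in> A. q \<in> chart_dom c}"

text \<open>
  A tangent vector at \<open>q\<close> is the family of its coordinate vectors in the charts around \<open>q\<close>; the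
  coordinates transform by the differentials of the transition maps. For charts not containing \<open>q\<close>
  the family takes the value \<open>0\<close>, so that linear operations and equality are those of functions.
\<close>

type_synonym ('q, 'e) tvec = "('q, 'e) chart \<Rightarrow> 'e"

definition tangent_space ::
  "('q, 'e::euclidean_space) chart set \<Rightarrow> 'q \<Rightarrow> ('q, 'e) tvec set" where
  "tangent_space A q =
     {v. (\<forall>c\<in>charts_at A q. \<forall>c'\<in>charts_at A q.
            v c' = frechet_derivative (transition c c') (at (chart_map c q)) (v c)) \<and>
         (\<forall>c. c \<notin> charts_at A q \<longrightarrow> v c = 0)}"

text \<open>The tangent vector at \<open>q\<close> whose coordinate vector in the chart \<open>c\<close> around \<open>q\<close> is \<open>w\<close>.\<close>

definition tangent_of ::
  "('q, 'e::euclidean_space) chart set \<Rightarrow> ('q, 'e) chart \<Rightarrow> 'q \<Rightarrow> 'e \<Rightarrow> ('q, 'e) tvec" where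
  "tangent_of A c q w =
     (\<lambda>c'. if c' \<in> charts_at A q
           then frechet_derivative (transition c c') (at (chart_map c q)) w else 0)"

section \<open>Absolutely continuous curves and the Finsler distance\<close>

definition abs_cont_on :: "real \<Rightarrow> real \<Rightarrow> (real \<Rightarrow> 'b::real_normed_vector) \<Rightarrow> bool" where
  "abs_cont_on a b f \<longleftrightarrow>
     (\<forall>e>0. \<exists>\<delta>>0. \<forall>D S. D division_of S \<and> S \<subseteq> {a..b} \<and> (\<Sum>K\<in>D. Sup K - Inf K) < \<delta> \<longrightarrow>
        (\<Sum>K\<in>D. norm (f (Sup K) - f (Inf K))) < e)"

definition ac_curve ::
  "('q::topological_space, 'e::euclidean_space) chart set \<Rightarrow> real \<Rightarrow> real \<Rightarrow> (real \<Rightarrow> 'q) \<Rightarrow> bool" where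
  "ac_curve A a b y \<longleftrightarrow> continuous_on {a..b} y \<and>
     (\<forall>c\<in>A. \<forall>u v. a \<le> u \<and> u \<le> v \<and> v \<le> b \<and> y ` {u..v} \<subseteq> chart_dom c \<longrightarrow>
        abs_cont_on u v (chart_map c \<circ> y))"

definition velocity ::
  "('q, 'e::euclidean_space) chart set \<Rightarrow> (real \<Rightarrow> 'q) \<Rightarrow> real \<Rightarrow> ('q, 'e) tvec" where
  "velocity A y s =
     (\<lambda>c. if c \<in> charts_at A (y s) then vector_derivative (chart_map c \<circ> y) (at s) else 0)"

text \<open>
  \<open>R q v\<close> is only meaningful for \<open>v \<in> tangent_space A q\<close>. Continuity on the tangent bundle is
  continuity in the bundle charts \<open>(x, w)\<close> induced by the charts of the manifold.
\<close>

definition finsler_structure ::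
  "('q, 'e::euclidean_space) chart set \<Rightarrow> ('q \<Rightarrow> ('q, 'e) tvec \<Rightarrow> real) \<Rightarrow> bool" where
  "finsler_structure A R \<longleftrightarrow>
     (\<forall>q. \<forall>v\<in>tangent_space A q. 0 \<le> R q v \<and> (R q v = 0 \<longleftrightarrow> v = (\<lambda>c. 0))) \<and>
     (\<forall>q. \<forall>v\<in>tangent_space A q. \<forall>a. R q (\<lambda>c. a *\<^sub>R v c) = \<bar>a\<bar> * R q v) \<and>
     (\<forall>q. \<forall>v\<in>tangent_space A q. \<forall>w\<in>tangent_space A q.
        R q (\<lambda>c. v c + w c) \<le> R q v + R q w) \<and>
     (\<forall>c\<in>A. continuous_on (chart_img c \<times> UNIV)
        (\<lambda>(x, w). R (chart_inv c x) (tangent_of A c (chart_inv c x) w)))"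

definition speed ::
  "('q, 'e::euclidean_space) chart set \<Rightarrow> ('q \<Rightarrow> ('q, 'e) tvec \<Rightarrow> real) \<Rightarrow>
   (real \<Rightarrow> 'q) \<Rightarrow> real \<Rightarrow> real" where
  "speed A R y s = R (y s) (velocity A y s)"

definition connecting_lengths ::
  "('q::topological_space, 'e::euclidean_space) chart set \<Rightarrow> ('q \<Rightarrow> ('q, 'e) tvec \<Rightarrow> real) \<Rightarrow>
   'q \<Rightarrow> 'q \<Rightarrow> real set" where
  "connecting_lengths A R q0 q1 =
     {integral {0..1} (speed A R y) | y. ac_curve A 0 1 y \<and> y 0 = q0 \<and> y 1 = q1}"

text \<open>
  The infimum is taken over a nonempty set only if \<open>q0\<close> and \<open>q1\<close> can be connected; it is a minimum
  when the space is complete.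
\<close>

definition finsler_dist ::
  "('q::topological_space, 'e::euclidean_space) chart set \<Rightarrow> ('q \<Rightarrow> ('q, 'e) tvec \<Rightarrow> real) \<Rightarrow>
   'q \<Rightarrow> 'q \<Rightarrow> real" where
  "finsler_dist A R q0 q1 = Inf (connecting_lengths A R q0 q1)"

section \<open>The energy and its slope\<close>

text \<open>
  An energy is a function of \<open>t\<close> and \<open>q\<close> whose values are relevant for \<open>t \<in> {0..T}\<close> only; at
  \<open>t = 0\<close> and \<open>t = T\<close> time derivatives are one-sided.
\<close>

definition C1_energy ::
  "('q, 'e::euclidean_space) chart set \<Rightarrow> real \<Rightarrow> (real \<Rightarrow> 'q \<Rightarrow> real) \<Rightarrow> bool" where
  "C1_energy A T E \<longleftrightarrow>
     (\<forall>c\<in>A. \<exists>D :: real \<times> 'e \<Rightarrow> (real \<times> 'e) \<Rightarrow>\<^sub>L real.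
        continuous_on ({0..T} \<times> chart_img c) D \<and>
        (\<forall>p\<in>{0..T} \<times> chart_img c.
           ((\<lambda>(t, x). E t (chart_inv c x)) has_derivative blinfun_apply (D p))
             (at p within {0..T} \<times> chart_img c)))"

definition time_deriv :: "real \<Rightarrow> (real \<Rightarrow> 'q \<Rightarrow> real) \<Rightarrow> real \<Rightarrow> 'q \<Rightarrow> real" where
  "time_deriv T E t q = vector_derivative (\<lambda>\<tau>. E \<tau> q) (at t within {0..T})"

text \<open>The pairing of the differential of \<open>E t\<close> at \<open>q\<close> with \<open>v\<close>; it does not depend on the chart.\<close>

definition space_diff ::
  "('q, 'e::euclidean_space) chart set \<Rightarrow> (real \<Rightarrow> 'q \<Rightarrow> real) \<Rightarrow> real \<Rightarrow> 'q \<Rightarrow>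
   ('q, 'e) tvec \<Rightarrow> real" where
  "space_diff A E t q v =
     (let c = (SOME c. c \<in> charts_at A q)
      in frechet_derivative (E t \<circ> chart_inv c) (at (chart_map c q)) (v c))"

definition slope ::
  "('q, 'e::euclidean_space) chart set \<Rightarrow> ('q \<Rightarrow> ('q, 'e) tvec \<Rightarrow> real) \<Rightarrow>
   (real \<Rightarrow> 'q \<Rightarrow> real) \<Rightarrow> real \<Rightarrow> 'q \<Rightarrow> real" where
  "slope A R E t q = (SUP v\<in>tangent_space A q - {\<lambda>c. 0}. space_diff A E t q v / R q v)"

section \<open>Parametrized metric solutions\<close>

definition Xi_set :: "(real \<times> real \<times> real) set" where
  "Xi_set = {(\<alpha>, 0, \<xi>) | \<alpha> \<xi>. 0 \<le> \<alpha> \<and> 0 \<le> \<xi> \<and> \<xi> < 1} \<union>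
            {(\<alpha>, \<nu>, 1) | \<alpha> \<nu>. 0 < \<alpha> \<and> 0 \<le> \<nu>} \<union>
            {(0, \<nu>, \<xi>) | \<nu> \<xi>. 0 \<le> \<nu> \<and> 1 \<le> \<xi>}"

definition nonneg_octant :: "(real \<times> real \<times> real) set" where
  "nonneg_octant = {0..} \<times> {0..} \<times> {0..}"

text \<open>For \<open>\<gamma> = 0\<close> homogeneity uses the convention \<open>0 \<cdot> \<infinity> = 0\<close> of \<^typ>\<open>ennreal\<close>.\<close>

definition admissible_M :: "(real \<times> real \<times> real \<Rightarrow> ennreal) \<Rightarrow> bool" where
  "admissible_M M \<longleftrightarrow>
     (\<forall>p\<in>nonneg_octant. M p \<le> Liminf (at p within nonneg_octant) M) \<and>
     (\<forall>\<alpha>\<ge>0. \<forall>\<nu>\<ge>0. \<forall>\<xi>\<ge>0. \<forall>\<gamma>\<ge>0. M (\<gamma> * \<alpha>, \<gamma> * \<nu>, \<xi>) = ennreal \<gamma> * M (\<alpha>, \<nu>, \<xi>)) \<and>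
     (\<forall>\<alpha>\<ge>0. \<forall>\<nu>\<ge>0. \<forall>\<xi>\<ge>0. ennreal (\<nu> * \<xi>) \<le> M (\<alpha>, \<nu>, \<xi>)) \<and>
     (\<forall>\<alpha>\<ge>0. \<forall>\<nu>\<ge>0. \<forall>\<xi>\<ge>0. M (\<alpha>, \<nu>, \<xi>) = ennreal (\<nu> * \<xi>) \<longleftrightarrow> (\<alpha>, \<nu>, \<xi>) \<in> Xi_set)"

text \<open>
  As \<open>'q\<close> is complete, an absolutely continuous curve on the open interval \<open>(s0, s1)\<close> extends to
  the closed one, so absolute continuity is stated on \<open>{s0..s1}\<close>. The energy inequality is stated in
  \<^typ>\<open>ereal\<close>, as \<open>M\<close> may be infinite.
\<close>

definition degenerate_param_solution ::
  "('q::topological_space, 'e::euclidean_space) chart set \<Rightarrow> ('q \<Rightarrow> ('q, 'e) tvec \<Rightarrow> real) \<Rightarrow>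
   real \<Rightarrow> (real \<Rightarrow> 'q \<Rightarrow> real) \<Rightarrow> (real \<times> real \<times> real \<Rightarrow> ennreal) \<Rightarrow> real \<Rightarrow> real \<Rightarrow>
   (real \<Rightarrow> real) \<Rightarrow> (real \<Rightarrow> 'q) \<Rightarrow> bool" where
  "degenerate_param_solution A R T E M s0 s1 t q \<longleftrightarrow>
     abs_cont_on s0 s1 t \<and> t ` {s0..s1} \<subseteq> {0..T} \<and> ac_curve A s0 s1 q \<and>
     mono_on {s0..s1} t \<and>
     (AE s\<in>{s0<..<s1} in lebesgue.
        \<exists>e'. ((\<lambda>r. E (t r) (q r)) has_real_derivative e') (at s) \<and>
          ereal (e' - time_deriv T E (t s) (q s) * deriv t s)
            \<le> - enn2ereal (M (deriv t s, speed A R q s, slope A R E (t s) (q s))))"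

definition param_solution ::
  "('q::topological_space, 'e::euclidean_space) chart set \<Rightarrow> ('q \<Rightarrow> ('q, 'e) tvec \<Rightarrow> real) \<Rightarrow>
   real \<Rightarrow> (real \<Rightarrow> 'q \<Rightarrow> real) \<Rightarrow> (real \<times> real \<times> real \<Rightarrow> ennreal) \<Rightarrow> real \<Rightarrow> real \<Rightarrow>
   (real \<Rightarrow> real) \<Rightarrow> (real \<Rightarrow> 'q) \<Rightarrow> bool" where
  "param_solution A R T E M s0 s1 t q \<longleftrightarrow>
     degenerate_param_solution A R T E M s0 s1 t q \<and>
     (AE s\<in>{s0<..<s1} in lebesgue. deriv t s + speed A R q s > 0)"

section \<open>Viscous approximation and weak convergence\<close>

definition psi :: "real \<Rightarrow> real \<Rightarrow> real" where
  "psi \<epsilon> \<nu> = \<nu> + \<epsilon> / 2 * \<nu>\<^sup>2"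

definition psi_star :: "real \<Rightarrow> real \<Rightarrow> real" where
  "psi_star \<epsilon> \<xi> = 1 / (2 * \<epsilon>) * (max 0 (\<xi> - 1))\<^sup>2"

text \<open>Weak convergence in \<open>L\<^sup>1\<close>, tested against the functions \<open>g\<close> in \<open>L\<^sup>\<infinity>\<close>.\<close>

definition weak_L1_limit ::
  "real \<Rightarrow> real \<Rightarrow> ('i \<Rightarrow> real \<Rightarrow> 'b::euclidean_space) \<Rightarrow> (real \<Rightarrow> 'b) \<Rightarrow> 'i filter \<Rightarrow> bool" where
  "weak_L1_limit a b f l F \<longleftrightarrow>
     (\<forall>\<^sub>F i in F. f i absolutely_integrable_on {a..b}) \<and> l absolutely_integrable_on {a..b} \<and>
     (\<forall>g. g \<in> borel_measurable (lebesgue_on {a..b}) \<and>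
          (\<exists>C. AE s in lebesgue_on {a..b}. norm (g s) \<le> C) \<longrightarrow>
        ((\<lambda>i. integral {a..b} (\<lambda>s. f i s \<bullet> g s)) \<longlongrightarrow> integral {a..b} (\<lambda>s. l s \<bullet> g s)) F)"

end

theory Submission
  imports Defs "HOL-Library.Diagonal_Subsequence"
begin

text \<open>
  Since \<open>\<psi>\<^sub>\<epsilon>(\<nu>) + \<psi>\<^sub>\<epsilon>\<^sup>*(\<xi>) \<ge> \<nu> max(1, \<xi>)\<close>, the energy inequality integrates, after the
  change of variables \<open>t = t\<^sub>\<epsilon>(s)\<close>, to an upper bound for the final energy by the initial energy, the
  work of \<open>\<partial>\<^sub>tE\<close> and \<open>- \<integral> |q\<^sub>\<epsilon>'| max(1, \<xi>\<^sub>\<epsilon>)\<close>, where \<open>\<xi>\<^sub>\<epsilon>\<close> is the slope along the curve. The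
  same inequality multiplied by \<open>\<epsilon>\<close> bounds \<open>\<integral> t\<^sub>\<epsilon>' ((\<xi>\<^sub>\<epsilon> - 1)\<^sup>+)\<^sup>2\<close> by \<open>O(\<epsilon>)\<close>.

  Weak convergence of \<open>m\<^sub>\<epsilon>\<close> makes the parametrized curves equicontinuous, and completeness yields a
  uniformly convergent subsequence. Its time components determine the weak limit of \<open>t\<^sub>\<epsilon>'\<close>, so
  \<open>|q\<^sub>\<epsilon>'|\<close> converges weakly to \<open>\<nu> = m - t'\<close>, and \<open>|q'| \<le> \<nu>\<close>. As the slope is continuous,
  both integrals pass to the limit. The chain rule gives \<open>(d/ds) E - \<partial>\<^sub>tE t' \<ge> - \<xi> |q'|\<close> for the limit
  curve; compared with the limit inequality it forces \<open>\<nu> max(1, \<xi>) = \<xi> |q'|\<close> a.e. Hence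
  \<open>|q'| = \<nu>\<close> and \<open>\<nu> = 0\<close> or \<open>\<xi> \<ge> 1\<close>, while the second integral gives \<open>t' = 0\<close> or \<open>\<xi> \<le> 1\<close>. This is
  exactly \<open>(t', |q'|, \<xi>) \<in> \<Xi>\<close>, where \<open>M = \<nu> \<xi>\<close>.
\<close>

section \<open>Absolute continuity\<close>

text \<open>Uniform convergence makes length only lower semicontinuous: oscillations of the
  approximations may leave the weak limit \<nu> of their speeds strictly above the speed of the
  limit curve. The dissipation excludes this because its coefficient max(1, \<xi>) is at least 1 and
  so controls \<nu> even where the slope vanishes; with the coefficient \<xi> alone nothing would
  follow there. The second integral complements the first, which says nothing about \<xi> where
  \<nu> = 0. Two further obstacles are geometric. Curves are known only through charts, so
  statements about them are proved on short intervals lying in one chart and then patched together.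
  The time maps may stand still on intervals, so a null set of times can have a preimage of positive
  measure; this is harmless because the derivative of the time map vanishes at almost every point of
  such a preimage, and what is transported from the time axis carries that derivative as a
  factor.\<close>

text \<open>Bisection of the interval, packaged as an induction rule. The bounds
  \<open>a \<le> u\<close> and \<open>v \<le> b\<close> are hidden in the predicate handed to
  \<open>Bolzano\<close>, so both premises may assume that they stay inside \<open>{a..b}\<close>.
  This is the tool for cutting a curve into pieces that lie in one chart.\<close>

lemma interval_patching [consumes 1, case_names trans local]:
  fixes P :: "real \<Rightarrow> real \<Rightarrow> bool"
  assumes "a \<le> b"
    and trans: "\<And>u v w. a \<le> u \<Longrightarrow> u \<le> v \<Longrightarrow> v \<le> w \<Longrightarrow> w \<le> b \<Longrightarrow> P u v \<Longrightarrow> P v w \<Longrightarrow> P u w"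
    and local: "\<And>x. a \<le> x \<Longrightarrow> x \<le> b \<Longrightarrow>
      \<exists>d>0. \<forall>u v. a \<le> u \<and> u \<le> x \<and> x \<le> v \<and> v \<le> b \<and> v - u < d \<longrightarrow> P u v"
  shows "P a b"
proof -
  let ?P = "\<lambda>u v. a \<le> u \<longrightarrow> v \<le> b \<longrightarrow> P u v"
  have "?P a b" using assms(1)
  proof (rule Bolzano[where P = ?P])
    show "\<And>u v w. ?P u v \<Longrightarrow> ?P v w \<Longrightarrow> u \<le> v \<Longrightarrow> v \<le> w \<Longrightarrow> ?P u w"
      using trans by (meson order.trans)
    show "\<exists>d>0. \<forall>u v. u \<le> x \<and> x \<le> v \<and> v - u < d \<longrightarrow> ?P u v" if "a \<le> x" "x \<le> b" for x
      using local[OF that] by blast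
  qed
  then show ?thesis by simp
qed

lemma abs_cont_on_iff:
  "abs_cont_on a b f \<longleftrightarrow> (\<forall>e>0. \<exists>\<delta>>0. \<forall>D S. D division_of S \<longrightarrow> S \<subseteq> {a..b} \<longrightarrow> (\<Sum>K\<in>D. Sup K - Inf K) < \<delta> \<longrightarrow>
    (\<Sum>K\<in>D. norm (f (Sup K) - f (Inf K))) < e)"
  unfolding abs_cont_on_def imp_conjL ..

lemma abs_cont_onE:
  assumes "abs_cont_on a b f" "e > 0"
  obtains \<delta> where "\<delta> > 0" "\<forall>D S. D division_of S \<longrightarrow> S \<subseteq> {a..b} \<longrightarrow> (\<Sum>K\<in>D. Sup K - Inf K) < \<delta> \<longrightarrow>
    (\<Sum>K\<in>D. norm (f (Sup K) - f (Inf K))) < e"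
  using assms(1)[unfolded abs_cont_on_iff, rule_format, OF assms(2)] by (elim exE conjE)

lemma abs_cont_onI:
  assumes "\<And>e. e > 0 \<Longrightarrow> \<exists>\<delta>>0. \<forall>D S. D division_of S \<longrightarrow> S \<subseteq> {a..b} \<longrightarrow> (\<Sum>K\<in>D. Sup K - Inf K) < \<delta> \<longrightarrow>
    (\<Sum>K\<in>D. norm (f (Sup K) - f (Inf K))) < e"
  shows "abs_cont_on a b f"
  unfolding abs_cont_on_iff by (intro allI impI assms)

section \<open>Divisions and their increments\<close>

text \<open>The total length becomes the measure of the union, which is monotone in the set;
  smallness then passes to every division of a smaller set without comparing sums.\<close>

lemma division_length_sum:
  fixes D :: "real set set"
  assumes "D division_of S"
  shows "(\<Sum>K\<in>D. Sup K - Inf K) = measure lebesgue S"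
proof -
  have "(\<Sum>K\<in>D. Sup K - Inf K) = (\<Sum>K\<in>D. measure lebesgue K)"
  proof (rule sum.cong)
    fix K assume "K \<in> D"
    then obtain u v where "K = cbox u v" "K \<noteq> {}" using assms by blast
    then show "Sup K - Inf K = measure lebesgue K" by auto
  qed auto
  then show ?thesis using content_division[OF assms] by simp
qed

text \<open>The value 0 at the empty set allows a division to be intersected with an interval
  without separating off the members that miss it.\<close>

definition increment :: "(real \<Rightarrow> real) \<Rightarrow> real set \<Rightarrow> real" where
  "increment f K = (if K = {} then 0 else \<bar>f (Sup K) - f (Inf K)\<bar>)"

lemma increment_Icc: "u \<le> v \<Longrightarrow> increment f {u..v} = \<bar>f v - f u\<bar>"
  by (simp add: increment_def)

lemma increment_division:
  assumes "D division_of S"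
  shows "(\<Sum>K\<in>D. norm (f (Sup K) - f (Inf K))) = sum (increment f) D"
  using assms by (intro sum.cong) (auto simp: increment_def)

text \<open>After cutting or joining divisions, the members that coincide or shrink to a point are
  exactly of this kind, so sums over images and unions stay exact.\<close>

lemma increment_degenerate:
  assumes "interior K = {}" "K = cbox u v"
  shows "increment f K = 0"
proof (cases "u < v")
  case True
  then show ?thesis using assms by (simp add: interior_cbox)
next
  case False
  then show ?thesis using assms by (cases "u = v") (auto simp: increment_def)
qed

lemma restrict_division:
  fixes D :: "real set set" and a b :: real
  assumes D: "D division_of S"
  defines "D' \<equiv> (\<lambda>K. K \<inter> {a..b}) ` {K\<in>D. K \<inter> {a..b} \<noteq> {}}"
  shows "D' division_of (S \<inter> {a..b})" "sum (increment f) D' = (\<Sum>K\<in>D. increment f (K \<inter> {a..b}))"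
proof -
  have fin: "finite D" using D by auto
  note cb = division_ofD(4)[OF D] and int = division_ofD(5)[OF D]
  have cb': "\<exists>u v. K \<inter> {a..b} = cbox u v" if KD: "K \<in> D" for K
  proof -
    obtain u v where "K = cbox u v" using cb[OF KD] by blast
    then have "K \<inter> {a..b} = cbox (max u a) (min v b)" by auto
    then show ?thesis by blast
  qed
  show "D' division_of (S \<inter> {a..b})"
  proof (rule division_ofI)
    fix K assume "K \<in> D'"
    then obtain L where "L \<in> D" "K = L \<inter> {a..b}" unfolding D'_def by (elim imageE) (rule that, simp_all)
    then show "\<exists>a b. K = cbox a b" using cb'[of L] by simp
  next
    fix K1 K2 assume "K1 \<in> D'" "K2 \<in> D'" "K1 \<noteq> K2"
    then obtain L1 L2 where "L1 \<in> D" "L2 \<in> D" "L1 \<noteq> L2" "K1 = L1 \<inter> {a..b}" "K2 = L2 \<inter> {a..b}"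
      unfolding D'_def by blast
    then show "interior K1 \<inter> interior K2 = {}" using int[of L1 L2] by (auto simp: interior_Int)
  qed (use fin division_ofD(6)[OF D] in \<open>auto simp: D'_def\<close>)
  \<comment> \<open>Distinct members may have the same trace on \<open>{a..b}\<close>, which the
    image counts once. Such a trace lies in two members with disjoint interiors, so it has empty
    interior and increment 0.\<close>
  have "sum (increment f) D' = (\<Sum>K\<in>{K\<in>D. K \<inter> {a..b} \<noteq> {}}. increment f (K \<inter> {a..b}))"
    unfolding D'_def
  proof (subst sum.reindex_nontrivial)
    fix K L assume H: "K \<in> {K\<in>D. K \<inter> {a..b} \<noteq> {}}" "L \<in> {K\<in>D. K \<inter> {a..b} \<noteq> {}}" "K \<noteq> L"
      "K \<inter> {a..b} = L \<inter> {a..b}"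
    then have "interior (K \<inter> {a..b}) \<subseteq> interior K \<inter> interior L" by (metis Int_greatest inf.cobounded1 interior_mono)
    then have "interior (K \<inter> {a..b}) = {}" using int[of K L] H by auto
    then show "increment f (K \<inter> {a..b}) = 0"
      using increment_degenerate cb' H(1) by blast
  qed (use fin in auto)
  also have "\<dots> = (\<Sum>K\<in>D. increment f (K \<inter> {a..b}))"
    by (rule sum.mono_neutral_left) (use fin in \<open>auto simp: increment_def\<close>)
  finally show "sum (increment f) D' = (\<Sum>K\<in>D. increment f (K \<inter> {a..b}))" .
qed

lemma increment_split:
  fixes a b c u v :: real and K :: "real set"
  assumes "K = cbox u v" "K \<subseteq> {a..c}" "a \<le> b" "b \<le> c"
  shows "increment f K \<le> increment f (K \<inter> {a..b}) + increment f (K \<inter> {b..c})"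
proof (cases "u \<le> v")
  case True
  then have uv: "a \<le> u" "v \<le> c" using assms by auto
  consider "v < b" | "b < u" | "u \<le> b" "b \<le> v" by linarith
  then show ?thesis
  proof cases
    case 1
    then have "K \<inter> {a..b} = K" using assms uv by auto
    then show ?thesis by (auto simp: increment_def)
  next
    case 2
    then have "K \<inter> {b..c} = K" using assms uv by auto
    then show ?thesis by (auto simp: increment_def)
  next
    case 3
    then have "K \<inter> {a..b} = {u..b}" "K \<inter> {b..c} = {b..v}" using assms uv by auto
    then show ?thesis using 3 True assms(1) by (simp add: increment_Icc)
  qed
next
  case False
  then show ?thesis using assms by (auto simp: increment_def)
qed

section \<open>Total variation\<close>

definition variation_sums :: "(real \<Rightarrow> real) \<Rightarrow> real \<Rightarrow> real \<Rightarrow> real set" where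
  "variation_sums f u w = {sum (increment f) D | D S. D division_of S \<and> S \<subseteq> {u..w}}"

definition variation :: "(real \<Rightarrow> real) \<Rightarrow> real \<Rightarrow> real \<Rightarrow> real" where
  "variation f u w = Sup (variation_sums f u w)"

lemma variation_sumsI:
  "D division_of S \<Longrightarrow> S \<subseteq> {u..w} \<Longrightarrow> sum (increment f) D \<in> variation_sums f u w"
  by (auto simp: variation_sums_def)

lemma variation_sumsE:
  assumes "x \<in> variation_sums f u w"
  obtains D S where "D division_of S" "S \<subseteq> {u..w}" "x = sum (increment f) D"
  using assms unfolding variation_sums_def mem_Collect_eq by (elim exE conjE)

lemma variation_sums_nonempty: "variation_sums f u w \<noteq> {}"
  unfolding variation_sums_def using division_of_trivial by blast

lemma variation_sums_split:
  assumes "x \<in> variation_sums f a c" "a \<le> b" "b \<le> c"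
  obtains y z where "y \<in> variation_sums f a b" "z \<in> variation_sums f b c" "x \<le> y + z"
proof -
  obtain D S where D: "D division_of S" "S \<subseteq> {a..c}" "x = sum (increment f) D"
    using assms(1) by (rule variation_sumsE)
  note R = restrict_division[OF D(1)]
  have 1: "(\<Sum>K\<in>D. increment f (K \<inter> {a..b})) \<in> variation_sums f a b"
    unfolding R(2)[symmetric] by (rule variation_sumsI[OF R(1)]) auto
  have 2: "(\<Sum>K\<in>D. increment f (K \<inter> {b..c})) \<in> variation_sums f b c"
    unfolding R(2)[symmetric] by (rule variation_sumsI[OF R(1)]) auto
  have "x \<le> (\<Sum>K\<in>D. increment f (K \<inter> {a..b}) + increment f (K \<inter> {b..c}))"
    unfolding D(3)
  proof (rule sum_mono)
    fix K assume "K \<in> D"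
    then obtain u v where "K = cbox u v" "K \<subseteq> {a..c}"
      using division_ofD(4)[OF D(1)] division_ofD(2)[OF D(1)] D(2) by (meson order.trans)
    then show "increment f K \<le> increment f (K \<inter> {a..b}) + increment f (K \<inter> {b..c})"
      using increment_split assms by blast
  qed
  then show ?thesis using that[OF 1 2] by (simp add: sum.distrib)
qed

lemma variation_sums_join:
  assumes "y \<in> variation_sums f a b" "z \<in> variation_sums f b c" "a \<le> b" "b \<le> c"
  shows "y + z \<in> variation_sums f a c"
proof -
  obtain D S where D: "D division_of S" "S \<subseteq> {a..b}" "y = sum (increment f) D"
    using assms(1) by (rule variation_sumsE)
  obtain D' S' where D': "D' division_of S'" "S' \<subseteq> {b..c}" "z = sum (increment f) D'"
    using assms(2) by (rule variation_sumsE)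
  have fin: "finite D" "finite D'" using D D' by auto
  have sm: "interior S \<inter> interior S' = {}"
  proof -
    have "interior S \<subseteq> {a<..<b}" "interior S' \<subseteq> {b<..<c}"
      using interior_mono[OF D(2)] interior_mono[OF D'(2)] by auto
    then show ?thesis by fastforce
  qed
  have U: "D \<union> D' division_of (S \<union> S')"
    using division_disjoint_union[OF D(1) D'(1) sm] .
  have "sum (increment f) (D \<union> D') = sum (increment f) D + sum (increment f) D'"
  proof (rule sum.union_inter_neutral[OF fin], rule ballI)
    \<comment> \<open>Only the one-point interval at \<open>b\<close> can be a member of both
      divisions.\<close>
    fix K assume K: "K \<in> D \<inter> D'"
    then have "interior K = {}" using sm division_ofD(2)[OF D(1)] division_ofD(2)[OF D'(1)]
        interior_mono[of K S] interior_mono[of K S'] by blast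
    moreover obtain u v where "K = cbox u v" using K division_ofD(4)[OF D(1)] by blast
    ultimately show "increment f K = 0" using increment_degenerate by blast
  qed
  moreover have "S \<union> S' \<subseteq> {a..c}" using D D' assms by fastforce
  ultimately show ?thesis using variation_sumsI[OF U, of a c f] D(3) D'(3) by simp
qed

lemma abs_cont_increments:
  fixes f :: "real \<Rightarrow> real"
  assumes "abs_cont_on a b f" "e > 0"
  obtains \<delta> where "\<delta> > 0" "\<forall>D S. D division_of S \<longrightarrow> S \<subseteq> {a..b} \<longrightarrow> measure lebesgue S < \<delta> \<longrightarrow> sum (increment f) D < e"
proof -
  obtain \<delta> where "\<delta> > 0" and \<delta>: "\<forall>D S. D division_of S \<longrightarrow> S \<subseteq> {a..b} \<longrightarrow> (\<Sum>K\<in>D. Sup K - Inf K) < \<delta> \<longrightarrow> (\<Sum>K\<in>D. norm (f (Sup K) - f (Inf K))) < e"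
    by (rule abs_cont_onE[OF assms])
  show ?thesis
  proof (rule that[OF \<open>\<delta> > 0\<close>], intro allI impI)
    fix D S assume D: "D division_of S" "S \<subseteq> {a..b}" "measure lebesgue S < \<delta>"
    show "sum (increment f) D < e"
      using \<delta>[rule_format, OF D(1,2)] D(3) unfolding division_length_sum[OF D(1)] increment_division[OF D(1)] by simp
  qed
qed

lemma abs_cont_on_subinterval:
  assumes "abs_cont_on a b f" "a \<le> u" "v \<le> b"
  shows "abs_cont_on u v f"
proof (rule abs_cont_onI)
  fix e :: real assume "e > 0"
  obtain \<delta> where d: "\<delta> > 0" "\<forall>D S. D division_of S \<longrightarrow> S \<subseteq> {a..b} \<longrightarrow> (\<Sum>K\<in>D. Sup K - Inf K) < \<delta> \<longrightarrow> (\<Sum>K\<in>D. norm (f (Sup K) - f (Inf K))) < e"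
    by (rule abs_cont_onE[OF assms(1) \<open>e > 0\<close>])
  have sub: "{u..v} \<subseteq> {a..b}" using assms by auto
  show "\<exists>\<delta>>0. \<forall>D S. D division_of S \<longrightarrow> S \<subseteq> {u..v} \<longrightarrow> (\<Sum>K\<in>D. Sup K - Inf K) < \<delta> \<longrightarrow>
        (\<Sum>K\<in>D. norm (f (Sup K) - f (Inf K))) < e"
    using d sub by (meson order.trans)
qed

lemma abs_cont_on_imp_continuous:
  fixes f :: "real \<Rightarrow> 'b::real_normed_vector"
  assumes "abs_cont_on a b f"
  shows "continuous_on {a..b} f"
  unfolding continuous_on_iff
proof (intro ballI allI impI)
  fix x e :: real assume x: "x \<in> {a..b}" and "e > 0"
  obtain \<delta> where d: "\<delta>>0" "\<forall>D S. D division_of S \<longrightarrow> S \<subseteq> {a..b} \<longrightarrow> (\<Sum>K\<in>D. Sup K - Inf K) < \<delta> \<longrightarrow>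
        (\<Sum>K\<in>D. norm (f (Sup K) - f (Inf K))) < e"
    by (rule abs_cont_onE[OF assms \<open>e > 0\<close>])
  have *: "norm (f v - f u) < e" if "u \<in> {a..b}" "v \<in> {a..b}" "u \<le> v" "v - u < \<delta>" for u v
  proof -
    have "{{u..v}} division_of {u..v}"
      using division_of_self[of u v] that by simp
    from d(2)[rule_format, OF this] show ?thesis using that by simp
  qed
  show "\<exists>d>0. \<forall>x'\<in>{a..b}. dist x' x < d \<longrightarrow> dist (f x') (f x) < e"
  proof (intro exI[of _ \<delta>] conjI d ballI impI)
    fix x' assume "x' \<in> {a..b}" "dist x' x < \<delta>"
    then show "dist (f x') (f x) < e"
      using *[of x x'] *[of x' x] x by (cases "x \<le> x'") (auto simp: dist_norm norm_minus_commute)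
  qed
qed

text \<open>On an interval shorter than the \<delta> belonging to the tolerance 1 all sums are at
  most 1, and bounds add up when two intervals are joined.\<close>

lemma variation_bdd:
  assumes "abs_cont_on a b f" "a \<le> b"
  shows "bdd_above (variation_sums f a b)"
proof -
  obtain \<delta> where d: "\<delta> > 0" "\<forall>D S. D division_of S \<longrightarrow> S \<subseteq> {a..b} \<longrightarrow> measure lebesgue S < \<delta> \<longrightarrow> sum (increment f) D < 1" by (rule abs_cont_increments[OF assms(1), of 1]) auto
  show ?thesis using assms(2)
  proof (induction rule: interval_patching)
    case (trans u v w)
    then obtain B C where BC: "\<And>y. y \<in> variation_sums f u v \<Longrightarrow> y \<le> B" "\<And>y. y \<in> variation_sums f v w \<Longrightarrow> y \<le> C"
      unfolding bdd_above_def by metis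
    have "x \<le> B + C" if "x \<in> variation_sums f u w" for x
      by (rule variation_sums_split[OF that trans(2,3)]) (use BC in force)
    then show ?case by (rule bdd_above.I)
  next
    case (local x)
    show ?case
    proof (intro exI[of _ \<delta>] conjI d allI impI, elim conjE)
      fix u v assume uv: "u \<le> x" "x \<le> v" "v - u < \<delta>" "a \<le> u" "v \<le> b"
      show "bdd_above (variation_sums f u v)"
      proof (rule bdd_above.I)
        fix y assume "y \<in> variation_sums f u v"
        then obtain D S where D: "D division_of S" "S \<subseteq> {u..v}" "y = sum (increment f) D"
          by (rule variation_sumsE)
        have "measure lebesgue S \<le> measure lebesgue {u..v}"
          by (rule measure_mono_fmeasurable[OF D(2)]) (use lmeasurable_division[OF D(1)] in auto)
        then have "measure lebesgue S < \<delta>" using uv by simp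
        moreover have "S \<subseteq> {a..b}" using D(2) uv by auto
        ultimately show "y \<le> 1" using d(2)[rule_format, OF D(1)] D(3) by simp
      qed
    qed
  qed
qed

lemma variation_add:
  assumes "abs_cont_on a c f" "a \<le> b" "b \<le> c"
  shows "variation f a c = variation f a b + variation f b c"
proof (rule antisym)
  have bd: "bdd_above (variation_sums f a b)" "bdd_above (variation_sums f b c)" "bdd_above (variation_sums f a c)"
    using variation_bdd abs_cont_on_subinterval[OF assms(1)] assms by (meson order.refl order.trans)+
  show "variation f a c \<le> variation f a b + variation f b c"
    unfolding variation_def
  proof (rule cSup_least[OF variation_sums_nonempty])
    fix x assume x: "x \<in> variation_sums f a c"
    obtain y z where "y \<in> variation_sums f a b" "z \<in> variation_sums f b c" "x \<le> y + z"
      using variation_sums_split[OF x assms(2,3)] .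
    then show "x \<le> Sup (variation_sums f a b) + Sup (variation_sums f b c)"
      using cSup_upper[OF _ bd(1)] cSup_upper[OF _ bd(2)] by fastforce
  qed
  have "y + z \<le> variation f a c" if "y \<in> variation_sums f a b" "z \<in> variation_sums f b c" for y z
    using variation_sums_join[OF that assms(2,3)] cSup_upper[OF _ bd(3)] unfolding variation_def by blast
  then have "z \<le> variation f a c - y" if "y \<in> variation_sums f a b" "z \<in> variation_sums f b c" for y z
    using that by fastforce
  then have "variation f b c \<le> variation f a c - y" if "y \<in> variation_sums f a b" for y
    unfolding variation_def using that by (intro cSup_least[OF variation_sums_nonempty]) auto
  then have "y \<le> variation f a c - variation f b c" if "y \<in> variation_sums f a b" for y
    using that by fastforce
  then have "variation f a b \<le> variation f a c - variation f b c"
    unfolding variation_def by (intro cSup_least[OF variation_sums_nonempty]) auto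
  then show "variation f a b + variation f b c \<le> variation f a c" by simp
qed

lemma increment_le_variation:
  assumes "abs_cont_on u v f" "u \<le> v"
  shows "\<bar>f v - f u\<bar> \<le> variation f u v"
proof -
  have "{{u..v}} division_of {u..v}" using division_of_self[of u v] assms by simp
  then have "sum (increment f) {{u..v}} \<in> variation_sums f u v"
    by (rule variation_sumsI) simp
  then show ?thesis
    unfolding variation_def using cSup_upper[OF _ variation_bdd[OF assms]] assms(2)
    by (simp add: increment_Icc)
qed

text \<open>Dropping the members with empty interior costs nothing. It makes families chosen inside
  non-overlapping intervals disjoint as sets of intervals, so that
  \<open>abs_cont_on_variation\<close> can sum over their union.\<close>

lemma variation_approx:
  assumes "abs_cont_on u v f" "u \<le> v" "e > 0"
  obtains D S where "D division_of S" "S \<subseteq> {u..v}" "\<And>K. K \<in> D \<Longrightarrow> interior K \<noteq> {}"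
    "variation f u v < sum (increment f) D + e"
proof -
  obtain x where x: "x \<in> variation_sums f u v" "variation f u v - e < x"
    using less_cSup_iff[OF variation_sums_nonempty variation_bdd[OF assms(1,2)], of "variation f u v - e"] assms(3)
    unfolding variation_def by auto
  then obtain D S where D: "D division_of S" "S \<subseteq> {u..v}" "x = sum (increment f) D"
    by (elim variation_sumsE)
  let ?D = "{K\<in>D. interior K \<noteq> {}}"
  have 1: "?D division_of \<Union>?D" by (rule division_of_subset[OF division_of_union_self[OF D(1)]]) auto
  have 2: "sum (increment f) ?D = sum (increment f) D"
  proof (rule sum.mono_neutral_left)
    show "\<forall>i\<in>D - {K \<in> D. interior K \<noteq> {}}. increment f i = 0"
      using increment_degenerate division_ofD(4)[OF D(1)] by (metis (mono_tags, lifting) Diff_iff mem_Collect_eq)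
  qed (use division_of_finite[OF D(1)] in auto)
  have "\<Union>?D \<subseteq> {u..v}" using division_ofD(6)[OF D(1)] D(2) by auto
  show ?thesis
  proof (rule that[OF 1])
    show "\<Union>?D \<subseteq> {u..v}" by fact
    show "variation f u v < sum (increment f) ?D + e" using x(2) 2 D(3) by linarith
  qed simp
qed

text \<open>Every member of a short division is replaced by a nearly optimal division inside it.
  Together these form a division that is at least as short, so the increments of \<open>f\<close>
  over it are small, and they almost equal the increments of the variation.\<close>

lemma abs_cont_on_variation:
  assumes ac: "abs_cont_on a b f" and "a \<le> b"
  shows "abs_cont_on a b (variation f a)"
  unfolding abs_cont_on_def
proof (intro allI impI)
  fix e :: real assume e: "e > 0"
  obtain \<delta> where d: "\<delta> > 0" "\<forall>D S. D division_of S \<longrightarrow> S \<subseteq> {a..b} \<longrightarrow> measure lebesgue S < \<delta> \<longrightarrow> sum (increment f) D < e/2" by (rule abs_cont_increments[OF ac, of "e/2"]) (use e in auto)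
  show "\<exists>\<delta>>0. \<forall>D S. D division_of S \<and> S \<subseteq> {a..b} \<and> (\<Sum>K\<in>D. Sup K - Inf K) < \<delta> \<longrightarrow>
        (\<Sum>K\<in>D. norm (variation f a (Sup K) - variation f a (Inf K))) < e"
  proof (intro exI[of _ \<delta>] conjI d allI impI, elim conjE)
    fix D S assume D: "D division_of S" "S \<subseteq> {a..b}" "(\<Sum>K\<in>D. Sup K - Inf K) < \<delta>"
    have fin: "finite D" using D by auto
    \<comment> \<open>Each member is allowed the error \<open>e / (2 * n)\<close>, so that all
      errors together stay below \<open>e / 2\<close>; the added 1 covers the empty
      division.\<close>
    define n where "n = real (card D) + 1"
    have n: "n > 0" unfolding n_def by simp
    have K: "\<exists>u v. K = {u..v} \<and> u \<le> v \<and> a \<le> u \<and> v \<le> b" if KD: "K \<in> D" for K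
    proof -
      obtain u v where "K = cbox u v" "K \<noteq> {}" "K \<subseteq> S"
        using division_ofD(2)[OF D(1) KD] division_ofD(3)[OF D(1) KD] division_ofD(4)[OF D(1) KD] by (elim exE) simp
      then show ?thesis using D(2) by (intro exI[of _ u] exI[of _ v]) (auto simp: subset_iff)
    qed
    have "\<exists>D' S'. D' division_of S' \<and> S' \<subseteq> K \<and> (\<forall>L\<in>D'. interior L \<noteq> {}) \<and>
        norm (variation f a (Sup K) - variation f a (Inf K)) < sum (increment f) D' + e / (2 * n)"
      if KD: "K \<in> D" for K
    proof -
      obtain u v where uv: "K = {u..v}" "u \<le> v" "a \<le> u" "v \<le> b" using K[OF KD] by blast
      have acv: "abs_cont_on a v f" "abs_cont_on u v f"
        using abs_cont_on_subinterval[OF ac] uv by auto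
      obtain D' S' where "D' division_of S'" "S' \<subseteq> {u..v}" "\<And>L. L \<in> D' \<Longrightarrow> interior L \<noteq> {}"
        "variation f u v < sum (increment f) D' + e / (2 * n)"
        using variation_approx[OF acv(2) uv(2), of "e / (2*n)"] e n by auto
      moreover have "variation f a v - variation f a u = variation f u v"
        using variation_add[OF acv(1) uv(3,2)] by simp
      moreover have "0 \<le> variation f u v" using increment_le_variation[OF acv(2) uv(2)] by linarith
      ultimately show ?thesis using uv by (intro exI[of _ D'] exI[of _ S']) auto
    qed
    then obtain D' S' where D': "\<And>K. K \<in> D \<Longrightarrow> D' K division_of S' K" "\<And>K. K \<in> D \<Longrightarrow> S' K \<subseteq> K"
      "\<And>K L. K \<in> D \<Longrightarrow> L \<in> D' K \<Longrightarrow> interior L \<noteq> {}"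
      "\<And>K. K \<in> D \<Longrightarrow> norm (variation f a (Sup K) - variation f a (Inf K)) < sum (increment f) (D' K) + e / (2 * n)"
      by metis
    have sub: "L \<subseteq> K" if "K \<in> D" "L \<in> D' K" for K L
      using division_ofD(2)[OF D'(1)] D'(2) that by (meson order.trans)
    have disj: "interior L \<inter> interior L' = {}" if "K \<in> D" "K' \<in> D" "K \<noteq> K'" "L \<in> D' K" "L' \<in> D' K'" for K K' L L'
    proof -
      have "interior K \<inter> interior K' = {}" using division_ofD(5)[OF D(1)] that by blast
      then show ?thesis using interior_mono[OF sub[OF that(1,4)]] interior_mono[OF sub[OF that(2,5)]] by blast
    qed
    have div: "(\<Union>K\<in>D. D' K) division_of (\<Union>K\<in>D. S' K)"
    proof (rule division_ofI)
      show "finite (\<Union>K\<in>D. D' K)" using fin D'(1) by auto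
      show "\<Union>(\<Union>K\<in>D. D' K) = (\<Union>K\<in>D. S' K)"
      proof -
        have "\<Union>(\<Union>K\<in>D. D' K) = (\<Union>K\<in>D. \<Union>(D' K))" by blast
        also have "\<dots> = (\<Union>K\<in>D. S' K)" using division_ofD(6)[OF D'(1)] by (intro SUP_cong refl)
        finally show ?thesis .
      qed
      fix L assume "L \<in> (\<Union>K\<in>D. D' K)"
      then obtain K where K: "K \<in> D" "L \<in> D' K" by blast
      show "L \<subseteq> (\<Union>K\<in>D. S' K)" "L \<noteq> {}" "\<exists>a b. L = cbox a b" using division_ofD(2-4)[OF D'(1)[OF K(1)] K(2)] K(1) by blast+
    next
      fix L L' assume "L \<in> (\<Union>K\<in>D. D' K)" "L' \<in> (\<Union>K\<in>D. D' K)" "L \<noteq> L'"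
      then obtain K K' where K: "K \<in> D" "L \<in> D' K" "K' \<in> D" "L' \<in> D' K'" by blast
      show "interior L \<inter> interior L' = {}"
      proof (cases "K = K'")
        case True
        then show ?thesis using K division_ofD(5)[OF D'(1)[OF K(1)]] \<open>L \<noteq> L'\<close> by blast
      qed (use disj K in blast)
    qed
    have "measure lebesgue (\<Union>K\<in>D. S' K) \<le> measure lebesgue S"
    proof (rule measure_mono_fmeasurable)
      show "(\<Union>K\<in>D. S' K) \<subseteq> S" using D'(2) division_ofD(2)[OF D(1)] by blast
    qed (use lmeasurable_division[OF div] lmeasurable_division[OF D(1)] in auto)
    then have m: "measure lebesgue (\<Union>K\<in>D. S' K) < \<delta>" using D(3) division_length_sum[OF D(1)] by simp
    have "(\<Union>K\<in>D. S' K) \<subseteq> {a..b}" using D'(2) division_ofD(2)[OF D(1)] D(2) by blast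
    then have lt: "sum (increment f) (\<Union>K\<in>D. D' K) < e/2" using d(2)[rule_format, OF div _ m] by simp
    have "sum (increment f) (\<Union>K\<in>D. D' K) = (\<Sum>K\<in>D. sum (increment f) (D' K))"
    proof (rule sum.UNION_disjoint[OF fin])
      show "\<forall>i\<in>D. finite (D' i)" using D' by auto
      show "\<forall>i\<in>D. \<forall>j\<in>D. i \<noteq> j \<longrightarrow> D' i \<inter> D' j = {}" using disj D'(3) by fastforce
    qed
    then have "(\<Sum>K\<in>D. sum (increment f) (D' K) + e / (2 * n)) < e/2 + real (card D) * (e/(2*n))"
      using lt by (simp add: sum.distrib)
    moreover have "real (card D) * (e/(2*n)) \<le> e/2"
      using e n by (simp add: field_simps n_def)
    moreover have "(\<Sum>K\<in>D. norm (variation f a (Sup K) - variation f a (Inf K))) \<le> (\<Sum>K\<in>D. sum (increment f) (D' K) + e / (2 * n))"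
      using D'(4) by (intro sum_mono) force
    ultimately show "(\<Sum>K\<in>D. norm (variation f a (Sup K) - variation f a (Inf K))) < e" by linarith
  qed
qed

section \<open>Densities and derivatives of absolutely continuous functions\<close>

lemma countable_sets_emeasure_le:
  assumes "countable \<D>" "\<And>K. K \<in> \<D> \<Longrightarrow> K \<in> sets M"
    and fin: "\<And>F. finite F \<Longrightarrow> F \<subseteq> \<D> \<Longrightarrow> emeasure M (\<Union>F) \<le> c"
  shows "emeasure M (\<Union>\<D>) \<le> c"
proof (cases "\<D> = {}")
  case True
  then show ?thesis using fin[of "{}"] by simp
next
  case False
  define A where "A n = from_nat_into \<D> ` {..n}" for n :: nat
  have A: "A n \<subseteq> \<D>" "finite (A n)" for n
    unfolding A_def using from_nat_into[OF False] by auto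
  have U: "(\<Union>n. \<Union>(A n)) = \<Union>\<D>"
  proof -
    have "(\<Union>n. A n) = range (from_nat_into \<D>)" unfolding A_def by auto
    then have "\<Union>(\<Union>n. A n) = \<Union>\<D>" using range_from_nat_into[OF False assms(1)] by simp
    moreover have "(\<Union>n. \<Union>(A n)) = \<Union>(\<Union>n. A n)" by blast
    ultimately show ?thesis by simp
  qed
  have "(SUP n. emeasure M (\<Union>(A n))) = emeasure M (\<Union>n. \<Union>(A n))"
  proof (rule SUP_emeasure_incseq)
    show "range (\<lambda>n. \<Union>(A n)) \<subseteq> sets M"
      using A assms(2) by (auto intro!: sets.finite_Union)
    show "incseq (\<lambda>n. \<Union>(A n))"
      unfolding A_def incseq_def by force
  qed
  moreover have "(SUP n. emeasure M (\<Union>(A n))) \<le> c"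
    using fin A by (intro SUP_least) auto
  ultimately show ?thesis using U by simp
qed

text \<open>The density is the Radon-Nikodym derivative of the Stieltjes measure of
  \<open>G\<close>. That this measure vanishes on Lebesgue null sets is read off from short
  divisions: a null set lies in an open set of measure below \<delta>, which is exhausted by finite
  unions of non-overlapping intervals, and these are divisions.\<close>

lemma mono_abs_cont_density:
  fixes G :: "real \<Rightarrow> real"
  assumes ac: "abs_cont_on a b G" and mono: "mono_on {a..b} G" and ab: "a \<le> b"
  obtains g where "\<And>x. 0 \<le> g x"
    "\<And>u v. a \<le> u \<Longrightarrow> u \<le> v \<Longrightarrow> v \<le> b \<Longrightarrow> (g has_integral (G v - G u)) {u..v}"
proof -
  \<comment> \<open>Continuing \<open>G\<close> by constants gives a function on the whole line
    whose measure does not charge the two outer half-lines. Their endpoints are not charged either,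
    because the continuation is continuous.\<close>
  define F where "F x = G (max a (min b x))" for x
  have Fm: "F x \<le> F y" if "x \<le> y" for x y
    unfolding F_def using that ab by (intro mono_onD[OF mono]) auto
  have Fc: "continuous_on UNIV F"
    unfolding F_def using ab
    by (intro continuous_on_compose2[OF abs_cont_on_imp_continuous[OF ac]] continuous_intros) auto
  have Frc: "continuous (at_right x) F" for x
    using Fc by (simp add: continuous_on_eq_continuous_at continuous_at_imp_continuous_at_within)
  have FG: "F x = G x" if "x \<in> {a..b}" for x using that by (simp add: F_def max_absorb2 min_absorb2)
  define \<mu> where "\<mu> = interval_measure F"
  have sets: "sets \<mu> = sets borel" by (simp add: \<mu>_def)
  have Icc: "emeasure \<mu> {u..v} = F v - F u" if "u \<le> v" for u v
    unfolding \<mu>_def by (rule emeasure_interval_measure_Icc[OF that Fm Fc])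
  have Ioc: "emeasure \<mu> {u<..v} = F v - F u" if "u \<le> v" for u v
    unfolding \<mu>_def by (rule emeasure_interval_measure_Ioc[OF that Fm Frc])
  have out1: "{..a} \<in> null_sets \<mu>"
  proof -
    have "(\<Union>n. {a - real n<..a}) \<in> null_sets \<mu>"
      by (intro null_sets_UN null_setsI) (auto simp: Ioc sets F_def max_def min_def)
    moreover have "(\<Union>n. {a - real n<..a}) = {..a}"
    proof safe
      fix x assume "x \<le> a"
      obtain n where "a - x < real n" using reals_Archimedean2 by blast
      then show "x \<in> (\<Union>n. {a - real n<..a})" using \<open>x \<le> a\<close> by (auto intro!: exI[of _ n])
    qed auto
    ultimately show ?thesis by simp
  qed
  have out2: "{b..} \<in> null_sets \<mu>"
  proof -
    have "(\<Union>n. {b..b + real n}) \<in> null_sets \<mu>"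
      using ab by (intro null_sets_UN null_setsI) (auto simp: Icc sets F_def max_def min_def)
    moreover have "(\<Union>n. {b..b + real n}) = {b..}"
    proof safe
      fix x assume "b \<le> x"
      obtain n where "x - b < real n" using reals_Archimedean2 by blast
      then show "x \<in> (\<Union>n. {b..b + real n})" using \<open>b \<le> x\<close> by (auto intro!: exI[of _ n])
    qed auto
    ultimately show ?thesis by simp
  qed
  have inside: "emeasure \<mu> N \<le> ennreal e" if N: "N \<in> null_sets lborel" "N \<subseteq> {a<..<b}" and e: "e > 0" for N e
  proof (cases "a < b")
    case False
    then show ?thesis using N by simp
  next
    case True
    obtain \<delta> where d: "\<delta> > 0" "\<forall>D S. D division_of S \<longrightarrow> S \<subseteq> {a..b} \<longrightarrow> measure lebesgue S < \<delta>
     \<longrightarrow> sum (increment G) D < e" by (rule abs_cont_increments[OF ac e])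
    have Nb: "N \<in> sets borel" using N(1) by auto
    obtain U where U: "open U" "N \<subseteq> U" "emeasure lborel (U - N) < \<delta>"
      by (rule outer_regular_lborel[OF Nb d(1)])
    define V where "V = U \<inter> {a<..<b}"
    have V: "open V" "N \<subseteq> V" "V \<subseteq> {a<..<b}" using U N(2) by (auto simp: V_def)
    have "emeasure lborel V \<le> emeasure lborel (U - N)"
    proof -
      have "emeasure lborel V \<le> emeasure lborel ((U - N) \<union> N)"
        using U Nb by (intro emeasure_mono) (auto simp: V_def)
      also have "\<dots> = emeasure lborel (U - N)"
        using U Nb N(1) by (intro emeasure_Un_null_set) auto
      finally show ?thesis .
    qed
    then have Vm: "emeasure lborel V < \<delta>" using U(3) by simp
    \<comment> \<open>With this gauge a covering interval whose tag lies in \<open>V\<close> is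
      itself contained in \<open>V\<close>, so the covering does not enlarge the measure.\<close>
    have ga: "gauge (\<lambda>x. if x \<in> V then V else UNIV)" using V(1) by (auto simp: gauge_def)
    have ne: "box a b \<noteq> {}" using True by (simp add: box_real)
    have sub: "V \<subseteq> cbox a b" using V(3) by auto
    obtain \<D> where D: "countable \<D>"
      "\<And>K. K \<in> \<D> \<Longrightarrow> interior K \<noteq> {} \<and> (\<exists>c d. K = cbox c d)"
      "pairwise (\<lambda>A B. interior A \<inter> interior B = {}) \<D>"
      "\<And>K. K \<in> \<D> \<Longrightarrow> \<exists>x\<in>V \<inter> K. K \<subseteq> (if x \<in> V then V else UNIV)" "V \<subseteq> \<Union>\<D>"
      using covering_lemma[OF sub ne ga] by metis
    have Kb: "K \<in> sets borel" if KD: "K \<in> \<D>" for K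
    proof -
      obtain c d where "K = cbox c d" using D(2)[OF KD] by blast
      then show ?thesis by simp
    qed
    have KV: "K \<subseteq> V" if "K \<in> \<D>" for K using D(4)[OF that] by auto
    have "emeasure \<mu> (\<Union>\<D>) \<le> ennreal e"
    proof (rule countable_sets_emeasure_le[OF D(1)])
      show "K \<in> sets \<mu>" if "K \<in> \<D>" for K using D(2)[OF that] by (auto simp: sets)
      fix \<F> assume F: "finite \<F>" "\<F> \<subseteq> \<D>"
      have div: "\<F> division_of \<Union>\<F>"
      proof (rule division_ofI)
        fix K assume "K \<in> \<F>"
        then have "K \<in> \<D>" using F by auto
        then show "K \<noteq> {}" "\<exists>a b. K = cbox a b" using D(2)[of K] by auto
      next
        fix K L assume "K \<in> \<F>" "L \<in> \<F>" "K \<noteq> L"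
        then show "interior K \<inter> interior L = {}" using D(3) F(2) by (auto simp: pairwise_def)
      qed (use F in auto)
      have FV: "\<Union>\<F> \<subseteq> V" using KV F by auto
      have "emeasure lebesgue (\<Union>\<F>) \<le> emeasure lborel V"
      proof -
        have "\<Union>\<F> \<in> sets borel" using F Kb by (intro sets.finite_Union) auto
        then have "emeasure lebesgue (\<Union>\<F>) = emeasure lborel (\<Union>\<F>)" by (simp add: emeasure_completion)
        also have "\<dots> \<le> emeasure lborel V" using FV V by (intro emeasure_mono) auto
        finally show ?thesis .
      qed
      then have "emeasure lebesgue (\<Union>\<F>) < \<delta>" using Vm by simp
      then have "measure lebesgue (\<Union>\<F>) < \<delta>"
        using d(1) by (simp add: emeasure_eq_measure2[OF lmeasurable_division[OF div]] ennreal_less_iff)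
      moreover have "\<Union>\<F> \<subseteq> {a..b}" using FV V(3) by (meson greaterThanLessThan_subseteq_atLeastAtMost_iff order.refl order.trans)
      ultimately have lt: "sum (increment G) \<F> < e" using d(2) div by blast
      have "emeasure \<mu> (\<Union>\<F>) \<le> (\<Sum>K\<in>\<F>. emeasure \<mu> K)"
      proof -
        have "emeasure \<mu> (\<Union>K\<in>\<F>. K) \<le> (\<Sum>K\<in>\<F>. emeasure \<mu> K)"
          using F Kb by (intro emeasure_subadditive_finite) (auto simp: sets)
        then show ?thesis by simp
      qed
      also have "\<dots> \<le> (\<Sum>K\<in>\<F>. ennreal (increment G K))"
      proof (rule sum_mono)
        fix K assume "K \<in> \<F>"
        then have K: "K \<in> \<D>" using F by auto
        then obtain c d where cd: "K = {c..d}" "c \<le> d" using D(2)[of K] by fastforce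
        then have "c \<in> {a..b}" "d \<in> {a..b}" using KV[OF K] V(3) by (auto simp: subset_iff)
        then show "emeasure \<mu> K \<le> ennreal (increment G K)"
          using Icc[OF cd(2)] cd FG by (simp add: increment_Icc ennreal_leI)
      qed
      also have "\<dots> = ennreal (sum (increment G) \<F>)"
        by (intro sum_ennreal) (auto simp: increment_def)
      also have "\<dots> \<le> ennreal e" using lt by (intro ennreal_leI) simp
      finally show "emeasure \<mu> (\<Union>\<F>) \<le> ennreal e" .
    qed
    moreover have "emeasure \<mu> N \<le> emeasure \<mu> (\<Union>\<D>)"
    proof (rule emeasure_mono)
      show "N \<subseteq> \<Union>\<D>" using V D(5) by auto
      have "\<Union>\<D> \<in> sets borel" using D(1) Kb by (intro sets.countable_Union) auto
      then show "\<Union>\<D> \<in> sets \<mu>" by (simp add: sets)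
    qed
    ultimately show ?thesis by simp
  qed
  have "absolutely_continuous lborel \<mu>"
    unfolding absolutely_continuous_def
  proof
    fix N :: "real set" assume N: "N \<in> null_sets lborel"
    have "N \<inter> {a<..<b} \<in> null_sets \<mu>"
    proof (rule null_setsI)
      have "N \<inter> {a<..<b} \<in> null_sets lborel" by (rule null_set_Int2[OF N]) simp
      then have "emeasure \<mu> (N \<inter> {a<..<b}) \<le> 0 + ennreal e" if "e > 0" for e
        using inside[OF _ _ that] by simp
      then show "emeasure \<mu> (N \<inter> {a<..<b}) = 0"
        by (metis ennreal_le_epsilon ennreal_zero_neq_top le_zero_eq top_neq_ennreal)
      show "N \<inter> {a<..<b} \<in> sets \<mu>" using N by (auto simp: sets)
    qed
    then have "N \<inter> {a<..<b} \<union> ({..a} \<union> {b..}) \<in> null_sets \<mu>" using out1 out2 by auto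
    moreover have "N \<subseteq> N \<inter> {a<..<b} \<union> ({..a} \<union> {b..})" by auto
    ultimately show "N \<in> null_sets \<mu>" using N null_sets_subset sets by (metis null_setsD2 sets_lborel)
  qed
  from sigma_finite_measure.Radon_Nikodym[OF sigma_finite_lborel this] obtain h where h: "h \<in> borel_measurable lborel" "density lborel h = \<mu>"
    using sets by auto
  have hI: "(\<integral>\<^sup>+x. h x * indicator {u..v} x \<partial>lborel) = ennreal (G v - G u)"
    if "a \<le> u" "u \<le> v" "v \<le> b" for u v
    using Icc[OF that(2)] emeasure_density[OF h(1), of "{u..v}"] h(2) FG that by simp
  \<comment> \<open>The density can be infinite only on a null set, since its integral over
    \<open>{a..b}\<close> is finite; there \<open>enn2real\<close> returns 0.\<close>
  define g where "g x = enn2real (h x) * indicator {a..b} x" for x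
  have g0: "0 \<le> g x" for x by (simp add: g_def)
  have gb: "g \<in> borel_measurable borel" unfolding g_def using h(1) by simp
  have "AE x in lborel. h x * indicator {a..b} x \<noteq> \<infinity>"
    using h(1) hI[of a b] ab by (intro nn_integral_PInf_AE) auto
  then have ae: "AE x in lborel. ennreal (g x) = h x * indicator {a..b} x"
    by eventually_elim (auto simp: g_def indicator_def less_top)
  show ?thesis
  proof (rule that[of g])
    show "0 \<le> g x" for x by (rule g0)
    fix u v assume uv: "a \<le> u" "u \<le> v" "v \<le> b"
    have "(\<integral>\<^sup>+x. ennreal (g x * indicator {u..v} x) \<partial>lborel) = (\<integral>\<^sup>+x. h x * indicator {u..v} x \<partial>lborel)"
      using ae uv by (intro nn_integral_cong_AE, elim eventually_mono) (auto simp: indicator_def)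
    then have "(\<integral>\<^sup>+x. ennreal (g x * indicator {u..v} x) \<partial>lborel) = ennreal (G v - G u)"
      using hI[OF uv] by simp
    moreover have "0 \<le> G v - G u" using mono_onD[OF mono, of u v] uv by auto
    ultimately have "((\<lambda>x. g x * indicator {u..v} x) has_integral (G v - G u)) UNIV"
      using gb g0 by (intro nn_integral_has_integral) (auto intro!: borel_measurable_times)
    moreover have "(\<lambda>x. g x * indicator {u..v} x) = (\<lambda>x. if x \<in> {u..v} then g x else 0)" by auto
    ultimately have "((\<lambda>x. if x \<in> {u..v} then g x else 0) has_integral (G v - G u)) UNIV" by (simp only:)
    then show "(g has_integral (G v - G u)) {u..v}"
      using has_integral_restrict[OF subset_UNIV, of "{u..v}" g] by blast
  qed
qed

text \<open>Differentiation of the integral yields limits of averages over \<open>[x, x + h]\<close>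
  with \<open>h > 0\<close> only. The averages to the left of \<open>x\<close> are those to the
  right of \<open>-x\<close> for the reflected function, which explains the second exceptional set
  and its image under negation.\<close>

lemma indefinite_integral_derivative:
  fixes f g :: "real \<Rightarrow> 'b::euclidean_space"
  assumes fg: "\<And>u v. a \<le> u \<Longrightarrow> u \<le> v \<Longrightarrow> v \<le> b \<Longrightarrow> (g has_integral (f v - f u)) {u..v}" and "a \<le> b"
  obtains N where "negligible N" "\<And>x. x \<in> {a<..<b} - N \<Longrightarrow> (f has_vector_derivative g x) (at x)"
proof -
  define k where "k x = (if x \<in> {a..b} then g x else 0)" for x
  have "g integrable_on {a..b}" using fg[of a b] assms(2) by (auto simp: integrable_on_def)
  then have ku: "k integrable_on UNIV" unfolding k_def by (simp only: Henstock_Kurzweil_Integration.integrable_restrict_UNIV)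
  have k1: "k integrable_on cbox u v" for u v
    using integrable_on_subcbox[OF ku] by simp
  have k2: "(\<lambda>x. k (- x)) integrable_on cbox u v" for u v
    using k1[of "-v" "-u"] integrable_reflect[where f = k and a = "-v" and b = "-u"] by simp
  have kI: "integral {u..v} k = f v - f u" if "a \<le> u" "u \<le> v" "v \<le> b" for u v
  proof -
    have "(k has_integral (f v - f u)) {u..v}"
      using has_integral_eq[OF _ fg[OF that], of k] that by (auto simp: k_def)
    then show ?thesis by (rule integral_unique)
  qed
  obtain N1 where N1: "negligible N1"
    "\<And>x e. x \<notin> N1 \<Longrightarrow> 0 < e \<Longrightarrow> \<exists>d>0. \<forall>h. 0 < h \<and> h < d \<longrightarrow> norm (integral (cbox x (x + h *\<^sub>R One)) k /\<^sub>R h ^ DIM(real) - k x) < e"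
    using integrable_ccontinuous_explicit[of k] k1 by metis
  obtain N2 where N2: "negligible N2"
    "\<And>x e. x \<notin> N2 \<Longrightarrow> 0 < e \<Longrightarrow> \<exists>d>0. \<forall>h. 0 < h \<and> h < d \<longrightarrow> norm (integral (cbox x (x + h *\<^sub>R One)) (\<lambda>x. k (- x)) /\<^sub>R h ^ DIM(real) - k (- x)) < e"
    using integrable_ccontinuous_explicit[of "\<lambda>x. k (- x)"] k2 by metis
  have negN: "negligible (N1 \<union> uminus ` N2)"
    using N1(1) negligible_differentiable_image_negligible[OF order_refl N2(1), of uminus]
    by (simp add: negligible_Un differentiable_on_def)
  show ?thesis
  proof (rule that[OF negN])
    fix x assume x: "x \<in> {a<..<b} - (N1 \<union> uminus ` N2)"
    then have nx: "x \<notin> N1" "- x \<notin> N2" by (auto simp: image_iff)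
    have kx: "k x = g x" using x by (simp add: k_def)
    show "(f has_vector_derivative g x) (at x)"
      unfolding has_vector_derivative_def has_derivative_at'
    proof (intro conjI allI impI)
      show "bounded_linear (\<lambda>h. h *\<^sub>R g x)" by (rule bounded_linear_scaleR_left)
      fix e :: real assume e: "e > 0"
      obtain d1 where d1: "d1 > 0" "\<And>h. 0 < h \<Longrightarrow> h < d1 \<Longrightarrow> norm (integral {x..x+h} k /\<^sub>R h - g x) < e"
        using N1(2)[OF nx(1) e] kx by auto
      obtain d2 where d2: "d2 > 0" "\<And>h. 0 < h \<Longrightarrow> h < d2 \<Longrightarrow> norm (integral {-x..-x+h} (\<lambda>x. k (- x)) /\<^sub>R h - g x) < e"
        using N2(2)[OF nx(2) e] kx by auto
      have key: "norm (f v - f u - (v - u) *\<^sub>R g x) / (v - u) < e"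
        if "u < v" "norm ((f v - f u) /\<^sub>R (v - u) - g x) < e" for u v
      proof -
        have "(f v - f u) /\<^sub>R (v - u) - g x = (f v - f u - (v - u) *\<^sub>R g x) /\<^sub>R (v - u)"
          using that(1) by (simp add: scaleR_diff_right)
        then show ?thesis using that by (simp add: divide_inverse mult.commute)
      qed
      show "\<exists>d>0. \<forall>x'. 0 < norm (x' - x) \<and> norm (x' - x) < d \<longrightarrow>
        norm (f x' - f x - (x' - x) *\<^sub>R g x) / norm (x' - x) < e"
      proof (intro exI[of _ "Min {d1, d2, x - a, b - x}"] conjI allI impI)
        show "0 < Min {d1, d2, x - a, b - x}" using d1 d2 x by auto
        fix x' assume x': "0 < norm (x' - x) \<and> norm (x' - x) < Min {d1, d2, x - a, b - x}"
        show "norm (f x' - f x - (x' - x) *\<^sub>R g x) / norm (x' - x) < e"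
        proof (cases "x < x'")
          case True
          then have "norm (integral {x..x'} k /\<^sub>R (x' - x) - g x) < e" using d1(2)[of "x' - x"] x' by auto
          then have "norm ((f x' - f x) /\<^sub>R (x' - x) - g x) < e" using kI[of x x'] True x x' by auto
          from key[OF True this] show ?thesis using True by simp
        next
          case False
          then have lt: "x' < x" using x' by auto
          have "norm (integral {-x..-x'} (\<lambda>x. k (- x)) /\<^sub>R (x - x') - g x) < e" using d2(2)[of "x - x'"] x' lt by auto
          then have "norm ((f x - f x') /\<^sub>R (x - x') - g x) < e" using kI[of x' x] lt x x' by auto
          from key[OF lt this] have "norm (f x - f x' - (x - x') *\<^sub>R g x) / (x - x') < e" .
          moreover have "f x - f x' - (x - x') *\<^sub>R g x = - (f x' - f x - (x' - x) *\<^sub>R g x)"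
            by (simp add: algebra_simps)
          ultimately show ?thesis using lt by (metis abs_minus_commute abs_of_pos diff_gt_0_iff_gt norm_minus_cancel real_norm_def)
        qed
      qed
    qed
  qed
qed

lemma abs_cont_on_diff:
  fixes f g :: "real \<Rightarrow> 'b::real_normed_vector"
  assumes "abs_cont_on a b f" "abs_cont_on a b g"
  shows "abs_cont_on a b (\<lambda>x. f x - g x)"
proof (rule abs_cont_onI)
  fix e :: real assume e: "e > 0"
  obtain d1 where d1: "d1>0" "\<forall>D S. D division_of S \<longrightarrow> S \<subseteq> {a..b} \<longrightarrow> (\<Sum>K\<in>D. Sup K - Inf K) < d1 \<longrightarrow>
      (\<Sum>K\<in>D. norm (f (Sup K) - f (Inf K))) < e/2" by (rule abs_cont_onE[OF assms(1), of "e/2"]) (use e in auto)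
  obtain d2 where d2: "d2>0" "\<forall>D S. D division_of S \<longrightarrow> S \<subseteq> {a..b} \<longrightarrow> (\<Sum>K\<in>D. Sup K - Inf K) < d2 \<longrightarrow>
      (\<Sum>K\<in>D. norm (g (Sup K) - g (Inf K))) < e/2" by (rule abs_cont_onE[OF assms(2), of "e/2"]) (use e in auto)
  show "\<exists>d>0. \<forall>D S. D division_of S \<longrightarrow> S \<subseteq> {a..b} \<longrightarrow> (\<Sum>K\<in>D. Sup K - Inf K) < d \<longrightarrow>
      (\<Sum>K\<in>D. norm (f (Sup K) - g (Sup K) - (f (Inf K) - g (Inf K)))) < e"
  proof (intro exI[of _ "min d1 d2"] conjI allI impI)
    fix D S assume D: "D division_of S" "S \<subseteq> {a..b}" "(\<Sum>K\<in>D. Sup K - Inf K) < min d1 d2"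
    have "(\<Sum>K\<in>D. norm (f (Sup K) - g (Sup K) - (f (Inf K) - g (Inf K)))) \<le>
      (\<Sum>K\<in>D. norm (f (Sup K) - f (Inf K)) + norm (g (Sup K) - g (Inf K)))"
    proof (rule sum_mono)
      fix K
      have "f (Sup K) - g (Sup K) - (f (Inf K) - g (Inf K)) = (f (Sup K) - f (Inf K)) - (g (Sup K) - g (Inf K))" by simp
      then show "norm (f (Sup K) - g (Sup K) - (f (Inf K) - g (Inf K))) \<le> norm (f (Sup K) - f (Inf K)) + norm (g (Sup K) - g (Inf K))"
        by (metis norm_triangle_ineq4)
    qed
    also have "\<dots> < e/2 + e/2"
      unfolding sum.distrib using d1(2)[rule_format, OF D(1,2)] d2(2)[rule_format, OF D(1,2)] D(3)
      by (intro add_strict_mono) auto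
    finally show "(\<Sum>K\<in>D. norm (f (Sup K) - g (Sup K) - (f (Inf K) - g (Inf K)))) < e" by simp
  qed (use d1 d2 in auto)
qed

text \<open>Jordan decomposition: \<open>f\<close> is the difference of its variation and of the
  variation minus \<open>f\<close>, both monotone and absolutely continuous.\<close>

lemma abs_cont_density_real:
  fixes f :: "real \<Rightarrow> real"
  assumes ac: "abs_cont_on a b f" and ab: "a \<le> b"
  shows "\<exists>g. g absolutely_integrable_on {a..b} \<and>
    (\<forall>u v. a \<le> u \<longrightarrow> u \<le> v \<longrightarrow> v \<le> b \<longrightarrow> (g has_integral (f v - f u)) {u..v})"
proof -
  let ?W = "variation f a"
  have acW: "abs_cont_on a b ?W" by (rule abs_cont_on_variation[OF ac ab])
  have inc: "\<bar>f v - f u\<bar> \<le> ?W v - ?W u" if "a \<le> u" "u \<le> v" "v \<le> b" for u v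
    using increment_le_variation[OF abs_cont_on_subinterval[OF ac that(1,3)] that(2)]
      variation_add[OF abs_cont_on_subinterval[OF ac order.refl that(3)] that(1,2)] by simp
  have m1: "mono_on {a..b} ?W" using inc by (force intro: mono_onI)
  have m2: "mono_on {a..b} (\<lambda>x. ?W x - f x)" using inc by (force intro: mono_onI)
  obtain g1 where g1: "\<And>x. 0 \<le> g1 x"
    "\<And>u v. a \<le> u \<Longrightarrow> u \<le> v \<Longrightarrow> v \<le> b \<Longrightarrow> (g1 has_integral (?W v - ?W u)) {u..v}"
    using mono_abs_cont_density[OF acW m1 ab] by metis
  obtain g2 where g2: "\<And>x. 0 \<le> g2 x"
    "\<And>u v. a \<le> u \<Longrightarrow> u \<le> v \<Longrightarrow> v \<le> b \<Longrightarrow> (g2 has_integral (?W v - f v - (?W u - f u))) {u..v}"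
    using mono_abs_cont_density[OF abs_cont_on_diff[OF acW ac] m2 ab] by metis
  have "g1 absolutely_integrable_on {a..b}" "g2 absolutely_integrable_on {a..b}"
    using g1(1) g1(2)[of a b] g2(1) g2(2)[of a b] ab
    by (auto intro!: nonnegative_absolutely_integrable_1 simp: integrable_on_def)
  then have "(\<lambda>x. g1 x - g2 x) absolutely_integrable_on {a..b}" by (rule set_integral_diff)
  moreover have "((\<lambda>x. g1 x - g2 x) has_integral (f v - f u)) {u..v}" if "a \<le> u" "u \<le> v" "v \<le> b" for u v
    using has_integral_diff[OF g1(2)[OF that] g2(2)[OF that]] by (simp add: algebra_simps)
  ultimately show ?thesis by blast
qed

lemma abs_cont_on_inner:
  assumes "abs_cont_on a b f" "i \<in> Basis"
  shows "abs_cont_on a b (\<lambda>x. f x \<bullet> i)"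
proof (rule abs_cont_onI)
  fix e :: real assume e: "e > 0"
  obtain d1 where d1: "d1>0" "\<forall>D S. D division_of S \<longrightarrow> S \<subseteq> {a..b} \<longrightarrow> (\<Sum>K\<in>D. Sup K - Inf K) < d1 \<longrightarrow>
      (\<Sum>K\<in>D. norm (f (Sup K) - f (Inf K))) < e" by (rule abs_cont_onE[OF assms(1) e])
  have "(\<Sum>K\<in>D. norm (f (Sup K) \<bullet> i - f (Inf K) \<bullet> i)) \<le> (\<Sum>K\<in>D. norm (f (Sup K) - f (Inf K)))" for D
    by (intro sum_mono) (simp add: Basis_le_norm[OF assms(2)] flip: inner_diff_left)
  then show "\<exists>d>0. \<forall>D S. D division_of S \<longrightarrow> S \<subseteq> {a..b} \<longrightarrow> (\<Sum>K\<in>D. Sup K - Inf K) < d \<longrightarrow>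
      (\<Sum>K\<in>D. norm (f (Sup K) \<bullet> i - f (Inf K) \<bullet> i)) < e"
    using d1 by (meson order_le_less_trans)
qed

lemma abs_cont_density:
  fixes f :: "real \<Rightarrow> 'b::euclidean_space"
  assumes ac: "abs_cont_on a b f" and ab: "a \<le> b"
  obtains g where "g absolutely_integrable_on {a..b}"
    "\<And>u v. a \<le> u \<Longrightarrow> u \<le> v \<Longrightarrow> v \<le> b \<Longrightarrow> (g has_integral (f v - f u)) {u..v}"
proof -
  have "\<exists>g. g absolutely_integrable_on {a..b} \<and>
    (\<forall>u v. a \<le> u \<longrightarrow> u \<le> v \<longrightarrow> v \<le> b \<longrightarrow> (g has_integral (f v \<bullet> i - f u \<bullet> i)) {u..v})" if "i \<in> Basis" for i
    by (rule abs_cont_density_real[OF abs_cont_on_inner[OF ac that] ab])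
  then obtain g where g: "\<And>i. i \<in> Basis \<Longrightarrow> g i absolutely_integrable_on {a..b}"
    "\<And>i u v. i \<in> Basis \<Longrightarrow> a \<le> u \<Longrightarrow> u \<le> v \<Longrightarrow> v \<le> b \<Longrightarrow> (g i has_integral (f v \<bullet> i - f u \<bullet> i)) {u..v}"
    by metis
  define G where "G x = (\<Sum>i\<in>Basis. g i x *\<^sub>R i)" for x
  have Gi: "G x \<bullet> i = g i x" if "i \<in> Basis" for x i
    unfolding G_def using that by (simp add: inner_sum_left inner_Basis if_distrib cong: if_cong)
  show ?thesis
  proof (rule that[of G])
    show "G absolutely_integrable_on {a..b}"
      by (rule absolutely_integrable_componentwise) (simp add: Gi g(1))
    show "(G has_integral (f v - f u)) {u..v}" if "a \<le> u" "u \<le> v" "v \<le> b" for u v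
      by (rule has_integral_componentwise) (simp add: Gi g(2)[OF _ that] inner_diff_left)
  qed
qed

text \<open>The density agrees with \<open>vector_derivative\<close> almost everywhere, and the
  arbitrary value of the latter at points without derivative does not affect integrals. From here on
  the derivative itself serves as the density.\<close>

theorem abs_cont_on_FTC:
  fixes f :: "real \<Rightarrow> 'b::euclidean_space"
  assumes ac: "abs_cont_on a b f" and ab: "a \<le> b"
  shows "\<exists>N. negligible N \<and> (\<forall>x\<in>{a<..<b} - N. (f has_vector_derivative vector_derivative f (at x)) (at x))"
    and "(\<lambda>x. vector_derivative f (at x)) absolutely_integrable_on {a..b}"
    and "\<And>u v. a \<le> u \<Longrightarrow> u \<le> v \<Longrightarrow> v \<le> b \<Longrightarrow> ((\<lambda>x. vector_derivative f (at x)) has_integral (f v - f u)) {u..v}"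
proof -
  obtain g where g: "g absolutely_integrable_on {a..b}"
    "\<And>u v. a \<le> u \<Longrightarrow> u \<le> v \<Longrightarrow> v \<le> b \<Longrightarrow> (g has_integral (f v - f u)) {u..v}"
    using abs_cont_density[OF ac ab] by metis
  obtain N where N: "negligible N" "\<And>x. x \<in> {a<..<b} - N \<Longrightarrow> (f has_vector_derivative g x) (at x)"
    using indefinite_integral_derivative[OF g(2) ab] by metis
  have vd: "vector_derivative f (at x) = g x" if "x \<in> {a<..<b} - N" for x
    using N(2)[OF that] by (rule vector_derivative_at)
  then show "\<exists>N. negligible N \<and> (\<forall>x\<in>{a<..<b} - N. (f has_vector_derivative vector_derivative f (at x)) (at x))"
    using N by (intro exI[of _ N]) auto
  have neg: "negligible (N \<union> {a, b})" using N(1) by simp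
  show "(\<lambda>x. vector_derivative f (at x)) absolutely_integrable_on {a..b}"
    using vd by (intro absolutely_integrable_spike[OF g(1) neg]) auto
  show "((\<lambda>x. vector_derivative f (at x)) has_integral (f v - f u)) {u..v}" if "a \<le> u" "u \<le> v" "v \<le> b" for u v
    using vd that by (intro has_integral_spike[OF neg _ g(2)[OF that]]) auto
qed

text \<open>The integral is absolutely continuous in its set: \<open>\<bar>m\<bar>\<close> is
  truncated at a level \<open>n\<close> whose remainder has integral below \<open>e / 2\<close>, and
  the truncated part contributes at most \<open>n\<close> times the total length, which is where
  \<delta> comes from.\<close>

lemma abs_cont_onI_integral:
  fixes f :: "real \<Rightarrow> 'b::real_normed_vector" and m :: "real \<Rightarrow> real"
  assumes m: "m absolutely_integrable_on {a..b}"
    and le: "\<And>u v. a \<le> u \<Longrightarrow> u \<le> v \<Longrightarrow> v \<le> b \<Longrightarrow> norm (f v - f u) \<le> integral {u..v} m"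
  shows "abs_cont_on a b f"
proof (rule abs_cont_onI)
  fix e :: real assume e: "e > 0"
  define k where "k n x = min \<bar>m x\<bar> (real n)" for n x
  have am: "(\<lambda>x. \<bar>m x\<bar>) absolutely_integrable_on {a..b}" using absolutely_integrable_abs[OF m] by simp
  have kai: "k n absolutely_integrable_on {a..b}" for n
    unfolding k_def by (intro absolutely_integrable_min_1 am) (simp add: absolutely_integrable_on_const)
  have "(\<lambda>n. integral {a..b} (k n)) \<longlonglongrightarrow> integral {a..b} (\<lambda>x. \<bar>m x\<bar>)"
  proof (rule dominated_convergence(2))
    show "k n integrable_on {a..b}" for n using kai by (rule set_lebesgue_integral_eq_integral(1))
    show "(\<lambda>x. \<bar>m x\<bar>) integrable_on {a..b}" using am by (rule set_lebesgue_integral_eq_integral(1))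
    show "(\<lambda>n. k n x) \<longlonglongrightarrow> \<bar>m x\<bar>" for x
    proof (rule tendsto_eventually)
      obtain n0 where "\<bar>m x\<bar> < real n0" using reals_Archimedean2 by blast
      then show "\<forall>\<^sub>F n in sequentially. k n x = \<bar>m x\<bar>"
        unfolding k_def eventually_sequentially by (intro exI[of _ n0]) (auto simp: min_def)
    qed
  qed (auto simp: k_def)
  then have lim: "(\<lambda>n. integral {a..b} (k n)) \<longlonglongrightarrow> integral {a..b} (\<lambda>x. \<bar>m x\<bar>)" .
  obtain n where n: "integral {a..b} (\<lambda>x. \<bar>m x\<bar>) - integral {a..b} (k n) < e/2"
  proof -
    obtain n where "norm (integral {a..b} (k n) - integral {a..b} (\<lambda>x. \<bar>m x\<bar>)) < e/2"
      using e LIMSEQ_D[OF lim, of "e/2"] by (meson half_gt_zero order.refl)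
    then show ?thesis by (intro that[of n]) (simp add: abs_real_def split: if_splits)
  qed
  define \<delta> where "\<delta> = e / (2 * (real n + 1))"
  have d: "\<delta> > 0" using e by (simp add: \<delta>_def)
  let ?r = "\<lambda>x. \<bar>m x\<bar> - k n x"
  have rai: "?r absolutely_integrable_on {a..b}" using am kai by (rule set_integral_diff)
  show "\<exists>d>0. \<forall>D S. D division_of S \<longrightarrow> S \<subseteq> {a..b} \<longrightarrow> (\<Sum>K\<in>D. Sup K - Inf K) < d \<longrightarrow>
      (\<Sum>K\<in>D. norm (f (Sup K) - f (Inf K))) < e"
  proof (intro exI[of _ \<delta>] conjI d allI impI)
    fix D S assume D: "D division_of S" "S \<subseteq> {a..b}" "(\<Sum>K\<in>D. Sup K - Inf K) < \<delta>"
    have S: "S \<in> sets lebesgue" using lmeasurable_division[OF D(1)] by auto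
    have rS: "?r integrable_on S" using set_integrable_subset[OF rai S D(2)] by (rule set_lebesgue_integral_eq_integral(1))
    have "(\<Sum>K\<in>D. norm (f (Sup K) - f (Inf K))) \<le> (\<Sum>K\<in>D. integral K ?r + real n * (Sup K - Inf K))"
    proof (rule sum_mono)
      fix K assume K: "K \<in> D"
      obtain u v where uv: "K = {u..v}" using division_ofD(4)[OF D(1) K] by auto
      have "u \<le> v" using uv division_ofD(3)[OF D(1) K] by auto
      moreover have sub: "{u..v} \<subseteq> {a..b}" using division_ofD(2)[OF D(1) K] D(2) uv by blast
      ultimately have uv': "a \<le> u" "u \<le> v" "v \<le> b" by auto
      have i: "m integrable_on {u..v}" "(\<lambda>x. \<bar>m x\<bar>) integrable_on {u..v}" "k n integrable_on {u..v}" "?r integrable_on {u..v}"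
        by (rule set_lebesgue_integral_eq_integral(1), rule absolutely_integrable_on_subinterval[OF _ sub], fact)+
      have "norm (f v - f u) \<le> integral {u..v} m" by (rule le[OF uv'])
      also have "\<dots> \<le> integral {u..v} (\<lambda>x. \<bar>m x\<bar>)" by (rule integral_le[OF i(1,2)]) auto
      also have "\<dots> = integral {u..v} ?r + integral {u..v} (k n)"
        using integral_diff[OF i(2,3)] by simp
      also have "integral {u..v} (k n) \<le> integral {u..v} (\<lambda>_. real n)"
        by (rule integral_le[OF i(3)]) (auto simp: k_def)
      also have "\<dots> = real n * (v - u)" using uv' by simp
      finally show "norm (f (Sup K) - f (Inf K)) \<le> integral K ?r + real n * (Sup K - Inf K)"
        using uv uv' by simp
    qed
    also have "\<dots> = integral S ?r + real n * (\<Sum>K\<in>D. Sup K - Inf K)"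
      by (simp add: sum.distrib integral_combine_division_topdown[OF rS D(1)] sum_distrib_left)
    also have "integral S ?r \<le> integral {a..b} ?r"
      using rai by (intro integral_subset_le[OF D(2) rS]) (auto simp: k_def set_lebesgue_integral_eq_integral(1))
    also have "integral {a..b} ?r < e/2"
      using n integral_diff[of "\<lambda>x. \<bar>m x\<bar>" "{a..b}" "k n"] am kai by (simp add: set_lebesgue_integral_eq_integral(1))
    also have "real n * (\<Sum>K\<in>D. Sup K - Inf K) \<le> real n * \<delta>" using D(3) by (intro mult_left_mono) auto
    also have "real n * \<delta> \<le> e/2" using e by (simp add: \<delta>_def field_simps)
    finally show "(\<Sum>K\<in>D. norm (f (Sup K) - f (Inf K))) < e" by simp
  qed
qed

text \<open>The local statement concerns open intervals, so the joint \<open>v\<close> is added to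
  the exceptional set. Only finitely many joints arise.\<close>

lemma negligible_patching [consumes 1, case_names local]:
  fixes a b :: real
  assumes "a \<le> b"
    and local: "\<And>x. a \<le> x \<Longrightarrow> x \<le> b \<Longrightarrow> \<exists>d>0. \<forall>u v. a \<le> u \<and> u \<le> x \<and> x \<le> v \<and> v \<le> b \<and> v - u < d \<longrightarrow>
      (\<exists>N. negligible N \<and> (\<forall>s\<in>{u<..<v} - N. Q s))"
  shows "\<exists>N. negligible N \<and> (\<forall>s\<in>{a<..<b} - N. Q s)"
  using assms(1)
proof (induction rule: interval_patching)
  case (trans u v w)
  then obtain N1 N2 where N: "negligible N1" "negligible N2"
    "\<forall>s\<in>{u<..<v} - N1. Q s" "\<forall>s\<in>{v<..<w} - N2. Q s" by blast
  have "\<forall>s\<in>{u<..<w} - (N1 \<union> N2 \<union> {v}). Q s"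
  proof
    fix s assume s: "s \<in> {u<..<w} - (N1 \<union> N2 \<union> {v})"
    then consider "s \<in> {u<..<v} - N1" | "s \<in> {v<..<w} - N2" by force
    then show "Q s" using N(3,4) by cases blast+
  qed
  moreover have "negligible (N1 \<union> N2 \<union> {v})" using N by simp
  ultimately show ?case by blast
qed (rule local)

lemma integral_nonneg_eq_0_imp_negligible:
  fixes f :: "'a::euclidean_space \<Rightarrow> real"
  assumes f: "f absolutely_integrable_on S" and nn: "\<And>x. x \<in> S \<Longrightarrow> 0 \<le> f x" and 0: "integral S f = 0"
  shows "negligible {x\<in>S. f x \<noteq> 0}"
proof -
  let ?g = "\<lambda>x. indicator S x *\<^sub>R f x"
  have i: "integrable lebesgue ?g" using f by (simp add: set_integrable_def)
  have "(LINT x|lebesgue. ?g x) = 0"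
    using set_lebesgue_integral_eq_integral(2)[OF f] 0 by (simp add: set_lebesgue_integral_def)
  then have "AE x in lebesgue. ?g x = 0"
    using integral_nonneg_eq_0_iff_AE[OF i] nn by (auto simp: indicator_def)
  then obtain N where N: "N \<in> null_sets lebesgue" "{x \<in> space lebesgue. \<not> ?g x = 0} \<subseteq> N"
    unfolding eventually_ae_filter by blast
  have "{x\<in>S. f x \<noteq> 0} \<subseteq> {x \<in> space lebesgue. \<not> ?g x = 0}" by (auto simp: indicator_def)
  then show ?thesis using N negligible_subset unfolding negligible_iff_null_sets[symmetric] by (meson order.trans)
qed

lemma has_vector_derivative_quotient:
  fixes f :: "real \<Rightarrow> 'b::real_normed_vector"
  assumes "(f has_vector_derivative D) (at s)"
  shows "((\<lambda>k. (f (s + k) - f s) /\<^sub>R k) \<longlongrightarrow> D) (at 0)"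
proof -
  have "((\<lambda>y. norm (f y - f s - (y - s) *\<^sub>R D) / norm (y - s)) \<longlongrightarrow> 0) (at s)"
    using assms unfolding has_vector_derivative_def has_derivative_iff_norm by blast
  then have A: "((\<lambda>k. norm (f (s + k) - f s - k *\<^sub>R D) / norm k) \<longlongrightarrow> 0) (at 0)"
    by (drule_tac LIM_offset_zero) simp
  have "((\<lambda>k. norm ((f (s + k) - f s) /\<^sub>R k - D)) \<longlongrightarrow> 0) (at 0)"
  proof (rule Lim_transform_eventually[OF A])
    have "norm (f (s + k) - f s - k *\<^sub>R D) / norm k = norm ((f (s + k) - f s) /\<^sub>R k - D)" if "k \<noteq> 0" for k
    proof -
      have "(f (s + k) - f s) /\<^sub>R k - D = (f (s + k) - f s - k *\<^sub>R D) /\<^sub>R k"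
        using that by (simp add: scaleR_diff_right)
      then show ?thesis by (simp add: divide_inverse mult.commute)
    qed
    then show "\<forall>\<^sub>F k in at 0. norm (f (s + k) - f s - k *\<^sub>R D) / norm k = norm ((f (s + k) - f s) /\<^sub>R k - D)"
      by (simp add: eventually_at_filter)
  qed
  then show ?thesis by (rule LIM_zero_cancel[OF tendsto_norm_zero_cancel])
qed

lemma integral_le_off_negligible:
  fixes f g :: "'a::euclidean_space \<Rightarrow> real"
  assumes "f integrable_on S" "g integrable_on S" "negligible N" "\<And>x. x \<in> S - N \<Longrightarrow> f x \<le> g x"
  shows "integral S f \<le> integral S g"
proof -
  let ?g = "\<lambda>x. if x \<in> N then f x else g x"
  have "(?g has_integral integral S g) S"
    by (rule has_integral_spike[OF assms(3) _ integrable_integral[OF assms(2)]]) auto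
  then show ?thesis
    by (rule has_integral_le[OF integrable_integral[OF assms(1)]]) (use assms(4) in auto)
qed

lemma deriv_eq_vector_derivative: "deriv h = (\<lambda>s. vector_derivative h (at s))" for h :: "real \<Rightarrow> real"
  by (rule ext) (rule field_derivative_eq_vector_derivative)

section \<open>Monotone reparametrization and change of variables\<close>

text \<open>The setting of the time maps \<open>that_eps\<close>. Monotonicity is not strict, so
  \<open>h\<close> may stand still on intervals and need not be injective.\<close>

locale mono_ac =
  fixes a b :: real and h :: "real \<Rightarrow> real"
  assumes ac: "abs_cont_on a b h" and mono: "mono_on {a..b} h" and ab: "a \<le> b"
begin

lemma deriv_absolutely_integrable: "deriv h absolutely_integrable_on {a..b}"
  unfolding deriv_eq_vector_derivative by (rule abs_cont_on_FTC(2)[OF ac ab])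

lemma deriv_has_integral:
  "a \<le> u \<Longrightarrow> u \<le> v \<Longrightarrow> v \<le> b \<Longrightarrow> (deriv h has_integral (h v - h u)) {u..v}"
  unfolding deriv_eq_vector_derivative by (rule abs_cont_on_FTC(3)[OF ac ab])

text \<open>Provides a set on which the change of variables for injective maps applies. If
  \<open>h\<close> took the same value at two points, it would be constant between them by
  monotonicity, so its derivative at the left one would vanish.\<close>

lemma regular_set:
  obtains N S where "negligible N" "S = {s\<in>{a<..<b} - N. deriv h s \<noteq> 0}"
    "\<forall>s\<in>{a<..<b} - N. (h has_real_derivative deriv h s) (at s) \<and> 0 \<le> deriv h s"
    "S \<in> sets lebesgue" "inj_on h S"
proof -
  obtain N where N: "negligible N" "\<And>s. s \<in> {a<..<b} - N \<Longrightarrow> (h has_vector_derivative vector_derivative h (at s)) (at s)"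
    using abs_cont_on_FTC(1)[OF ac ab] by blast
  then have d: "(h has_real_derivative deriv h s) (at s)" if "s \<in> {a<..<b} - N" for s
    using that by (simp add: has_real_derivative_iff_has_vector_derivative deriv_eq_vector_derivative)
  have nn: "0 \<le> deriv h s" if "s \<in> {a<..<b} - N" for s
    using mono_on_imp_deriv_nonneg[OF mono d[OF that]] that by (simp add: interior_atLeastAtMost_real)
  define S where "S = {s\<in>{a<..<b} - N. deriv h s \<noteq> 0}"
  have "deriv h \<in> borel_measurable (lebesgue_on {a..b})"
    using absolutely_integrable_imp_borel_measurable[OF deriv_absolutely_integrable] by simp
  then have "{s \<in> space (lebesgue_on {a..b}). deriv h s \<noteq> 0} \<in> sets (lebesgue_on {a..b})"
    by measurable
  then have "{s \<in> {a..b}. deriv h s \<noteq> 0} \<in> sets lebesgue"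
    by (simp add: sets_restrict_space_iff)
  moreover have "S = {s \<in> {a..b}. deriv h s \<noteq> 0} \<inter> ({a<..<b} - N)" by (auto simp: S_def)
  ultimately have Sm: "S \<in> sets lebesgue"
    using negligible_imp_sets[OF N(1)] by (simp add: sets.Int sets.Diff)
  have "h x \<noteq> h y" if xy: "x \<in> S" "y \<in> S" "x < y" for x y
  proof
    assume eq: "h x = h y"
    have const: "h s = h x" if "s \<in> {x..y}" for s
    proof -
      have "h x \<le> h s" "h s \<le> h y" using xy that by (auto simp: S_def intro!: mono_onD[OF mono])
      then show ?thesis using eq by simp
    qed
    have 1: "(h has_vector_derivative deriv h x) (at x within cbox x y)"
      using d[of x] xy by (auto simp: S_def has_real_derivative_iff_has_vector_derivative intro: has_vector_derivative_at_within)
    have "((\<lambda>_. h x) has_vector_derivative 0) (at x within cbox x y)" by (rule has_vector_derivative_const)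
    then have 2: "(h has_vector_derivative 0) (at x within cbox x y)"
    proof (rule has_vector_derivative_transform[rotated 2])
      show "x \<in> cbox x y" using xy(3) by simp
      show "h s = h x" if "s \<in> cbox x y" for s by (rule const) (use that in simp)
    qed
    have "deriv h x = 0"
      by (rule vector_derivative_unique_within_closed_interval[OF _ _ 1 2]) (use xy in auto)
    then show False using xy by (auto simp: S_def)
  qed
  then have inj: "inj_on h S" by (intro inj_onI) (metis linorder_less_linear)
  have "\<forall>s\<in>{a<..<b} - N. (h has_real_derivative deriv h s) (at s) \<and> 0 \<le> deriv h s"
    by (intro ballI conjI d nn)
  from that[OF N(1) S_def this Sm inj] show ?thesis .
qed

lemma h_range: "s \<in> {a..b} \<Longrightarrow> h s \<in> {h a..h b}"
  using mono_onD[OF mono] by auto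

text \<open>The change of variables for injective maps integrates over \<open>S\<close> with the
  absolute value of the derivative. Outside \<open>S\<close> the integrand vanishes up to a null
  set, and on \<open>S\<close> the derivative is nonnegative.\<close>

lemma restrict_regular:
  fixes f :: "real \<Rightarrow> 'b::euclidean_space"
  assumes N: "negligible N" and S: "S = {s\<in>{a<..<b} - N. deriv h s \<noteq> 0}"
    and nn: "\<And>s. s \<in> {a<..<b} - N \<Longrightarrow> 0 \<le> deriv h s"
  shows "(\<lambda>s. deriv h s *\<^sub>R f (h s)) absolutely_integrable_on {a..b} \<longleftrightarrow> (\<lambda>s. \<bar>deriv h s\<bar> *\<^sub>R f (h s)) absolutely_integrable_on S"
    "integral {a..b} (\<lambda>s. deriv h s *\<^sub>R f (h s)) = integral S (\<lambda>s. \<bar>deriv h s\<bar> *\<^sub>R f (h s))"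
proof -
  let ?F = "\<lambda>s. \<bar>deriv h s\<bar> *\<^sub>R f (h s)" and ?G = "\<lambda>s. deriv h s *\<^sub>R f (h s)"
  have neg: "negligible (N \<union> {a, b})" using N by simp
  have sub: "S \<subseteq> {a..b}" using S by auto
  have eq: "?G s = (if s \<in> S then ?F s else 0)" if "s \<in> {a..b} - (N \<union> {a, b})" for s
    using that nn[of s] S by auto
  have "?G absolutely_integrable_on {a..b} \<longleftrightarrow> (\<lambda>s. if s \<in> S then ?F s else 0) absolutely_integrable_on {a..b}"
    by (rule absolutely_integrable_spike_eq[OF neg]) (use eq in auto)
  also have "\<dots> \<longleftrightarrow> ?F absolutely_integrable_on S"
  proof -
    have e: "(\<lambda>s. if s \<in> {a..b} then if s \<in> S then ?F s else 0 else 0) = (\<lambda>s. if s \<in> S then ?F s else 0)"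
      using subsetD[OF sub] by (intro ext) auto
    show ?thesis
      using absolutely_integrable_restrict_UNIV[of "{a..b}" "\<lambda>s. if s \<in> S then ?F s else 0", unfolded e]
        absolutely_integrable_restrict_UNIV[of S ?F] by blast
  qed
  finally show "?G absolutely_integrable_on {a..b} \<longleftrightarrow> ?F absolutely_integrable_on S" .
  have "integral {a..b} ?G = integral {a..b} (\<lambda>s. if s \<in> S then ?F s else 0)"
    by (rule integral_spike[OF neg]) (use eq in auto)
  also have "\<dots> = integral S ?F"
    unfolding Henstock_Kurzweil_Integration.integral_restrict_Int Int_absorb2[OF sub] ..
  finally show "integral {a..b} ?G = integral S ?F" .
qed

lemma change_of_variables:
  fixes f :: "real \<Rightarrow> 'b::euclidean_space"
  assumes f: "f absolutely_integrable_on {h a..h b}"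
  shows "(\<lambda>s. deriv h s *\<^sub>R f (h s)) absolutely_integrable_on {a..b}"
    and "integral {a..b} (\<lambda>s. deriv h s *\<^sub>R f (h s)) = integral {h a..h b} f"
proof -
  obtain N S where NS: "negligible N" "S = {s\<in>{a<..<b} - N. deriv h s \<noteq> 0}"
    "\<forall>s\<in>{a<..<b} - N. (h has_real_derivative deriv h s) (at s) \<and> 0 \<le> deriv h s"
    "S \<in> sets lebesgue" "inj_on h S" by (rule regular_set)
  have dS: "(h has_field_derivative deriv h x) (at x within S)" if "x \<in> S" for x
    using NS(2,3) that by (auto intro: has_field_derivative_at_within)
  note rr = restrict_regular[OF NS(1,2)]
  have nn: "0 \<le> deriv h s" if "s \<in> {a<..<b} - N" for s using NS(3) that by blast
  have sub: "h ` S \<subseteq> {h a..h b}"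
  proof (rule image_subsetI)
    fix s assume "s \<in> S"
    then have "s \<in> {a..b}" using NS(2) by auto
    then show "h s \<in> {h a..h b}" by (rule h_range)
  qed
  have "(\<lambda>s. deriv h s *\<^sub>R (1::real)) absolutely_integrable_on {a..b}"
    using deriv_absolutely_integrable by simp
  moreover have "integral {a..b} (\<lambda>s. deriv h s *\<^sub>R (1::real)) = h b - h a"
    using deriv_has_integral[of a b] ab by (simp add: integral_unique)
  ultimately have one: "(\<lambda>_. 1::real) absolutely_integrable_on h ` S" "integral (h ` S) (\<lambda>_. 1::real) = h b - h a"
    using has_absolute_integral_change_of_variables_real[OF NS(4) dS NS(5), of "\<lambda>_. 1::real" "h b - h a"]
      rr[OF nn, of "\<lambda>_. 1::real"] by simp_all
  then have lm: "h ` S \<in> lmeasurable" "measure lebesgue (h ` S) = h b - h a"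
    by (auto simp: lmeasurable_iff_integrable_on lmeasure_integral set_lebesgue_integral_eq_integral(1))
  have hab: "h a \<le> h b" using mono_onD[OF mono, of a b] ab by auto
  have "measure lebesgue ({h a..h b} - h ` S) = 0"
    using measurable_measure_Diff[of "{h a..h b}" lebesgue "h ` S"] lm sub hab by (simp add: fmeasurableD)
  then have neg: "negligible ({h a..h b} - h ` S)"
    using lm by (simp add: negligible_iff_measure fmeasurable.Diff)
  have neg': "negligible (h ` S - {h a..h b})" using sub by (simp add: Diff_eq_empty_iff[THEN iffD2])
  have fS: "f absolutely_integrable_on h ` S" "integral (h ` S) f = integral {h a..h b} f"
  proof -
    show "f absolutely_integrable_on h ` S"
      by (rule set_integrable_subset[OF f _ sub]) (use lm in auto)
    show "integral (h ` S) f = integral {h a..h b} f"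
    proof (rule integral_spike_set)
      show "negligible {x \<in> h ` S - {h a..h b}. f x \<noteq> 0}" by (rule negligible_subset[OF neg']) auto
      show "negligible {x \<in> {h a..h b} - h ` S. f x \<noteq> 0}" by (rule negligible_subset[OF neg]) auto
    qed
  qed
  then have "(\<lambda>s. \<bar>deriv h s\<bar> *\<^sub>R f (h s)) absolutely_integrable_on S \<and> integral S (\<lambda>s. \<bar>deriv h s\<bar> *\<^sub>R f (h s)) = integral {h a..h b} f"
    using has_absolute_integral_change_of_variables_real[OF NS(4) dS NS(5), of f "integral {h a..h b} f"] by simp
  then show "(\<lambda>s. deriv h s *\<^sub>R f (h s)) absolutely_integrable_on {a..b}"
    "integral {a..b} (\<lambda>s. deriv h s *\<^sub>R f (h s)) = integral {h a..h b} f"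
    using rr[OF nn, of f] by simp_all
qed

text \<open>The preimage of a null set can have positive measure where \<open>h\<close> stands
  still. Changing variables in the integral of the indicator of \<open>Z\<close>, which is 0, shows
  that the derivative vanishes almost everywhere on this preimage.\<close>

lemma preimage_negligible:
  assumes "negligible Z"
  obtains N where "negligible N"
    "\<And>s. s \<in> {a<..<b} - N \<Longrightarrow> (h has_real_derivative deriv h s) (at s) \<and> 0 \<le> deriv h s \<and> (deriv h s = 0 \<or> h s \<notin> Z)"
proof -
  obtain N S where NS: "negligible N" "S = {s\<in>{a<..<b} - N. deriv h s \<noteq> 0}"
    "\<forall>s\<in>{a<..<b} - N. (h has_real_derivative deriv h s) (at s) \<and> 0 \<le> deriv h s"
    "S \<in> sets lebesgue" "inj_on h S" by (rule regular_set)
  let ?f = "indicator Z :: real \<Rightarrow> real"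
  have f: "?f absolutely_integrable_on {h a..h b}" "integral {h a..h b} ?f = 0"
  proof -
    have "(?f has_integral 0) {h a..h b}"
      by (rule has_integral_spike[OF assms _ has_integral_0]) (auto simp: indicator_def)
    then show "integral {h a..h b} ?f = 0" by (rule integral_unique)
    show "?f absolutely_integrable_on {h a..h b}"
      by (rule absolutely_integrable_spike[OF absolutely_integrable_zero assms]) (auto simp: indicator_def)
  qed
  have nn: "0 \<le> deriv h s" if "s \<in> {a<..<b} - N" for s using NS(3) that by blast
  note rr = restrict_regular[OF NS(1,2) nn, of ?f]
  have 1: "(\<lambda>s. \<bar>deriv h s\<bar> *\<^sub>R ?f (h s)) absolutely_integrable_on S"
    "integral S (\<lambda>s. \<bar>deriv h s\<bar> *\<^sub>R ?f (h s)) = 0"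
    using change_of_variables[OF f(1)] f(2) rr by simp_all
  have neg: "negligible {s\<in>S. \<bar>deriv h s\<bar> *\<^sub>R ?f (h s) \<noteq> 0}"
    by (rule integral_nonneg_eq_0_imp_negligible[OF 1(1) _ 1(2)]) auto
  show ?thesis
  proof (rule that)
    show "negligible (N \<union> {s\<in>S. \<bar>deriv h s\<bar> *\<^sub>R ?f (h s) \<noteq> 0})" using NS(1) neg by simp
    fix s assume s: "s \<in> {a<..<b} - (N \<union> {s\<in>S. \<bar>deriv h s\<bar> *\<^sub>R ?f (h s) \<noteq> 0})"
    then show "(h has_real_derivative deriv h s) (at s) \<and> 0 \<le> deriv h s \<and> (deriv h s = 0 \<or> h s \<notin> Z)"
      using NS(2,3) by (auto simp: indicator_def)
  qed
qed

end

section \<open>Joining and composing absolutely continuous functions\<close>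

lemma abs_cont_on_norm_le:
  fixes f :: "real \<Rightarrow> 'b::euclidean_space"
  assumes "abs_cont_on a b f" "a \<le> u" "u \<le> v" "v \<le> b"
  shows "norm (f v - f u) \<le> integral {u..v} (\<lambda>s. norm (vector_derivative f (at s)))"
proof -
  have ab: "a \<le> b" and sub: "{u..v} \<subseteq> {a..b}" using assms by auto
  have i: "((\<lambda>s. vector_derivative f (at s)) has_integral (f v - f u)) {u..v}"
    using abs_cont_on_FTC(3)[OF assms(1) ab] assms by blast
  have "(\<lambda>s. vector_derivative f (at s)) absolutely_integrable_on {u..v}"
    by (rule absolutely_integrable_on_subinterval[OF abs_cont_on_FTC(2)[OF assms(1) ab] sub])
  then have "(\<lambda>s. norm (vector_derivative f (at s))) integrable_on {u..v}"
    by (simp add: absolutely_integrable_on_def)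
  then have "norm (integral {u..v} (\<lambda>s. vector_derivative f (at s))) \<le> integral {u..v} (\<lambda>s. norm (vector_derivative f (at s)))"
    using i by (intro integral_norm_bound_integral) (auto simp: integrable_on_def)
  then show ?thesis using i by (simp add: integral_unique)
qed

lemma abs_cont_on_norm_integrable:
  fixes f :: "real \<Rightarrow> 'b::euclidean_space"
  assumes "abs_cont_on a b f" "a \<le> b"
  shows "(\<lambda>s. norm (vector_derivative f (at s))) absolutely_integrable_on {a..b}"
  by (rule absolutely_integrable_norm[OF abs_cont_on_FTC(2)[OF assms], unfolded o_def])

lemma abs_cont_on_cong:
  assumes "\<And>x. x \<in> {a..b} \<Longrightarrow> f x = g x"
  shows "abs_cont_on a b f \<longleftrightarrow> abs_cont_on a b g"
proof -
  have "(\<Sum>K\<in>D. norm (f (Sup K) - f (Inf K))) = (\<Sum>K\<in>D. norm (g (Sup K) - g (Inf K)))"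
    if D: "D division_of S" "S \<subseteq> {a..b}" for D S
  proof (rule sum.cong)
    fix K assume K: "K \<in> D"
    obtain u v where uv: "K = {u..v}" using division_ofD(4)[OF D(1) K] by auto
    have "K \<subseteq> {a..b}" using division_ofD(2)[OF D(1) K] D(2) by (rule order.trans)
    then have "u \<in> {a..b}" "v \<in> {a..b}" "u \<le> v" using uv division_ofD(3)[OF D(1) K] by auto
    then show "norm (f (Sup K) - f (Inf K)) = norm (g (Sup K) - g (Inf K))" using assms uv by simp
  qed simp
  then show ?thesis unfolding abs_cont_on_iff by (auto cong: imp_cong)
qed

text \<open>The integral of the norm of the derivative dominates the increments on both pieces and,
  by the triangle inequality, those across \<open>b\<close>. So divisions do not have to be cut at
  \<open>b\<close>.\<close>

lemma abs_cont_on_combine: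
  fixes f :: "real \<Rightarrow> 'b::euclidean_space"
  assumes f: "abs_cont_on a b f" "abs_cont_on b c f" and abc: "a \<le> b" "b \<le> c"
  shows "abs_cont_on a c f"
proof (rule abs_cont_onI_integral)
  let ?m = "\<lambda>s. norm (vector_derivative f (at s))"
  have ai: "?m absolutely_integrable_on {a..b}" "?m absolutely_integrable_on {b..c}"
    using abs_cont_on_norm_integrable f abc by auto
  show m: "?m absolutely_integrable_on {a..c}"
    by (rule absolutely_integrable_on_combine[OF ai abc])
  fix u v assume uv: "a \<le> u" "u \<le> v" "v \<le> c"
  consider "v \<le> b" | "b \<le> u" | "u \<le> b" "b \<le> v" by linarith
  then show "norm (f v - f u) \<le> integral {u..v} ?m"
  proof cases
    case 1
    then show ?thesis using abs_cont_on_norm_le[OF f(1)] uv by auto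
  next
    case 2
    then show ?thesis using abs_cont_on_norm_le[OF f(2)] uv by auto
  next
    case 3
    have "norm (f v - f u) \<le> norm (f b - f u) + norm (f v - f b)" using norm_triangle_ineq[of "f b - f u" "f v - f b"] by simp
    also have "\<dots> \<le> integral {u..b} ?m + integral {b..v} ?m"
      using abs_cont_on_norm_le[OF f(1), of u b] abs_cont_on_norm_le[OF f(2), of b v] uv 3 by auto
    also have "\<dots> = integral {u..v} ?m"
      using m absolutely_integrable_on_subinterval[OF m, of u v] uv 3
      by (intro Henstock_Kurzweil_Integration.integral_combine) (auto simp: set_lebesgue_integral_eq_integral(1))
    finally show ?thesis .
  qed
qed

lemma abs_cont_on_dominated:
  fixes f :: "real \<Rightarrow> 'c::real_normed_vector" and g :: "real \<Rightarrow> 'b::euclidean_space"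
  assumes g: "abs_cont_on a b g"
    and le: "\<And>u v. a \<le> u \<Longrightarrow> u \<le> v \<Longrightarrow> v \<le> b \<Longrightarrow> norm (f v - f u) \<le> C * norm (g v - g u)"
    and "a \<le> b" "0 \<le> C"
  shows "abs_cont_on a b f"
proof (rule abs_cont_onI_integral)
  show "(\<lambda>s. C * norm (vector_derivative g (at s))) absolutely_integrable_on {a..b}"
    by (intro set_integrable_mult_right abs_cont_on_norm_integrable[OF g \<open>a \<le> b\<close>])
  fix u v assume uv: "a \<le> u" "u \<le> v" "v \<le> b"
  show "norm (f v - f u) \<le> integral {u..v} (\<lambda>s. C * norm (vector_derivative g (at s)))"
    using le[OF uv] mult_left_mono[OF abs_cont_on_norm_le[OF g uv] \<open>0 \<le> C\<close>] by simp
qed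

lemma (in mono_ac) compose_derivative:
  fixes x :: "real \<Rightarrow> 'b::euclidean_space"
  assumes x: "abs_cont_on (h a) (h b) x"
  shows "abs_cont_on a b (x \<circ> h)"
    and "\<exists>N. negligible N \<and> (\<forall>s\<in>{a<..<b} - N. ((x \<circ> h) has_vector_derivative
      (deriv h s *\<^sub>R vector_derivative x (at (h s)))) (at s))"
proof -
  let ?G = "\<lambda>s. deriv h s *\<^sub>R vector_derivative x (at (h s))"
  have hab: "h a \<le> h b" using mono_onD[OF mono, of a b] ab by auto
  note g = abs_cont_on_FTC(2,3)[OF x hab]
  have GI: "(?G has_integral ((x \<circ> h) v - (x \<circ> h) u)) {u..v}" if uv: "a \<le> u" "u \<le> v" "v \<le> b" for u v
  proof -
    interpret uv: mono_ac u v h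
      using ac mono uv by unfold_locales (auto intro: abs_cont_on_subinterval mono_on_subset)
    have huv: "h a \<le> h u" "h u \<le> h v" "h v \<le> h b" using uv by (auto intro!: mono_onD[OF mono])
    have ai: "(\<lambda>t. vector_derivative x (at t)) absolutely_integrable_on {h u..h v}"
      using huv by (intro absolutely_integrable_on_subinterval[OF g(1)]) auto
    show ?thesis
      using uv.change_of_variables[OF ai] g(2)[OF huv]
      by (simp add: has_integral_iff set_lebesgue_integral_eq_integral(1))
  qed
  have Gai: "?G absolutely_integrable_on {a..b}" by (rule change_of_variables(1)[OF g(1)])
  show "abs_cont_on a b (x \<circ> h)"
  proof (rule abs_cont_onI_integral)
    show n: "(\<lambda>s. norm (?G s)) absolutely_integrable_on {a..b}"
      by (rule absolutely_integrable_norm[OF Gai, unfolded o_def])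
    fix u v assume uv: "a \<le> u" "u \<le> v" "v \<le> b"
    have "(\<lambda>s. norm (?G s)) absolutely_integrable_on {u..v}"
      using uv by (intro absolutely_integrable_on_subinterval[OF n]) auto
    then have "norm (integral {u..v} ?G) \<le> integral {u..v} (\<lambda>s. norm (?G s))"
      using GI[OF uv] by (intro integral_norm_bound_integral) (auto simp: integrable_on_def set_lebesgue_integral_eq_integral(1)[unfolded integrable_on_def])
    then show "norm ((x \<circ> h) v - (x \<circ> h) u) \<le> integral {u..v} (\<lambda>s. norm (?G s))"
      using GI[OF uv] by (simp add: integral_unique)
  qed
  show "\<exists>N. negligible N \<and> (\<forall>s\<in>{a<..<b} - N. ((x \<circ> h) has_vector_derivative ?G s) (at s))"
    using indefinite_integral_derivative[OF GI ab] by metis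
qed

text \<open>Jensen's inequality for a seminorm, obtained by differentiating \<open>\<nu> (x s - x u)\<close>.\<close>

lemma seminorm_increment_le:
  fixes x :: "real \<Rightarrow> 'b::euclidean_space" and \<nu> :: "'b \<Rightarrow> real"
  assumes x: "abs_cont_on u v x" and uv: "u \<le> v"
    and tri: "\<And>w z. \<nu> (w + z) \<le> \<nu> w + \<nu> z" and hom: "\<And>r w. \<nu> (r *\<^sub>R w) = \<bar>r\<bar> * \<nu> w"
    and bd: "\<And>w. \<nu> w \<le> C * norm w" and "0 \<le> C"
    and int: "(\<lambda>s. \<nu> (vector_derivative x (at s))) integrable_on {u..v}"
  shows "\<nu> (x v - x u) \<le> integral {u..v} (\<lambda>s. \<nu> (vector_derivative x (at s)))"
proof -
  define \<phi> where "\<phi> s = \<nu> (x s - x u)" for s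
  have minus: "\<nu> (- w) = \<nu> w" for w using hom[of "-1" w] by simp
  have diff: "\<bar>\<nu> w - \<nu> z\<bar> \<le> \<nu> (w - z)" for w z
    using tri[of "w - z" z] tri[of "z - w" w] minus[of "w - z"] by simp
  have zero: "\<nu> 0 = 0" using hom[of 0 0] by simp
  have \<phi>d: "\<bar>\<phi> s - \<phi> r\<bar> \<le> \<nu> (x s - x r)" for s r
    using diff[of "x s - x u" "x r - x u"] by (simp add: \<phi>_def)
  have \<phi>ac: "abs_cont_on u v \<phi>"
  proof (rule abs_cont_on_dominated[OF x _ uv \<open>0 \<le> C\<close>])
    show "norm (\<phi> s - \<phi> r) \<le> C * norm (x s - x r)" for r s
      using \<phi>d[of s r] bd[of "x s - x r"] by simp
  qed
  have cont: "(\<nu> \<longlongrightarrow> \<nu> w) (at w)" for w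
  proof (rule LIM_I)
    fix e :: real assume e: "e > 0"
    show "\<exists>d>0. \<forall>z. z \<noteq> w \<and> norm (z - w) < d \<longrightarrow> norm (\<nu> z - \<nu> w) < e"
    proof (intro exI[of _ "e / (C + 1)"] conjI allI impI)
      show "0 < e / (C + 1)" using e \<open>0 \<le> C\<close> by simp
      fix z assume z: "z \<noteq> w \<and> norm (z - w) < e / (C + 1)"
      have "norm (\<nu> z - \<nu> w) \<le> C * norm (z - w)" using diff[of z w] bd[of "z - w"] by simp
      also have "\<dots> \<le> (C + 1) * norm (z - w)" by (simp add: mult_right_mono)
      also have "\<dots> < e" using z \<open>0 \<le> C\<close> by (simp add: pos_less_divide_eq mult.commute)
      finally show "norm (\<nu> z - \<nu> w) < e" .
    qed
  qed
  obtain N1 where N1: "negligible N1" "\<And>s. s \<in> {u<..<v} - N1 \<Longrightarrow> (x has_vector_derivative vector_derivative x (at s)) (at s)"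
    using abs_cont_on_FTC(1)[OF x uv] by blast
  obtain N2 where N2: "negligible N2" "\<And>s. s \<in> {u<..<v} - N2 \<Longrightarrow> (\<phi> has_vector_derivative vector_derivative \<phi> (at s)) (at s)"
    using abs_cont_on_FTC(1)[OF \<phi>ac uv] by blast
  \<comment> \<open>The reverse triangle inequality bounds the difference quotient of \<phi> by
    \<nu> of the difference quotient of \<open>x\<close>; continuity of \<nu> allows the limit from
    the right.\<close>
  have le: "vector_derivative \<phi> (at s) \<le> \<nu> (vector_derivative x (at s))" if s: "s \<in> {u..v} - (N1 \<union> N2 \<union> {u, v})" for s
  proof -
    let ?D = "vector_derivative x (at s)" and ?d = "vector_derivative \<phi> (at s)"
    have "(\<phi> has_real_derivative ?d) (at s)"
      using N2(2)[of s] s by (simp add: has_real_derivative_iff_has_vector_derivative)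
    then have t1: "((\<lambda>k. (\<phi> (s + k) - \<phi> s) / k) \<longlongrightarrow> ?d) (at_right 0)"
      by (auto simp: DERIV_def intro: filterlim_mono at_le)
    have "((\<lambda>k. (x (s + k) - x s) /\<^sub>R k) \<longlongrightarrow> ?D) (at 0)"
      using N1(2)[of s] s by (intro has_vector_derivative_quotient) auto
    then have "((\<lambda>k. (x (s + k) - x s) /\<^sub>R k) \<longlongrightarrow> ?D) (at_right 0)"
      by (auto intro: filterlim_mono at_le)
    then have t2: "((\<lambda>k. \<nu> ((x (s + k) - x s) /\<^sub>R k)) \<longlongrightarrow> \<nu> ?D) (at_right 0)"
      by (intro isCont_tendsto_compose[of ?D \<nu>]) (auto simp: isCont_def cont)
    show ?thesis
    proof (rule tendsto_le[OF _ t2 t1])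
      have "(\<phi> (s + k) - \<phi> s) / k \<le> \<nu> ((x (s + k) - x s) /\<^sub>R k)" if "k > 0" for k
        using \<phi>d[of "s + k" s] that by (simp add: hom divide_inverse mult.commute mult_left_mono)
      then show "\<forall>\<^sub>F k in at_right 0. (\<phi> (s + k) - \<phi> s) / k \<le> \<nu> ((x (s + k) - x s) /\<^sub>R k)"
        using eventually_at_right_less by (rule eventually_mono[rotated])
    qed simp
  qed
  have i: "((\<lambda>s. vector_derivative \<phi> (at s)) has_integral (\<phi> v - \<phi> u)) {u..v}"
    using abs_cont_on_FTC(3)[OF \<phi>ac uv] uv by blast
  have "integral {u..v} (\<lambda>s. vector_derivative \<phi> (at s)) \<le> integral {u..v} (\<lambda>s. \<nu> (vector_derivative x (at s)))"
    by (rule integral_le_off_negligible[OF _ int, where N = "N1 \<union> N2 \<union> {u, v}"])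
       (use i N1(1) N2(1) le in \<open>auto simp: integrable_on_def\<close>)
  then show ?thesis using i by (simp add: integral_unique \<phi>_def zero)
qed

section \<open>Curves in a Finsler manifold\<close>

locale finsler_manifold =
  fixes A :: "('q::{second_countable_topology,t2_space}, 'e::euclidean_space) chart set"
    and R :: "'q \<Rightarrow> ('q, 'e) tvec \<Rightarrow> real"
  assumes atlas: "smooth_atlas A" and finsler: "finsler_structure A R"
begin

lemma chart_cover: obtains c where "c \<in> A" "q \<in> chart_dom c"
proof -
  have "q \<in> (\<Union>c\<in>A. chart_dom c)" using atlas unfolding smooth_atlas_def by simp
  then show ?thesis using that by blast
qed

lemma
  assumes "c \<in> A"
  shows open_dom: "open (chart_dom c)" and open_img: "open (chart_img c)"
    and cont_map: "continuous_on (chart_dom c) (chart_map c)"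
    and cont_inv: "continuous_on (chart_img c) (chart_inv c)"
    and inv_map: "\<And>q. q \<in> chart_dom c \<Longrightarrow> chart_inv c (chart_map c q) = q"
    and map_inv: "\<And>x. x \<in> chart_img c \<Longrightarrow> chart_map c (chart_inv c x) = x"
    and map_mem: "\<And>q. q \<in> chart_dom c \<Longrightarrow> chart_map c q \<in> chart_img c"
    and inv_mem: "\<And>x. x \<in> chart_img c \<Longrightarrow> chart_inv c x \<in> chart_dom c"
proof -
  have h: "open (chart_dom c)" "open (chart_img c)"
    "homeomorphism (chart_dom c) (chart_img c) (chart_map c) (chart_inv c)"
    using atlas assms unfolding smooth_atlas_def by blast+
  show "open (chart_dom c)" "open (chart_img c)" using h by blast+
  show "continuous_on (chart_dom c) (chart_map c)" "continuous_on (chart_img c) (chart_inv c)"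
    "\<And>q. q \<in> chart_dom c \<Longrightarrow> chart_inv c (chart_map c q) = q"
    "\<And>x. x \<in> chart_img c \<Longrightarrow> chart_map c (chart_inv c x) = x"
    "\<And>q. q \<in> chart_dom c \<Longrightarrow> chart_map c q \<in> chart_img c"
    "\<And>x. x \<in> chart_img c \<Longrightarrow> chart_inv c x \<in> chart_dom c"
    using h(3) unfolding homeomorphism_def by blast+
qed

lemma eventually_inv_in:
  assumes c: "c \<in> A" and x: "x \<in> chart_img c" and W: "open W" "chart_inv c x \<in> W"
  shows "\<forall>\<^sub>F z in nhds x. z \<in> chart_img c \<and> chart_inv c z \<in> W"
proof -
  have "isCont (chart_inv c) x"
    using cont_inv[OF c] open_img[OF c] x by (simp add: continuous_on_eq_continuous_at)
  then have "filterlim (chart_inv c) (nhds (chart_inv c x)) (nhds x)"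
    by (simp add: isCont_def tendsto_at_iff_tendsto_nhds)
  then have "\<forall>\<^sub>F z in nhds x. chart_inv c z \<in> W" using W topological_tendstoD by blast
  moreover have "\<forall>\<^sub>F z in nhds x. z \<in> chart_img c" using open_img[OF c] x by (rule eventually_nhds_in_open)
  ultimately show ?thesis by eventually_elim simp
qed

section \<open>Tangent vectors and the norm read in a chart\<close>

lemma transition_derivative:
  assumes "c \<in> A" "c' \<in> A" "q \<in> chart_dom c" "q \<in> chart_dom c'"
  shows "(transition c c' has_derivative frechet_derivative (transition c c') (at (chart_map c q))) (at (chart_map c q))"
proof -
  have "Ck_on (Suc 0) (chart_map c ` (chart_dom c \<inter> chart_dom c')) (transition c c')"
    using atlas assms unfolding smooth_atlas_def by blast
  then have "transition c c' differentiable (at (chart_map c q))" using assms by simp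
  then show ?thesis by (simp add: frechet_derivative_works)
qed

lemma transition_derivative_continuous:
  assumes "c \<in> A" "c' \<in> A"
  shows "continuous_on (chart_map c ` (chart_dom c \<inter> chart_dom c'))
    (\<lambda>x. frechet_derivative (transition c c') (at x) v)"
proof -
  have "Ck_on (Suc 0) (chart_map c ` (chart_dom c \<inter> chart_dom c')) (transition c c')"
    using atlas assms unfolding smooth_atlas_def by blast
  then show ?thesis by simp
qed

text \<open>The direct transition map factors through the middle chart only near the point, since
  elsewhere \<open>chart_inv c1 z\<close> may leave the domain of \<open>c2\<close>. The chain rule
  is therefore combined with an eventual equality.\<close>

lemma transition_cocycle:
  assumes c: "c1 \<in> A" "c2 \<in> A" "c3 \<in> A" and q: "q \<in> chart_dom c1" "q \<in> chart_dom c2" "q \<in> chart_dom c3"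
  shows "frechet_derivative (transition c1 c3) (at (chart_map c1 q)) w =
    frechet_derivative (transition c2 c3) (at (chart_map c2 q)) (frechet_derivative (transition c1 c2) (at (chart_map c1 q)) w)"
proof -
  have e: "transition c1 c2 (chart_map c1 q) = chart_map c2 q" using c q by (simp add: transition_def inv_map)
  have d: "(transition c2 c3 \<circ> transition c1 c2 has_derivative
    frechet_derivative (transition c2 c3) (at (chart_map c2 q)) \<circ> frechet_derivative (transition c1 c2) (at (chart_map c1 q))) (at (chart_map c1 q))"
    by (rule diff_chain_at) (use transition_derivative c q e in auto)
  have "\<forall>\<^sub>F z in nhds (chart_map c1 q). z \<in> chart_img c1 \<and> chart_inv c1 z \<in> chart_dom c2"
    by (rule eventually_inv_in) (use c q open_dom in \<open>auto simp: map_mem inv_map\<close>)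
  then have ev: "\<forall>\<^sub>F z in nhds (chart_map c1 q). (transition c2 c3 \<circ> transition c1 c2) z = transition c1 c3 z"
    by eventually_elim (use c in \<open>simp add: transition_def inv_map\<close>)
  have "(transition c1 c3 has_derivative
    frechet_derivative (transition c2 c3) (at (chart_map c2 q)) \<circ> frechet_derivative (transition c1 c2) (at (chart_map c1 q))) (at (chart_map c1 q))"
    by (rule has_derivative_transform_eventually[OF d])
       (use ev eventually_nhds_x_imp_x[OF ev] in \<open>auto simp: eventually_at_filter elim: eventually_mono\<close>)
  then show ?thesis using has_derivative_unique[OF transition_derivative[OF c(1,3) q(1,3)]] by (simp add: o_def)
qed

lemma transition_self:
  assumes c: "c \<in> A" and q: "q \<in> chart_dom c"
  shows "frechet_derivative (transition c c) (at (chart_map c q)) w = w"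
proof -
  have d: "((\<lambda>z. z) has_derivative (\<lambda>z. z)) (at (chart_map c q))" by (rule has_derivative_ident)
  have "\<forall>\<^sub>F z in nhds (chart_map c q). z \<in> chart_img c" using open_img[OF c] map_mem[OF c q] by (rule eventually_nhds_in_open)
  then have ev: "\<forall>\<^sub>F z in nhds (chart_map c q). z = transition c c z"
    by eventually_elim (use c in \<open>simp add: transition_def map_inv\<close>)
  have "(transition c c has_derivative (\<lambda>z. z)) (at (chart_map c q))"
    by (rule has_derivative_transform_eventually[OF d])
       (use ev eventually_nhds_x_imp_x[OF ev] in \<open>auto simp: eventually_at_filter elim: eventually_mono\<close>)
  then show ?thesis using has_derivative_unique[OF transition_derivative[OF c c q q]] by simp
qed

lemma charts_atI: "c \<in> A \<Longrightarrow> q \<in> chart_dom c \<Longrightarrow> c \<in> charts_at A q"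
  by (simp add: charts_at_def)

lemma tangent_of_mem:
  assumes "c \<in> A" "q \<in> chart_dom c"
  shows "tangent_of A c q w \<in> tangent_space A q"
  unfolding tangent_space_def mem_Collect_eq
proof (intro conjI ballI allI impI)
  fix c1 c2 assume "c1 \<in> charts_at A q" "c2 \<in> charts_at A q"
  then show "tangent_of A c q w c2 = frechet_derivative (transition c1 c2) (at (chart_map c1 q)) (tangent_of A c q w c1)"
    using transition_cocycle[OF assms(1) _ _ assms(2), of c1 c2 w] by (simp add: tangent_of_def charts_at_def)
qed (simp add: tangent_of_def)

lemma tangent_of_coord:
  assumes "c \<in> A" "q \<in> chart_dom c"
  shows "tangent_of A c q w c = w"
  using assms transition_self unfolding tangent_of_def charts_at_def by simp

lemma tangent_of_eq:
  assumes "c \<in> A" "q \<in> chart_dom c" "v \<in> tangent_space A q"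
  shows "tangent_of A c q (v c) = v"
proof
  fix c'
  have "c \<in> charts_at A q" using assms by (simp add: charts_atI)
  moreover have v: "\<forall>c\<in>charts_at A q. \<forall>c'\<in>charts_at A q. v c' = frechet_derivative (transition c c') (at (chart_map c q)) (v c)"
    using assms(3) unfolding tangent_space_def mem_Collect_eq by (rule conjunct1)
  moreover have "\<forall>c. c \<notin> charts_at A q \<longrightarrow> v c = 0"
    using assms(3) unfolding tangent_space_def mem_Collect_eq by (rule conjunct2)
  ultimately show "tangent_of A c q (v c) c' = v c'"
    unfolding tangent_of_def by (metis (full_types))
qed

lemma tangent_of_linear:
  assumes "c \<in> A" "q \<in> chart_dom c"
  shows "tangent_of A c q (w + z) = (\<lambda>c'. tangent_of A c q w c' + tangent_of A c q z c')"
    and "tangent_of A c q (a *\<^sub>R w) = (\<lambda>c'. a *\<^sub>R tangent_of A c q w c')"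
    and "tangent_of A c q w = (\<lambda>c. 0) \<longleftrightarrow> w = 0"
proof -
  have lin: "linear (frechet_derivative (transition c c') (at (chart_map c q)))" if "c' \<in> charts_at A q" for c'
    using transition_derivative[of c c' q] assms that unfolding charts_at_def by (intro has_derivative_linear) auto
  show "tangent_of A c q (w + z) = (\<lambda>c'. tangent_of A c q w c' + tangent_of A c q z c')"
    by (rule ext) (simp add: tangent_of_def linear_add[OF lin])
  show "tangent_of A c q (a *\<^sub>R w) = (\<lambda>c'. a *\<^sub>R tangent_of A c q w c')"
    by (rule ext) (simp add: tangent_of_def linear_scale[OF lin])
  show "tangent_of A c q w = (\<lambda>c. 0) \<longleftrightarrow> w = 0"
  proof
    assume "tangent_of A c q w = (\<lambda>c. 0)"
    then show "w = 0" using tangent_of_coord[OF assms, of w] by simp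
  next
    assume "w = 0"
    then show "tangent_of A c q w = (\<lambda>c. 0)"
      by (intro ext) (simp add: tangent_of_def linear_0[OF lin])
  qed
qed

text \<open>Tangent spaces at different points have no vectors in common to compare. In coordinates
  position and vector vary independently, so norms at neighbouring points can be estimated against
  each other.\<close>

definition local_norm :: "('q, 'e) chart \<Rightarrow> 'e \<Rightarrow> 'e \<Rightarrow> real" where
  "local_norm c x w = R (chart_inv c x) (tangent_of A c (chart_inv c x) w)"

lemma local_norm_at:
  "c \<in> A \<Longrightarrow> q \<in> chart_dom c \<Longrightarrow> local_norm c (chart_map c q) w = R q (tangent_of A c q w)"
  by (simp add: local_norm_def inv_map)

context
  fixes c x assumes c: "c \<in> A" and x: "x \<in> chart_img c"
begin

private lemma qd: "chart_inv c x \<in> chart_dom c" by (rule inv_mem[OF c x])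

lemma local_norm_nonneg: "0 \<le> local_norm c x w"
  unfolding local_norm_def using finsler tangent_of_mem[OF c qd] unfolding finsler_structure_def by blast

lemma local_norm_eq_0: "local_norm c x w = 0 \<longleftrightarrow> w = 0"
  unfolding local_norm_def using finsler tangent_of_mem[OF c qd] tangent_of_linear(3)[OF c qd]
  unfolding finsler_structure_def by blast

lemma local_norm_scale: "local_norm c x (a *\<^sub>R w) = \<bar>a\<bar> * local_norm c x w"
  unfolding local_norm_def tangent_of_linear(2)[OF c qd]
  using finsler tangent_of_mem[OF c qd] unfolding finsler_structure_def by blast

lemma local_norm_triangle: "local_norm c x (w + z) \<le> local_norm c x w + local_norm c x z"
  unfolding local_norm_def tangent_of_linear(1)[OF c qd]
  using finsler tangent_of_mem[OF c qd] unfolding finsler_structure_def by blast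

lemma local_norm_minus: "local_norm c x (- w) = local_norm c x w"
  using local_norm_scale[of "-1" w] by simp

end

lemma local_norm_continuous:
  "c \<in> A \<Longrightarrow> continuous_on (chart_img c \<times> UNIV) (\<lambda>(x, w). local_norm c x w)"
  using finsler unfolding finsler_structure_def local_norm_def by blast

text \<open>Continuity in the position is uniform over the compact unit sphere; homogeneity carries
  the estimate to all vectors.\<close>

lemma local_norm_near:
  assumes c: "c \<in> A" and x0: "x0 \<in> chart_img c" and e: "e > 0"
  obtains r where "r > 0" "cball x0 r \<subseteq> chart_img c"
    "\<forall>x\<in>cball x0 r. \<forall>w. \<bar>local_norm c x w - local_norm c x0 w\<bar> \<le> e * norm w"
proof -
  have cont: "continuous_on (chart_img c \<times> sphere 0 1) (\<lambda>(x, w). local_norm c x w)"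
    by (rule continuous_on_subset[OF local_norm_continuous[OF c]]) auto
  obtain X0 where X0: "x0 \<in> X0" "open X0"
    "\<forall>x\<in>X0 \<inter> chart_img c. \<forall>w\<in>sphere 0 1. dist ((\<lambda>(x, w). local_norm c x w) (x, w)) ((\<lambda>(x, w). local_norm c x w) (x0, w)) \<le> e"
    using continuous_on_prod_compactE[OF cont compact_sphere x0 e] by blast
  have "open (X0 \<inter> chart_img c)" "x0 \<in> X0 \<inter> chart_img c" using X0 open_img[OF c] x0 by auto
  then obtain r where r: "r > 0" "cball x0 r \<subseteq> X0 \<inter> chart_img c" by (meson open_contains_cball)
  have "\<bar>local_norm c x w - local_norm c x0 w\<bar> \<le> e * norm w" if x: "x \<in> cball x0 r" for x w
  proof (cases "w = 0")
    case True
    moreover have "x \<in> chart_img c" using x r by auto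
    ultimately show ?thesis using local_norm_eq_0[OF c, of x 0] local_norm_eq_0[OF c x0, of 0] by simp
  next
    case False
    let ?u = "w /\<^sub>R norm w"
    have xc: "x \<in> chart_img c" "x \<in> X0" using x r by auto
    have "?u \<in> sphere 0 1" using False by simp
    then have "\<bar>local_norm c x ?u - local_norm c x0 ?u\<bar> \<le> e" using X0(3) xc by (auto simp: dist_real_def)
    then have "norm w * \<bar>local_norm c x ?u - local_norm c x0 ?u\<bar> \<le> norm w * e" by (intro mult_left_mono) auto
    moreover have "local_norm c x w = norm w * local_norm c x ?u" "local_norm c x0 w = norm w * local_norm c x0 ?u"
      using local_norm_scale[OF c xc(1), of "norm w" ?u] local_norm_scale[OF c x0, of "norm w" ?u] False by auto
    ultimately show ?thesis by (simp add: abs_mult mult.commute flip: right_diff_distrib)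
  qed
  then show ?thesis using that[OF r(1)] r(2) by blast
qed

lemma local_norm_equiv_at:
  assumes c: "c \<in> A" and x0: "x0 \<in> chart_img c"
  obtains k K where "k > 0" "K > 0" "\<forall>w. k * norm w \<le> local_norm c x0 w \<and> local_norm c x0 w \<le> K * norm w"
proof -
  have cont: "continuous_on (sphere 0 1) (local_norm c x0)"
  proof -
    have "continuous_on (sphere 0 1) (\<lambda>w. (\<lambda>(x, w). local_norm c x w) (x0, w))"
      by (rule continuous_on_compose2[OF local_norm_continuous[OF c]]) (use x0 in \<open>auto intro!: continuous_intros\<close>)
    then show ?thesis by simp
  qed
  have ne: "sphere (0::'e) 1 \<noteq> {}" by simp
  obtain w1 where w1: "w1 \<in> sphere 0 1" "\<forall>w\<in>sphere 0 1. local_norm c x0 w1 \<le> local_norm c x0 w"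
    using continuous_attains_inf[OF compact_sphere ne cont] by blast
  obtain w2 where w2: "w2 \<in> sphere 0 1" "\<forall>w\<in>sphere 0 1. local_norm c x0 w \<le> local_norm c x0 w2"
    using continuous_attains_sup[OF compact_sphere ne cont] by blast
  have "w1 \<noteq> 0" "w2 \<noteq> 0" using w1(1) w2(1) by (metis mem_sphere_0 norm_zero zero_neq_one)+
  then have "local_norm c x0 w1 \<noteq> 0" "local_norm c x0 w2 \<noteq> 0" by (simp_all add: local_norm_eq_0[OF c x0])
  then have pos: "local_norm c x0 w1 > 0" "local_norm c x0 w2 > 0"
    using local_norm_nonneg[OF c x0, of w1] local_norm_nonneg[OF c x0, of w2] by (simp_all add: order_less_le)
  have "local_norm c x0 w1 * norm w \<le> local_norm c x0 w \<and> local_norm c x0 w \<le> local_norm c x0 w2 * norm w" for w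
  proof (cases "w = 0")
    case True
    then show ?thesis using local_norm_eq_0[OF c x0, of 0] by simp
  next
    case False
    let ?u = "w /\<^sub>R norm w"
    have "?u \<in> sphere 0 1" using False by simp
    then have "local_norm c x0 w1 \<le> local_norm c x0 ?u" "local_norm c x0 ?u \<le> local_norm c x0 w2" using w1 w2 by blast+
    moreover have "local_norm c x0 w = norm w * local_norm c x0 ?u"
      using local_norm_scale[OF c x0, of "norm w" ?u] False by auto
    ultimately show ?thesis by (simp add: mult.commute mult_left_mono)
  qed
  then show ?thesis using that[OF pos] by blast
qed

text \<open>Near \<open>x0\<close> the norm changes by at most half the lower constant at
  \<open>x0\<close>, so the other half remains as a lower constant valid on a whole ball.\<close>

lemma local_norm_equiv:
  assumes c: "c \<in> A" and x0: "x0 \<in> chart_img c"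
  obtains r k K where "r > 0" "k > 0" "K > 0" "cball x0 r \<subseteq> chart_img c"
    "\<forall>x\<in>cball x0 r. \<forall>w. k * norm w \<le> local_norm c x w \<and> local_norm c x w \<le> K * norm w"
proof -
  obtain k K where kK: "k > 0" "K > 0" "\<forall>w. k * norm w \<le> local_norm c x0 w \<and> local_norm c x0 w \<le> K * norm w"
    by (rule local_norm_equiv_at[OF c x0])
  obtain r where r: "r > 0" "cball x0 r \<subseteq> chart_img c"
    "\<forall>x\<in>cball x0 r. \<forall>w. \<bar>local_norm c x w - local_norm c x0 w\<bar> \<le> (k/2) * norm w"
    using local_norm_near[OF c x0, of "k/2"] kK(1) by (metis half_gt_zero)
  have "k/2 * norm w \<le> local_norm c x w \<and> local_norm c x w \<le> (K + k/2) * norm w" if "x \<in> cball x0 r" for x w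
  proof -
    have "\<bar>local_norm c x w - local_norm c x0 w\<bar> \<le> (k/2) * norm w" using r(3) that by blast
    moreover have "k * norm w \<le> local_norm c x0 w" "local_norm c x0 w \<le> K * norm w" using kK(3) by blast+
    moreover have "(K + k/2) * norm w = K * norm w + (k/2) * norm w" "k * norm w = (k/2) * norm w + (k/2) * norm w"
      by (simp_all add: algebra_simps)
    ultimately show ?thesis unfolding abs_le_iff by linarith
  qed
  then show ?thesis using that[of r "k/2" "K + k/2"] r kK by auto
qed

text \<open>A derivative in one chart produces derivatives in all charts through the transition
  maps. So \<open>velocity\<close> is then a genuine tangent vector and not a family containing
  default values of \<open>vector_derivative\<close>.\<close>

lemma velocity_eq_tangent_of:
  assumes c: "c \<in> A" and y: "isCont y s" "y s \<in> chart_dom c"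
    and d: "((chart_map c \<circ> y) has_vector_derivative w) (at s)"
  shows "velocity A y s = tangent_of A c (y s) w"
proof
  fix c'
  show "velocity A y s c' = tangent_of A c (y s) w c'"
  proof (cases "c' \<in> charts_at A (y s)")
    case True
    then have c': "c' \<in> A" "y s \<in> chart_dom c'" by (auto simp: charts_at_def)
    have "filterlim y (nhds (y s)) (nhds s)"
      using y(1) by (simp add: isCont_def tendsto_at_iff_tendsto_nhds)
    then have ev0: "\<forall>\<^sub>F r in nhds s. y r \<in> chart_dom c"
      using topological_tendstoD open_dom[OF c] y(2) by blast
    then have ev: "\<forall>\<^sub>F r in nhds s. (transition c c' \<circ> (chart_map c \<circ> y)) r = (chart_map c' \<circ> y) r"
      by eventually_elim (use c in \<open>simp add: transition_def inv_map\<close>)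
    have "((transition c c' \<circ> (chart_map c \<circ> y)) has_derivative
      frechet_derivative (transition c c') (at (chart_map c (y s))) \<circ> (\<lambda>h. h *\<^sub>R w)) (at s)"
      using d transition_derivative[OF c c'(1) y(2) c'(2)] unfolding has_vector_derivative_def
      by (intro diff_chain_at) auto
    then have "((chart_map c' \<circ> y) has_derivative
      frechet_derivative (transition c c') (at (chart_map c (y s))) \<circ> (\<lambda>h. h *\<^sub>R w)) (at s)"
      by (rule has_derivative_transform_eventually)
         (use ev eventually_nhds_x_imp_x[OF ev] in \<open>auto simp: eventually_at_filter elim: eventually_mono\<close>)
    moreover have "frechet_derivative (transition c c') (at (chart_map c (y s))) \<circ> (\<lambda>h. h *\<^sub>R w)
      = (\<lambda>h. h *\<^sub>R frechet_derivative (transition c c') (at (chart_map c (y s))) w)"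
      using has_derivative_linear[OF transition_derivative[OF c c'(1) y(2) c'(2)]] by (auto simp: linear_scale)
    ultimately have "((chart_map c' \<circ> y) has_vector_derivative
      frechet_derivative (transition c c') (at (chart_map c (y s))) w) (at s)"
      unfolding has_vector_derivative_def by simp
    then show ?thesis using True by (simp add: velocity_def tangent_of_def vector_derivative_at)
  next
    case False
    then show ?thesis by (simp add: velocity_def tangent_of_def)
  qed
qed

lemma speed_eq_local_norm:
  assumes "c \<in> A" "isCont y s" "y s \<in> chart_dom c" "((chart_map c \<circ> y) has_vector_derivative w) (at s)"
  shows "speed A R y s = local_norm c (chart_map c (y s)) w"
  using velocity_eq_tangent_of[OF assms] local_norm_at[OF assms(1,3)] by (simp add: speed_def)

section \<open>Speed and length of curves\<close>

lemma ac_curve_subinterval: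
  "ac_curve A a b y \<Longrightarrow> a \<le> u \<Longrightarrow> v \<le> b \<Longrightarrow> ac_curve A u v y"
  unfolding ac_curve_def by (auto intro: continuous_on_subset)

lemma ac_curve_isCont: "ac_curve A a b y \<Longrightarrow> s \<in> {a<..<b} \<Longrightarrow> isCont y s"
  unfolding ac_curve_def
  by (metis continuous_on_interior interior_atLeastAtMost_real)

lemma ac_curve_in_chart:
  assumes "ac_curve A a b y" "c \<in> A" "y ` {u..v} \<subseteq> chart_dom c" "a \<le> u" "u \<le> v" "v \<le> b"
  shows "abs_cont_on u v (chart_map c \<circ> y)"
  using assms unfolding ac_curve_def by blast

lemma continuous_local_image:
  fixes y :: "real \<Rightarrow> 'q"
  assumes y: "continuous_on {a..b} y" and s: "s \<in> {a..b}" and W: "open W" "y s \<in> W"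
  obtains d where "d > 0" "\<forall>u v. a \<le> u \<and> u \<le> s \<and> s \<le> v \<and> v \<le> b \<and> v - u < d \<longrightarrow> y ` {u..v} \<subseteq> W"
proof -
  have "(y \<longlongrightarrow> y s) (at s within {a..b})" using y s by (simp add: continuous_on_def)
  then have "\<forall>\<^sub>F r in at s within {a..b}. y r \<in> W" using W by (rule topological_tendstoD)
  then obtain d where d: "d > 0" "\<forall>r\<in>{a..b}. r \<noteq> s \<and> dist r s < d \<longrightarrow> y r \<in> W"
    unfolding eventually_at by blast
  show ?thesis
  proof (rule that[OF d(1)], intro allI impI subsetI)
    fix u v z assume uv: "a \<le> u \<and> u \<le> s \<and> s \<le> v \<and> v \<le> b \<and> v - u < d" and "z \<in> y ` {u..v}"
    then obtain r where r: "r \<in> {u..v}" "z = y r" by blast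
    then have "r \<in> {a..b}" "dist r s < d" using uv by (auto simp: dist_real_def)
    then show "z \<in> W" using d(2) W(2) r by (cases "r = s") auto
  qed
qed

lemma open_chart_preimage:
  assumes c: "c \<in> A" and B: "open B"
  shows "open {q \<in> chart_dom c. chart_map c q \<in> B}"
proof -
  have "open (chart_map c -` B \<inter> chart_dom c)"
    using cont_map[OF c] open_dom[OF c] B continuous_on_open_vimage by blast
  then show ?thesis by (simp add: vimage_def Int_def conj_commute)
qed

lemma curve_chart_ball:
  fixes y :: "real \<Rightarrow> 'q"
  assumes y: "continuous_on {a..b} y" and s: "s \<in> {a..b}" and c: "c \<in> A" "y s \<in> chart_dom c" and r: "r > 0"
  obtains d where "d > 0" "\<forall>u v. a \<le> u \<and> u \<le> s \<and> s \<le> v \<and> v \<le> b \<and> v - u < d \<longrightarrow>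
    y ` {u..v} \<subseteq> chart_dom c \<and> (\<forall>r'\<in>{u..v}. chart_map c (y r') \<in> ball (chart_map c (y s)) r)"
proof -
  let ?W = "{q \<in> chart_dom c. chart_map c q \<in> ball (chart_map c (y s)) r}"
  have W: "open ?W" "y s \<in> ?W" using open_chart_preimage[OF c(1) open_ball] c r by auto
  obtain d where "d > 0" "\<forall>u v. a \<le> u \<and> u \<le> s \<and> s \<le> v \<and> v \<le> b \<and> v - u < d \<longrightarrow> y ` {u..v} \<subseteq> ?W"
    by (rule continuous_local_image[OF y s W])
  then show ?thesis by (intro that[of d]) (blast+)
qed

lemma speed_in_chart:
  assumes y: "ac_curve A a b y" and c: "c \<in> A" "y ` {a..b} \<subseteq> chart_dom c" and ab: "a \<le> b"
  obtains N where "negligible N"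
    "\<forall>s\<in>{a<..<b} - N. ((chart_map c \<circ> y) has_vector_derivative vector_derivative (chart_map c \<circ> y) (at s)) (at s)
      \<and> speed A R y s = local_norm c (chart_map c (y s)) (vector_derivative (chart_map c \<circ> y) (at s))"
proof -
  obtain N where N: "negligible N" "\<forall>s\<in>{a<..<b} - N. ((chart_map c \<circ> y) has_vector_derivative vector_derivative (chart_map c \<circ> y) (at s)) (at s)"
    using abs_cont_on_FTC(1)[OF ac_curve_in_chart[OF y c order.refl ab order.refl] ab] by blast
  show ?thesis
  proof (rule that[OF N(1)], intro ballI conjI)
    fix s assume s: "s \<in> {a<..<b} - N"
    then show "((chart_map c \<circ> y) has_vector_derivative vector_derivative (chart_map c \<circ> y) (at s)) (at s)"
      using N by blast
    then show "speed A R y s = local_norm c (chart_map c (y s)) (vector_derivative (chart_map c \<circ> y) (at s))"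
      using s c ac_curve_isCont[OF y] by (intro speed_eq_local_norm) auto
  qed
qed

lemma speed_integrable_in_chart:
  assumes y: "ac_curve A a b y" and c: "c \<in> A" "y ` {a..b} \<subseteq> chart_dom c" and ab: "a \<le> b"
    and K: "\<And>s w. s \<in> {a..b} \<Longrightarrow> local_norm c (chart_map c (y s)) w \<le> K * norm w"
  shows "speed A R y absolutely_integrable_on {a..b}"
    and "(\<lambda>s. local_norm c (chart_map c (y s)) (vector_derivative (chart_map c \<circ> y) (at s))) absolutely_integrable_on {a..b}"
    and "integral {a..b} (speed A R y) = integral {a..b} (\<lambda>s. local_norm c (chart_map c (y s)) (vector_derivative (chart_map c \<circ> y) (at s)))"
proof -
  let ?x = "chart_map c \<circ> y" and ?F = "\<lambda>s. local_norm c (chart_map c (y s)) (vector_derivative (chart_map c \<circ> y) (at s))"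
  have ac: "abs_cont_on a b ?x" by (rule ac_curve_in_chart[OF y c order.refl ab order.refl])
  have mem: "?x s \<in> chart_img c" if "s \<in> {a..b}" for s
    using c that map_mem[OF c(1), of "y s"] by (auto simp: image_subset_iff)
  have m1: "?x \<in> borel_measurable (lebesgue_on {a..b})"
    by (rule continuous_imp_measurable_on_sets_lebesgue[OF abs_cont_on_imp_continuous[OF ac]]) simp
  have m2: "(\<lambda>s. vector_derivative ?x (at s)) \<in> borel_measurable (lebesgue_on {a..b})"
    by (rule absolutely_integrable_imp_borel_measurable[OF abs_cont_on_FTC(2)[OF ac ab]]) simp
  \<comment> \<open>The local norm is continuous only over the open chart image. Extended by 0 it is
    Borel on the whole product, and the curve stays where the extension changes nothing.\<close>
  let ?G = "\<lambda>p. indicator (chart_img c \<times> (UNIV::'e set)) p *\<^sub>R (\<lambda>(x, w). local_norm c x w) p"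
  have "?G \<in> borel_measurable borel"
    by (rule borel_measurable_continuous_on_indicator[OF _ local_norm_continuous[OF c(1)]])
       (intro borel_open open_Times open_img c open_UNIV)
  moreover have "(\<lambda>s. (?x s, vector_derivative ?x (at s))) \<in> borel_measurable (lebesgue_on {a..b})"
    using m1 m2 by (rule borel_measurable_Pair)
  ultimately have "(\<lambda>s. ?G (?x s, vector_derivative ?x (at s))) \<in> borel_measurable (lebesgue_on {a..b})"
    by (rule measurable_compose[rotated])
  then have meas: "?F \<in> borel_measurable (lebesgue_on {a..b})"
    by (rule measurable_cong[THEN iffD1, rotated]) (use mem in auto)
  have K0: "(\<lambda>s. K * norm (vector_derivative ?x (at s))) integrable_on {a..b}"
    using set_integrable_mult_right[OF abs_cont_on_norm_integrable[OF ac ab]] by (intro set_lebesgue_integral_eq_integral(1)) auto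
  show Fi: "?F absolutely_integrable_on {a..b}"
    by (rule measurable_bounded_by_integrable_imp_absolutely_integrable[OF meas _ K0])
       (use K mem local_norm_nonneg[OF c(1)] in auto)
  obtain N where N: "negligible N" "\<forall>s\<in>{a<..<b} - N. ((chart_map c \<circ> y) has_vector_derivative vector_derivative (chart_map c \<circ> y) (at s)) (at s)
      \<and> speed A R y s = ?F s" by (rule speed_in_chart[OF y c ab])
  have neg: "negligible (N \<union> {a, b})" using N(1) by simp
  show "speed A R y absolutely_integrable_on {a..b}"
    by (rule absolutely_integrable_spike[OF Fi neg]) (use N(2) in auto)
  show "integral {a..b} (speed A R y) = integral {a..b} ?F"
    by (rule integral_spike[OF neg]) (use N(2) in auto)
qed

lemma
  assumes y: "ac_curve A a b y" and ab: "a \<le> b"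
  shows speed_integrable: "speed A R y absolutely_integrable_on {a..b}"
    and speed_nonneg: "\<exists>N. negligible N \<and> (\<forall>s\<in>{a..b} - N. velocity A y s \<in> tangent_space A (y s) \<and> 0 \<le> speed A R y s)"
proof -
  have cont: "continuous_on {a..b} y" using y unfolding ac_curve_def by blast
  have "speed A R y absolutely_integrable_on {a..b} \<and>
    (\<exists>N. negligible N \<and> (\<forall>s\<in>{a..b} - N. velocity A y s \<in> tangent_space A (y s) \<and> 0 \<le> speed A R y s))"
    using ab
  proof (induction rule: interval_patching)
    case (trans u v w)
    then obtain N1 N2 where N: "negligible N1" "negligible N2"
      "\<forall>s\<in>{u..v} - N1. velocity A y s \<in> tangent_space A (y s) \<and> 0 \<le> speed A R y s"
      "\<forall>s\<in>{v..w} - N2. velocity A y s \<in> tangent_space A (y s) \<and> 0 \<le> speed A R y s" by blast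
    have "speed A R y absolutely_integrable_on {u..w}"
      using trans(5,6) by (intro absolutely_integrable_on_combine[OF _ _ trans(2,3)]) blast+
    moreover have "\<forall>s\<in>{u..w} - (N1 \<union> N2). velocity A y s \<in> tangent_space A (y s) \<and> 0 \<le> speed A R y s"
      using N(3,4) by (metis DiffD1 DiffD2 DiffI UnCI atLeastAtMost_iff linorder_linear)
    moreover have "negligible (N1 \<union> N2)" using N by simp
    ultimately show ?case by blast
  next
    case (local s)
    then have s: "s \<in> {a..b}" by simp
    obtain c where c: "c \<in> A" "y s \<in> chart_dom c" by (rule chart_cover)
    obtain r k K where rk: "r > 0" "k > 0" "K > 0" "cball (chart_map c (y s)) r \<subseteq> chart_img c"
      "\<forall>x\<in>cball (chart_map c (y s)) r. \<forall>w. k * norm w \<le> local_norm c x w \<and> local_norm c x w \<le> K * norm w"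
      by (rule local_norm_equiv[OF c(1) map_mem[OF c]])
    obtain d where d: "d > 0" "\<forall>u v. a \<le> u \<and> u \<le> s \<and> s \<le> v \<and> v \<le> b \<and> v - u < d \<longrightarrow>
      y ` {u..v} \<subseteq> chart_dom c \<and> (\<forall>r'\<in>{u..v}. chart_map c (y r') \<in> ball (chart_map c (y s)) r)"
      by (rule curve_chart_ball[OF cont s c rk(1)])
    show ?case
    proof (intro exI[of _ d] conjI d(1) allI impI)
      fix u v assume uv: "a \<le> u \<and> u \<le> s \<and> s \<le> v \<and> v \<le> b \<and> v - u < d"
      then have uv': "u \<le> v" and im: "y ` {u..v} \<subseteq> chart_dom c"
        "\<And>t. t \<in> {u..v} \<Longrightarrow> chart_map c (y t) \<in> ball (chart_map c (y s)) r"
        using d(2) by (meson order.trans, blast+)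
      have yuv: "ac_curve A u v y" using ac_curve_subinterval[OF y] uv by blast
      have K: "local_norm c (chart_map c (y t)) w \<le> K * norm w" if "t \<in> {u..v}" for t w
        using im(2)[OF that] rk(5) by (meson ball_subset_cball subsetD)
      show "speed A R y absolutely_integrable_on {u..v}"
        by (rule speed_integrable_in_chart(1)[OF yuv c(1) im(1) uv' K])
      obtain N where N: "negligible N" "\<forall>t\<in>{u<..<v} - N. ((chart_map c \<circ> y) has_vector_derivative vector_derivative (chart_map c \<circ> y) (at t)) (at t)
        \<and> speed A R y t = local_norm c (chart_map c (y t)) (vector_derivative (chart_map c \<circ> y) (at t))"
        by (rule speed_in_chart[OF yuv c(1) im(1) uv'])
      show "\<exists>N. negligible N \<and> (\<forall>t\<in>{u..v} - N. velocity A y t \<in> tangent_space A (y t) \<and> 0 \<le> speed A R y t)"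
      proof (intro exI[of _ "N \<union> {u, v}"] conjI ballI)
        fix t assume t: "t \<in> {u..v} - (N \<union> {u, v})"
        then have t': "t \<in> {u<..<v} - N" by auto
        have yt: "y t \<in> chart_dom c" using im(1) t by auto
        have "velocity A y t = tangent_of A c (y t) (vector_derivative (chart_map c \<circ> y) (at t))"
          using N(2) t' yt ac_curve_isCont[OF yuv] by (intro velocity_eq_tangent_of[OF c(1)]) auto
        then show "velocity A y t \<in> tangent_space A (y t)" using tangent_of_mem[OF c(1) yt] by simp
        show "0 \<le> speed A R y t"
          using N(2) t' local_norm_nonneg[OF c(1) map_mem[OF c(1) yt]] by auto
      qed (use N(1) in simp)
    qed
  qed
  then show "speed A R y absolutely_integrable_on {a..b}"
    "\<exists>N. negligible N \<and> (\<forall>s\<in>{a..b} - N. velocity A y s \<in> tangent_space A (y s) \<and> 0 \<le> speed A R y s)" by blast+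
qed

lemma speed_integrable_on:
  assumes "ac_curve A a b y" "a \<le> u" "u \<le> v" "v \<le> b"
  shows "speed A R y integrable_on {u..v}"
  using speed_integrable[OF ac_curve_subinterval[OF assms(1,2,4)] assms(3)] set_lebesgue_integral_eq_integral(1) by blast

lemma length_nonneg:
  assumes "ac_curve A a b y" "a \<le> u" "u \<le> v" "v \<le> b"
  shows "0 \<le> integral {u..v} (speed A R y)"
proof -
  obtain N where N: "negligible N" "\<forall>s\<in>{u..v} - N. velocity A y s \<in> tangent_space A (y s) \<and> 0 \<le> speed A R y s"
    using speed_nonneg[OF ac_curve_subinterval[OF assms(1,2,4)] assms(3)] by blast
  have "integral {u..v} (\<lambda>_. 0) \<le> integral {u..v} (speed A R y)"
    by (rule integral_le_off_negligible[OF _ speed_integrable_on[OF assms] N(1)]) (use N(2) in auto)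
  then show ?thesis by simp
qed

lemma length_combine:
  assumes "ac_curve A a b y" "a \<le> u" "u \<le> v" "v \<le> w" "w \<le> b"
  shows "integral {u..v} (speed A R y) + integral {v..w} (speed A R y) = integral {u..w} (speed A R y)"
  by (rule Henstock_Kurzweil_Integration.integral_combine[OF assms(3,4)])
     (rule speed_integrable_on[OF assms(1)], use assms in auto)

text \<open>Where the derivative of \<open>h\<close> vanishes, both sides of the speed formula are
  0, whatever happens to \<open>y\<close> at \<open>h s\<close>. Elsewhere almost every parameter is
  mapped to a regular time of \<open>y\<close>.\<close>

lemma ac_curve_compose:
  assumes h: "mono_ac a b h" and y: "ac_curve A (h a) (h b) y"
  shows "ac_curve A a b (y \<circ> h)"
    and "\<exists>N. negligible N \<and> (\<forall>s\<in>{a<..<b} - N. speed A R (y \<circ> h) s = deriv h s * speed A R y (h s))"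
proof -
  interpret mono_ac a b h by (rule h)
  have ch: "continuous_on {a..b} h" by (rule abs_cont_on_imp_continuous[OF ac])
  have cy: "continuous_on {h a..h b} y" using y unfolding ac_curve_def by blast
  have sub: "mono_ac u v h" if "a \<le> u" "u \<le> v" "v \<le> b" for u v
    using ac mono that by unfold_locales (auto intro: abs_cont_on_subinterval mono_on_subset)
  \<comment> \<open>By the intermediate value theorem every time between the end values is attained,
    so a chart containing the composed curve on \<open>{u..v}\<close> contains \<open>y\<close> on
    the corresponding interval of times.\<close>
  have img: "{h u..h v} \<subseteq> h ` {u..v}" if "a \<le> u" "u \<le> v" "v \<le> b" for u v
  proof
    fix t assume "t \<in> {h u..h v}"
    moreover have "continuous_on {u..v} h" using ch that by (auto intro: continuous_on_subset)
    ultimately show "t \<in> h ` {u..v}" using IVT'[of h u t v] that by auto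
  qed
  have cyh: "continuous_on {a..b} (y \<circ> h)"
  proof (rule continuous_on_compose[OF ch])
    show "continuous_on (h ` {a..b}) y" by (rule continuous_on_subset[OF cy]) (use h_range in auto)
  qed
  have le: "h u \<le> h v" if "a \<le> u" "u \<le> v" "v \<le> b" for u v using mono_onD[OF mono, of u v] that by auto
  have acc: "abs_cont_on (h u) (h v) (chart_map c \<circ> y)"
    if "c \<in> A" "a \<le> u" "u \<le> v" "v \<le> b" "(y \<circ> h) ` {u..v} \<subseteq> chart_dom c" for c u v
  proof (rule ac_curve_in_chart[OF y that(1)])
    show "y ` {h u..h v} \<subseteq> chart_dom c" using img[OF that(2-4)] that(5) by (auto simp: image_subset_iff)
  qed (use le that in auto)
  show acyh: "ac_curve A a b (y \<circ> h)"
    unfolding ac_curve_def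
  proof (intro conjI cyh ballI allI impI, elim conjE)
    fix c u v assume c: "c \<in> A" and uv: "a \<le> u" "u \<le> v" "v \<le> b" "(y \<circ> h) ` {u..v} \<subseteq> chart_dom c"
    show "abs_cont_on u v (chart_map c \<circ> (y \<circ> h))"
      using mono_ac.compose_derivative(1)[OF sub[OF uv(1-3)] acc[OF c uv]] by (simp only: o_assoc)
  qed
  show "\<exists>N. negligible N \<and> (\<forall>s\<in>{a<..<b} - N. speed A R (y \<circ> h) s = deriv h s * speed A R y (h s))"
    using ab
  proof (induction rule: negligible_patching)
    case (local s)
    then have s: "s \<in> {a..b}" by simp
    obtain c where c: "c \<in> A" "(y \<circ> h) s \<in> chart_dom c" by (rule chart_cover)
    obtain d where d: "d > 0" "\<forall>u v. a \<le> u \<and> u \<le> s \<and> s \<le> v \<and> v \<le> b \<and> v - u < d \<longrightarrow> (y \<circ> h) ` {u..v} \<subseteq> chart_dom c"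
      by (rule continuous_local_image[OF cyh s open_dom[OF c(1)] c(2)])
    show ?case
    proof (intro exI[of _ d] conjI d(1) allI impI)
      fix u v assume "a \<le> u \<and> u \<le> s \<and> s \<le> v \<and> v \<le> b \<and> v - u < d"
      then have uv: "a \<le> u" "u \<le> v" "v \<le> b" and im: "(y \<circ> h) ` {u..v} \<subseteq> chart_dom c" using d(2) by auto
      interpret uv: mono_ac u v h by (rule sub[OF uv])
      let ?x = "chart_map c \<circ> y"
      have ax: "abs_cont_on (h u) (h v) ?x" by (rule acc[OF c(1) uv im])
      have yc: "ac_curve A (h u) (h v) y" "y ` {h u..h v} \<subseteq> chart_dom c"
        using ac_curve_subinterval[OF y, of "h u" "h v"] le uv img[OF uv] im by (auto simp: image_subset_iff)
      obtain N1 where N1: "negligible N1" "\<forall>s\<in>{u<..<v} - N1. ((?x \<circ> h) has_vector_derivative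
        (deriv h s *\<^sub>R vector_derivative ?x (at (h s)))) (at s)"
        using uv.compose_derivative(2)[OF ax] by blast
      obtain Z where Z: "negligible Z" "\<forall>t\<in>{h u<..<h v} - Z. (?x has_vector_derivative vector_derivative ?x (at t)) (at t)
        \<and> speed A R y t = local_norm c (chart_map c (y t)) (vector_derivative ?x (at t))"
        by (rule speed_in_chart[OF yc(1) c(1) yc(2) le[OF uv]])
      \<comment> \<open>With the end values included in the exceptional set, a nonzero derivative
        places \<open>h s\<close> in the open interval, where the chart formula for the speed of
        \<open>y\<close> holds.\<close>
      have "negligible (Z \<union> {h u, h v})" using Z by simp
      then obtain N2 where N2: "negligible N2" "\<And>s. s \<in> {u<..<v} - N2 \<Longrightarrow> (h has_real_derivative deriv h s) (at s) \<and> 0 \<le> deriv h s \<and> (deriv h s = 0 \<or> h s \<notin> Z \<union> {h u, h v})"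
        using uv.preimage_negligible by metis
      show "\<exists>N. negligible N \<and> (\<forall>s\<in>{u<..<v} - N. speed A R (y \<circ> h) s = deriv h s * speed A R y (h s))"
      proof (intro exI[of _ "N1 \<union> N2"] conjI ballI)
        fix t assume t: "t \<in> {u<..<v} - (N1 \<union> N2)"
        have tm: "(y \<circ> h) t \<in> chart_dom c" using im t by auto
        have img': "chart_map c (y (h t)) \<in> chart_img c" using map_mem[OF c(1) tm] by simp
        have "((chart_map c \<circ> (y \<circ> h)) has_vector_derivative (deriv h t *\<^sub>R vector_derivative ?x (at (h t)))) (at t)"
          using N1(2) t by (simp add: o_assoc)
        then have 1: "speed A R (y \<circ> h) t = local_norm c (chart_map c ((y \<circ> h) t)) (deriv h t *\<^sub>R vector_derivative ?x (at (h t)))"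
          using ac_curve_isCont[OF acyh, of t] t uv tm by (intro speed_eq_local_norm[OF c(1)]) auto
        have h': "0 \<le> deriv h t" "deriv h t = 0 \<or> h t \<notin> Z \<union> {h u, h v}" using N2(2) t by auto
        have "speed A R (y \<circ> h) t = deriv h t * local_norm c (chart_map c (y (h t))) (vector_derivative ?x (at (h t)))"
          using 1 h'(1) by (simp add: local_norm_scale[OF c(1) img'])
        moreover have "h t \<in> {h u<..<h v} - Z" if "deriv h t \<noteq> 0"
          using uv.h_range[of t] h'(2) that t by force
        ultimately show "speed A R (y \<circ> h) t = deriv h t * speed A R y (h t)"
          using Z(2) by (cases "deriv h t = 0") (simp_all del: o_apply)
      qed (use N1(1) N2(1) in simp)
    qed
  qed
qed

lemma length_compose:
  assumes h: "mono_ac a b h" and y: "ac_curve A (h a) (h b) y"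
  shows "integral {a..b} (speed A R (y \<circ> h)) = integral {h a..h b} (speed A R y)"
proof -
  interpret mono_ac a b h by (rule h)
  have hab: "h a \<le> h b" using mono_onD[OF mono, of a b] ab by auto
  obtain N where N: "negligible N" "\<forall>s\<in>{a<..<b} - N. speed A R (y \<circ> h) s = deriv h s * speed A R y (h s)"
    using ac_curve_compose(2)[OF assms] by blast
  have "negligible (N \<union> {a, b})" using N by simp
  then have "integral {a..b} (speed A R (y \<circ> h)) = integral {a..b} (\<lambda>s. deriv h s *\<^sub>R speed A R y (h s))"
    by (rule integral_spike) (use N in auto)
  also have "\<dots> = integral {h a..h b} (speed A R y)"
    by (rule change_of_variables(2)[OF speed_integrable[OF y hab]])
  finally show ?thesis .
qed

end

section \<open>The Finsler distance\<close>

lemma seminorm_continuous: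
  fixes \<nu> :: "'b::real_normed_vector \<Rightarrow> real"
  assumes tri: "\<And>w z. \<nu> (w + z) \<le> \<nu> w + \<nu> z" and hom: "\<And>r w. \<nu> (r *\<^sub>R w) = \<bar>r\<bar> * \<nu> w"
    and bd: "\<And>w. \<nu> w \<le> C * norm w" and "0 \<le> C"
  shows "continuous_on UNIV \<nu>"
proof -
  have minus: "\<nu> (- w) = \<nu> w" for w using hom[of "-1" w] by simp
  have "\<bar>\<nu> w - \<nu> z\<bar> \<le> C * norm (w - z)" for w z
    using tri[of "w - z" z] tri[of "z - w" w] minus[of "w - z"] bd[of "w - z"] by simp
  then have "C-lipschitz_on UNIV \<nu>"
    using \<open>0 \<le> C\<close> by (intro lipschitz_onI) (auto simp: dist_norm)
  then show ?thesis by (rule lipschitz_on_continuous_on)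
qed

lemma mono_ac_affine:
  assumes "0 \<le> \<alpha>" "a \<le> b"
  shows "mono_ac a b (\<lambda>s. \<alpha> * s + \<beta>)"
proof
  show "abs_cont_on a b (\<lambda>s. \<alpha> * s + \<beta>)"
  proof (rule abs_cont_onI_integral)
    show "(\<lambda>_. \<alpha>) absolutely_integrable_on {a..b}" by (simp add: absolutely_integrable_on_const)
    fix u v assume "a \<le> u" "u \<le> v" "v \<le> b"
    moreover have "\<alpha> * v - \<alpha> * u = \<alpha> * (v - u)" by (simp add: algebra_simps)
    ultimately show "norm (\<alpha> * v + \<beta> - (\<alpha> * u + \<beta>)) \<le> integral {u..v} (\<lambda>_. \<alpha>)"
      using assms by simp
  qed
  show "mono_on {a..b} (\<lambda>s. \<alpha> * s + \<beta>)" using assms by (auto intro!: mono_onI mult_left_mono)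
qed (rule assms)

context finsler_manifold
begin

lemma speed_cong:
  assumes "\<forall>\<^sub>F r in nhds s. y r = z r"
  shows "speed A R y s = speed A R z s"
proof -
  have e: "y s = z s" using assms by (rule eventually_nhds_x_imp_x)
  have vd: "vector_derivative (f \<circ> y) (at s) = vector_derivative (f \<circ> z) (at s)" for f :: "'q \<Rightarrow> 'e"
  proof -
    have ev: "\<forall>\<^sub>F r in nhds s. (f \<circ> y) r = (f \<circ> z) r" using assms by eventually_elim simp
    have "((f \<circ> y) has_vector_derivative D) (at s) \<longleftrightarrow> ((f \<circ> z) has_vector_derivative D) (at s)" for D
      by (rule has_vector_derivative_cong_ev) (use ev e in \<open>auto elim: eventually_mono\<close>)
    then show ?thesis unfolding vector_derivative_def by simp
  qed
  show ?thesis unfolding speed_def velocity_def e vd ..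
qed

lemma ac_curve_concat:
  assumes y1: "ac_curve A a b y1" and y2: "ac_curve A b c y2" and eq: "y1 b = y2 b" and abc: "a \<le> b" "b \<le> c"
  defines "z \<equiv> \<lambda>s. if s \<le> b then y1 s else y2 s"
  shows "ac_curve A a c z"
    and "integral {a..c} (speed A R z) = integral {a..b} (speed A R y1) + integral {b..c} (speed A R y2)"
proof -
  have z1: "z s = y1 s" if "s \<le> b" for s using that by (simp add: z_def)
  have z2: "z s = y2 s" if "b \<le> s" for s using that eq by (auto simp: z_def)
  have c1: "continuous_on {a..b} z"
    using y1 z1 unfolding ac_curve_def by (metis (mono_tags, lifting) atLeastAtMost_iff continuous_on_cong)
  have c2: "continuous_on {b..c} z"
    using y2 z2 unfolding ac_curve_def by (metis (mono_tags, lifting) atLeastAtMost_iff continuous_on_cong)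
  have un: "{a..c} = {a..b} \<union> {b..c}" using abc by auto
  have cont: "continuous_on {a..c} z"
    unfolding un by (rule continuous_on_closed_Un) (use c1 c2 in auto)
  have a1: "abs_cont_on u v (chart_map k \<circ> z)" if "k \<in> A" "a \<le> u" "u \<le> v" "v \<le> b" "z ` {u..v} \<subseteq> chart_dom k" for k u v
  proof -
    have "abs_cont_on u v (chart_map k \<circ> y1)"
      by (rule ac_curve_in_chart[OF y1 that(1) _ that(2-4)]) (use that(4,5) z1 in \<open>force simp: image_subset_iff\<close>)
    then show ?thesis using that(4) by (subst abs_cont_on_cong[where g = "chart_map k \<circ> y1"]) (auto simp: z1)
  qed
  have a2: "abs_cont_on u v (chart_map k \<circ> z)" if "k \<in> A" "b \<le> u" "u \<le> v" "v \<le> c" "z ` {u..v} \<subseteq> chart_dom k" for k u v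
  proof -
    have "abs_cont_on u v (chart_map k \<circ> y2)"
      by (rule ac_curve_in_chart[OF y2 that(1) _ that(2-4)]) (use that(2,5) z2 in \<open>force simp: image_subset_iff\<close>)
    then show ?thesis using that(2) by (subst abs_cont_on_cong[where g = "chart_map k \<circ> y2"]) (auto simp: z2)
  qed
  show acz: "ac_curve A a c z"
    unfolding ac_curve_def
  proof (intro conjI cont ballI allI impI, elim conjE)
    fix k u v assume k: "k \<in> A" and uv: "a \<le> u" "u \<le> v" "v \<le> c" "z ` {u..v} \<subseteq> chart_dom k"
    consider "v \<le> b" | "b \<le> u" | "u \<le> b" "b \<le> v" by linarith
    then show "abs_cont_on u v (chart_map k \<circ> z)"
    proof cases
      case 1 then show ?thesis using a1[OF k uv(1,2) _ uv(4)] by simp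
    next
      case 2 then show ?thesis using a2[OF k _ uv(2,3,4)] by simp
    next
      case 3
      have "z ` {u..b} \<subseteq> chart_dom k" "z ` {b..v} \<subseteq> chart_dom k" using 3 uv(4) by (auto simp: image_subset_iff)
      then show ?thesis using abs_cont_on_combine[OF a1[OF k uv(1) 3(1) order.refl] a2[OF k order.refl 3(2) uv(3)] 3] by simp
    qed
  qed
  \<comment> \<open>At an endpoint of a piece the two-sided derivative depends on values beyond the
    piece, so speeds are compared in the interior only.\<close>
  have "integral {a..b} (speed A R z) = integral {a..b} (speed A R y1)"
  proof (rule integral_spike[of "{a, b}"])
    fix s assume s: "s \<in> {a..b} - {a, b}"
    then have "\<forall>\<^sub>F r in nhds s. r \<in> {..<b}" by (intro eventually_nhds_in_open) auto
    then have "\<forall>\<^sub>F r in nhds s. y1 r = z r" by eventually_elim (simp add: z1)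
    then show "speed A R y1 s = speed A R z s" by (rule speed_cong)
  qed simp
  moreover have "integral {b..c} (speed A R z) = integral {b..c} (speed A R y2)"
  proof (rule integral_spike[of "{b, c}"])
    fix s assume s: "s \<in> {b..c} - {b, c}"
    then have "\<forall>\<^sub>F r in nhds s. r \<in> {b<..}" by (intro eventually_nhds_in_open) auto
    then have "\<forall>\<^sub>F r in nhds s. y2 r = z r" by eventually_elim (simp add: z2)
    then show "speed A R y2 s = speed A R z s" by (rule speed_cong)
  qed simp
  ultimately show "integral {a..c} (speed A R z) = integral {a..b} (speed A R y1) + integral {b..c} (speed A R y2)"
    using length_combine[OF acz order.refl abc order.refl] by simp
qed

lemma reflect_integral:
  fixes f :: "real \<Rightarrow> real"
  assumes "f absolutely_integrable_on {1 - v..1 - u}"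
  shows "(\<lambda>s. f (1 - s)) absolutely_integrable_on {u..v}" "integral {u..v} (\<lambda>s. f (1 - s)) = integral {1 - v..1 - u} f"
proof -
  have im: "(\<lambda>s. 1 - s) ` {u..v} = {1 - v..1 - u}" by (rule image_diff_atLeastAtMost)
  have "(\<lambda>s. \<bar>- 1\<bar> *\<^sub>R f (1 - s)) absolutely_integrable_on {u..v} \<and> integral {u..v} (\<lambda>s. \<bar>- 1\<bar> *\<^sub>R f (1 - s)) = integral {1 - v..1 - u} f"
    by (subst has_absolute_integral_change_of_variables_real)
       (auto intro!: derivative_eq_intros simp: im assms inj_on_def)
  then show "(\<lambda>s. f (1 - s)) absolutely_integrable_on {u..v}" "integral {u..v} (\<lambda>s. f (1 - s)) = integral {1 - v..1 - u} f"
    by simp_all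
qed

text \<open>Reversal changes the sign of the velocity, which a norm does not see. This is what makes
  the distance symmetric.\<close>

lemma ac_curve_reverse:
  assumes y: "ac_curve A 0 1 y"
  shows "ac_curve A 0 1 (\<lambda>s. y (1 - s))"
    and "integral {0..1} (speed A R (\<lambda>s. y (1 - s))) = integral {0..1} (speed A R y)"
proof -
  let ?z = "\<lambda>s. y (1 - s)"
  have cont: "continuous_on {0..1} ?z"
    by (rule continuous_on_compose2[of "{0..1}" y]) (use y in \<open>auto simp: ac_curve_def intro!: continuous_intros\<close>)
  have sub: "abs_cont_on (1 - v) (1 - u) (chart_map c \<circ> y)" "y ` {1 - v..1 - u} \<subseteq> chart_dom c"
    if "c \<in> A" "0 \<le> u" "u \<le> v" "v \<le> 1" "?z ` {u..v} \<subseteq> chart_dom c" for c u v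
  proof -
    show s: "y ` {1 - v..1 - u} \<subseteq> chart_dom c"
    proof
      fix q assume "q \<in> y ` {1 - v..1 - u}"
      then obtain t where "t \<in> {1 - v..1 - u}" "q = y t" by blast
      then have "q = ?z (1 - t)" "1 - t \<in> {u..v}" by auto
      then show "q \<in> chart_dom c" using that(5) by blast
    qed
    show "abs_cont_on (1 - v) (1 - u) (chart_map c \<circ> y)"
      by (rule ac_curve_in_chart[OF y that(1) s]) (use that in auto)
  qed
  show acz: "ac_curve A 0 1 ?z"
    unfolding ac_curve_def
  proof (intro conjI cont ballI allI impI, elim conjE)
    fix c u v assume c: "c \<in> A" and uv: "0 \<le> u" "u \<le> v" "v \<le> 1" "?z ` {u..v} \<subseteq> chart_dom c"
    note ac = sub(1)[OF c uv]
    let ?m = "\<lambda>t. norm (vector_derivative (chart_map c \<circ> y) (at t))"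
    have m: "?m absolutely_integrable_on {1 - v..1 - u}" using abs_cont_on_norm_integrable[OF ac] uv by simp
    show "abs_cont_on u v (chart_map c \<circ> ?z)"
    proof (rule abs_cont_onI_integral[OF reflect_integral(1)[OF m]])
      fix u' v' assume uv': "u \<le> u'" "u' \<le> v'" "v' \<le> v"
      have m': "?m absolutely_integrable_on {1 - v'..1 - u'}"
        by (rule absolutely_integrable_on_subinterval[OF m]) (use uv' in auto)
      show "norm ((chart_map c \<circ> ?z) v' - (chart_map c \<circ> ?z) u') \<le> integral {u'..v'} (\<lambda>s. ?m (1 - s))"
        using abs_cont_on_norm_le[OF ac, of "1 - v'" "1 - u'"] uv'
        by (simp add: reflect_integral(2)[OF m'] norm_minus_commute)
    qed
  qed
  have ae: "\<exists>N. negligible N \<and> (\<forall>s\<in>{0<..<1} - N. speed A R ?z s = speed A R y (1 - s))"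
    using zero_le_one
  proof (induction rule: negligible_patching)
    case (local s)
    then have s: "s \<in> {0..1}" by simp
    obtain c where c: "c \<in> A" "?z s \<in> chart_dom c" by (rule chart_cover)
    obtain d where d: "d > 0" "\<forall>u v. 0 \<le> u \<and> u \<le> s \<and> s \<le> v \<and> v \<le> 1 \<and> v - u < d \<longrightarrow> ?z ` {u..v} \<subseteq> chart_dom c"
      by (rule continuous_local_image[OF cont s open_dom[OF c(1)] c(2)])
    show ?case
    proof (intro exI[of _ d] conjI d(1) allI impI)
      fix u v assume "0 \<le> u \<and> u \<le> s \<and> s \<le> v \<and> v \<le> 1 \<and> v - u < d"
      then have uv: "0 \<le> u" "u \<le> v" "v \<le> 1" and im: "?z ` {u..v} \<subseteq> chart_dom c" using d(2) by auto
      note sb = sub[OF c(1) uv im]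
      have yc: "ac_curve A (1 - v) (1 - u) y" using ac_curve_subinterval[OF y] uv by simp
      let ?x = "chart_map c \<circ> y"
      obtain N where N: "negligible N" "\<forall>t\<in>{1 - v<..<1 - u} - N. (?x has_vector_derivative vector_derivative ?x (at t)) (at t)
        \<and> speed A R y t = local_norm c (chart_map c (y t)) (vector_derivative ?x (at t))"
        by (rule speed_in_chart[OF yc c(1) sb(2)]) (use uv in simp)
      have neg: "negligible ((\<lambda>s. 1 - s) ` N)"
        by (rule negligible_differentiable_image_negligible[OF order_refl N(1)])
           (auto simp: differentiable_on_def intro!: derivative_intros)
      show "\<exists>N. negligible N \<and> (\<forall>s\<in>{u<..<v} - N. speed A R ?z s = speed A R y (1 - s))"
      proof (intro exI[of _ "(\<lambda>s. 1 - s) ` N"] conjI ballI neg)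
        fix t assume t: "t \<in> {u<..<v} - (\<lambda>s. 1 - s) ` N"
        have "1 - t \<notin> N" using t by (auto simp: image_iff)
        then have t': "1 - t \<in> {1 - v<..<1 - u} - N" using t by auto
        let ?D = "vector_derivative ?x (at (1 - t))"
        have D: "(?x has_vector_derivative ?D) (at (1 - t))" using N(2) t' by blast
        have "((?x \<circ> (\<lambda>s. 1 - s)) has_vector_derivative (- 1) *\<^sub>R ?D) (at t)"
          by (rule vector_diff_chain_at) (use D in \<open>auto intro!: derivative_eq_intros\<close>)
        then have "((chart_map c \<circ> ?z) has_vector_derivative - ?D) (at t)" by (simp add: o_def)
        moreover have tm: "?z t \<in> chart_dom c" using im t by auto
        moreover have "isCont ?z t" using ac_curve_isCont[OF acz] t uv by auto
        ultimately have "speed A R ?z t = local_norm c (chart_map c (?z t)) (- ?D)"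
          using c(1) by (intro speed_eq_local_norm) auto
        also have "\<dots> = local_norm c (chart_map c (?z t)) ?D"
          by (rule local_norm_minus[OF c(1) map_mem[OF c(1) tm]])
        also have "\<dots> = speed A R y (1 - t)" using N(2) t' by simp
        finally show "speed A R ?z t = speed A R y (1 - t)" .
      qed
    qed
  qed
  then obtain N where N: "negligible N" "\<forall>s\<in>{0<..<1} - N. speed A R ?z s = speed A R y (1 - s)" by blast
  have "integral {0..1} (speed A R ?z) = integral {0..1} (\<lambda>s. speed A R y (1 - s))"
  proof (rule integral_spike[of "N \<union> {0, 1}"])
    fix s assume "s \<in> {0..1} - (N \<union> {0, 1})"
    then have "s \<in> {0<..<1} - N" by auto
    then show "speed A R y (1 - s) = speed A R ?z s" using N(2) by simp
  qed (use N(1) in simp)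
  then show "integral {0..1} (speed A R ?z) = integral {0..1} (speed A R y)"
    using reflect_integral(2)[where f = "speed A R y" and u = 0 and v = 1] speed_integrable[OF y] by simp
qed

section \<open>Length against displacement in a chart\<close>

text \<open>A fixed seminorm below all norms met along the curve turns length into a bound for the
  displacement in the chart. It is applied both to a multiple of the Euclidean norm and to a
  slightly shrunk norm of a single point.\<close>

lemma seminorm_le_length:
  assumes y: "ac_curve A a b y" and ab: "a \<le> b" and c: "c \<in> A" "y ` {a..b} \<subseteq> chart_dom c"
    and tri: "\<And>w z. \<nu> (w + z) \<le> \<nu> w + \<nu> z" and hom: "\<And>r w. \<nu> (r *\<^sub>R w) = \<bar>r\<bar> * \<nu> w"
    and bd: "\<And>w. \<nu> w \<le> C * norm w" and "0 \<le> C"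
    and le: "\<And>s w. s \<in> {a..b} \<Longrightarrow> \<nu> w \<le> local_norm c (chart_map c (y s)) w"
  shows "\<nu> (chart_map c (y b) - chart_map c (y a)) \<le> integral {a..b} (speed A R y)"
proof -
  let ?x = "chart_map c \<circ> y"
  have ac: "abs_cont_on a b ?x" by (rule ac_curve_in_chart[OF y c order.refl ab order.refl])
  have cont: "continuous_on UNIV \<nu>" using seminorm_continuous[of \<nu> C] tri hom bd \<open>0 \<le> C\<close> by blast
  have nn: "0 \<le> \<nu> w" for w using tri[of w "- w"] hom[of "-1" w] hom[of 0 w] by simp
  have "(\<lambda>s. \<nu> (vector_derivative ?x (at s))) absolutely_integrable_on {a..b}"
  proof (rule measurable_bounded_by_integrable_imp_absolutely_integrable)
    have "\<nu> \<in> borel_measurable borel" using cont by (rule borel_measurable_continuous_onI)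
    moreover have "(\<lambda>s. vector_derivative ?x (at s)) \<in> borel_measurable (lebesgue_on {a..b})"
      by (rule absolutely_integrable_imp_borel_measurable[OF abs_cont_on_FTC(2)[OF ac ab]]) simp
    ultimately show "(\<lambda>s. \<nu> (vector_derivative ?x (at s))) \<in> borel_measurable (lebesgue_on {a..b})"
      by (rule measurable_compose[rotated])
    show "(\<lambda>s. C * norm (vector_derivative ?x (at s))) integrable_on {a..b}"
      using set_integrable_mult_right[OF abs_cont_on_norm_integrable[OF ac ab]] by (intro set_lebesgue_integral_eq_integral(1)) auto
    show "norm (\<nu> (vector_derivative ?x (at s))) \<le> C * norm (vector_derivative ?x (at s))" for s
      using bd nn by simp
  qed simp
  then have i: "(\<lambda>s. \<nu> (vector_derivative ?x (at s))) integrable_on {a..b}" by (rule set_lebesgue_integral_eq_integral(1))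
  have "\<nu> (?x b - ?x a) \<le> integral {a..b} (\<lambda>s. \<nu> (vector_derivative ?x (at s)))"
    using seminorm_increment_le[OF ac ab, of \<nu> C] tri hom bd \<open>0 \<le> C\<close> i by blast
  moreover obtain N where N: "negligible N" "\<forall>s\<in>{a<..<b} - N. (?x has_vector_derivative vector_derivative ?x (at s)) (at s)
      \<and> speed A R y s = local_norm c (chart_map c (y s)) (vector_derivative ?x (at s))"
    by (rule speed_in_chart[OF y c ab])
  moreover have "integral {a..b} (\<lambda>s. \<nu> (vector_derivative ?x (at s))) \<le> integral {a..b} (speed A R y)"
  proof (rule integral_le_off_negligible[OF i, where N = "N \<union> {a, b}"])
    show "speed A R y integrable_on {a..b}" by (rule speed_integrable_on[OF y order.refl ab order.refl])
    fix s assume s: "s \<in> {a..b} - (N \<union> {a, b})"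
    then have "s \<in> {a<..<b} - N" by auto
    then have "speed A R y s = local_norm c (chart_map c (y s)) (vector_derivative ?x (at s))" using N(2) by blast
    then show "\<nu> (vector_derivative ?x (at s)) \<le> speed A R y s" using le s by simp
  qed (use N(1) in simp)
  ultimately show ?thesis by simp
qed

text \<open>Up to its first exit time the curve lies in the chart and has to cover the distance from
  its starting point to the boundary of the ball, at a cost of at least \<open>k\<close> per
  unit.\<close>

lemma curve_exit_length:
  assumes y: "ac_curve A a b y" and ab: "a \<le> b" and c: "c \<in> A" and k: "k > 0"
    and sub: "cball x0 r \<subseteq> chart_img c"
    and le: "\<forall>x\<in>cball x0 r. \<forall>w. k * norm w \<le> local_norm c x w"
    and ya: "y a \<in> chart_dom c" "dist x0 (chart_map c (y a)) < r"
    and exit: "\<not> (y ` {a..b} \<subseteq> {q \<in> chart_dom c. chart_map c q \<in> ball x0 r})"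
  shows "k * (r - dist x0 (chart_map c (y a))) \<le> integral {a..b} (speed A R y)"
proof -
  let ?G = "{q \<in> chart_dom c. chart_map c q \<in> ball x0 r}"
  have G: "open ?G" by (rule open_chart_preimage[OF c open_ball])
  have cont: "continuous_on {a..b} y" using y unfolding ac_curve_def by blast
  have "closed ({a..b} \<inter> y -` (- ?G))" by (rule continuous_closed_preimage[OF cont]) (use G in auto)
  then have "compact ({a..b} \<inter> ({a..b} \<inter> y -` (- ?G)))" by (rule compact_Int_closed[OF compact_Icc])
  then have comp: "compact ({a..b} \<inter> y -` (- ?G))" by (simp only: Int_assoc[symmetric] Int_absorb)
  have ne: "{a..b} \<inter> y -` (- ?G) \<noteq> {}" using exit by (auto simp: image_subset_iff)
  obtain \<tau> where \<tau>: "\<tau> \<in> {a..b} \<inter> y -` (- ?G)" "\<forall>s\<in>{a..b} \<inter> y -` (- ?G). \<tau> \<le> s"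
    using compact_attains_inf[OF comp ne] by blast
  have inG: "y s \<in> ?G" if "s \<in> {a..<\<tau>}" for s
  proof (rule ccontr)
    assume "y s \<notin> ?G"
    then have "s \<in> {a..b} \<inter> y -` (- ?G)" using that \<tau>(1) by auto
    then show False using \<tau>(2) that by force
  qed
  have "y a \<in> ?G" using ya by simp
  moreover have "y \<tau> \<notin> ?G" "a \<le> \<tau>" using \<tau>(1) by auto
  ultimately have "a \<noteq> \<tau>" by metis
  with \<open>a \<le> \<tau>\<close> have a\<tau>: "a < \<tau>" by simp
  \<comment> \<open>At the exit time \<tau> the curve may already be outside the chart domain, so
    its coordinates cannot be evaluated there. Just before \<tau> they come arbitrarily close to the
    sphere: otherwise the curve would stay in the compact image of a smaller ball, and so would its
    limit \<open>y \<tau>\<close>.\<close>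
  have far: "\<exists>u\<in>{a..<\<tau>}. \<rho> < dist x0 (chart_map c (y u))" if \<rho>: "\<rho> < r" for \<rho>
  proof (rule ccontr)
    assume "\<not> ?thesis"
    then have near: "dist x0 (chart_map c (y u)) \<le> \<rho>" if "u \<in> {a..<\<tau>}" for u using that by (meson not_le)
    have subc: "cball x0 \<rho> \<subseteq> chart_img c" using sub \<rho> by auto
    have "compact (chart_inv c ` cball x0 \<rho>)"
      by (rule compact_continuous_image[OF continuous_on_subset[OF cont_inv[OF c] subc] compact_cball])
    then have cl: "closed (chart_inv c ` cball x0 \<rho>)" by (rule compact_imp_closed)
    have "(y \<longlongrightarrow> y \<tau>) (at \<tau> within {a..b})" using cont \<tau>(1) by (simp add: continuous_on_def)
    then have lim: "(y \<longlongrightarrow> y \<tau>) (at \<tau> within {a..<\<tau>})" by (rule tendsto_within_subset) (use \<tau>(1) in auto)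
    have nb: "at \<tau> within {a..<\<tau>} \<noteq> bot"
    proof -
      have "\<tau> \<in> closure {a<..<\<tau>}" using a\<tau> by simp
      then have "\<tau> islimpt {a<..<\<tau>}" by (simp add: islimpt_in_closure)
      then have "\<tau> islimpt {a..<\<tau>}" by (rule islimpt_subset) auto
      then show ?thesis by (simp add: trivial_limit_within)
    qed
    have "y \<tau> \<in> chart_inv c ` cball x0 \<rho>"
    proof (rule Lim_in_closed_set[OF cl _ nb lim])
      have "y u \<in> chart_inv c ` cball x0 \<rho>" if "u \<in> {a..<\<tau>}" for u
        using near[OF that] inG[OF that] inv_map[OF c, of "y u"] by (intro image_eqI[of _ _ "chart_map c (y u)"]) auto
      then show "\<forall>\<^sub>F u in at \<tau> within {a..<\<tau>}. y u \<in> chart_inv c ` cball x0 \<rho>" by (simp add: eventually_at_filter)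
    qed
    then obtain x where x: "x \<in> cball x0 \<rho>" "y \<tau> = chart_inv c x" by blast
    then have "x \<in> chart_img c" using subc by auto
    then have "y \<tau> \<in> ?G" using x \<rho> inv_mem[OF c] map_inv[OF c] by auto
    then show False using \<tau>(1) by auto
  qed
  show ?thesis
  proof (rule field_le_epsilon)
    fix e :: real assume e: "e > 0"
    obtain u where u: "u \<in> {a..<\<tau>}" "r - e / k < dist x0 (chart_map c (y u))" using far[of "r - e/k"] e k by auto
    have ub: "a \<le> u" "u \<le> b" using u(1) \<tau>(1) by auto
    have im: "y s \<in> ?G" if "s \<in> {a..u}" for s using inG[of s] that u(1) by auto
    have "k * norm (chart_map c (y u) - chart_map c (y a)) \<le> integral {a..u} (speed A R y)"
    proof (rule seminorm_le_length[OF ac_curve_subinterval[OF y order.refl ub(2)] ub(1) c, where C = k])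
      show "y ` {a..u} \<subseteq> chart_dom c" using im by auto
      show "k * norm w \<le> local_norm c (chart_map c (y s)) w" if "s \<in> {a..u}" for s w
        using le im[OF that] by auto
      show "k * norm (w + z) \<le> k * norm w + k * norm z" for w z :: 'e
        using k norm_triangle_ineq[of w z] by (metis distrib_left mult_le_cancel_left_pos)
    qed (use k in auto)
    also have "\<dots> \<le> integral {a..b} (speed A R y)"
      using length_combine[OF y order.refl ub order.refl] length_nonneg[OF y ub order.refl] by simp
    finally have 1: "k * norm (chart_map c (y u) - chart_map c (y a)) \<le> integral {a..b} (speed A R y)" .
    have "dist x0 (chart_map c (y u)) \<le> dist x0 (chart_map c (y a)) + norm (chart_map c (y u) - chart_map c (y a))"
      by (metis dist_commute dist_norm dist_triangle)
    then have "r - dist x0 (chart_map c (y a)) \<le> norm (chart_map c (y u) - chart_map c (y a)) + e / k" using u(2) by simp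
    then have "k * (r - dist x0 (chart_map c (y a))) \<le> k * (norm (chart_map c (y u) - chart_map c (y a)) + e / k)"
      using k by (intro mult_left_mono) auto
    also have "\<dots> = k * norm (chart_map c (y u) - chart_map c (y a)) + e" using k by (simp add: distrib_left)
    finally show "k * (r - dist x0 (chart_map c (y a))) \<le> integral {a..b} (speed A R y) + e" using 1 by simp
  qed
qed

text \<open>Supplies competitors for the infimum in the distance. A straight segment in one chart
  must be absolutely continuous in every chart, which the continuous differentials of the transition
  maps guarantee.\<close>

lemma segment_curve:
  assumes c: "c \<in> A" and seg: "\<And>s. s \<in> {0..1} \<Longrightarrow> x0 + s *\<^sub>R w \<in> chart_img c"
    and K: "\<And>s. s \<in> {0..1} \<Longrightarrow> local_norm c (x0 + s *\<^sub>R w) w \<le> L"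
  shows "ac_curve A 0 1 (\<lambda>s. chart_inv c (x0 + s *\<^sub>R w))"
    and "integral {0..1} (speed A R (\<lambda>s. chart_inv c (x0 + s *\<^sub>R w))) \<le> L"
proof -
  let ?x = "\<lambda>s. x0 + s *\<^sub>R w" and ?y = "\<lambda>s. chart_inv c (x0 + s *\<^sub>R w)"
  have cont: "continuous_on {0..1} ?y"
    by (rule continuous_on_compose2[OF cont_inv[OF c]]) (use seg in \<open>auto intro!: continuous_intros\<close>)
  have xd: "(?x has_vector_derivative w) (at s)" for s
    by (auto intro!: derivative_eq_intros simp: has_vector_derivative_def)
  show acy: "ac_curve A 0 1 ?y"
    unfolding ac_curve_def
  proof (intro conjI cont ballI allI impI, elim conjE)
    fix c' u v assume c': "c' \<in> A" and uv: "0 \<le> u" "u \<le> v" "v \<le> 1" "?y ` {u..v} \<subseteq> chart_dom c'"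
    let ?D = "\<lambda>s. frechet_derivative (transition c c') (at (?x s)) w"
    have mem: "?y s \<in> chart_dom c \<inter> chart_dom c'" "chart_map c (?y s) = ?x s" if "s \<in> {u..v}" for s
    proof -
      have "?x s \<in> chart_img c" using seg that uv by auto
      then show "?y s \<in> chart_dom c \<inter> chart_dom c'" "chart_map c (?y s) = ?x s"
        using inv_mem[OF c] map_inv[OF c] uv(4) that by auto
    qed
    have der: "((chart_map c' \<circ> ?y) has_vector_derivative ?D s) (at s within {u..v})" if s: "s \<in> {u..v}" for s
    proof -
      have td: "(transition c c' has_derivative frechet_derivative (transition c c') (at (?x s))) (at (?x s))"
        using transition_derivative[OF c c', of "?y s"] mem[OF s] by simp
      have "((transition c c' \<circ> ?x) has_derivative frechet_derivative (transition c c') (at (?x s)) \<circ> (\<lambda>h. h *\<^sub>R w)) (at s)"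
        using xd[of s] td unfolding has_vector_derivative_def by (intro diff_chain_at) auto
      moreover have "frechet_derivative (transition c c') (at (?x s)) \<circ> (\<lambda>h. h *\<^sub>R w) = (\<lambda>h. h *\<^sub>R ?D s)"
        using has_derivative_linear[OF td] by (auto simp: linear_scale)
      moreover have "transition c c' \<circ> ?x = chart_map c' \<circ> ?y" by (simp add: transition_def o_def)
      ultimately have "((chart_map c' \<circ> ?y) has_vector_derivative ?D s) (at s)"
        unfolding has_vector_derivative_def by simp
      then show ?thesis by (rule has_vector_derivative_at_within)
    qed
    have Dc: "continuous_on {u..v} ?D"
    proof (rule continuous_on_compose2[OF transition_derivative_continuous[OF c c', of w]])
      show "continuous_on {u..v} ?x" by (intro continuous_intros)
      show "?x ` {u..v} \<subseteq> chart_map c ` (chart_dom c \<inter> chart_dom c')"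
        using mem by (metis (no_types, lifting) image_eqI image_subsetI)
    qed
    show "abs_cont_on u v (chart_map c' \<circ> ?y)"
    proof (rule abs_cont_onI_integral)
      show "(\<lambda>s. norm (?D s)) absolutely_integrable_on {u..v}"
        by (intro absolutely_integrable_continuous_real continuous_on_norm Dc)
      fix u' v' assume uv': "u \<le> u'" "u' \<le> v'" "v' \<le> v"
      have "(?D has_integral ((chart_map c' \<circ> ?y) v' - (chart_map c' \<circ> ?y) u')) {u'..v'}"
      proof (rule fundamental_theorem_of_calculus[OF uv'(2)])
        fix s assume "s \<in> {u'..v'}"
        then have "s \<in> {u..v}" "{u'..v'} \<subseteq> {u..v}" using uv' by auto
        then show "((chart_map c' \<circ> ?y) has_vector_derivative ?D s) (at s within {u'..v'})"
          by (intro has_vector_derivative_within_subset[OF der])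
      qed
      moreover have "(\<lambda>s. norm (?D s)) integrable_on {u'..v'}"
        by (intro integrable_continuous_real continuous_on_norm continuous_on_subset[OF Dc]) (use uv' in auto)
      ultimately show "norm ((chart_map c' \<circ> ?y) v' - (chart_map c' \<circ> ?y) u') \<le> integral {u'..v'} (\<lambda>s. norm (?D s))"
        by (metis (no_types, lifting) has_integral_integrable integral_norm_bound_integral integral_unique order_refl)
    qed
  qed
  have im: "?y ` {0..1} \<subseteq> chart_dom c" using seg inv_mem[OF c] by auto
  obtain N where N: "negligible N" "\<forall>s\<in>{0<..<1} - N. ((chart_map c \<circ> ?y) has_vector_derivative vector_derivative (chart_map c \<circ> ?y) (at s)) (at s)
      \<and> speed A R ?y s = local_norm c (chart_map c (?y s)) (vector_derivative (chart_map c \<circ> ?y) (at s))"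
    by (rule speed_in_chart[OF acy c im]) simp
  have "integral {0..1} (speed A R ?y) \<le> integral {0..1} (\<lambda>_::real. L)"
  proof (rule integral_le_off_negligible[where N = "N \<union> {0, 1}"])
    show "speed A R ?y integrable_on {0..1}" by (rule speed_integrable_on[OF acy]) auto
    show "(\<lambda>_. L) integrable_on {0..1::real}" by (rule integrable_const_ivl)
    fix s assume s: "s \<in> {0..1} - (N \<union> {0, 1})"
    have ev: "\<forall>\<^sub>F r in nhds s. r \<in> {0<..<1}" using s by (intro eventually_nhds_in_open) auto
    have "((chart_map c \<circ> ?y) has_vector_derivative w) (at s)"
    proof (rule has_vector_derivative_transform_within_open[OF xd])
      show "open {0<..<1::real}" by simp
      show "s \<in> {0<..<1}" using s by auto
      show "?x r = (chart_map c \<circ> ?y) r" if "r \<in> {0<..<1}" for r using map_inv[OF c seg] that by auto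
    qed
    then have "vector_derivative (chart_map c \<circ> ?y) (at s) = w" by (rule vector_derivative_at)
    moreover have "chart_map c (?y s) = ?x s" using map_inv[OF c seg] s by auto
    moreover have "s \<in> {0<..<1} - N" using s by auto
    ultimately show "speed A R ?y s \<le> L" using N(2) K[of s] s by auto
  qed (use N(1) in auto)
  then show "integral {0..1} (speed A R ?y) \<le> L" by simp
qed

end

section \<open>The distance and the manifold topology\<close>

locale finsler_space = finsler_manifold A R
  for A :: "('q::{second_countable_topology,t2_space}, 'e::euclidean_space) chart set"
    and R :: "'q \<Rightarrow> ('q, 'e) tvec \<Rightarrow> real" +
  assumes connectable: "\<And>x y. connecting_lengths A R x y \<noteq> {}"
begin

abbreviation d :: "'q \<Rightarrow> 'q \<Rightarrow> real" where "d \<equiv> finsler_dist A R"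

lemma connecting_nonneg: "l \<in> connecting_lengths A R x y \<Longrightarrow> 0 \<le> l"
  unfolding connecting_lengths_def using length_nonneg[of 0 1] by auto

lemma d_nonneg: "0 \<le> d x y"
  unfolding finsler_dist_def by (rule cInf_greatest[OF connectable connecting_nonneg])

lemma d_le: "l \<in> connecting_lengths A R x y \<Longrightarrow> d x y \<le> l"
  unfolding finsler_dist_def by (rule cInf_lower) (auto intro!: bdd_belowI connecting_nonneg)

lemma d_less_curve:
  assumes "d x x' < e"
  obtains y where "ac_curve A 0 1 y" "y 0 = x" "y 1 = x'" "integral {0..1} (speed A R y) < e"
  using cInf_lessD[OF connectable, of x x' e] assms unfolding finsler_dist_def connecting_lengths_def by blast

lemma d_le_length:
  assumes y: "ac_curve A a b y" and ab: "a \<le> b"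
  shows "d (y a) (y b) \<le> integral {a..b} (speed A R y)"
proof -
  let ?h = "\<lambda>s. (b - a) * s + a"
  have h: "mono_ac 0 1 ?h" using ab by (intro mono_ac_affine) auto
  have y': "ac_curve A (?h 0) (?h 1) y" using y by simp
  have "integral {0..1} (speed A R (y \<circ> ?h)) \<in> connecting_lengths A R (y a) (y b)"
    unfolding connecting_lengths_def using ac_curve_compose(1)[OF h y']
    by (intro CollectI exI[of _ "y \<circ> ?h"]) auto
  then show ?thesis using d_le length_compose[OF h y'] by fastforce
qed

text \<open>Any closed curve through \<open>x\<close>, restricted to the one-point parameter
  interval, has length 0.\<close>

lemma d_refl: "d x x = 0"
proof -
  obtain y where y: "ac_curve A 0 1 y" "y 0 = x"
    using connectable[of x x] unfolding connecting_lengths_def by blast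
  have "ac_curve A 0 0 y" using ac_curve_subinterval[OF y(1)] by simp
  then have "d (y 0) (y 0) \<le> 0" using d_le_length[of 0 0 y] by simp
  then show ?thesis using d_nonneg y(2) by (metis order_antisym)
qed

lemma d_sym_le: "d x' x \<le> d x x'"
proof (rule field_le_epsilon)
  fix e :: real assume "e > 0"
  then obtain y where y: "ac_curve A 0 1 y" "y 0 = x" "y 1 = x'" "integral {0..1} (speed A R y) < d x x' + e"
    using d_less_curve[of x x' "d x x' + e"] by auto
  show "d x' x \<le> d x x' + e"
    using d_le_length[OF ac_curve_reverse(1)[OF y(1)]] ac_curve_reverse(2)[OF y(1)] y by simp
qed

lemma d_sym: "d x y = d y x" by (rule order_antisym) (rule d_sym_le)+

lemma d_triangle: "d x z \<le> d x y + d y z"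
proof (rule field_le_epsilon)
  fix e :: real assume e: "e > 0"
  obtain y1 where y1: "ac_curve A 0 1 y1" "y1 0 = x" "y1 1 = y" "integral {0..1} (speed A R y1) < d x y + e/2"
    using d_less_curve[of x y "d x y + e/2"] e by auto
  obtain y2 where y2: "ac_curve A 0 1 y2" "y2 0 = y" "y2 1 = z" "integral {0..1} (speed A R y2) < d y z + e/2"
    using d_less_curve[of y z "d y z + e/2"] e by auto
  let ?h = "\<lambda>s::real. 1 * s + (-1)"
  have h: "mono_ac 1 2 ?h" by (intro mono_ac_affine) auto
  have y2': "ac_curve A (?h 1) (?h 2) y2" using y2 by simp
  define y3 where "y3 = y2 \<circ> ?h"
  have 1: "ac_curve A 1 2 y3" unfolding y3_def by (rule ac_curve_compose(1)[OF h y2'])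
  have y3: "y3 1 = y" "y3 2 = z" using y2 by (simp_all add: y3_def)
  then have eq: "y1 1 = y3 1" using y1 by simp
  note cc = ac_curve_concat[OF y1(1) 1 eq]
  have l2: "integral {1..2} (speed A R y3) = integral {0..1} (speed A R y2)"
    unfolding y3_def using length_compose[OF h y2'] by simp
  have "d (if (0::real) \<le> 1 then y1 0 else y3 0) (if (2::real) \<le> 1 then y1 2 else y3 2)
    \<le> integral {0..1} (speed A R y1) + integral {1..2} (speed A R y3)"
    using d_le_length[OF cc(1)] cc(2) by simp
  then show "d x z \<le> d x y + d y z + e" using l2 y1 y2 y3 by simp
qed

text \<open>Since \<open>d\<close> is an infimum over all curves, a lower bound must also cover
  those that leave the chart; these are too long to matter.\<close>

lemma d_lower_local:
  assumes c: "c \<in> A" and x0: "x0 \<in> chart_img c"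
  obtains r k where "r > 0" "k > 0"
    "\<forall>p p'. p \<in> chart_dom c \<longrightarrow> dist x0 (chart_map c p) < r \<longrightarrow> d p p' < k * r \<longrightarrow>
      p' \<in> chart_dom c \<and> k * norm (chart_map c p' - chart_map c p) \<le> d p p'"
proof -
  obtain r k K where rk: "r > 0" "k > 0" "K > 0" "cball x0 r \<subseteq> chart_img c"
    "\<forall>x\<in>cball x0 r. \<forall>w. k * norm w \<le> local_norm c x w \<and> local_norm c x w \<le> K * norm w"
    by (rule local_norm_equiv[OF c x0])
  \<comment> \<open>Starting within \<open>r / 2\<close> of the centre leaves at least
    \<open>r / 2\<close> to the boundary, so a curve that leaves the ball has length at least
    \<open>k * (r / 2)\<close>.\<close>
  have main: "p' \<in> chart_dom c \<and> k * norm (chart_map c p' - chart_map c p) \<le> d p p'"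
    if p: "p \<in> chart_dom c" "dist x0 (chart_map c p) < r/2" "d p p' < k * (r/2)" for p p'
  proof -
    have in_chart: "p' \<in> chart_dom c \<and> k * norm (chart_map c p' - chart_map c p) \<le> integral {0..1} (speed A R y)"
      if y: "ac_curve A 0 1 y" "y 0 = p" "y 1 = p'" "integral {0..1} (speed A R y) < k * (r/2)" for y
    proof -
      have sub: "y ` {0..1} \<subseteq> {q \<in> chart_dom c. chart_map c q \<in> ball x0 r}"
      proof (rule ccontr)
        assume "\<not> ?thesis"
        then have "k * (r - dist x0 (chart_map c (y 0))) \<le> integral {0..1} (speed A R y)"
          using rk p y by (intro curve_exit_length[OF y(1) _ c rk(2,4)]) auto
        moreover have "k * (r/2) \<le> k * (r - dist x0 (chart_map c (y 0)))"
          using rk p y by (intro mult_left_mono) auto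
        ultimately show False using y(4) by simp
      qed
      have "k * norm (chart_map c (y 1) - chart_map c (y 0)) \<le> integral {0..1} (speed A R y)"
      proof (rule seminorm_le_length[OF y(1) zero_le_one c, where C = k])
        show "y ` {0..1} \<subseteq> chart_dom c" using sub by auto
        show "k * norm w \<le> local_norm c (chart_map c (y s)) w" if "s \<in> {0..1}" for s w
        proof -
          have "y s \<in> {q \<in> chart_dom c. chart_map c q \<in> ball x0 r}" using sub that by (meson image_subset_iff)
          then show ?thesis using rk(5) by auto
        qed
        show "k * norm (w + z) \<le> k * norm w + k * norm z" for w z :: 'e
          using rk(2) norm_triangle_ineq[of w z] by (metis distrib_left mult_le_cancel_left_pos)
      qed (use rk in auto)
      moreover have "p' \<in> chart_dom c" using sub y(3) by force
      ultimately show ?thesis using y by simp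
    qed
    show ?thesis
    proof
      obtain y where "ac_curve A 0 1 y" "y 0 = p" "y 1 = p'" "integral {0..1} (speed A R y) < k * (r/2)"
        by (rule d_less_curve[OF p(3)])
      then show "p' \<in> chart_dom c" using in_chart by blast
      show "k * norm (chart_map c p' - chart_map c p) \<le> d p p'"
      proof (rule dense_ge_bounded[OF p(3)])
        fix e assume e: "d p p' < e" "e < k * (r/2)"
        obtain y where "ac_curve A 0 1 y" "y 0 = p" "y 1 = p'" "integral {0..1} (speed A R y) < e"
          by (rule d_less_curve[OF e(1)])
        then show "k * norm (chart_map c p' - chart_map c p) \<le> e" using in_chart[of y] e(2) by auto
      qed
    qed
  qed
  show ?thesis by (rule that[of "r/2" k]) (use rk main in auto)
qed

text \<open>The sharp infinitesimal form of the lower bound. The factor \<theta> can be taken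
  arbitrarily close to 1, which later bounds the speed by the metric density without losing a
  constant.\<close>

lemma d_lower_norm:
  assumes c: "c \<in> A" and p: "p \<in> chart_dom c" and \<theta>: "0 < \<theta>" "\<theta> < 1"
  obtains \<rho> where "\<rho> > 0"
    "\<forall>p'. d p p' < \<rho> \<longrightarrow> p' \<in> chart_dom c \<and>
      \<theta> * local_norm c (chart_map c p) (chart_map c p' - chart_map c p) \<le> d p p'"
proof -
  let ?x0 = "chart_map c p"
  have x0: "?x0 \<in> chart_img c" by (rule map_mem[OF c p])
  obtain k K where kK: "k > 0" "K > 0" "\<forall>w. k * norm w \<le> local_norm c ?x0 w \<and> local_norm c ?x0 w \<le> K * norm w"
    by (rule local_norm_equiv_at[OF c x0])
  \<comment> \<open>A variation of the norm by \<open>(1 - \<theta>) * k * norm w\<close> is at most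
    the fraction \<open>1 - \<theta>\<close> of the norm at \<open>p\<close>, so at least the
    fraction \<theta> of it survives on the ball.\<close>
  have "(1 - \<theta>) * k > 0" using kK \<theta> by simp
  then obtain r where r: "r > 0" "cball ?x0 r \<subseteq> chart_img c"
    "\<forall>x\<in>cball ?x0 r. \<forall>w. \<bar>local_norm c x w - local_norm c ?x0 w\<bar> \<le> ((1 - \<theta>) * k) * norm w"
    by (rule local_norm_near[OF c x0])
  have low: "\<theta> * local_norm c ?x0 w \<le> local_norm c x w" if "x \<in> cball ?x0 r" for x w
  proof -
    have "\<bar>local_norm c x w - local_norm c ?x0 w\<bar> \<le> (1 - \<theta>) * k * norm w" using r(3) that by blast
    also have "\<dots> \<le> (1 - \<theta>) * local_norm c ?x0 w" using kK(3) \<theta> by (simp add: mult.assoc mult_left_mono)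
    finally show ?thesis by (simp add: algebra_simps abs_le_iff)
  qed
  define k' where "k' = \<theta> * k"
  have k': "k' > 0" using \<theta> kK by (simp add: k'_def)
  have low': "\<forall>x\<in>cball ?x0 r. \<forall>w. k' * norm w \<le> local_norm c x w"
  proof (intro ballI allI)
    fix x w assume "x \<in> cball ?x0 r"
    then have "\<theta> * local_norm c ?x0 w \<le> local_norm c x w" by (rule low)
    moreover have "\<theta> * (k * norm w) \<le> \<theta> * local_norm c ?x0 w" using kK(3) \<theta> by (intro mult_left_mono) auto
    ultimately show "k' * norm w \<le> local_norm c x w" by (simp add: k'_def mult.assoc)
  qed
  have in_chart: "p' \<in> chart_dom c \<and> \<theta> * local_norm c ?x0 (chart_map c p' - ?x0) \<le> integral {0..1} (speed A R y)"
    if y: "ac_curve A 0 1 y" "y 0 = p" "y 1 = p'" "integral {0..1} (speed A R y) < k' * r" for y p'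
  proof -
    have sub: "y ` {0..1} \<subseteq> {q \<in> chart_dom c. chart_map c q \<in> ball ?x0 r}"
    proof (rule ccontr)
      assume "\<not> ?thesis"
      then have "k' * (r - dist ?x0 (chart_map c (y 0))) \<le> integral {0..1} (speed A R y)"
        using r p y by (intro curve_exit_length[OF y(1) _ c k' r(2) low']) auto
      then show False using y by simp
    qed
    have "\<theta> * local_norm c ?x0 (chart_map c (y 1) - chart_map c (y 0)) \<le> integral {0..1} (speed A R y)"
    proof (rule seminorm_le_length[OF y(1) zero_le_one c, where C = "\<theta> * K"])
      show "y ` {0..1} \<subseteq> chart_dom c" using sub by auto
      show "\<theta> * local_norm c ?x0 w \<le> local_norm c (chart_map c (y s)) w" if "s \<in> {0..1}" for s w
      proof (rule low)
        have "y s \<in> {q \<in> chart_dom c. chart_map c q \<in> ball ?x0 r}" using sub that by (meson image_subset_iff)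
        then show "chart_map c (y s) \<in> cball ?x0 r" by auto
      qed
      show "\<theta> * local_norm c ?x0 (w + z) \<le> \<theta> * local_norm c ?x0 w + \<theta> * local_norm c ?x0 z" for w z
        using \<theta> local_norm_triangle[OF c x0, of w z] by (metis distrib_left mult_le_cancel_left_pos)
      show "\<theta> * local_norm c ?x0 w \<le> \<theta> * K * norm w" for w
        using \<theta> kK(3) by (simp add: mult.assoc mult_left_mono)
    qed (use \<theta> kK in \<open>auto simp: local_norm_scale[OF c x0]\<close>)
    moreover have "p' \<in> chart_dom c" using sub y(3) by force
    ultimately show ?thesis using y by simp
  qed
  show ?thesis
  proof (rule that[of "k' * r"])
    show "k' * r > 0" using k' r by simp
    show "\<forall>p'. d p p' < k' * r \<longrightarrow> p' \<in> chart_dom c \<and> \<theta> * local_norm c ?x0 (chart_map c p' - ?x0) \<le> d p p'"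
    proof (intro allI impI conjI)
    fix p' assume p': "d p p' < k' * r"
    obtain y where "ac_curve A 0 1 y" "y 0 = p" "y 1 = p'" "integral {0..1} (speed A R y) < k' * r"
      by (rule d_less_curve[OF p'])
    then show "p' \<in> chart_dom c" using in_chart by blast
    show "\<theta> * local_norm c ?x0 (chart_map c p' - ?x0) \<le> d p p'"
    proof (rule dense_ge_bounded[OF p'])
      fix e assume e: "d p p' < e" "e < k' * r"
      obtain y where "ac_curve A 0 1 y" "y 0 = p" "y 1 = p'" "integral {0..1} (speed A R y) < e"
        by (rule d_less_curve[OF e(1)])
      then show "\<theta> * local_norm c ?x0 (chart_map c p' - ?x0) \<le> e" using in_chart[of y] e(2) by fastforce
    qed
    qed
  qed
qed

text \<open>The straight segment in the chart joins the two points, and it stays in a ball where the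
  norms have a common upper constant.\<close>

lemma d_upper_local:
  assumes c: "c \<in> A" and p: "p \<in> chart_dom c"
  obtains r K where "r > 0" "K > 0" "cball (chart_map c p) r \<subseteq> chart_img c"
    "\<forall>p'\<in>chart_dom c. dist (chart_map c p) (chart_map c p') \<le> r \<longrightarrow> d p p' \<le> K * norm (chart_map c p' - chart_map c p)"
proof -
  let ?x0 = "chart_map c p"
  obtain r k K where rk: "r > 0" "k > 0" "K > 0" "cball ?x0 r \<subseteq> chart_img c"
    "\<forall>x\<in>cball ?x0 r. \<forall>w. k * norm w \<le> local_norm c x w \<and> local_norm c x w \<le> K * norm w"
    by (rule local_norm_equiv[OF c map_mem[OF c p]])
  show ?thesis
  proof (rule that[OF rk(1,3,4)], intro ballI impI)
    fix p' assume p': "p' \<in> chart_dom c" "dist ?x0 (chart_map c p') \<le> r"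
    define w where "w = chart_map c p' - ?x0"
    have nw: "norm w \<le> r" using p'(2) by (simp add: w_def dist_norm norm_minus_commute)
    have seg: "?x0 + s *\<^sub>R w \<in> cball ?x0 r" if "s \<in> {0..1}" for s
    proof -
      have "norm (s *\<^sub>R w) \<le> 1 * norm w" using that by (simp add: mult_left_le_one_le)
      then show ?thesis using nw by (simp add: dist_norm)
    qed
    have 1: "?x0 + s *\<^sub>R w \<in> chart_img c" if "s \<in> {0..1}" for s using seg[OF that] rk(4) by blast
    have 2: "local_norm c (?x0 + s *\<^sub>R w) w \<le> K * norm w" if "s \<in> {0..1}" for s using seg[OF that] rk(5) by blast
    have "d (chart_inv c (?x0 + 0 *\<^sub>R w)) (chart_inv c (?x0 + 1 *\<^sub>R w)) \<le> K * norm w"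
      using d_le_length[OF segment_curve(1)[OF c 1 2] zero_le_one] segment_curve(2)[OF c 1 2] by simp
    then show "d p p' \<le> K * norm (chart_map c p' - ?x0)"
      using inv_map[OF c p] inv_map[OF c p'(1)] by (simp add: w_def)
  qed
qed

lemma d_eq_0: "d x y = 0 \<longleftrightarrow> x = y"
proof
  assume 0: "d x y = 0"
  obtain c where c: "c \<in> A" "x \<in> chart_dom c" by (rule chart_cover)
  obtain r k where rk: "r > 0" "k > 0"
    "\<forall>p p'. p \<in> chart_dom c \<longrightarrow> dist (chart_map c x) (chart_map c p) < r \<longrightarrow> d p p' < k * r \<longrightarrow>
      p' \<in> chart_dom c \<and> k * norm (chart_map c p' - chart_map c p) \<le> d p p'"
    by (rule d_lower_local[OF c(1) map_mem[OF c]])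
  then have "y \<in> chart_dom c \<and> k * norm (chart_map c y - chart_map c x) \<le> 0"
    using c 0 by (metis dist_self mult_pos_pos)
  then have "y \<in> chart_dom c" "chart_map c y = chart_map c x" using rk(2) by (auto simp: mult_le_0_iff)
  then show "x = y" using inv_map[OF c(1)] c(2) by metis
qed (simp add: d_refl)

sublocale Metric_space UNIV d
  by unfold_locales (auto simp: d_nonneg d_sym d_eq_0 d_triangle)

text \<open>The lower bound for \<open>d\<close> shows that small metric balls lie in a given open
  set, the upper bound that chart balls lie in metric balls. Completeness with respect to
  \<open>d\<close> thereby becomes a statement about convergence in the manifold.\<close>

lemma open_iff_d: "open S \<longleftrightarrow> (\<forall>x\<in>S. \<exists>e>0. \<forall>y. d x y < e \<longrightarrow> y \<in> S)"
proof
  assume S: "open S"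
  show "\<forall>x\<in>S. \<exists>e>0. \<forall>y. d x y < e \<longrightarrow> y \<in> S"
  proof
    fix x assume x: "x \<in> S"
    obtain c where c: "c \<in> A" "x \<in> chart_dom c" by (rule chart_cover)
    have xi: "chart_map c x \<in> chart_img c" by (rule map_mem[OF c])
    obtain r k where rk: "r > 0" "k > 0"
      "\<forall>p p'. p \<in> chart_dom c \<longrightarrow> dist (chart_map c x) (chart_map c p) < r \<longrightarrow> d p p' < k * r \<longrightarrow>
        p' \<in> chart_dom c \<and> k * norm (chart_map c p' - chart_map c p) \<le> d p p'"
      by (rule d_lower_local[OF c(1) xi])
    have "\<forall>\<^sub>F z in nhds (chart_map c x). z \<in> chart_img c \<and> chart_inv c z \<in> S"
      by (rule eventually_inv_in[OF c(1) xi S]) (simp add: inv_map[OF c] x)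
    then obtain \<rho> where \<rho>: "\<rho> > 0" "\<And>z. dist z (chart_map c x) < \<rho> \<Longrightarrow> chart_inv c z \<in> S"
      unfolding eventually_nhds_metric by blast
    show "\<exists>e>0. \<forall>y. d x y < e \<longrightarrow> y \<in> S"
    proof (intro exI[of _ "min (k * r) (k * \<rho>)"] conjI allI impI)
      show "0 < min (k * r) (k * \<rho>)" using rk \<rho> by simp
      fix y assume y: "d x y < min (k * r) (k * \<rho>)"
      then have yd: "y \<in> chart_dom c" "k * norm (chart_map c y - chart_map c x) \<le> d x y" using rk c by auto
      then have "k * norm (chart_map c y - chart_map c x) < k * \<rho>" using y by simp
      then have "chart_inv c (chart_map c y) \<in> S" using rk(2) by (intro \<rho>(2)) (simp add: dist_norm)
      then show "y \<in> S" using inv_map[OF c(1) yd(1)] by simp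
    qed
  qed
next
  assume S: "\<forall>x\<in>S. \<exists>e>0. \<forall>y. d x y < e \<longrightarrow> y \<in> S"
  show "open S"
  proof (subst open_subopen, rule ballI)
    fix x assume "x \<in> S"
    then obtain e where e: "e > 0" "\<And>y. d x y < e \<Longrightarrow> y \<in> S" using S by blast
    obtain c where c: "c \<in> A" "x \<in> chart_dom c" by (rule chart_cover)
    obtain r K where rK: "r > 0" "K > 0" "cball (chart_map c x) r \<subseteq> chart_img c"
      "\<forall>p'\<in>chart_dom c. dist (chart_map c x) (chart_map c p') \<le> r \<longrightarrow> d x p' \<le> K * norm (chart_map c p' - chart_map c x)"
      by (rule d_upper_local[OF c])
    let ?T = "{q \<in> chart_dom c. chart_map c q \<in> ball (chart_map c x) (min r (e / K))}"
    have "?T \<subseteq> S"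
    proof
      fix q assume q: "q \<in> ?T"
      then have "d x q \<le> K * norm (chart_map c q - chart_map c x)" using rK(4) by auto
      also have "\<dots> < e" using q rK(2) by (simp add: dist_norm norm_minus_commute pos_less_divide_eq mult.commute)
      finally show "q \<in> S" by (rule e(2))
    qed
    moreover have "open ?T" by (rule open_chart_preimage[OF c(1) open_ball])
    moreover have "x \<in> ?T" using c rK e by simp
    ultimately show "\<exists>T. open T \<and> x \<in> T \<and> T \<subseteq> S" by blast
  qed
qed

lemma tendsto_iff_d: "(f \<longlongrightarrow> x) F \<longleftrightarrow> ((\<lambda>i. d (f i) x) \<longlongrightarrow> 0) F"
proof
  assume f: "(f \<longlongrightarrow> x) F"
  show "((\<lambda>i. d (f i) x) \<longlongrightarrow> 0) F"
  proof (rule tendstoI)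
    fix e :: real assume e: "e > 0"
    have "open {y. d x y < e}"
      unfolding open_iff_d
    proof safe
      fix y assume y: "d x y < e"
      show "\<exists>e'>0. \<forall>z. d y z < e' \<longrightarrow> z \<in> {y. d x y < e}"
      proof (intro exI[of _ "e - d x y"] conjI allI impI)
        fix z assume "d y z < e - d x y"
        then show "z \<in> {y. d x y < e}" using d_triangle[of x z y] by simp
      qed (use y in simp)
    qed
    then have "\<forall>\<^sub>F i in F. f i \<in> {y. d x y < e}" using f e by (intro topological_tendstoD) (auto simp: d_refl)
    then show "\<forall>\<^sub>F i in F. dist (d (f i) x) 0 < e" by eventually_elim (simp add: d_nonneg d_sym)
  qed
next
  assume f: "((\<lambda>i. d (f i) x) \<longlongrightarrow> 0) F"
  show "(f \<longlongrightarrow> x) F"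
  proof (rule topological_tendstoI)
    fix S assume "open S" "x \<in> S"
    then obtain e where e: "e > 0" "\<And>y. d x y < e \<Longrightarrow> y \<in> S" unfolding open_iff_d by blast
    have "\<forall>\<^sub>F i in F. dist (d (f i) x) 0 < e" using f e(1) by (rule tendstoD)
    then show "\<forall>\<^sub>F i in F. f i \<in> S" by eventually_elim (use e(2) in \<open>simp add: d_nonneg d_sym\<close>)
  qed
qed

end

section \<open>Compactness of equicontinuous curves\<close>

context Metric_space
begin

text \<open>Centres of the given net may lie outside \<open>S\<close>; moving each useful centre
  into \<open>S\<close> doubles the radius.\<close>

lemma mtotally_boundedI:
  assumes "S \<subseteq> M" and net: "\<And>e. e > 0 \<Longrightarrow> \<exists>K. finite K \<and> S \<subseteq> (\<Union>x\<in>K. mball x e)"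
  shows "mtotally_bounded S"
  unfolding mtotally_bounded_def
proof (intro allI impI)
  fix e :: real assume e: "e > 0"
  then obtain K where K: "finite K" "S \<subseteq> (\<Union>x\<in>K. mball x (e/2))" using net[of "e/2"] by auto
  define p where "p x = (SOME y. y \<in> S \<inter> mball x (e/2))" for x
  have p: "p x \<in> S \<inter> mball x (e/2)" if "S \<inter> mball x (e/2) \<noteq> {}" for x
  proof -
    have "\<exists>y. y \<in> S \<inter> mball x (e/2)" using that by blast
    then show ?thesis unfolding p_def by (rule someI_ex)
  qed
  let ?K = "p ` {x\<in>K. S \<inter> mball x (e/2) \<noteq> {}}"
  show "\<exists>K. finite K \<and> K \<subseteq> S \<and> S \<subseteq> (\<Union>x\<in>K. mball x e)"
  proof (intro exI[of _ ?K] conjI subsetI)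
    fix y assume y: "y \<in> S"
    then obtain x where x: "x \<in> K" "y \<in> mball x (e/2)" using K(2) by auto
    then have ne: "S \<inter> mball x (e/2) \<noteq> {}" using y by blast
    have px: "p x \<in> S" "p x \<in> mball x (e/2)" using p[OF ne] by auto
    have "d (p x) y \<le> d (p x) x + d x y" using px x y by (intro triangle) auto
    moreover have "d (p x) x < e/2" "d x y < e/2" using px(2) x(2) by (simp_all add: commute[of "p x" x])
    ultimately have "d (p x) y < e" by linarith
    then have "y \<in> mball (p x) e" using px x by auto
    then show "y \<in> (\<Union>x\<in>?K. mball x e)" using x(1) ne by blast
  qed (use K(1) p in auto)
qed

text \<open>The Arzela-Ascoli argument with equicontinuity required only for large indices, as weak
  convergence provides it. A diagonal sequence is Cauchy at the points of a countable dense set, and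
  equicontinuity makes it uniformly Cauchy, with \<open>e / 3\<close> for each of the three
  distances.\<close>

lemma equicontinuous_subsequence:
  fixes f :: "nat \<Rightarrow> real \<Rightarrow> 'a"
  assumes comp: mcomplete and ab: "a \<le> b"
    and tb: "\<And>s. s \<in> {a..b} \<Longrightarrow> mtotally_bounded (range (\<lambda>n. f n s))"
    and equi: "\<And>e. e > 0 \<Longrightarrow> \<exists>\<delta>>0. \<forall>\<^sub>F n in sequentially. \<forall>s\<in>{a..b}. \<forall>s'\<in>{a..b}. \<bar>s - s'\<bar> < \<delta> \<longrightarrow> d (f n s) (f n s') < e"
  obtains r g where "strict_mono r" "\<forall>s\<in>{a..b}. g s \<in> M"
    "\<forall>e>0. \<forall>\<^sub>F n in sequentially. \<forall>s\<in>{a..b}. d (f (r n) s) (g s) < e"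
proof -
  have fM: "f n s \<in> M" if "s \<in> {a..b}" for n s
    using mtotally_bounded_imp_subset[OF tb[OF that]] by auto
  \<comment> \<open>Each grid is finite, so one index serves all its points; the union over all mesh
    sizes is countable. \<open>Suc K\<close> avoids a division by zero.\<close>
  define grid where "grid K = (\<lambda>i. a + (b - a) * real i / real (Suc K)) ` {..Suc K}" for K
  have gsub: "grid K \<subseteq> {a..b}" for K
  proof -
    have 1: "(b - a) * real i / real (Suc K) \<le> b - a" if "i \<le> Suc K" for i
    proof -
      have "(b - a) * real i \<le> (b - a) * real (Suc K)" using ab that by (intro mult_left_mono) auto
      then show ?thesis by (simp add: pos_divide_le_eq del: of_nat_Suc)
    qed
    have 2: "0 \<le> (b - a) * real i / real (Suc K)" for i using ab by simp
    show ?thesis unfolding grid_def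
    proof (rule image_subsetI)
      fix i assume "i \<in> {..Suc K}"
      then show "a + (b - a) * real i / real (Suc K) \<in> {a..b}" using 1[of i] 2[of i] by (simp del: of_nat_Suc)
    qed
  qed
  have gdense: "\<exists>t\<in>grid K. \<bar>s - t\<bar> < \<delta>" if s: "s \<in> {a..b}" and K: "(b - a) / real (Suc K) < \<delta>" and d: "\<delta> > 0" for s K \<delta>
  proof (cases "a = b")
    case True
    then have "a \<in> grid K" unfolding grid_def by (intro image_eqI[of _ _ 0]) auto
    then show ?thesis using s True d by (intro bexI[of _ a]) auto
  next
    case False
    then have ba: "b - a > 0" using ab by simp
    define x where "x = (s - a) * real (Suc K) / (b - a)"
    have x: "0 \<le> x" "x \<le> real (Suc K)" using s ba by (auto simp: x_def divide_le_eq mult_right_mono)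
    define i where "i = nat \<lfloor>x\<rfloor>"
    have i: "real i \<le> x" "x < real i + 1" using x(1) unfolding i_def by linarith+
    have "i \<le> Suc K" using i x by linarith
    then have mem: "a + (b - a) * real i / real (Suc K) \<in> grid K" unfolding grid_def by blast
    have s_eq: "s = a + (b - a) * x / real (Suc K)" using ba by (simp add: x_def del: of_nat_Suc)
    have "s - (a + (b - a) * real i / real (Suc K)) = (b - a) / real (Suc K) * (x - real i)"
      by (subst s_eq) (simp add: algebra_simps diff_divide_distrib del: of_nat_Suc)
    moreover have "\<bar>(b - a) / real (Suc K) * (x - real i)\<bar> \<le> (b - a) / real (Suc K) * 1"
      unfolding abs_mult using ba i by (intro mult_mono) auto
    ultimately show ?thesis using K mem by (intro bexI[of _ "a + (b - a) * real i / real (Suc K)"]) auto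
  qed
  define D where "D = (\<Union>K. grid K)"
  have Dc: "countable D" unfolding D_def grid_def by auto
  have Dne: "D \<noteq> {}" unfolding D_def grid_def by auto
  have Dsub: "D \<subseteq> {a..b}" unfolding D_def using gsub by auto
  let ?t = "from_nat_into D"
  have t: "?t n \<in> {a..b}" for n using from_nat_into[OF Dne, of n] Dsub by blast
  define P where "P n s \<longleftrightarrow> MCauchy (\<lambda>i. f (s i) (?t n))" for n :: nat and s :: "nat \<Rightarrow> nat"
  interpret sub: subseqs P
  proof
    fix n :: nat and s :: "nat \<Rightarrow> nat"
    have "range (\<lambda>i. f (s i) (?t n)) \<subseteq> range (\<lambda>i. f i (?t n))" by auto
    then have "\<exists>r :: nat \<Rightarrow> nat. strict_mono r \<and> MCauchy ((\<lambda>i. f (s i) (?t n)) \<circ> r)"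
      using tb[OF t[of n]] unfolding mtotally_bounded_sequentially by blast
    then show "\<exists>r'. strict_mono r' \<and> P n (s \<circ> r')" unfolding P_def by (simp add: o_def)
  qed
  define r where "r = sub.diagseq"
  have r: "strict_mono r" unfolding r_def by (rule sub.subseq_diagseq)
  have cauchy_D: "\<exists>N. \<forall>n n'. N \<le> n \<longrightarrow> N \<le> n' \<longrightarrow> d (f (r n) t) (f (r n') t) < e" if tD: "t \<in> D" and e: "e > 0" for t e
  proof -
    obtain k where k: "t = ?t k" using from_nat_into_surj[OF Dc tD] by metis
    \<comment> \<open>The diagonal sequence is a subsequence of the one selected at stage
      \<open>k\<close> only from the index \<open>Suc k\<close> on.\<close>
    have "P k (r \<circ> ((+) (Suc k)))"
      unfolding r_def
    proof (rule sub.diagseq_holds)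
      fix s r' :: "nat \<Rightarrow> nat" and n assume "strict_mono r'" "P n s"
      then show "P n (s \<circ> r')" unfolding P_def using MCauchy_subsequence[of r' "\<lambda>i. f (s i) (?t n)"] by (simp add: o_def)
    qed
    then obtain N where N: "\<And>n n'. N \<le> n \<Longrightarrow> N \<le> n' \<Longrightarrow> d (f (r (Suc k + n)) t) (f (r (Suc k + n')) t) < e"
      using e unfolding P_def MCauchy_def k by fastforce
    show ?thesis
    proof (intro exI[of _ "Suc k + N"] allI impI)
      fix n n' assume "Suc k + N \<le> n" "Suc k + N \<le> n'"
      then show "d (f (r n) t) (f (r n') t) < e" using N[of "n - Suc k" "n' - Suc k"] by simp
    qed
  qed
  have ucauchy: "\<exists>N. \<forall>n n'. N \<le> n \<longrightarrow> N \<le> n' \<longrightarrow> (\<forall>s\<in>{a..b}. d (f (r n) s) (f (r n') s) < e)" if e: "e > 0" for e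
  proof -
    obtain \<delta> where \<delta>: "\<delta> > 0" "\<forall>\<^sub>F n in sequentially. \<forall>s\<in>{a..b}. \<forall>s'\<in>{a..b}. \<bar>s - s'\<bar> < \<delta> \<longrightarrow> d (f n s) (f n s') < e/3"
      using equi[of "e/3"] e by auto
    obtain N1 where N1: "\<And>n. n \<ge> N1 \<Longrightarrow> \<forall>s\<in>{a..b}. \<forall>s'\<in>{a..b}. \<bar>s - s'\<bar> < \<delta> \<longrightarrow> d (f n s) (f n s') < e/3"
      using \<delta>(2) unfolding eventually_sequentially by blast
    obtain K where "(b - a) / \<delta> < real K" using reals_Archimedean2 by blast
    then have K: "(b - a) / real (Suc K) < \<delta>" using \<delta>(1) by (simp add: field_simps)
    have "\<forall>t\<in>grid K. \<exists>N. \<forall>n n'. N \<le> n \<longrightarrow> N \<le> n' \<longrightarrow> d (f (r n) t) (f (r n') t) < e/3"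
      using cauchy_D e unfolding D_def by (metis UN_I UNIV_I divide_pos_pos zero_less_numeral)
    then obtain N where N: "\<And>t n n'. t \<in> grid K \<Longrightarrow> N t \<le> n \<Longrightarrow> N t \<le> n' \<Longrightarrow> d (f (r n) t) (f (r n') t) < e/3"
      by metis
    have fin: "finite (insert N1 (N ` grid K))" by (simp add: grid_def)
    show ?thesis
    proof (intro exI[of _ "Max (insert N1 (N ` grid K))"] allI impI ballI)
      fix n n' s assume n: "Max (insert N1 (N ` grid K)) \<le> n" "Max (insert N1 (N ` grid K)) \<le> n'" and s: "s \<in> {a..b}"
      obtain t where t: "t \<in> grid K" "\<bar>s - t\<bar> < \<delta>" using gdense[OF s K \<delta>(1)] by blast
      have tab: "t \<in> {a..b}" using gsub t by blast
      have "N1 \<le> n" "N1 \<le> n'" "N t \<le> n" "N t \<le> n'" using n fin t by auto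
      then have "N1 \<le> r n" "N1 \<le> r n'" using seq_suble[OF r] by (meson order.trans)+
      then have 1: "d (f (r n) s) (f (r n) t) < e/3" "d (f (r n') s) (f (r n') t) < e/3" using N1 s tab t by blast+
      have 2: "d (f (r n) t) (f (r n') t) < e/3" by (rule N[OF t(1)]) fact+
      have "d (f (r n) s) (f (r n') s) \<le> d (f (r n) s) (f (r n) t) + d (f (r n) t) (f (r n') s)"
        using fM s tab by (intro triangle) auto
      moreover have "d (f (r n) t) (f (r n') s) \<le> d (f (r n) t) (f (r n') t) + d (f (r n') t) (f (r n') s)"
        using fM s tab by (intro triangle) auto
      ultimately show "d (f (r n) s) (f (r n') s) < e" using 1 2 commute[of "f (r n') s" "f (r n') t"] by simp
    qed
  qed
  have "\<exists>l. limitin mtopology (\<lambda>n. f (r n) s) l sequentially" if s: "s \<in> {a..b}" for s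
  proof -
    have "MCauchy (\<lambda>n. f (r n) s)" unfolding MCauchy_def using ucauchy s fM by blast
    then show ?thesis using comp unfolding mcomplete_def by blast
  qed
  then obtain g where g: "\<And>s. s \<in> {a..b} \<Longrightarrow> limitin mtopology (\<lambda>n. f (r n) s) (g s) sequentially" by metis
  show ?thesis
  proof (rule that[OF r])
    show gM: "\<forall>s\<in>{a..b}. g s \<in> M" using g limitin_mspace by blast
    show "\<forall>e>0. \<forall>\<^sub>F n in sequentially. \<forall>s\<in>{a..b}. d (f (r n) s) (g s) < e"
    proof (intro allI impI)
      fix e :: real assume e: "e > 0"
      obtain N where N: "\<And>n n' s. N \<le> n \<Longrightarrow> N \<le> n' \<Longrightarrow> s \<in> {a..b} \<Longrightarrow> d (f (r n) s) (f (r n') s) < e/2"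
        using ucauchy[of "e/2"] e by (meson half_gt_zero)
      have "d (f (r n) s) (g s) < e" if n: "n \<ge> N" and s: "s \<in> {a..b}" for n s
      proof -
        have "\<forall>\<^sub>F n' in sequentially. f (r n') s \<in> M \<and> d (f (r n') s) (g s) < e/2"
          using g[OF s] half_gt_zero[OF e] unfolding limitin_metric by blast
        then obtain N' where N': "\<And>n'. n' \<ge> N' \<Longrightarrow> d (f (r n') s) (g s) < e/2" unfolding eventually_sequentially by blast
        have "d (f (r n) s) (g s) \<le> d (f (r n) s) (f (r (max N N')) s) + d (f (r (max N N')) s) (g s)"
          using fM s gM by (intro triangle) auto
        then show ?thesis using N[OF n _ s, of "max N N'"] N'[of "max N N'"] by simp
      qed
      then show "\<forall>\<^sub>F n in sequentially. \<forall>s\<in>{a..b}. d (f (r n) s) (g s) < e" unfolding eventually_sequentially by blast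
    qed
  qed
qed

end

context finsler_space
begin

section \<open>Total boundedness of families of curves\<close>

lemma mtopology_openin: "openin mtopology S \<longleftrightarrow> open S"
  unfolding openin_mtopology open_iff_d by (auto simp: subset_iff)

lemma mtopology_euclidean: "mtopology = euclidean"
  by (simp add: topology_eq mtopology_openin)

lemma compact_mtotally_bounded: "compact K \<Longrightarrow> mtotally_bounded K"
  by (rule compactin_imp_mtotally_bounded) (simp add: mtopology_euclidean)

lemma locally_mtotally_bounded: "\<exists>r>0. mtotally_bounded (mball x r)"
proof -
  obtain c where c: "c \<in> A" "x \<in> chart_dom c" by (rule chart_cover)
  have xi: "chart_map c x \<in> chart_img c" by (rule map_mem[OF c])
  obtain \<rho> where \<rho>: "\<rho> > 0" "cball (chart_map c x) \<rho> \<subseteq> chart_img c" using open_img[OF c(1)] xi by (meson open_contains_cball)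
  obtain r k where rk: "r > 0" "k > 0"
    "\<forall>p p'. p \<in> chart_dom c \<longrightarrow> dist (chart_map c x) (chart_map c p) < r \<longrightarrow> d p p' < k * r \<longrightarrow>
      p' \<in> chart_dom c \<and> k * norm (chart_map c p' - chart_map c p) \<le> d p p'"
    by (rule d_lower_local[OF c(1) xi])
  have "mball x (min (k * r) (k * \<rho>)) \<subseteq> chart_inv c ` cball (chart_map c x) \<rho>"
  proof
    fix y assume y: "y \<in> mball x (min (k * r) (k * \<rho>))"
    then have yd: "y \<in> chart_dom c" "k * norm (chart_map c y - chart_map c x) \<le> d x y" using rk c by auto
    then have "k * norm (chart_map c y - chart_map c x) \<le> k * \<rho>" using y by simp
    then have "chart_map c y \<in> cball (chart_map c x) \<rho>" using rk(2) by (simp add: dist_norm norm_minus_commute)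
    then show "y \<in> chart_inv c ` cball (chart_map c x) \<rho>" using inv_map[OF c(1) yd(1)] by (metis image_eqI)
  qed
  moreover have "compact (chart_inv c ` cball (chart_map c x) \<rho>)"
    by (rule compact_continuous_image[OF continuous_on_subset[OF cont_inv[OF c(1)] \<rho>(2)] compact_cball])
  ultimately have "mtotally_bounded (mball x (min (k * r) (k * \<rho>)))"
    using compact_mtotally_bounded mtotally_bounded_subset by blast
  then show ?thesis using rk \<rho> by (intro exI[of _ "min (k * r) (k * \<rho>)"]) auto
qed

lemma mtotally_bounded_neighbourhood:
  assumes comp: mcomplete and S: "mtotally_bounded S"
  obtains \<rho> where "\<rho> > 0" "mtotally_bounded {y. \<exists>z\<in>S. d z y < \<rho>}"
proof -
  obtain r where r: "\<And>x. r x > 0" "\<And>x. mtotally_bounded (mball x (r x))" using locally_mtotally_bounded by metis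
  have cpt: "compactin mtopology (mtopology closure_of S)"
    using S mtotally_bounded_eq_compact_closure_of[OF comp] by blast
  let ?U = "(\<lambda>x. mball x (r x / 2)) ` UNIV"
  have op: "openin mtopology U" if U: "U \<in> ?U" for U
  proof -
    obtain x where "U = mball x (r x / 2)" using U by blast
    then show ?thesis by simp
  qed
  have cov: "mtopology closure_of S \<subseteq> \<Union>?U"
  proof
    fix y
    have "y \<in> mball y (r y / 2)" using r(1)[of y] by simp
    then show "y \<in> \<Union>?U" by blast
  qed
  obtain \<F> where \<F>: "finite \<F>" "\<F> \<subseteq> ?U" "mtopology closure_of S \<subseteq> \<Union>\<F>"
    using compactinD[OF cpt op cov] by blast
  obtain F where F: "finite F" "\<F> = (\<lambda>x. mball x (r x / 2)) ` F"
    using finite_subset_image[OF \<F>(1,2)] by (elim exE conjE)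
  have SF: "S \<subseteq> (\<Union>x\<in>F. mball x (r x / 2))"
    using \<F>(3) F(2) closure_of_subset[of S mtopology] by auto
  \<comment> \<open>The inserted 1 keeps the minimum defined when \<open>F\<close> is empty.\<close>
  define \<rho> where "\<rho> = Min (insert 1 ((\<lambda>x. r x / 2) ` F))"
  have \<rho>: "\<rho> > 0" unfolding \<rho>_def using F(1) r(1) by (subst Min_gr_iff) auto
  have \<rho>le: "\<rho> \<le> r x / 2" if "x \<in> F" for x unfolding \<rho>_def using F(1) that by (intro Min_le) auto
  have "{y. \<exists>z\<in>S. d z y < \<rho>} \<subseteq> (\<Union>x\<in>F. mball x (r x))"
  proof
    fix y assume "y \<in> {y. \<exists>z\<in>S. d z y < \<rho>}"
    then obtain z where z: "z \<in> S" "d z y < \<rho>" by blast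
    then obtain x where x: "x \<in> F" "d x z < r x / 2" using SF by auto
    have "d x y < r x" using d_triangle[of x y z] z(2) x \<rho>le[OF x(1)] by simp
    then show "y \<in> (\<Union>x\<in>F. mball x (r x))" using x(1) by auto
  qed
  moreover have "mtotally_bounded (\<Union>x\<in>F. mball x (r x))" using F(1) r(2) by (intro mtotally_bounded_Union) auto
  ultimately show ?thesis using that[OF \<rho>] mtotally_bounded_subset by blast
qed

text \<open>The set of parameters with relatively compact orbit is open by local compactness and closed by
  completeness, so it spreads from \<open>a\<close> over the whole interval; no Hopf--Rinow theorem is needed.\<close>

lemma equicontinuous_mtotally_bounded:
  fixes f :: "nat \<Rightarrow> real \<Rightarrow> 'q"
  assumes comp: mcomplete
    and equi: "\<And>e. e > 0 \<Longrightarrow> \<exists>\<delta>>0. \<forall>\<^sub>F n in sequentially. \<forall>s\<in>{a..b}. \<forall>s'\<in>{a..b}. \<bar>s - s'\<bar> < \<delta> \<longrightarrow> d (f n s) (f n s') < e"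
    and start: "mtotally_bounded (range (\<lambda>n. f n a))" and s: "s \<in> {a..b}"
  shows "mtotally_bounded (range (\<lambda>n. f n s))"
proof -
  define Q where "Q s \<longleftrightarrow> mtotally_bounded (range (\<lambda>n. f n s))" for s
  have "a \<le> s" using s by simp
  \<comment> \<open>Implication between the endpoint values is transitive, so it can be patched;
    locally it holds because \<open>Q\<close> is constant near each parameter.\<close>
  then have "Q a \<longrightarrow> Q s"
  proof (induction rule: interval_patching)
    case (local x)
    then have x: "x \<in> {a..b}" using s by auto
    have "\<exists>\<delta>>0. \<forall>u\<in>{a..b}. \<bar>u - x\<bar> < \<delta> \<longrightarrow> Q u = Q x"
    proof (cases "Q x")
      case True
      obtain \<rho> where \<rho>: "\<rho> > 0" "mtotally_bounded {y. \<exists>z\<in>range (\<lambda>n. f n x). d z y < \<rho>}"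
        by (rule mtotally_bounded_neighbourhood[OF comp True[unfolded Q_def]])
      obtain \<delta> where \<delta>: "\<delta> > 0" "\<forall>\<^sub>F n in sequentially. \<forall>s\<in>{a..b}. \<forall>s'\<in>{a..b}. \<bar>s - s'\<bar> < \<delta> \<longrightarrow> d (f n s) (f n s') < \<rho>"
        using equi[OF \<rho>(1)] by blast
      obtain N where N: "\<And>n. n \<ge> N \<Longrightarrow> \<forall>s\<in>{a..b}. \<forall>s'\<in>{a..b}. \<bar>s - s'\<bar> < \<delta> \<longrightarrow> d (f n s) (f n s') < \<rho>"
        using \<delta>(2) unfolding eventually_sequentially by blast
      have "Q u" if u: "u \<in> {a..b}" "\<bar>u - x\<bar> < \<delta>" for u
      proof -
        \<comment> \<open>Equicontinuity starts at the index \<open>N\<close>; the earlier curves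
          contribute finitely many points.\<close>
        have "range (\<lambda>n. f n u) \<subseteq> (\<lambda>n. f n u) ` {..<N} \<union> {y. \<exists>z\<in>range (\<lambda>n. f n x). d z y < \<rho>}"
        proof
          fix y assume "y \<in> range (\<lambda>n. f n u)"
          then obtain n where n: "y = f n u" by blast
          show "y \<in> (\<lambda>n. f n u) ` {..<N} \<union> {y. \<exists>z\<in>range (\<lambda>n. f n x). d z y < \<rho>}"
          proof (cases "n < N")
            case False
            then have "d (f n x) (f n u) < \<rho>" using N[of n] x u by (auto simp: abs_minus_commute)
            then show ?thesis using n by blast
          qed (use n in auto)
        qed
        moreover have "mtotally_bounded ((\<lambda>n. f n u) ` {..<N} \<union> {y. \<exists>z\<in>range (\<lambda>n. f n x). d z y < \<rho>})"
          by (intro mtotally_bounded_Un[OF finite_imp_mtotally_bounded \<rho>(2)]) auto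
        ultimately show ?thesis unfolding Q_def using mtotally_bounded_subset by blast
      qed
      then show ?thesis using \<delta>(1) True by blast
    next
      case False
      have "\<exists>\<delta>>0. \<forall>u\<in>{a..b}. \<bar>u - x\<bar> < \<delta> \<longrightarrow> \<not> Q u"
      proof (rule ccontr)
        assume contr: "\<not> ?thesis"
        have "Q x"
          unfolding Q_def
        proof (rule mtotally_boundedI)
          fix e :: real assume e: "e > 0"
          obtain \<delta> where \<delta>: "\<delta> > 0" "\<forall>\<^sub>F n in sequentially. \<forall>s\<in>{a..b}. \<forall>s'\<in>{a..b}. \<bar>s - s'\<bar> < \<delta> \<longrightarrow> d (f n s) (f n s') < e/2"
            using equi[of "e/2"] e by auto
          obtain N where N: "\<And>n. n \<ge> N \<Longrightarrow> \<forall>s\<in>{a..b}. \<forall>s'\<in>{a..b}. \<bar>s - s'\<bar> < \<delta> \<longrightarrow> d (f n s) (f n s') < e/2"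
            using \<delta>(2) unfolding eventually_sequentially by blast
          obtain u where u: "u \<in> {a..b}" "\<bar>u - x\<bar> < \<delta>" "Q u" using contr \<delta>(1) by blast
          then obtain K where K: "finite K" "range (\<lambda>n. f n u) \<subseteq> (\<Union>z\<in>K. mball z (e/2))"
            using e unfolding Q_def mtotally_bounded_def by (meson half_gt_zero)
          show "\<exists>K. finite K \<and> range (\<lambda>n. f n x) \<subseteq> (\<Union>z\<in>K. mball z e)"
          proof (intro exI[of _ "K \<union> (\<lambda>n. f n x) ` {..<N}"] conjI subsetI)
            fix y assume "y \<in> range (\<lambda>n. f n x)"
            then obtain n where n: "y = f n x" by blast
            show "y \<in> (\<Union>z\<in>K \<union> (\<lambda>n. f n x) ` {..<N}. mball z e)"
            proof (cases "n < N")
              case True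
              moreover have "f n x \<in> mball (f n x) e" using e by simp
              ultimately show ?thesis using n by blast
            next
              case False
              then have 1: "d (f n u) (f n x) < e/2" using N[of n] x u by auto
              obtain z where z: "z \<in> K" "d z (f n u) < e/2" using subsetD[OF K(2), of "f n u"] by auto
              have "d z y < e" using d_triangle[of z "f n x" "f n u"] 1 z n by simp
              then show ?thesis using z(1) by auto
            qed
          qed (use K(1) in simp)
        qed simp
        then show False using False by simp
      qed
      then show ?thesis using False by blast
    qed
    then obtain \<delta> where \<delta>: "\<delta> > 0" "\<forall>u\<in>{a..b}. \<bar>u - x\<bar> < \<delta> \<longrightarrow> Q u = Q x" by blast
    show ?case
    proof (intro exI[of _ \<delta>] conjI \<delta>(1) allI impI)
      fix u v assume uv: "a \<le> u \<and> u \<le> x \<and> x \<le> v \<and> v \<le> s \<and> v - u < \<delta>" "Q u"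
      then have "u \<in> {a..b}" "v \<in> {a..b}" "\<bar>u - x\<bar> < \<delta>" "\<bar>v - x\<bar> < \<delta>" using s by auto
      then show "Q v" using \<delta>(2) uv(2) by blast
    qed
  qed blast
  then show ?thesis using start unfolding Q_def by blast
qed

section \<open>Curves whose distances are bounded by a density\<close>

text \<open>Recovers chart calculus from purely metric information, the only kind that survives
  uniform convergence. The crude lower bound for \<open>d\<close> gives absolute continuity in
  charts; the sharp one, divided by a small time step, bounds the derivative where both the curve
  and the primitive of \<open>m\<close> are differentiable.\<close>

lemma
  fixes q :: "real \<Rightarrow> 'q"
  assumes m: "m absolutely_integrable_on {a..b}" and ab: "a \<le> b"
    and le: "\<And>u v. a \<le> u \<Longrightarrow> u \<le> v \<Longrightarrow> v \<le> b \<Longrightarrow> d (q u) (q v) \<le> integral {u..v} m"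
  shows ac_curve_of_dist: "ac_curve A a b q"
    and speed_le_of_dist: "\<exists>N. negligible N \<and> (\<forall>s\<in>{a<..<b} - N. speed A R q s \<le> m s)"
proof -
  define F where "F t = integral {a..t} m" for t
  have mi: "m integrable_on {a..b}" using m by (rule set_lebesgue_integral_eq_integral(1))
  have mi': "m integrable_on {u..v}" if "a \<le> u" "v \<le> b" for u v
    using integrable_on_subinterval[OF mi] that by auto
  have FI: "integral {u..v} m = F v - F u" if "a \<le> u" "u \<le> v" "v \<le> b" for u v
    using Henstock_Kurzweil_Integration.integral_combine[OF that(1,2) mi'[OF order.refl that(3)]] by (simp add: F_def)
  have Fc: "continuous_on {a..b} F" unfolding F_def by (rule indefinite_integral_continuous_1[OF mi])
  have dF: "d (q r) (q s) \<le> \<bar>F r - F s\<bar>" if "r \<in> {a..b}" "s \<in> {a..b}" for r s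
    using le[of r s] le[of s r] FI[of r s] FI[of s r] that d_sym[of "q r" "q s"] by (cases "r \<le> s") auto
  have qc: "continuous_on {a..b} q"
    unfolding continuous_on_def tendsto_iff_d
  proof
    fix s assume s: "s \<in> {a..b}"
    have "((\<lambda>r. \<bar>F r - F s\<bar>) \<longlongrightarrow> \<bar>F s - F s\<bar>) (at s within {a..b})"
      using Fc s by (intro tendsto_intros) (simp add: continuous_on_def)
    then have lim: "((\<lambda>r. \<bar>F r - F s\<bar>) \<longlongrightarrow> 0) (at s within {a..b})" by simp
    have ev: "\<forall>\<^sub>F r in at s within {a..b}. d (q r) (q s) \<le> \<bar>F r - F s\<bar>"
      using dF s by (simp add: eventually_at_filter)
    show "((\<lambda>r. d (q r) (q s)) \<longlongrightarrow> 0) (at s within {a..b})"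
      by (rule tendsto_sandwich[OF _ ev tendsto_const lim]) (simp add: d_nonneg)
  qed
  \<comment> \<open>The comparison with the primitive is stated for all pairs of parameters so that
    it survives joining. The two constants are added, which only weakens the bounds because
    \<open>F\<close> is nondecreasing.\<close>
  have lip: "\<exists>C\<ge>0. \<forall>r r'. u \<le> r \<longrightarrow> r \<le> r' \<longrightarrow> r' \<le> v \<longrightarrow> norm (chart_map c (q r') - chart_map c (q r)) \<le> C * (F r' - F r)"
    if c: "c \<in> A" and uv: "a \<le> u" "u \<le> v" "v \<le> b" and im: "q ` {u..v} \<subseteq> chart_dom c" for c u v
    using uv(2)
  proof (induction rule: interval_patching)
    case (trans u' v' w')
    then obtain C1 C2 where C: "C1 \<ge> 0" "C2 \<ge> 0"
      "\<And>r r'. u' \<le> r \<Longrightarrow> r \<le> r' \<Longrightarrow> r' \<le> v' \<Longrightarrow> norm (chart_map c (q r') - chart_map c (q r)) \<le> C1 * (F r' - F r)"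
      "\<And>r r'. v' \<le> r \<Longrightarrow> r \<le> r' \<Longrightarrow> r' \<le> w' \<Longrightarrow> norm (chart_map c (q r') - chart_map c (q r)) \<le> C2 * (F r' - F r)" by blast
    have F0: "0 \<le> F r' - F r" if "u' \<le> r" "r \<le> r'" "r' \<le> w'" for r r'
    proof -
      have "a \<le> r" "r' \<le> b" using that trans(1-4) uv by linarith+
      then show ?thesis using d_nonneg[of "q r" "q r'"] le[of r r'] FI[of r r'] that(2) by linarith
    qed
    have 1: "norm (chart_map c (q r') - chart_map c (q r)) \<le> (C1 + C2) * (F r' - F r)" if "u' \<le> r" "r \<le> r'" "r' \<le> v'" for r r'
    proof -
      have "C1 * (F r' - F r) \<le> (C1 + C2) * (F r' - F r)"
        using C(2) F0[of r r'] that trans(3) by (intro mult_right_mono) auto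
      then show ?thesis using C(3)[OF that] by linarith
    qed
    have 2: "norm (chart_map c (q r') - chart_map c (q r)) \<le> (C1 + C2) * (F r' - F r)" if "v' \<le> r" "r \<le> r'" "r' \<le> w'" for r r'
    proof -
      have "C2 * (F r' - F r) \<le> (C1 + C2) * (F r' - F r)"
        using C(1) F0[of r r'] that trans(2) by (intro mult_right_mono) auto
      then show ?thesis using C(4)[OF that] by linarith
    qed
    show ?case
    proof (intro exI[of _ "C1 + C2"] conjI allI impI)
      fix r r' assume r: "u' \<le> r" "r \<le> r'" "r' \<le> w'"
      consider "r' \<le> v'" | "v' \<le> r" | "r \<le> v'" "v' \<le> r'" by linarith
      then show "norm (chart_map c (q r') - chart_map c (q r)) \<le> (C1 + C2) * (F r' - F r)"
      proof cases
        case 3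
        have "norm (chart_map c (q r') - chart_map c (q r)) \<le> norm (chart_map c (q r') - chart_map c (q v')) + norm (chart_map c (q v') - chart_map c (q r))"
          using norm_triangle_ineq[of "chart_map c (q r') - chart_map c (q v')" "chart_map c (q v') - chart_map c (q r)"] by simp
        also have "\<dots> \<le> (C1 + C2) * (F r' - F v') + (C1 + C2) * (F v' - F r)"
          using 1[of r v'] 2[of v' r'] 3 r by (intro add_mono) auto
        finally show ?thesis by (simp add: algebra_simps)
      qed (use 1 2 r in auto)
    qed (use C in simp)
  next
    case (local s)
    then have s: "s \<in> {u..v}" "s \<in> {a..b}" using uv by auto
    have qs: "q s \<in> chart_dom c" using im s by auto
    obtain r k where rk: "r > 0" "k > 0"
      "\<forall>p p'. p \<in> chart_dom c \<longrightarrow> dist (chart_map c (q s)) (chart_map c p) < r \<longrightarrow> d p p' < k * r \<longrightarrow>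
        p' \<in> chart_dom c \<and> k * norm (chart_map c p' - chart_map c p) \<le> d p p'"
      by (rule d_lower_local[OF c map_mem[OF c qs]])
    obtain d1 where d1: "d1 > 0" "\<forall>u v. a \<le> u \<and> u \<le> s \<and> s \<le> v \<and> v \<le> b \<and> v - u < d1 \<longrightarrow>
      q ` {u..v} \<subseteq> chart_dom c \<and> (\<forall>r'\<in>{u..v}. chart_map c (q r') \<in> ball (chart_map c (q s)) r)"
      by (rule curve_chart_ball[OF qc s(2) c qs rk(1)])
    have "k * r / 2 > 0" using rk by simp
    then obtain d2 where d2: "d2 > 0" "\<forall>t\<in>{a..b}. dist t s < d2 \<longrightarrow> dist (F t) (F s) < k * r / 2"
      using Fc s(2) unfolding continuous_on_iff by blast
    show ?case
    proof (rule exI[of _ "min d1 d2"], intro conjI allI impI)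
      show "0 < min d1 d2" using d1 d2 by simp
      fix u' v' assume u': "u \<le> u' \<and> u' \<le> s \<and> s \<le> v' \<and> v' \<le> v \<and> v' - u' < min d1 d2"
      then have ball: "\<And>t. t \<in> {u'..v'} \<Longrightarrow> q t \<in> chart_dom c \<and> chart_map c (q t) \<in> ball (chart_map c (q s)) r"
        using d1(2)[rule_format, of u' v'] uv by auto
      show "\<exists>C\<ge>0. \<forall>r r'. u' \<le> r \<longrightarrow> r \<le> r' \<longrightarrow> r' \<le> v' \<longrightarrow> norm (chart_map c (q r') - chart_map c (q r)) \<le> C * (F r' - F r)"
      proof (intro exI[of _ "1 / k"] conjI allI impI)
        fix t t' assume t: "u' \<le> t" "t \<le> t'" "t' \<le> v'"
        have tm: "t \<in> {a..b}" "t' \<in> {a..b}" "dist t s < d2" "dist t' s < d2" using t u' uv by (auto simp: dist_real_def)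
        have dd: "d (q t) (q t') \<le> F t' - F t" using le[of t t'] FI[of t t'] tm t by auto
        also have "\<dots> < k * r" using d2(2)[rule_format, OF tm(1,3)] d2(2)[rule_format, OF tm(2,4)]
          unfolding dist_real_def abs_less_iff by linarith
        finally have "k * norm (chart_map c (q t') - chart_map c (q t)) \<le> d (q t) (q t')"
          using rk(3) ball[of t] t by auto
        then show "norm (chart_map c (q t') - chart_map c (q t)) \<le> 1 / k * (F t' - F t)"
          using dd rk(2) by (simp add: pos_le_divide_eq mult.commute)
      qed (use rk in simp)
    qed
  qed
  show acq: "ac_curve A a b q"
    unfolding ac_curve_def
  proof (intro conjI qc ballI allI impI, elim conjE)
    fix c u v assume c: "c \<in> A" and uv: "a \<le> u" "u \<le> v" "v \<le> b" and im: "q ` {u..v} \<subseteq> chart_dom c"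
    obtain C where C: "C \<ge> 0" "\<And>r r'. u \<le> r \<Longrightarrow> r \<le> r' \<Longrightarrow> r' \<le> v \<Longrightarrow> norm (chart_map c (q r') - chart_map c (q r)) \<le> C * (F r' - F r)"
      using lip[OF c uv im] by blast
    show "abs_cont_on u v (chart_map c \<circ> q)"
    proof (rule abs_cont_onI_integral)
      have "m absolutely_integrable_on {u..v}" using uv by (intro absolutely_integrable_on_subinterval[OF m]) auto
      then show "(\<lambda>s. C * m s) absolutely_integrable_on {u..v}" by (intro set_integrable_mult_right) auto
      fix r r' assume r: "u \<le> r" "r \<le> r'" "r' \<le> v"
      show "norm ((chart_map c \<circ> q) r' - (chart_map c \<circ> q) r) \<le> integral {r..r'} (\<lambda>s. C * m s)"
        using C(2)[OF r] FI[of r r'] r uv by simp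
    qed
  qed
  have mF: "(m has_integral (F v - F u)) {u..v}" if "a \<le> u" "u \<le> v" "v \<le> b" for u v
    using integrable_integral[OF mi'[OF that(1,3)]] FI[OF that] by simp
  obtain N0 where N0: "negligible N0" "\<And>s. s \<in> {a<..<b} - N0 \<Longrightarrow> (F has_vector_derivative m s) (at s)"
    using indefinite_integral_derivative[OF mF ab] by metis
  show "\<exists>N. negligible N \<and> (\<forall>s\<in>{a<..<b} - N. speed A R q s \<le> m s)"
    using ab
  proof (induction rule: negligible_patching)
    case (local s)
    then have s: "s \<in> {a..b}" by simp
    obtain c where c: "c \<in> A" "q s \<in> chart_dom c" by (rule chart_cover)
    obtain \<delta> where \<delta>: "\<delta> > 0" "\<forall>u v. a \<le> u \<and> u \<le> s \<and> s \<le> v \<and> v \<le> b \<and> v - u < \<delta> \<longrightarrow> q ` {u..v} \<subseteq> chart_dom c"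
      by (rule continuous_local_image[OF qc s open_dom[OF c(1)] c(2)])
    show ?case
    proof (intro exI[of _ \<delta>] conjI \<delta>(1) allI impI)
      fix u v assume "a \<le> u \<and> u \<le> s \<and> s \<le> v \<and> v \<le> b \<and> v - u < \<delta>"
      then have uv: "a \<le> u" "u \<le> v" "v \<le> b" and im: "q ` {u..v} \<subseteq> chart_dom c" using \<delta>(2) by auto
      have quv: "ac_curve A u v q" by (rule ac_curve_subinterval[OF acq uv(1,3)])
      let ?x = "chart_map c \<circ> q"
      obtain N where N: "negligible N" "\<forall>t\<in>{u<..<v} - N. (?x has_vector_derivative vector_derivative ?x (at t)) (at t)
        \<and> speed A R q t = local_norm c (chart_map c (q t)) (vector_derivative ?x (at t))"
        by (rule speed_in_chart[OF quv c(1) im uv(2)])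
      show "\<exists>N. negligible N \<and> (\<forall>t\<in>{u<..<v} - N. speed A R q t \<le> m t)"
      proof (intro exI[of _ "N \<union> N0"] conjI ballI)
        show "negligible (N \<union> N0)" using N(1) N0(1) by simp
        fix t assume t: "t \<in> {u<..<v} - (N \<union> N0)"
        have qt: "q t \<in> chart_dom c" using im t by auto
        have xi: "chart_map c (q t) \<in> chart_img c" by (rule map_mem[OF c(1) qt])
        let ?D = "vector_derivative ?x (at t)" and ?n = "local_norm c (chart_map c (q t))"
        have xd: "(?x has_vector_derivative ?D) (at t)" "speed A R q t = ?n ?D" using N(2) t by auto
        have Fd: "(F has_vector_derivative m t) (at t)" using N0(2) t uv by auto
        obtain k K where kK: "k > 0" "K > 0" "\<forall>w. k * norm w \<le> ?n w \<and> ?n w \<le> K * norm w"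
          by (rule local_norm_equiv_at[OF c(1) xi])
        have nc: "continuous_on UNIV ?n"
          by (rule seminorm_continuous[where C = K])
             (use kK local_norm_triangle[OF c(1) xi] local_norm_scale[OF c(1) xi] in auto)
        \<comment> \<open>The factor \<open>z\<close> plays the part of \<theta> in
          \<open>d_lower_norm\<close>. The neighbourhood there depends on \<open>z\<close>, so the
          limit of the difference quotient is taken first and \<open>z\<close> tends to 1
          afterwards.\<close>
        have "z * ?n ?D \<le> m t" if z: "0 < z" "z < 1" for z
        proof -
          obtain \<rho> where \<rho>: "\<rho> > 0" "\<forall>p'. d (q t) p' < \<rho> \<longrightarrow> p' \<in> chart_dom c \<and>
            z * ?n (chart_map c p' - chart_map c (q t)) \<le> d (q t) p'"
            by (rule d_lower_norm[OF c(1) qt z])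
          have t1: "((\<lambda>h. (F (t + h) - F t) /\<^sub>R h) \<longlongrightarrow> m t) (at_right 0)"
            using has_vector_derivative_quotient[OF Fd] by (rule filterlim_mono) (auto simp: at_le)
          have "((\<lambda>h. (?x (t + h) - ?x t) /\<^sub>R h) \<longlongrightarrow> ?D) (at_right 0)"
            using has_vector_derivative_quotient[OF xd(1)] by (rule filterlim_mono) (auto simp: at_le)
          then have t2: "((\<lambda>h. z * ?n ((?x (t + h) - ?x t) /\<^sub>R h)) \<longlongrightarrow> z * ?n ?D) (at_right 0)"
            using nc by (intro tendsto_intros isCont_tendsto_compose[of ?D ?n]) (simp_all add: continuous_on_eq_continuous_at)
          have Ft: "isCont F t" using has_vector_derivative_continuous[OF Fd] .
          have "((\<lambda>h. F (t + h)) \<longlongrightarrow> F t) (at 0)" using Ft by (simp add: isCont_iff)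
          then have "((\<lambda>h. F (t + h)) \<longlongrightarrow> F t) (at_right 0)" by (rule filterlim_mono) (auto simp: at_le)
          then have ev1: "\<forall>\<^sub>F h in at_right 0. dist (F (t + h)) (F t) < \<rho>" using \<rho>(1) by (rule tendstoD)
          have ev2: "\<forall>\<^sub>F h in at_right 0. h \<in> {0<..<v - t}" by (rule eventually_at_right_real) (use t in simp)
          show ?thesis
          proof (rule tendsto_le[OF _ t1 t2])
            show "\<forall>\<^sub>F h in at_right 0. z * ?n ((?x (t + h) - ?x t) /\<^sub>R h) \<le> (F (t + h) - F t) /\<^sub>R h"
              using ev1 ev2
            proof eventually_elim
              case (elim h)
              then have h: "0 < h" "t + h \<le> b" "a \<le> t" using t uv by auto
              have dd: "d (q t) (q (t + h)) \<le> F (t + h) - F t" using le[of t "t + h"] FI[of t "t + h"] h by simp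
              then have "d (q t) (q (t + h)) < \<rho>" using elim(1) by (auto simp: dist_real_def)
              then have "z * ?n (chart_map c (q (t + h)) - chart_map c (q t)) \<le> F (t + h) - F t" using \<rho>(2) dd by fastforce
              then have "(z * ?n (chart_map c (q (t + h)) - chart_map c (q t))) / h \<le> (F (t + h) - F t) / h"
                using h(1) by (intro divide_right_mono) auto
              moreover have "?n ((?x (t + h) - ?x t) /\<^sub>R h) = ?n (chart_map c (q (t + h)) - chart_map c (q t)) / h"
                using h(1) by (simp add: local_norm_scale[OF c(1) xi] divide_inverse mult.commute)
              ultimately show ?case by (simp add: divide_inverse mult_ac)
            qed
          qed simp
        qed
        then have "?n ?D \<le> m t" by (rule field_le_mult_one_interval)
        then show "speed A R q t \<le> m t" using xd(2) by simp
      qed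
    qed
  qed
qed

end

section \<open>The energy along curves\<close>

text \<open>Continuity at \<open>x0\<close> is uniform in the compact variable, so the suprema
  differ by no more than the functions do. The slope is a supremum of this kind.\<close>

lemma continuous_on_SUP_compact:
  fixes f :: "'a::topological_space \<times> 'b::topological_space \<Rightarrow> real"
  assumes f: "continuous_on (U \<times> C) f" and C: "compact C" "C \<noteq> {}"
  shows "continuous_on U (\<lambda>x. SUP w\<in>C. f (x, w))"
  unfolding continuous_on_def
proof (intro ballI tendstoI)
  fix x0 and e :: real assume x0: "x0 \<in> U" and e: "e > 0"
  have bd: "bdd_above ((\<lambda>w. f (x, w)) ` C)" if "x \<in> U" for x
  proof -
    have "continuous_on C (\<lambda>w. f (x, w))"
      by (rule continuous_on_compose2[OF f]) (use that in \<open>auto intro!: continuous_intros\<close>)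
    then have "compact ((\<lambda>w. f (x, w)) ` C)" by (rule compact_continuous_image[OF _ C(1)])
    then show ?thesis by (rule bounded_imp_bdd_above[OF compact_imp_bounded])
  qed
  obtain X0 where X0: "x0 \<in> X0" "open X0" "\<forall>x\<in>X0 \<inter> U. \<forall>w\<in>C. dist (f (x, w)) (f (x0, w)) \<le> e/2"
    by (rule continuous_on_prod_compactE[OF f C(1) x0 half_gt_zero[OF e]])
  have "dist (SUP w\<in>C. f (x, w)) (SUP w\<in>C. f (x0, w)) < e" if x: "x \<in> X0" "x \<in> U" for x
  proof -
    have near: "\<bar>f (x, w) - f (x0, w)\<bar> \<le> e/2" if "w \<in> C" for w
      using X0(3) x that by (auto simp: dist_real_def)
    have "(SUP w\<in>C. f (x, w)) \<le> (SUP w\<in>C. f (x0, w)) + e/2"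
    proof (rule cSUP_least[OF C(2)])
      fix w assume w: "w \<in> C"
      have "f (x0, w) \<le> (SUP w\<in>C. f (x0, w))" by (rule cSUP_upper[OF w bd[OF x0]])
      then show "f (x, w) \<le> (SUP w\<in>C. f (x0, w)) + e/2" using near[OF w] by linarith
    qed
    moreover have "(SUP w\<in>C. f (x0, w)) \<le> (SUP w\<in>C. f (x, w)) + e/2"
    proof (rule cSUP_least[OF C(2)])
      fix w assume w: "w \<in> C"
      have "f (x, w) \<le> (SUP w\<in>C. f (x, w))" by (rule cSUP_upper[OF w bd[OF x(2)]])
      then show "f (x0, w) \<le> (SUP w\<in>C. f (x, w)) + e/2" using near[OF w] by linarith
    qed
    ultimately show ?thesis using e unfolding dist_real_def by linarith
  qed
  then show "\<forall>\<^sub>F x in at x0 within U. dist (SUP w\<in>C. f (x, w)) (SUP w\<in>C. f (x0, w)) < e"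
    unfolding eventually_at_topological using X0(1,2) by blast
qed

locale finsler_energy = finsler_space A R
  for A :: "('q::{second_countable_topology,t2_space}, 'e::euclidean_space) chart set"
    and R :: "'q \<Rightarrow> ('q, 'e) tvec \<Rightarrow> real" +
  fixes T :: real and E :: "real \<Rightarrow> 'q \<Rightarrow> real"
  assumes T: "0 < T" and energy: "C1_energy A T E"
begin

text \<open>One differential is fixed for each chart, so that its continuity and its derivative
  property refer to the same function. At the times 0 and \<open>T\<close> it contains the one-sided
  time derivative.\<close>

definition chart_diff :: "('q, 'e) chart \<Rightarrow> real \<times> 'e \<Rightarrow> (real \<times> 'e) \<Rightarrow>\<^sub>L real" where
  "chart_diff c = (SOME D. continuous_on ({0..T} \<times> chart_img c) D \<and>
        (\<forall>p\<in>{0..T} \<times> chart_img c.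
           ((\<lambda>(t, x). E t (chart_inv c x)) has_derivative blinfun_apply (D p))
             (at p within {0..T} \<times> chart_img c)))"

lemma
  assumes "c \<in> A"
  shows chart_diff_continuous: "continuous_on ({0..T} \<times> chart_img c) (chart_diff c)"
    and chart_diff_derivative: "\<And>p. p \<in> {0..T} \<times> chart_img c \<Longrightarrow>
      ((\<lambda>(t, x). E t (chart_inv c x)) has_derivative blinfun_apply (chart_diff c p)) (at p within {0..T} \<times> chart_img c)"
proof -
  have "\<exists>D. continuous_on ({0..T} \<times> chart_img c) D \<and>
        (\<forall>p\<in>{0..T} \<times> chart_img c.
           ((\<lambda>(t, x). E t (chart_inv c x)) has_derivative blinfun_apply (D p))
             (at p within {0..T} \<times> chart_img c))"
    using energy assms unfolding C1_energy_def by (rule bspec)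
  note this[THEN someI_ex, folded chart_diff_def]
  then show "continuous_on ({0..T} \<times> chart_img c) (chart_diff c)"
    "\<And>p. p \<in> {0..T} \<times> chart_img c \<Longrightarrow>
      ((\<lambda>(t, x). E t (chart_inv c x)) has_derivative blinfun_apply (chart_diff c p)) (at p within {0..T} \<times> chart_img c)"
    by blast+
qed

lemma chart_diff_split: "blinfun_apply (chart_diff c p) (h, w) = h * blinfun_apply (chart_diff c p) (1, 0) + blinfun_apply (chart_diff c p) (0, w)"
proof -
  have "(h, w) = h *\<^sub>R (1, 0) + (0, w)" by simp
  then show ?thesis by (metis blinfun.add_right blinfun.scaleR_right real_scaleR_def)
qed

lemma time_deriv_chart:
  assumes c: "c \<in> A" "q \<in> chart_dom c" and t: "t \<in> {0..T}"
  shows "time_deriv T E t q = blinfun_apply (chart_diff c (t, chart_map c q)) (1, 0)"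
proof -
  let ?p = "\<lambda>\<tau>. (\<tau>, chart_map c q)" and ?D = "chart_diff c (t, chart_map c q)"
  have im: "?p ` {0..T} \<subseteq> {0..T} \<times> chart_img c" using map_mem[OF c] by auto
  have d: "((\<lambda>(t, x). E t (chart_inv c x)) has_derivative blinfun_apply ?D) (at (?p t) within ?p ` {0..T})"
    by (rule has_derivative_subset[OF chart_diff_derivative[OF c(1)] im]) (use t map_mem[OF c] in auto)
  have "((\<lambda>(t, x). E t (chart_inv c x)) \<circ> ?p has_derivative blinfun_apply ?D \<circ> (\<lambda>h. (h, 0))) (at t within {0..T})"
    by (rule diff_chain_within[OF _ d]) (auto intro!: derivative_eq_intros)
  moreover have "blinfun_apply ?D \<circ> (\<lambda>h. (h, 0)) = (\<lambda>h. h *\<^sub>R blinfun_apply ?D (1, 0))"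
  proof
    fix h
    have "(h, 0::'e) = h *\<^sub>R (1, 0)" by simp
    then show "(blinfun_apply ?D \<circ> (\<lambda>h. (h, 0))) h = h *\<^sub>R blinfun_apply ?D (1, 0)"
      by (metis blinfun.scaleR_right comp_apply)
  qed
  moreover have "(\<lambda>(t, x). E t (chart_inv c x)) \<circ> ?p = (\<lambda>\<tau>. E \<tau> q)" using inv_map[OF c] by auto
  ultimately have "((\<lambda>\<tau>. E \<tau> q) has_vector_derivative blinfun_apply ?D (1, 0)) (at t within cbox 0 T)"
    unfolding has_vector_derivative_def by simp
  then have "vector_derivative (\<lambda>\<tau>. E \<tau> q) (at t within cbox 0 T) = blinfun_apply ?D (1, 0)"
    by (rule vector_derivative_within_cbox[OF T, rotated]) (use t in simp)
  then show ?thesis unfolding time_deriv_def by simp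
qed

lemma energy_chart_derivative:
  assumes c: "c \<in> A" "q \<in> chart_dom c" and t: "t \<in> {0..T}"
  shows "((E t \<circ> chart_inv c) has_derivative (\<lambda>w. blinfun_apply (chart_diff c (t, chart_map c q)) (0, w))) (at (chart_map c q))"
proof -
  let ?p = "\<lambda>x. (t, x)" and ?D = "chart_diff c (t, chart_map c q)"
  have im: "?p ` chart_img c \<subseteq> {0..T} \<times> chart_img c" using t by auto
  have d: "((\<lambda>(t, x). E t (chart_inv c x)) has_derivative blinfun_apply ?D) (at (?p (chart_map c q)) within ?p ` chart_img c)"
    by (rule has_derivative_subset[OF chart_diff_derivative[OF c(1)] im]) (use t map_mem[OF c] in auto)
  have "((\<lambda>(t, x). E t (chart_inv c x)) \<circ> ?p has_derivative blinfun_apply ?D \<circ> (\<lambda>w. (0, w))) (at (chart_map c q) within chart_img c)"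
    by (rule diff_chain_within[OF _ d]) (auto intro!: derivative_eq_intros)
  then show ?thesis
    using at_within_open[OF map_mem[OF c] open_img[OF c(1)]] by (simp add: o_def)
qed

text \<open>\<open>space_diff\<close> is evaluated in an arbitrarily selected chart. The chain rule
  for the transition map matches the transformation law of tangent vectors, so every chart gives the
  same value.\<close>

lemma space_diff_chart:
  assumes c: "c \<in> A" "q \<in> chart_dom c" and t: "t \<in> {0..T}" and v: "v \<in> tangent_space A q"
  shows "space_diff A E t q v = blinfun_apply (chart_diff c (t, chart_map c q)) (0, v c)"
proof -
  define k where "k = (SOME c. c \<in> charts_at A q)"
  have "k \<in> charts_at A q" unfolding k_def by (rule someI[of _ c]) (simp add: charts_atI c)
  then have k: "k \<in> A" "q \<in> chart_dom k" by (auto simp: charts_at_def)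
  have 1: "space_diff A E t q v = blinfun_apply (chart_diff k (t, chart_map k q)) (0, v k)"
    unfolding space_diff_def k_def[symmetric] Let_def
    using frechet_derivative_at[OF energy_chart_derivative[OF k t]] by metis
  let ?tr = "transition k c"
  have e: "?tr (chart_map k q) = chart_map c q" using k by (simp add: transition_def inv_map)
  have d: "((E t \<circ> chart_inv c) \<circ> ?tr has_derivative (\<lambda>w. blinfun_apply (chart_diff c (t, chart_map c q)) (0, w)) \<circ>
    frechet_derivative ?tr (at (chart_map k q))) (at (chart_map k q))"
    by (rule diff_chain_at[OF transition_derivative[OF k(1) c(1) k(2) c(2)]]) (use energy_chart_derivative[OF c t] e in simp)
  have "\<forall>\<^sub>F z in nhds (chart_map k q). z \<in> chart_img k \<and> chart_inv k z \<in> chart_dom c"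
    by (rule eventually_inv_in) (use c k open_dom in \<open>auto simp: map_mem inv_map\<close>)
  then have ev: "\<forall>\<^sub>F z in nhds (chart_map k q). ((E t \<circ> chart_inv c) \<circ> ?tr) z = (E t \<circ> chart_inv k) z"
    by eventually_elim (use c in \<open>simp add: transition_def inv_map\<close>)
  have "((E t \<circ> chart_inv k) has_derivative (\<lambda>w. blinfun_apply (chart_diff c (t, chart_map c q)) (0, w)) \<circ>
    frechet_derivative ?tr (at (chart_map k q))) (at (chart_map k q))"
    by (rule has_derivative_transform_eventually[OF d])
       (use ev eventually_nhds_x_imp_x[OF ev] in \<open>auto simp: eventually_at_filter elim: eventually_mono\<close>)
  from has_derivative_unique[OF this energy_chart_derivative[OF k t]]
  have "blinfun_apply (chart_diff k (t, chart_map k q)) (0, v k) =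
    blinfun_apply (chart_diff c (t, chart_map c q)) (0, frechet_derivative ?tr (at (chart_map k q)) (v k))"
    by (metis comp_apply)
  moreover have "v c = frechet_derivative ?tr (at (chart_map k q)) (v k)"
    using fun_cong[OF tangent_of_eq[OF k v], of c] charts_atI[OF c] by (simp add: tangent_of_def)
  ultimately show ?thesis using 1 by simp
qed

text \<open>By homogeneity the supremum over all nonzero vectors is one over the unit sphere.
  Compactness of the sphere is what gives boundedness and continuity of the slope.\<close>

lemma slope_chart:
  assumes c: "c \<in> A" "q \<in> chart_dom c" and t: "t \<in> {0..T}"
  shows "slope A R E t q = (SUP w\<in>sphere 0 1. blinfun_apply (chart_diff c (t, chart_map c q)) (0, w) / local_norm c (chart_map c q) w)"
proof -
  let ?D = "chart_diff c (t, chart_map c q)" and ?n = "local_norm c (chart_map c q)"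
  let ?G = "\<lambda>w. blinfun_apply ?D (0, w) / ?n w"
  have xi: "chart_map c q \<in> chart_img c" by (rule map_mem[OF c])
  have "(\<lambda>v. space_diff A E t q v / R q v) ` (tangent_space A q - {\<lambda>c. 0}) = ?G ` sphere 0 1"
  proof (intro equalityI subsetI)
    fix z assume "z \<in> (\<lambda>v. space_diff A E t q v / R q v) ` (tangent_space A q - {\<lambda>c. 0})"
    then obtain v where v: "v \<in> tangent_space A q" "v \<noteq> (\<lambda>c. 0)" "z = space_diff A E t q v / R q v" by blast
    have eq: "tangent_of A c q (v c) = v" by (rule tangent_of_eq[OF c v(1)])
    then have ne: "v c \<noteq> 0" using tangent_of_linear(3)[OF c, of "v c"] v(2) by simp
    have z: "z = ?G (v c)" using v(3) space_diff_chart[OF c t v(1)] local_norm_at[OF c, of "v c"] eq by simp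
    let ?u = "v c /\<^sub>R norm (v c)"
    have "?G ?u = ?G (v c)"
    proof -
      have "(0::real, ?u) = inverse (norm (v c)) *\<^sub>R (0, v c)" by simp
      then have "blinfun_apply ?D (0, ?u) = inverse (norm (v c)) * blinfun_apply ?D (0, v c)"
        by (metis blinfun.scaleR_right real_scaleR_def)
      moreover have "?n ?u = inverse (norm (v c)) * ?n (v c)" by (simp add: local_norm_scale[OF c(1) xi])
      ultimately show ?thesis using ne by simp
    qed
    moreover have "?u \<in> sphere 0 1" using ne by simp
    ultimately show "z \<in> ?G ` sphere 0 1" unfolding z by (intro image_eqI[of _ ?G ?u]) simp_all
  next
    fix z assume "z \<in> ?G ` sphere 0 1"
    then obtain w where w: "w \<in> sphere 0 1" "z = ?G w" by blast
    let ?v = "tangent_of A c q w"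
    have "w \<noteq> 0" using w(1) by auto
    then have "?v \<noteq> (\<lambda>c. 0)" using tangent_of_linear(3)[OF c, of w] by simp
    moreover have vt: "?v \<in> tangent_space A q" by (rule tangent_of_mem[OF c])
    moreover have "z = space_diff A E t q ?v / R q ?v"
      using w(2) space_diff_chart[OF c t vt] local_norm_at[OF c, of w] tangent_of_coord[OF c, of w] by simp
    ultimately show "z \<in> (\<lambda>v. space_diff A E t q v / R q v) ` (tangent_space A q - {\<lambda>c. 0})" by blast
  qed
  then show ?thesis unfolding slope_def by simp
qed

lemma quotient_continuous:
  assumes c: "c \<in> A"
  shows "continuous_on (({0..T} \<times> chart_img c) \<times> sphere 0 1)
    (\<lambda>(p, w). blinfun_apply (chart_diff c p) (0, w) / local_norm c (snd p) w)"
proof -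
  let ?S = "({0..T} \<times> chart_img c) \<times> sphere (0::'e) 1"
  have 1: "continuous_on ?S (\<lambda>z. chart_diff c (fst z))"
    by (rule continuous_on_compose2[OF chart_diff_continuous[OF c] continuous_on_fst[OF continuous_on_id]]) auto
  have 2: "continuous_on ?S (\<lambda>z. local_norm c (snd (fst z)) (snd z))"
  proof -
    have "continuous_on ?S (\<lambda>z. (\<lambda>(x, w). local_norm c x w) (snd (fst z), snd z))"
      by (rule continuous_on_compose2[OF local_norm_continuous[OF c]]) (auto intro!: continuous_intros)
    then show ?thesis by simp
  qed
  have nz: "local_norm c (snd (fst z)) (snd z) \<noteq> 0" if "z \<in> ?S" for z
  proof -
    have "snd (fst z) \<in> chart_img c" "snd z \<noteq> 0" using that by auto
    then show ?thesis using local_norm_eq_0[OF c] by blast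
  qed
  have "continuous_on ?S (\<lambda>z. blinfun_apply (chart_diff c (fst z)) (0, snd z) / local_norm c (snd (fst z)) (snd z))"
    by (intro continuous_on_divide blinfun.continuous_on 1 2 continuous_intros) (use nz in blast)
  then show ?thesis by (simp add: case_prod_unfold)
qed

lemma slope_bound:
  assumes t: "t \<in> {0..T}" and v: "v \<in> tangent_space A q"
  shows "space_diff A E t q v \<le> slope A R E t q * R q v" "- (slope A R E t q * R q v) \<le> space_diff A E t q v"
    "0 \<le> slope A R E t q"
proof -
  obtain c where c: "c \<in> A" "q \<in> chart_dom c" by (rule chart_cover)
  let ?x = "chart_map c q"
  let ?D = "chart_diff c (t, ?x)" and ?n = "local_norm c ?x"
  let ?G = "\<lambda>w. blinfun_apply ?D (0, w) / ?n w"
  have xi: "?x \<in> chart_img c" by (rule map_mem[OF c])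
  have "continuous_on (sphere 0 1) (\<lambda>w. (\<lambda>(p, w). blinfun_apply (chart_diff c p) (0, w) / local_norm c (snd p) w) ((t, ?x), w))"
    by (rule continuous_on_compose2[OF quotient_continuous[OF c(1)]]) (use t xi in \<open>auto intro!: continuous_intros\<close>)
  then have "continuous_on (sphere 0 1) ?G" by simp
  then have bd: "bdd_above (?G ` sphere 0 1)"
    by (intro bounded_imp_bdd_above compact_imp_bounded compact_continuous_image compact_sphere)
  have up: "?G w \<le> slope A R E t q" if "w \<in> sphere 0 1" for w
    unfolding slope_chart[OF c t] by (rule cSUP_upper[OF that bd])
  have key: "blinfun_apply ?D (0, w) \<le> slope A R E t q * ?n w" for w
  proof (cases "w = 0")
    case True
    then show ?thesis using local_norm_eq_0[OF c(1) xi, of 0] blinfun.zero_right[of ?D] by (simp add: zero_prod_def)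
  next
    case False
    let ?u = "w /\<^sub>R norm w"
    have u: "?u \<in> sphere 0 1" using False by simp
    have "(0::real, w) = norm w *\<^sub>R (0, ?u)" using False by simp
    then have 1: "blinfun_apply ?D (0, w) = norm w * blinfun_apply ?D (0, ?u)" by (metis blinfun.scaleR_right real_scaleR_def)
    have 2: "?n w = norm w * ?n ?u" using local_norm_scale[OF c(1) xi, of "norm w" ?u] False by simp
    have "?n ?u \<noteq> 0" using local_norm_eq_0[OF c(1) xi, of ?u] False by simp
    then have "?n ?u > 0" using local_norm_nonneg[OF c(1) xi, of ?u] by simp
    then have "blinfun_apply ?D (0, ?u) \<le> slope A R E t q * ?n ?u" using up[OF u] by (simp add: pos_divide_le_eq)
    then have "norm w * blinfun_apply ?D (0, ?u) \<le> norm w * (slope A R E t q * ?n ?u)" by (intro mult_left_mono) auto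
    then show ?thesis unfolding 1 2 by (simp add: mult.left_commute)
  qed
  have neg: "blinfun_apply ?D (0, - w) = - blinfun_apply ?D (0, w)" for w
  proof -
    have "(0::real, - w) = - (0, w)" by simp
    then show ?thesis by (metis blinfun.minus_right)
  qed
  have Rv: "R q v = ?n (v c)" using local_norm_at[OF c, of "v c"] tangent_of_eq[OF c v] by simp
  have sv: "space_diff A E t q v = blinfun_apply ?D (0, v c)" by (rule space_diff_chart[OF c t v])
  show "space_diff A E t q v \<le> slope A R E t q * R q v" unfolding Rv sv by (rule key)
  show "- (slope A R E t q * R q v) \<le> space_diff A E t q v"
    unfolding Rv sv using key[of "- v c"] neg local_norm_minus[OF c(1) xi, of "v c"] by simp
  obtain w :: 'e where w: "w \<in> sphere 0 1" using sphere_eq_empty[of "0::'e" 1] by (metis all_not_in_conv not_one_less_zero)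
  \<comment> \<open>Opposite directions give opposite quotients, and both are at most the supremum,
    which is therefore nonnegative.\<close>
  have "?G (- w) = - ?G w" using neg[of w] local_norm_minus[OF c(1) xi, of w] by simp
  then show "0 \<le> slope A R E t q" using up[of w] up[of "- w"] w by simp
qed

lemma continuous_from_charts:
  fixes f :: "real \<Rightarrow> 'q \<Rightarrow> 'b::topological_space"
  assumes h: "\<And>c. c \<in> A \<Longrightarrow> continuous_on ({0..T} \<times> chart_img c) (h c)"
    and f: "\<And>c t q. c \<in> A \<Longrightarrow> q \<in> chart_dom c \<Longrightarrow> t \<in> {0..T} \<Longrightarrow> f t q = h c (t, chart_map c q)"
  shows "continuous_on ({0..T} \<times> UNIV) (\<lambda>(t, q). f t q)"
  unfolding continuous_on_eq_continuous_within
proof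
  fix p assume p: "p \<in> {0..T} \<times> (UNIV::'q set)"
  obtain t q where tq: "p = (t, q)" "t \<in> {0..T}" using p by auto
  obtain c where c: "c \<in> A" "q \<in> chart_dom c" by (rule chart_cover)
  have "continuous_on ({0..T} \<times> chart_dom c) (\<lambda>p. (fst p, chart_map c (snd p)))"
    by (intro continuous_on_Pair continuous_on_fst continuous_on_id continuous_on_compose2[OF cont_map[OF c(1)] continuous_on_snd[OF continuous_on_id]]) auto
  then have "continuous_on ({0..T} \<times> chart_dom c) (\<lambda>p. h c (fst p, chart_map c (snd p)))"
    by (rule continuous_on_compose2[OF h[OF c(1)]]) (auto simp: map_mem[OF c(1)])
  then have "continuous_on ({0..T} \<times> chart_dom c) (\<lambda>(t, q). f t q)"
    by (rule continuous_on_cong[THEN iffD1, rotated 2]) (auto simp: f[OF c(1)])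
  then have "continuous (at p within {0..T} \<times> chart_dom c) (\<lambda>(t, q). f t q)"
    using tq c(2) by (auto simp: continuous_on_eq_continuous_within)
  moreover have "at p within {0..T} \<times> chart_dom c = at p within {0..T} \<times> UNIV"
    by (rule at_within_nhd[of _ "UNIV \<times> chart_dom c"]) (use tq c open_dom[OF c(1)] in \<open>auto intro: open_Times\<close>)
  ultimately show "continuous (at p within {0..T} \<times> UNIV) (\<lambda>(t, q). f t q)" by simp
qed

lemma energy_continuous: "continuous_on ({0..T} \<times> UNIV) (\<lambda>(t, q). E t q)"
proof (rule continuous_from_charts)
  show "continuous_on ({0..T} \<times> chart_img c) (\<lambda>(t, x). E t (chart_inv c x))" if "c \<in> A" for c
    using has_derivative_continuous_on[OF chart_diff_derivative[OF that]] by blast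
qed (simp add: inv_map)

lemma time_deriv_continuous: "continuous_on ({0..T} \<times> UNIV) (\<lambda>(t, q). time_deriv T E t q)"
proof (rule continuous_from_charts)
  show "continuous_on ({0..T} \<times> chart_img c) (\<lambda>p. blinfun_apply (chart_diff c p) (1, 0))" if "c \<in> A" for c
    by (intro blinfun.continuous_on chart_diff_continuous[OF that] continuous_on_const)
qed (simp add: time_deriv_chart)

lemma slope_continuous: "continuous_on ({0..T} \<times> UNIV) (\<lambda>(t, q). slope A R E t q)"
proof (rule continuous_from_charts)
  show "continuous_on ({0..T} \<times> chart_img c) (\<lambda>p. SUP w\<in>sphere 0 1. (\<lambda>(p, w). blinfun_apply (chart_diff c p) (0, w) / local_norm c (snd p) w) (p, w))"
    if "c \<in> A" for c
    by (rule continuous_on_SUP_compact[OF quotient_continuous[OF that] compact_sphere]) simp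
qed (simp add: slope_chart)

section \<open>The chain rule for the energy\<close>

text \<open>The differential of the energy is taken within the closed time interval. The open set
  \<open>S\<close> keeps nearby times there, so a two-sided derivative exists even if
  \<open>t s\<close> is 0 or \<open>T\<close>.\<close>

lemma energy_chain:
  assumes c: "c \<in> A" and y: "isCont y s" "y s \<in> chart_dom c"
    and w: "((chart_map c \<circ> y) has_vector_derivative w) (at s)"
    and t: "(t has_real_derivative t') (at s)" and S: "open S" "s \<in> S" "t ` S \<subseteq> {0..T}"
  shows "((\<lambda>r. E (t r) (y r)) has_real_derivative
    (time_deriv T E (t s) (y s) * t' + space_diff A E (t s) (y s) (velocity A y s))) (at s)"
proof -
  have "filterlim y (nhds (y s)) (nhds s)" using y(1) by (simp add: isCont_def tendsto_at_iff_tendsto_nhds)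
  then have "\<forall>\<^sub>F r in nhds s. y r \<in> chart_dom c" using topological_tendstoD open_dom[OF c] y(2) by blast
  then obtain S' where S': "open S'" "s \<in> S'" "\<And>r. r \<in> S' \<Longrightarrow> y r \<in> chart_dom c" unfolding eventually_nhds by blast
  let ?V = "S \<inter> S'" and ?p = "\<lambda>r. (t r, chart_map c (y r))" and ?D = "chart_diff c (t s, chart_map c (y s))"
  have V: "open ?V" "s \<in> ?V" using S S' by auto
  have ts: "t s \<in> {0..T}" using S by auto
  have im: "?p ` ?V \<subseteq> {0..T} \<times> chart_img c"
  proof (rule image_subsetI)
    fix r assume r: "r \<in> ?V"
    then have "t r \<in> {0..T}" using S(3) by blast
    moreover have "chart_map c (y r) \<in> chart_img c" using r S'(3) map_mem[OF c] by blast
    ultimately show "?p r \<in> {0..T} \<times> chart_img c" by simp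
  qed
  have d: "((\<lambda>(t, x). E t (chart_inv c x)) has_derivative blinfun_apply ?D) (at (?p s) within ?p ` ?V)"
    by (rule has_derivative_subset[OF chart_diff_derivative[OF c] im]) (use im V(2) in blast)
  have pd: "(?p has_derivative (\<lambda>h. (h * t', h *\<^sub>R w))) (at s within ?V)"
  proof -
    have "(t has_derivative (\<lambda>h. h * t')) (at s)" using t by (simp only: has_field_derivative_def mult_commute_abs)
    moreover have "((\<lambda>r. chart_map c (y r)) has_derivative (\<lambda>h. h *\<^sub>R w)) (at s)"
      using w unfolding has_vector_derivative_def o_def .
    ultimately show ?thesis by (rule has_derivative_Pair[OF has_derivative_at_withinI has_derivative_at_withinI])
  qed
  have "((\<lambda>(t, x). E t (chart_inv c x)) \<circ> ?p has_derivative blinfun_apply ?D \<circ> (\<lambda>h. (h * t', h *\<^sub>R w))) (at s within ?V)"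
    by (rule diff_chain_within[OF pd d])
  then have 1: "((\<lambda>(t, x). E t (chart_inv c x)) \<circ> ?p has_derivative blinfun_apply ?D \<circ> (\<lambda>h. (h * t', h *\<^sub>R w))) (at s)"
    using at_within_open[OF V(2,1)] by simp
  have vel: "velocity A y s = tangent_of A c (y s) w" by (rule velocity_eq_tangent_of[OF c y w])
  have sd: "space_diff A E (t s) (y s) (velocity A y s) = blinfun_apply ?D (0, w)"
    unfolding vel using space_diff_chart[OF c y(2) ts tangent_of_mem[OF c y(2)], of w] tangent_of_coord[OF c y(2), of w] by simp
  have lin: "blinfun_apply ?D \<circ> (\<lambda>h. (h * t', h *\<^sub>R w)) =
    (\<lambda>h. (time_deriv T E (t s) (y s) * t' + space_diff A E (t s) (y s) (velocity A y s)) * h)"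
  proof
    fix h
    have "(h * t', h *\<^sub>R w) = h *\<^sub>R (t', w)" by simp
    then have "blinfun_apply ?D (h * t', h *\<^sub>R w) = h * blinfun_apply ?D (t', w)"
      by (metis blinfun.scaleR_right real_scaleR_def)
    then show "(blinfun_apply ?D \<circ> (\<lambda>h. (h * t', h *\<^sub>R w))) h =
      (time_deriv T E (t s) (y s) * t' + space_diff A E (t s) (y s) (velocity A y s)) * h"
      using chart_diff_split[of c _ t' w] by (simp add: sd time_deriv_chart[OF c y(2) ts] algebra_simps)
  qed
  have 2: "((\<lambda>(t, x). E t (chart_inv c x)) \<circ> ?p has_derivative
    (\<lambda>h. (time_deriv T E (t s) (y s) * t' + space_diff A E (t s) (y s) (velocity A y s)) * h)) (at s)"
    using 1 unfolding lin .
  show ?thesis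
    unfolding has_field_derivative_def
    by (rule has_derivative_transform_within_open[OF 2 V]) (use S'(3) inv_map[OF c] in simp)
qed

text \<open>The mean value inequality on a compact convex product, where the continuous differential
  is bounded. It transfers absolute continuity from time and coordinates to the energy.\<close>

lemma energy_chart_lipschitz:
  assumes c: "c \<in> A" and K: "cball x0 r \<subseteq> chart_img c"
  obtains L where "L \<ge> 0" "\<And>t t' x x'. t \<in> {0..T} \<Longrightarrow> t' \<in> {0..T} \<Longrightarrow> x \<in> cball x0 r \<Longrightarrow> x' \<in> cball x0 r \<Longrightarrow>
    \<bar>E t (chart_inv c x) - E t' (chart_inv c x')\<bar> \<le> L * (\<bar>t - t'\<bar> + norm (x - x'))"
proof -
  let ?S = "{0..T} \<times> cball x0 r"
  have sub: "?S \<subseteq> {0..T} \<times> chart_img c" using K by auto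
  have "compact (chart_diff c ` ?S)"
    by (rule compact_continuous_image[OF continuous_on_subset[OF chart_diff_continuous[OF c] sub]]) (intro compact_Times compact_Icc compact_cball)
  then have "bounded (chart_diff c ` ?S)" by (rule compact_imp_bounded)
  then obtain L where Lb: "\<forall>D\<in>chart_diff c ` ?S. norm D \<le> L" unfolding bounded_iff by blast
  have L: "norm (chart_diff c p) \<le> L" if "p \<in> ?S" for p by (rule bspec[OF Lb imageI[OF that]])
  have L': "norm (chart_diff c p) \<le> max L 0" if "p \<in> ?S" for p using L[OF that] by simp
  show ?thesis
  proof (rule that[of "max L 0"])
    fix t t' x x' assume H: "t \<in> {0..T}" "t' \<in> {0..T}" "x \<in> cball x0 r" "x' \<in> cball x0 r"
    have "norm ((\<lambda>(t, x). E t (chart_inv c x)) (t, x) - (\<lambda>(t, x). E t (chart_inv c x)) (t', x')) \<le> max L 0 * norm ((t, x) - (t', x'))"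
    proof (rule differentiable_bound[of ?S])
      show "convex ?S" by (intro convex_Times convex_cball convex_real_interval)
      show "((\<lambda>(t, x). E t (chart_inv c x)) has_derivative blinfun_apply (chart_diff c p)) (at p within ?S)" if "p \<in> ?S" for p
        by (rule has_derivative_subset[OF chart_diff_derivative[OF c] sub]) (use that sub in blast)
      show "onorm (blinfun_apply (chart_diff c p)) \<le> max L 0" if "p \<in> ?S" for p
        using L'[OF that] by (simp add: norm_blinfun.rep_eq)
    qed (use H in auto)
    also have "\<dots> \<le> max L 0 * (\<bar>t - t'\<bar> + norm (x - x'))"
      using norm_Pair_le[of "t - t'" "x - x'"] by (intro mult_left_mono) auto
    finally show "\<bar>E t (chart_inv c x) - E t' (chart_inv c x')\<bar> \<le> max L 0 * (\<bar>t - t'\<bar> + norm (x - x'))" by simp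
  qed simp
qed

text \<open>The pointwise formula alone would not show that \<open>e'\<close> is integrable or that
  it integrates to the increment of the energy. Both follow once the energy along the curve is seen
  to be absolutely continuous on short pieces, where it is locally Lipschitz in time and
  coordinates.\<close>

lemma
  assumes t: "abs_cont_on a b t" "t ` {a..b} \<subseteq> {0..T}" and y: "ac_curve A a b y" and ab: "a \<le> b"
  defines "e' \<equiv> \<lambda>s. time_deriv T E (t s) (y s) * deriv t s + space_diff A E (t s) (y s) (velocity A y s)"
  shows energy_derivative: "\<exists>N. negligible N \<and> (\<forall>s\<in>{a<..<b} - N. ((\<lambda>r. E (t r) (y r)) has_real_derivative e' s) (at s))"
    and energy_integrable: "e' absolutely_integrable_on {a..b}"
    and energy_integral: "(e' has_integral (E (t b) (y b) - E (t a) (y a))) {a..b}"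
proof -
  have yc: "continuous_on {a..b} y" using y unfolding ac_curve_def by blast
  obtain Nt where Nt: "negligible Nt" "\<forall>s\<in>{a<..<b} - Nt. (t has_vector_derivative vector_derivative t (at s)) (at s)"
    using abs_cont_on_FTC(1)[OF t(1) ab] by blast
  have td: "(t has_real_derivative deriv t s) (at s)" if "s \<in> {a<..<b} - Nt" for s
    using Nt(2) that by (simp add: has_real_derivative_iff_has_vector_derivative deriv_eq_vector_derivative)
  have tS: "t ` {a<..<b} \<subseteq> {0..T}" using t(2) by (meson greaterThanLessThan_subseteq_atLeastAtMost_iff image_mono order.refl order.trans)
  show ae: "\<exists>N. negligible N \<and> (\<forall>s\<in>{a<..<b} - N. ((\<lambda>r. E (t r) (y r)) has_real_derivative e' s) (at s))"
    using ab
  proof (induction rule: negligible_patching)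
    case (local s)
    then have s: "s \<in> {a..b}" by simp
    obtain c where c: "c \<in> A" "y s \<in> chart_dom c" by (rule chart_cover)
    obtain \<delta> where \<delta>: "\<delta> > 0" "\<forall>u v. a \<le> u \<and> u \<le> s \<and> s \<le> v \<and> v \<le> b \<and> v - u < \<delta> \<longrightarrow> y ` {u..v} \<subseteq> chart_dom c"
      by (rule continuous_local_image[OF yc s open_dom[OF c(1)] c(2)])
    show ?case
    proof (intro exI[of _ \<delta>] conjI \<delta>(1) allI impI)
      fix u v assume "a \<le> u \<and> u \<le> s \<and> s \<le> v \<and> v \<le> b \<and> v - u < \<delta>"
      then have uv: "a \<le> u" "u \<le> v" "v \<le> b" and im: "y ` {u..v} \<subseteq> chart_dom c" using \<delta>(2) by auto
      obtain N where N: "negligible N" "\<forall>r\<in>{u<..<v} - N. ((chart_map c \<circ> y) has_vector_derivative vector_derivative (chart_map c \<circ> y) (at r)) (at r)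
        \<and> speed A R y r = local_norm c (chart_map c (y r)) (vector_derivative (chart_map c \<circ> y) (at r))"
        by (rule speed_in_chart[OF ac_curve_subinterval[OF y uv(1,3)] c(1) im uv(2)])
      show "\<exists>N. negligible N \<and> (\<forall>r\<in>{u<..<v} - N. ((\<lambda>r. E (t r) (y r)) has_real_derivative e' r) (at r))"
      proof (intro exI[of _ "N \<union> Nt"] conjI ballI)
        show "negligible (N \<union> Nt)" using N Nt by simp
        fix r assume r: "r \<in> {u<..<v} - (N \<union> Nt)"
        then have rab: "r \<in> {a<..<b}" using uv by auto
        show "((\<lambda>r. E (t r) (y r)) has_real_derivative e' r) (at r)"
          unfolding e'_def
        proof (rule energy_chain[OF c(1) ac_curve_isCont[OF y rab] _ _ _ open_greaterThanLessThan rab tS])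
          show "y r \<in> chart_dom c" using im r by auto
          show "((chart_map c \<circ> y) has_vector_derivative vector_derivative (chart_map c \<circ> y) (at r)) (at r)" using N(2) r by blast
          show "(t has_real_derivative deriv t r) (at r)" using td rab r by blast
        qed
      qed
    qed
  qed
  then obtain N where N: "negligible N" "\<forall>s\<in>{a<..<b} - N. ((\<lambda>r. E (t r) (y r)) has_real_derivative e' s) (at s)" by blast
  have "e' absolutely_integrable_on {a..b} \<and> (e' has_integral (E (t b) (y b) - E (t a) (y a))) {a..b}"
    using ab
  proof (induction rule: interval_patching)
    case (trans u v w)
    then have "e' absolutely_integrable_on {u..w}" by (intro absolutely_integrable_on_combine[OF _ _ trans(2,3)]) blast+
    moreover have "(e' has_integral (E (t v) (y v) - E (t u) (y u) + (E (t w) (y w) - E (t v) (y v)))) {u..w}"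
      using trans by (intro has_integral_combine[OF trans(2,3)]) blast+
    ultimately show ?case by (simp add: algebra_simps)
  next
    case (local s)
    then have s: "s \<in> {a..b}" by simp
    obtain c where c: "c \<in> A" "y s \<in> chart_dom c" by (rule chart_cover)
    let ?x = "chart_map c \<circ> y"
    obtain r where r: "r > 0" "cball (chart_map c (y s)) r \<subseteq> chart_img c"
      using open_img[OF c(1)] map_mem[OF c] by (meson open_contains_cball)
    obtain L where L: "L \<ge> 0" "\<And>t t' x x'. t \<in> {0..T} \<Longrightarrow> t' \<in> {0..T} \<Longrightarrow> x \<in> cball (chart_map c (y s)) r \<Longrightarrow> x' \<in> cball (chart_map c (y s)) r \<Longrightarrow>
      \<bar>E t (chart_inv c x) - E t' (chart_inv c x')\<bar> \<le> L * (\<bar>t - t'\<bar> + norm (x - x'))"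
      using energy_chart_lipschitz[OF c(1) r(2)] by metis
    obtain \<delta> where \<delta>: "\<delta> > 0" "\<forall>u v. a \<le> u \<and> u \<le> s \<and> s \<le> v \<and> v \<le> b \<and> v - u < \<delta> \<longrightarrow>
      y ` {u..v} \<subseteq> chart_dom c \<and> (\<forall>r'\<in>{u..v}. chart_map c (y r') \<in> ball (chart_map c (y s)) r)"
      by (rule curve_chart_ball[OF yc s c r(1)])
    show ?case
    proof (intro exI[of _ \<delta>] conjI[OF \<delta>(1)] allI impI)
      fix u v assume uv0: "a \<le> u \<and> u \<le> s \<and> s \<le> v \<and> v \<le> b \<and> v - u < \<delta>"
      then have uv: "a \<le> u" "u \<le> v" "v \<le> b" by auto
      have im: "y ` {u..v} \<subseteq> chart_dom c" "\<And>r'. r' \<in> {u..v} \<Longrightarrow> ?x r' \<in> cball (chart_map c (y s)) r"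
        using \<delta>(2)[rule_format, OF uv0] by (auto simp: less_imp_le)
      have ax: "abs_cont_on u v ?x" by (rule ac_curve_in_chart[OF y c(1) im(1) uv])
      have at: "abs_cont_on u v t" by (rule abs_cont_on_subinterval[OF t(1) uv(1,3)])
      let ?m = "\<lambda>s. L * (norm (vector_derivative t (at s)) + norm (vector_derivative ?x (at s)))"
      let ?e = "\<lambda>r. E (t r) (y r)"
      have e: "abs_cont_on u v ?e"
      proof (rule abs_cont_onI_integral)
        show m: "?m absolutely_integrable_on {u..v}"
          by (intro set_integrable_mult_right impI set_integral_add(1) abs_cont_on_norm_integrable ax at uv(2))
        fix r1 r2 assume r12: "u \<le> r1" "r1 \<le> r2" "r2 \<le> v"
        have tm: "t r1 \<in> {0..T}" "t r2 \<in> {0..T}" using t(2) r12 uv by (auto simp: image_subset_iff)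
        have rm: "r1 \<in> {u..v}" "r2 \<in> {u..v}" using r12 by auto
        have "?e r = E (t r) (chart_inv c (?x r))" if "r \<in> {u..v}" for r
          using inv_map[OF c(1), of "y r"] im(1) that by (auto simp: image_subset_iff)
        then have "norm (?e r2 - ?e r1) \<le> L * (\<bar>t r2 - t r1\<bar> + norm (?x r2 - ?x r1))"
          using L(2)[OF tm(2,1) im(2)[OF rm(2)] im(2)[OF rm(1)]] rm by simp
        also have "\<dots> \<le> L * (integral {r1..r2} (\<lambda>s. norm (vector_derivative t (at s))) + integral {r1..r2} (\<lambda>s. norm (vector_derivative ?x (at s))))"
          using abs_cont_on_norm_le[OF at r12] abs_cont_on_norm_le[OF ax r12] L(1) by (intro mult_left_mono add_mono) auto
        also have "\<dots> = integral {r1..r2} ?m"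
        proof -
          have sub: "{r1..r2} \<subseteq> {u..v}" using r12 by auto
          have "(\<lambda>s. norm (vector_derivative t (at s))) integrable_on {r1..r2}" "(\<lambda>s. norm (vector_derivative ?x (at s))) integrable_on {r1..r2}"
            using absolutely_integrable_on_subinterval[OF abs_cont_on_norm_integrable[OF at uv(2)] sub]
              absolutely_integrable_on_subinterval[OF abs_cont_on_norm_integrable[OF ax uv(2)] sub]
            by (simp_all add: set_lebesgue_integral_eq_integral(1))
          then show ?thesis by (simp add: Henstock_Kurzweil_Integration.integral_add)
        qed
        finally show "norm (?e r2 - ?e r1) \<le> integral {r1..r2} ?m" .
      qed
      have neg: "negligible (N \<union> {u, v})" using N(1) by simp
      have eq: "vector_derivative ?e (at r') = e' r'" if "r' \<in> {u..v} - (N \<union> {u, v})" for r'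
      proof -
        have "r' \<in> {a<..<b} - N" using that uv by auto
        then have "(?e has_vector_derivative e' r') (at r')" using N(2) by (simp add: has_real_derivative_iff_has_vector_derivative)
        then show ?thesis by (rule vector_derivative_at)
      qed
      have "e' absolutely_integrable_on {u..v}"
        by (rule absolutely_integrable_spike[OF abs_cont_on_FTC(2)[OF e uv(2)] neg]) (use eq in simp)
      moreover have "(e' has_integral (?e v - ?e u)) {u..v}"
        by (rule has_integral_spike[OF neg _ abs_cont_on_FTC(3)[OF e uv(2) order.refl uv(2) order.refl]]) (use eq in simp)
      ultimately show "e' absolutely_integrable_on {u..v} \<and> (e' has_integral (?e v - ?e u)) {u..v}" by blast
    qed
  qed
  then show "e' absolutely_integrable_on {a..b}" "(e' has_integral (E (t b) (y b) - E (t a) (y a))) {a..b}" by blast+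
qed

end

section \<open>Weak convergence of nonnegative densities\<close>

lemma AE_lebesgue_iff: "(AE x in lebesgue. P x) \<longleftrightarrow> (\<exists>N. negligible N \<and> (\<forall>x. x \<notin> N \<longrightarrow> P x))"
  unfolding eventually_ae_filter negligible_iff_null_sets by auto

lemma AE_lebesgue_on_iff:
  "S \<in> sets lebesgue \<Longrightarrow> (AE x in lebesgue_on S. P x) \<longleftrightarrow> (\<exists>N. negligible N \<and> (\<forall>x\<in>S - N. P x))"
  by (subst AE_restrict_space_iff) (auto simp: AE_lebesgue_iff)

lemma integral_bound_off_negligible:
  fixes f g :: "'a::euclidean_space \<Rightarrow> real"
  assumes f: "f integrable_on S" and g: "g integrable_on S" and N: "negligible N" "\<And>x. x \<in> S - N \<Longrightarrow> \<bar>f x\<bar> \<le> g x"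
  shows "\<bar>integral S f\<bar> \<le> integral S g"
proof -
  have "integral S f \<le> integral S g"
    by (rule integral_le_off_negligible[OF f g N(1)]) (use N(2) in \<open>simp add: abs_le_iff\<close>)
  moreover have "integral S (\<lambda>x. - f x) \<le> integral S g"
    by (rule integral_le_off_negligible[OF integrable_neg[OF f] g N(1)]) (use N(2) in \<open>simp add: abs_le_iff\<close>)
  ultimately show ?thesis by (simp add: abs_le_iff)
qed

lemma density_nonneg:
  fixes f g :: "real \<Rightarrow> real"
  assumes fg: "\<And>u v. a \<le> u \<Longrightarrow> u \<le> v \<Longrightarrow> v \<le> b \<Longrightarrow> (g has_integral (f v - f u)) {u..v}" and ab: "a \<le> b"
    and mono: "\<And>u v. a \<le> u \<Longrightarrow> u \<le> v \<Longrightarrow> v \<le> b \<Longrightarrow> f u \<le> f v"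
  shows "\<exists>N. negligible N \<and> (\<forall>s\<in>{a<..<b} - N. 0 \<le> g s)"
proof -
  obtain N where N: "negligible N" "\<And>x. x \<in> {a<..<b} - N \<Longrightarrow> (f has_vector_derivative g x) (at x)"
    using indefinite_integral_derivative[OF fg ab] by metis
  have m: "mono_on {a..b} f" using mono by (intro mono_onI) auto
  have "0 \<le> g s" if "s \<in> {a<..<b} - N" for s
    using mono_on_imp_deriv_nonneg[OF m, of "g s" s] N(2)[OF that] that
    by (simp add: has_real_derivative_iff_has_vector_derivative interior_atLeastAtMost_real)
  then show ?thesis using N(1) by blast
qed

context mono_ac
begin

lemma deriv_nonneg: "\<exists>N. negligible N \<and> (\<forall>s\<in>{a..b} - N. 0 \<le> deriv h s)"
proof -
  have "h u \<le> h v" if "a \<le> u" "u \<le> v" "v \<le> b" for u v using mono_onD[OF mono, of u v] that by auto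
  then obtain N where N: "negligible N" "\<forall>s\<in>{a<..<b} - N. 0 \<le> deriv h s"
    using density_nonneg[OF deriv_has_integral ab] by blast
  then show ?thesis by (intro exI[of _ "N \<union> {a, b}"]) auto
qed

end

lemma abs_int_bounded_times:
  fixes f g :: "real \<Rightarrow> real"
  assumes "f absolutely_integrable_on {a..b}" "g \<in> borel_measurable (lebesgue_on {a..b})" "bounded (g ` {a..b})"
  shows "(\<lambda>s. f s * g s) absolutely_integrable_on {a..b}"
  using absolutely_integrable_bounded_measurable_product_real[OF assms(2) _ assms(3,1)] by (simp add: mult.commute)

lemma continuous_measurable_bounded:
  fixes g :: "real \<Rightarrow> real"
  assumes "continuous_on {a..b} g"
  shows "g \<in> borel_measurable (lebesgue_on {a..b})" "bounded (g ` {a..b})"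
proof -
  show "g \<in> borel_measurable (lebesgue_on {a..b})"
    by (rule continuous_imp_measurable_on_sets_lebesgue[OF assms]) simp
  show "bounded (g ` {a..b})"
    by (rule compact_imp_bounded[OF compact_continuous_image[OF assms compact_Icc]])
qed

lemma indicator_measurable_bounded:
  "(indicator {u..v} :: real \<Rightarrow> real) \<in> borel_measurable (lebesgue_on {a..b})" "bounded ((indicator {u..v} :: real \<Rightarrow> real) ` {a..b})"
proof -
  have "(indicator {u..v} :: real \<Rightarrow> real) \<in> borel_measurable lebesgue" by (simp add: borel_measurable_indicator)
  then show "(indicator {u..v} :: real \<Rightarrow> real) \<in> borel_measurable (lebesgue_on {a..b})" by (rule measurable_restrict_space1)
  show "bounded ((indicator {u..v} :: real \<Rightarrow> real) ` {a..b})"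
    by (rule boundedI[of _ 1]) (auto simp: indicator_def)
qed

lemma integral_times_indicator:
  fixes f :: "real \<Rightarrow> real"
  assumes "a \<le> u" "v \<le> b"
  shows "integral {a..b} (\<lambda>s. f s * indicator {u..v} s) = integral {u..v} f"
proof -
  have "(\<lambda>s. f s * indicator {u..v} s) = (\<lambda>s. if s \<in> {u..v} then f s else 0)" by auto
  moreover have "{u..v} \<inter> {a..b} = {u..v}" using assms by auto
  ultimately show ?thesis by (simp only: Henstock_Kurzweil_Integration.integral_restrict_Int)
qed

section \<open>Weakly convergent majorants\<close>

text \<open>The role of \<open>m\<close> is played by the total densities of time plus arc length.
  Test functions are bounded everywhere on the interval; essential bounds are reduced to this case
  by truncation where needed.\<close>

locale weak_majorant =
  fixes a b :: real and m :: "nat \<Rightarrow> real \<Rightarrow> real" and ml :: "real \<Rightarrow> real"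
  assumes ab: "a \<le> b"
    and mi: "\<And>n. m n absolutely_integrable_on {a..b}" and mli: "ml absolutely_integrable_on {a..b}"
    and mw: "\<And>g. g \<in> borel_measurable (lebesgue_on {a..b}) \<Longrightarrow> bounded (g ` {a..b}) \<Longrightarrow>
      (\<lambda>n. integral {a..b} (\<lambda>s. m n s * g s)) \<longlonglongrightarrow> integral {a..b} (\<lambda>s. ml s * g s)"
    and m0: "\<And>n. \<exists>N. negligible N \<and> (\<forall>s\<in>{a..b} - N. 0 \<le> m n s)"
begin

lemma m_integrable: "a \<le> u \<Longrightarrow> v \<le> b \<Longrightarrow> m n integrable_on {u..v}"
  by (rule set_lebesgue_integral_eq_integral(1)[OF absolutely_integrable_on_subinterval[OF mi]]) auto

lemma ml_integrable: "a \<le> u \<Longrightarrow> v \<le> b \<Longrightarrow> ml integrable_on {u..v}"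
  by (rule set_lebesgue_integral_eq_integral(1)[OF absolutely_integrable_on_subinterval[OF mli]]) auto

lemma m_interval_limit: "a \<le> u \<Longrightarrow> v \<le> b \<Longrightarrow> (\<lambda>n. integral {u..v} (m n)) \<longlonglongrightarrow> integral {u..v} ml"
  using mw[OF indicator_measurable_bounded, of u v] by (simp add: integral_times_indicator)

lemma m_integral_mono:
  assumes "a \<le> u'" "u' \<le> u" "u \<le> v" "v \<le> v'" "v' \<le> b"
  shows "integral {u..v} (m n) \<le> integral {u'..v'} (m n)" "0 \<le> integral {u..v} (m n)"
proof -
  obtain N where N: "negligible N" "\<forall>s\<in>{a..b} - N. 0 \<le> m n s" using m0[of n] by (elim exE conjE)
  have nn: "0 \<le> integral {x..y} (m n)" if "a \<le> x" "x \<le> y" "y \<le> b" for x y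
  proof -
    have "integral {x..y} (\<lambda>_. 0) \<le> integral {x..y} (m n)"
    proof (rule integral_le_off_negligible[OF integrable_0 m_integrable[OF that(1,3)] N(1)])
      fix s assume "s \<in> {x..y} - N"
      then have "s \<in> {a..b} - N" using that by auto
      then show "0 \<le> m n s" by (rule bspec[OF N(2)])
    qed
    then show ?thesis by simp
  qed
  have "integral {u'..u} (m n) + integral {u..v} (m n) = integral {u'..v} (m n)"
    by (rule Henstock_Kurzweil_Integration.integral_combine) (use assms m_integrable in auto)
  moreover have "integral {u'..v} (m n) + integral {v..v'} (m n) = integral {u'..v'} (m n)"
    by (rule Henstock_Kurzweil_Integration.integral_combine) (use assms m_integrable in auto)
  ultimately show "integral {u..v} (m n) \<le> integral {u'..v'} (m n)"
    using nn[of u' u] nn[of v v'] assms by simp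
  show "0 \<le> integral {u..v} (m n)" using nn assms by simp
qed

text \<open>No Dunford--Pettis argument is needed: the monotone primitives converge pointwise to a continuous limit.\<close>

lemma m_equicontinuous:
  assumes e: "e > 0"
  shows "\<exists>\<delta>>0. \<forall>\<^sub>F n in sequentially. \<forall>u v. a \<le> u \<longrightarrow> u \<le> v \<longrightarrow> v \<le> b \<longrightarrow> v - u < \<delta> \<longrightarrow> integral {u..v} (m n) < e"
proof -
  define F where "F t = integral {a..t} ml" for t
  have FI: "integral {u..v} ml = F v - F u" if "a \<le> u" "u \<le> v" "v \<le> b" for u v
    using Henstock_Kurzweil_Integration.integral_combine[OF that(1,2) ml_integrable[OF order.refl that(3)]] by (simp add: F_def)
  have Fc: "continuous_on {a..b} F" unfolding F_def by (rule indefinite_integral_continuous_1[OF ml_integrable]) auto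
  define Fn where "Fn n t = integral {a..t} (m n)" for n t
  have FnI: "integral {u..v} (m n) = Fn n v - Fn n u" if "a \<le> u" "u \<le> v" "v \<le> b" for u v n
    using Henstock_Kurzweil_Integration.integral_combine[OF that(1,2) m_integrable[OF order.refl that(3), of n]]
    unfolding Fn_def by linarith
  have Fn_mono: "Fn n u \<le> Fn n v" if "a \<le> u" "u \<le> v" "v \<le> b" for n u v
    using FnI[OF that, of n] m_integral_mono(2)[of u u v v n] that by simp
  have FnF: "(\<lambda>n. Fn n t) \<longlonglongrightarrow> F t" if "t \<in> {a..b}" for t
    unfolding Fn_def F_def using that by (intro m_interval_limit) auto
  \<comment> \<open>On a short interval around \<open>x\<close> each primitive lies between its two
    end values, which are \<open>e/16\<close>-close to those of \<open>F\<close>, and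
    \<open>F\<close> itself stays within \<open>e/16\<close> of \<open>F x\<close>. So two pointwise
    limits control the whole interval.\<close>
  have "\<forall>\<^sub>F n in sequentially. \<forall>r\<in>{a..b}. \<bar>Fn n r - F r\<bar> < e/4"
    using ab
  proof (induction rule: interval_patching)
    case (trans u v w)
    from trans(5,6) show ?case
      by eventually_elim (metis atLeastAtMost_iff linorder_linear)
  next
    case (local x)
    have "e/16 > 0" using e by simp
    then obtain \<delta> where \<delta>: "\<delta> > 0" "\<forall>t\<in>{a..b}. dist t x < \<delta> \<longrightarrow> dist (F t) (F x) < e/16"
      using Fc local unfolding continuous_on_iff by (metis atLeastAtMost_iff)
    show ?case
    proof (rule exI[of _ \<delta>], intro conjI \<delta>(1) allI impI)
      fix u v assume uv: "a \<le> u \<and> u \<le> x \<and> x \<le> v \<and> v \<le> b \<and> v - u < \<delta>"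
      have "\<forall>\<^sub>F n in sequentially. dist (Fn n u) (F u) < e/16" "\<forall>\<^sub>F n in sequentially. dist (Fn n v) (F v) < e/16"
        by (rule tendstoD[OF FnF \<open>e/16 > 0\<close>], use uv in force)+
      then show "\<forall>\<^sub>F n in sequentially. \<forall>r\<in>{u..v}. \<bar>Fn n r - F r\<bar> < e/4"
      proof eventually_elim
        case (elim n)
        show ?case
        proof
          fix r assume r: "r \<in> {u..v}"
          have "Fn n u \<le> Fn n r" "Fn n r \<le> Fn n v" using r uv by (auto intro!: Fn_mono)
          moreover have H: "dist (F t) (F x) < e/16" if "t \<in> {a..b}" "dist t x < \<delta>" for t
            using \<delta>(2) that by blast
          have "dist (F u) (F x) < e/16" "dist (F v) (F x) < e/16" "dist (F r) (F x) < e/16"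
            by (rule H; use uv r in \<open>force simp: dist_real_def\<close>)+
          ultimately show "\<bar>Fn n r - F r\<bar> < e/4"
            using elim \<open>dist (F u) (F x) < e/16\<close> \<open>dist (F v) (F x) < e/16\<close> \<open>dist (F r) (F x) < e/16\<close> unfolding dist_real_def abs_less_iff by linarith
        qed
      qed
    qed
  qed
  then obtain N where N: "\<And>n r. n \<ge> N \<Longrightarrow> r \<in> {a..b} \<Longrightarrow> \<bar>Fn n r - F r\<bar> < e/4" unfolding eventually_sequentially by blast
  have "uniformly_continuous_on {a..b} F" using Fc compact_uniformly_continuous by blast
  then obtain \<delta> where \<delta>: "\<delta> > 0" "\<And>u v. u \<in> {a..b} \<Longrightarrow> v \<in> {a..b} \<Longrightarrow> dist v u < \<delta> \<Longrightarrow> dist (F v) (F u) < e/4"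
    using e unfolding uniformly_continuous_on_def by (metis zero_less_divide_iff zero_less_numeral)
  show ?thesis
  proof (rule exI[of _ \<delta>], intro conjI \<delta>(1))
    have "integral {u..v} (m n) < e" if "n \<ge> N" "a \<le> u" "u \<le> v" "v \<le> b" "v - u < \<delta>" for n u v
    proof -
      have "\<bar>Fn n u - F u\<bar> < e/4" "\<bar>Fn n v - F v\<bar> < e/4" using N[of n] that by auto
      moreover have "dist (F v) (F u) < e/4" using that by (intro \<delta>(2)) (auto simp: dist_real_def)
      ultimately show ?thesis using FnI[OF that(2-4), of n] e unfolding dist_real_def abs_less_iff by linarith
    qed
    then show "\<forall>\<^sub>F n in sequentially. \<forall>u v. a \<le> u \<longrightarrow> u \<le> v \<longrightarrow> v \<le> b \<longrightarrow> v - u < \<delta> \<longrightarrow> integral {u..v} (m n) < e"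
      unfolding eventually_sequentially by blast
  qed
qed

section \<open>From integrals over intervals to weak convergence\<close>

context
  fixes f :: "nat \<Rightarrow> real \<Rightarrow> real" and fl :: "real \<Rightarrow> real"
  assumes fi: "\<And>n. f n absolutely_integrable_on {a..b}" and fli: "fl absolutely_integrable_on {a..b}"
    and fm: "\<And>n. \<exists>N. negligible N \<and> (\<forall>s\<in>{a..b} - N. \<bar>f n s\<bar> \<le> m n s)"
    and flm: "\<exists>N. negligible N \<and> (\<forall>s\<in>{a..b} - N. \<bar>fl s\<bar> \<le> ml s)"
    and conv: "\<And>u v. a \<le> u \<Longrightarrow> u \<le> v \<Longrightarrow> v \<le> b \<Longrightarrow> (\<lambda>n. integral {u..v} (f n)) \<longlonglongrightarrow> integral {u..v} fl"
begin

text \<open>On short intervals \<open>g\<close> is almost constant, and there convergence of the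
  interval integrals suffices. The error is at most \<open>e\<close> times the mass of the
  majorants, which is additive over the pieces.\<close>

lemma weak_limit_continuous:
  fixes g :: "real \<Rightarrow> real"
  assumes g: "continuous_on {a..b} g"
  shows "(\<lambda>n. integral {a..b} (\<lambda>s. f n s * g s)) \<longlonglongrightarrow> integral {a..b} (\<lambda>s. fl s * g s)"
proof -
  have fg: "(\<lambda>s. k s * g s) integrable_on {u..v}" "k integrable_on {u..v}" if "k absolutely_integrable_on {a..b}" "a \<le> u" "v \<le> b" for k u v
  proof -
    have "(\<lambda>s. k s * g s) absolutely_integrable_on {a..b}" by (rule abs_int_bounded_times[OF that(1) continuous_measurable_bounded[OF g]])
    then have "(\<lambda>s. k s * g s) absolutely_integrable_on {u..v}" "k absolutely_integrable_on {u..v}"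
      using that by (auto intro: absolutely_integrable_on_subinterval)
    then show "(\<lambda>s. k s * g s) integrable_on {u..v}" "k integrable_on {u..v}" by (simp_all add: set_lebesgue_integral_eq_integral(1))
  qed
  \<comment> \<open>The slack \<open>e2\<close> is quantified inside the statement so that it can be
    halved at each joining. The term with the factor \<open>e\<close> is already additive over
    adjacent intervals and is not shared out.\<close>
  have main: "\<forall>e2>0. \<forall>\<^sub>F n in sequentially. \<bar>integral {a..b} (\<lambda>s. f n s * g s) - integral {a..b} (\<lambda>s. fl s * g s)\<bar>
    \<le> e * (integral {a..b} (m n) + integral {a..b} ml) + e2" if e: "e > 0" for e
    using ab
  proof (induction rule: interval_patching)
    case (trans u v w)
    show ?case
    proof (intro allI impI)
      fix e2 :: real assume "e2 > 0"
      then have "e2/2 > 0" by simp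
      have uvw: "a \<le> u" "u \<le> v" "v \<le> w" "w \<le> b" "a \<le> v" "v \<le> b" using trans by auto
      from trans(5)[rule_format, OF \<open>e2/2 > 0\<close>] trans(6)[rule_format, OF \<open>e2/2 > 0\<close>]
      show "\<forall>\<^sub>F n in sequentially. \<bar>integral {u..w} (\<lambda>s. f n s * g s) - integral {u..w} (\<lambda>s. fl s * g s)\<bar>
        \<le> e * (integral {u..w} (m n) + integral {u..w} ml) + e2"
      proof eventually_elim
        case (elim n)
        have "integral {u..v} k + integral {v..w} k = integral {u..w} k" if "k integrable_on {u..w}" for k :: "real \<Rightarrow> real"
          by (rule Henstock_Kurzweil_Integration.integral_combine[OF uvw(2,3) that])
        then have c: "integral {u..w} (\<lambda>s. f n s * g s) = integral {u..v} (\<lambda>s. f n s * g s) + integral {v..w} (\<lambda>s. f n s * g s)"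
          "integral {u..w} (\<lambda>s. fl s * g s) = integral {u..v} (\<lambda>s. fl s * g s) + integral {v..w} (\<lambda>s. fl s * g s)"
          "integral {u..w} (m n) = integral {u..v} (m n) + integral {v..w} (m n)"
          "integral {u..w} ml = integral {u..v} ml + integral {v..w} ml"
          using fg[OF fi uvw(1,4)] fg[OF fli uvw(1,4)] m_integrable[OF uvw(1,4)] ml_integrable[OF uvw(1,4)] by metis+
        show ?case using elim unfolding c by (simp add: distrib_left)
      qed
    qed
  next
    case (local x)
    obtain \<delta> where \<delta>: "\<delta> > 0" "\<forall>t\<in>{a..b}. dist t x < \<delta> \<longrightarrow> dist (g t) (g x) < e"
      using g local e unfolding continuous_on_iff by (metis atLeastAtMost_iff)
    show ?case
    proof (rule exI[of _ \<delta>], rule conjI[OF \<delta>(1)], intro allI impI)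
      fix u v and e2 :: real assume uv0: "a \<le> u \<and> u \<le> x \<and> x \<le> v \<and> v \<le> b \<and> v - u < \<delta>" and e2: "e2 > 0"
      then have uv: "a \<le> u" "u \<le> v" "v \<le> b" by auto
      have gx: "\<bar>g s - g x\<bar> \<le> e" if "s \<in> {u..v}" for s
      proof -
        have "s \<in> {a..b}" "dist s x < \<delta>" using that uv0 by (auto simp: dist_real_def)
        then show ?thesis using \<delta>(2) by (auto simp: dist_real_def intro: less_imp_le)
      qed
      have b: "\<bar>integral {u..v} (\<lambda>s. k s * g s) - g x * integral {u..v} k\<bar> \<le> e * integral {u..v} M"
        if k: "k absolutely_integrable_on {a..b}" "M integrable_on {u..v}" and N: "negligible N" "\<forall>s\<in>{a..b} - N. \<bar>k s\<bar> \<le> M s" for k M N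
      proof -
        have 1: "(\<lambda>s. k s * g s) integrable_on {u..v}" "(\<lambda>s. g x * k s) integrable_on {u..v}"
          using fg[OF k(1) uv(1,3)] by (auto intro: integrable_on_mult_right)
        have "integral {u..v} (\<lambda>s. k s * g s) - g x * integral {u..v} k = integral {u..v} (\<lambda>s. k s * g s - g x * k s)"
          using Henstock_Kurzweil_Integration.integral_diff[OF 1] by simp
        also have "\<bar>\<dots>\<bar> \<le> integral {u..v} (\<lambda>s. e * M s)"
        proof (rule integral_bound_off_negligible[OF integrable_diff[OF 1] integrable_on_mult_right[OF k(2)] N(1)])
          fix s assume s: "s \<in> {u..v} - N"
          then have "\<bar>k s\<bar> \<le> M s" using N(2) uv by auto
          moreover have "\<bar>k s * g s - g x * k s\<bar> = \<bar>g s - g x\<bar> * \<bar>k s\<bar>" by (simp add: algebra_simps flip: abs_mult)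
          ultimately show "\<bar>k s * g s - g x * k s\<bar> \<le> e * M s" using gx[of s] s e by (auto intro!: mult_mono)
        qed
        finally show ?thesis by simp
      qed
      have "(\<lambda>n. g x * integral {u..v} (f n)) \<longlonglongrightarrow> g x * integral {u..v} fl"
        by (intro tendsto_intros conv uv)
      then have "\<forall>\<^sub>F n in sequentially. dist (g x * integral {u..v} (f n)) (g x * integral {u..v} fl) < e2" using e2 by (rule tendstoD)
      then show "\<forall>\<^sub>F n in sequentially. \<bar>integral {u..v} (\<lambda>s. f n s * g s) - integral {u..v} (\<lambda>s. fl s * g s)\<bar>
        \<le> e * (integral {u..v} (m n) + integral {u..v} ml) + e2"
      proof eventually_elim
        case (elim n)
        obtain N1 where N1: "negligible N1" "\<forall>s\<in>{a..b} - N1. \<bar>f n s\<bar> \<le> m n s" using fm by blast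
        obtain N2 where N2: "negligible N2" "\<forall>s\<in>{a..b} - N2. \<bar>fl s\<bar> \<le> ml s" using flm by blast
        have "\<bar>integral {u..v} (\<lambda>s. f n s * g s) - g x * integral {u..v} (f n)\<bar> \<le> e * integral {u..v} (m n)"
          by (rule b[OF fi m_integrable[OF uv(1,3)] N1])
        moreover have "\<bar>integral {u..v} (\<lambda>s. fl s * g s) - g x * integral {u..v} fl\<bar> \<le> e * integral {u..v} ml"
          by (rule b[OF fli ml_integrable[OF uv(1,3)] N2])
        ultimately show ?case using elim unfolding dist_real_def distrib_left abs_less_iff abs_le_iff by linarith
      qed
    qed
  qed
  have ml0: "0 \<le> integral {a..b} ml"
    using m_interval_limit[OF order.refl order.refl] m_integral_mono(2)[of a a b b] ab by (intro LIMSEQ_le_const) auto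
  show ?thesis
  proof (rule tendstoI)
    fix e :: real assume e: "e > 0"
    define L where "L = 2 * integral {a..b} ml + 1"
    have L: "L > 0" using ml0 by (simp add: L_def)
    define e1 where "e1 = e / (4 * L)"
    have e1: "e1 > 0" using e L by (simp add: e1_def)
    have "\<forall>\<^sub>F n in sequentially. dist (integral {a..b} (m n)) (integral {a..b} ml) < 1"
      by (rule tendstoD[OF m_interval_limit]) auto
    moreover have "\<forall>\<^sub>F n in sequentially. \<bar>integral {a..b} (\<lambda>s. f n s * g s) - integral {a..b} (\<lambda>s. fl s * g s)\<bar>
      \<le> e1 * (integral {a..b} (m n) + integral {a..b} ml) + e/4" using main[OF e1] e by auto
    ultimately show "\<forall>\<^sub>F n in sequentially. dist (integral {a..b} (\<lambda>s. f n s * g s)) (integral {a..b} (\<lambda>s. fl s * g s)) < e"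
    proof eventually_elim
      case (elim n)
      have "e1 * (integral {a..b} (m n) + integral {a..b} ml) \<le> e1 * L"
        using elim(1) e1 by (intro mult_left_mono) (auto simp: L_def dist_real_def)
      also have "\<dots> = e/4" using L by (simp add: e1_def)
      finally show ?case using elim(2) e unfolding dist_real_def by linarith
    qed
  qed
qed

text \<open>Continuous \<open>G k\<close> approximate \<open>g\<close> almost everywhere, and the
  error is dominated by \<open>m n * \<bar>g - G k\<bar>\<close>. The function
  \<open>\<bar>g - G k\<bar>\<close> is itself an admissible test function, so for fixed
  \<open>k\<close> this error converges as \<open>n\<close> grows, and its limit is small by
  dominated convergence.\<close>

lemma weak_limit_bounded:
  fixes g :: "real \<Rightarrow> real"
  assumes g: "g \<in> borel_measurable (lebesgue_on {a..b})" and C: "\<And>s. \<bar>g s\<bar> \<le> C"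
  shows "(\<lambda>n. integral {a..b} (\<lambda>s. f n s * g s)) \<longlonglongrightarrow> integral {a..b} (\<lambda>s. fl s * g s)"
proof -
  have "g measurable_on {a..b}" by (rule measurable_on_iff_borel_measurable[THEN iffD2, OF _ g]) simp
  then obtain N g' where N: "negligible N" and g': "\<And>n. continuous_on UNIV (g' n)"
    "\<And>x. x \<notin> N \<Longrightarrow> (\<lambda>n. g' n x) \<longlonglongrightarrow> (if x \<in> {a..b} then g x else 0)"
    unfolding measurable_on_def by blast
  \<comment> \<open>Clipping at \<open>C\<close> preserves continuity and the limit
    \<open>g\<close>, and it provides the common bound needed for dominated convergence.\<close>
  define G where "G k x = max (- C) (min C (g' k x))" for k :: nat and x
  have C0: "0 \<le> C" using C[of 0] by linarith
  have Gc: "continuous_on {a..b} (G k)" for k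
    unfolding G_def by (intro continuous_intros continuous_on_subset[OF g'(1)]) auto
  have Gb: "\<bar>G k x\<bar> \<le> C" for k x unfolding G_def using C0 by (auto simp: abs_le_iff)
  have Glim: "(\<lambda>k. G k x) \<longlonglongrightarrow> g x" if "x \<in> {a..b}" "x \<notin> N" for x
  proof -
    have "(\<lambda>k. G k x) \<longlonglongrightarrow> max (- C) (min C (g x))"
      unfolding G_def using g'(2)[OF that(2)] that(1) by (intro tendsto_max tendsto_min tendsto_const) simp
    moreover have "max (- C) (min C (g x)) = g x" using C[of x] by (auto simp: abs_le_iff)
    ultimately show ?thesis by simp
  qed
  have gb: "bounded (g ` {a..b})" using C by (intro boundedI[of _ C]) auto
  have diff: "(\<lambda>s. \<bar>g s - G k s\<bar>) \<in> borel_measurable (lebesgue_on {a..b})" "bounded ((\<lambda>s. \<bar>g s - G k s\<bar>) ` {a..b})" for k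
  proof -
    show "(\<lambda>s. \<bar>g s - G k s\<bar>) \<in> borel_measurable (lebesgue_on {a..b})"
      using g continuous_measurable_bounded(1)[OF Gc[of k]] by (intro borel_measurable_abs borel_measurable_diff)
    have "\<bar>\<bar>g s - G k s\<bar>\<bar> \<le> 2 * C" for s using C[of s] Gb[of k s] by linarith
    then show "bounded ((\<lambda>s. \<bar>g s - G k s\<bar>) ` {a..b})" by (intro boundedI[of _ "2 * C"]) auto
  qed
  have mlabs: "(\<lambda>s. 2 * C * \<bar>ml s\<bar>) integrable_on {a..b}"
    using absolutely_integrable_abs[OF mli] by (intro integrable_on_mult_right) (simp add: set_lebesgue_integral_eq_integral(1))
  have lim0: "(\<lambda>k. integral {a..b} (\<lambda>s. ml s * \<bar>g s - G k s\<bar>)) \<longlonglongrightarrow> 0"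
  proof -
    let ?h = "\<lambda>k s. if s \<in> N then 0 else ml s * \<bar>g s - G k s\<bar>"
    have eq: "integral {a..b} (\<lambda>s. ml s * \<bar>g s - G k s\<bar>) = integral {a..b} (?h k)" for k
      by (rule integral_spike[OF N]) auto
    have hi: "?h k integrable_on {a..b}" for k
      by (rule integrable_spike[OF _ N]) (use abs_int_bounded_times[OF mli diff] in \<open>auto simp: set_lebesgue_integral_eq_integral(1)\<close>)
    have "(\<lambda>k. integral {a..b} (?h k)) \<longlonglongrightarrow> integral {a..b} (\<lambda>_. 0)"
    proof (rule dominated_convergence(2)[OF hi mlabs])
      show "norm (?h k s) \<le> 2 * C * \<bar>ml s\<bar>" for k s
      proof -
        have "\<bar>g s - G k s\<bar> \<le> 2 * C" using C[of s] Gb[of k s] by linarith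
        then have "\<bar>ml s\<bar> * \<bar>g s - G k s\<bar> \<le> \<bar>ml s\<bar> * (2 * C)" by (rule mult_left_mono) simp
        then show ?thesis using C0 by (auto simp: abs_mult mult.commute)
      qed
      fix s assume s: "s \<in> {a..b}"
      show "(\<lambda>k. ?h k s) \<longlonglongrightarrow> 0"
      proof (cases "s \<in> N")
        case False
        have "(\<lambda>k. ml s * \<bar>g s - G k s\<bar>) \<longlonglongrightarrow> ml s * \<bar>g s - g s\<bar>" by (intro tendsto_intros Glim s False)
        then show ?thesis using False by simp
      qed simp
    qed
    then show ?thesis unfolding eq by simp
  qed
  have near: "\<bar>integral {a..b} (\<lambda>s. k s * g s) - integral {a..b} (\<lambda>s. k s * G j s)\<bar> \<le> integral {a..b} (\<lambda>s. M s * \<bar>g s - G j s\<bar>)"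
    if k: "k absolutely_integrable_on {a..b}" "M absolutely_integrable_on {a..b}" and Z: "negligible Z" "\<forall>s\<in>{a..b} - Z. \<bar>k s\<bar> \<le> M s" for k M Z j
  proof -
    have 1: "(\<lambda>s. k s * g s) integrable_on {a..b}" "(\<lambda>s. k s * G j s) integrable_on {a..b}" "(\<lambda>s. M s * \<bar>g s - G j s\<bar>) integrable_on {a..b}"
      using abs_int_bounded_times[OF k(1) g gb] abs_int_bounded_times[OF k(1) continuous_measurable_bounded[OF Gc]] abs_int_bounded_times[OF k(2) diff]
      by (auto simp: set_lebesgue_integral_eq_integral(1))
    have "integral {a..b} (\<lambda>s. k s * g s) - integral {a..b} (\<lambda>s. k s * G j s) = integral {a..b} (\<lambda>s. k s * g s - k s * G j s)"
      using Henstock_Kurzweil_Integration.integral_diff[OF 1(1,2)] by simp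
    also have "\<bar>\<dots>\<bar> \<le> integral {a..b} (\<lambda>s. M s * \<bar>g s - G j s\<bar>)"
    proof (rule integral_bound_off_negligible[OF integrable_diff[OF 1(1,2)] 1(3) Z(1)])
      fix s assume s: "s \<in> {a..b} - Z"
      have "\<bar>k s * g s - k s * G j s\<bar> = \<bar>k s\<bar> * \<bar>g s - G j s\<bar>" by (simp add: right_diff_distrib flip: abs_mult)
      then show "\<bar>k s * g s - k s * G j s\<bar> \<le> M s * \<bar>g s - G j s\<bar>" using Z(2) s by (auto intro!: mult_right_mono)
    qed
    finally show ?thesis .
  qed
  show ?thesis
  proof (rule tendstoI)
    fix e :: real assume e: "e > 0"
    then have e3: "e/3 > 0" by simp
    obtain j where j: "dist (integral {a..b} (\<lambda>s. ml s * \<bar>g s - G j s\<bar>)) 0 < e/3"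
      using tendstoD[OF lim0 e3] unfolding eventually_sequentially by blast
    obtain N2 where N2: "negligible N2" "\<forall>s\<in>{a..b} - N2. \<bar>fl s\<bar> \<le> ml s" using flm by blast
    have "\<forall>\<^sub>F n in sequentially. integral {a..b} (\<lambda>s. m n s * \<bar>g s - G j s\<bar>) < e/3"
    proof (rule order_tendstoD(2)[OF mw[OF diff]])
      show "integral {a..b} (\<lambda>s. ml s * \<bar>g s - G j s\<bar>) < e/3" using j unfolding dist_real_def by linarith
    qed
    moreover have "\<forall>\<^sub>F n in sequentially. dist (integral {a..b} (\<lambda>s. f n s * G j s)) (integral {a..b} (\<lambda>s. fl s * G j s)) < e/3"
      by (rule tendstoD[OF weak_limit_continuous[OF Gc] e3])
    ultimately show "\<forall>\<^sub>F n in sequentially. dist (integral {a..b} (\<lambda>s. f n s * g s)) (integral {a..b} (\<lambda>s. fl s * g s)) < e"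
    proof eventually_elim
      case (elim n)
      obtain N1 where N1: "negligible N1" "\<forall>s\<in>{a..b} - N1. \<bar>f n s\<bar> \<le> m n s" using fm by blast
      show ?case using near[OF fi mi N1, of j] near[OF fli mli N2, of j] elim j unfolding dist_real_def by linarith
    qed
  qed
qed

end

end

lemma weak_L1_limit_filterlim:
  assumes "weak_L1_limit a b f l F" "filterlim r F G"
  shows "weak_L1_limit a b (\<lambda>i. f (r i)) l G"
  using assms unfolding weak_L1_limit_def
  by (auto dest: filterlim_compose intro: eventually_compose_filterlim)

lemma weak_majorantI:
  fixes f :: "nat \<Rightarrow> real \<Rightarrow> real"
  assumes ab: "a \<le> b" and w: "weak_L1_limit a b f l sequentially"
    and fi: "\<And>n. f n absolutely_integrable_on {a..b}"
    and f0: "\<And>n. \<exists>N. negligible N \<and> (\<forall>s\<in>{a..b} - N. 0 \<le> f n s)"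
  shows "weak_majorant a b f l"
proof (rule weak_majorant.intro[OF ab fi _ _ f0])
  show "l absolutely_integrable_on {a..b}" using w unfolding weak_L1_limit_def by blast
  fix g :: "real \<Rightarrow> real"
  assume g: "g \<in> borel_measurable (lebesgue_on {a..b})" "bounded (g ` {a..b})"
  obtain C where C: "\<forall>x\<in>g ` {a..b}. norm x \<le> C" using g(2) unfolding bounded_iff by blast
  have "AE s in lebesgue_on {a..b}. norm (g s) \<le> C"
    by (rule AE_I2) (use C in auto)
  then have "(\<lambda>n. integral {a..b} (\<lambda>s. f n s \<bullet> g s)) \<longlonglongrightarrow> integral {a..b} (\<lambda>s. l s \<bullet> g s)"
    using w g(1) unfolding weak_L1_limit_def by blast
  then show "(\<lambda>n. integral {a..b} (\<lambda>s. f n s * g s)) \<longlonglongrightarrow> integral {a..b} (\<lambda>s. l s * g s)" by simp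
qed

text \<open>Testing with the constant 1 bounds the masses of the nonnegative \<open>f n\<close>, so
  replacing \<open>h n\<close> by its uniform limit costs at most this bound times the uniform
  distance.\<close>

lemma weak_times_uniform:
  fixes f :: "nat \<Rightarrow> real \<Rightarrow> real" and h :: "nat \<Rightarrow> real \<Rightarrow> real"
  assumes fi: "\<And>n. f n absolutely_integrable_on {a..b}"
    and f0: "\<And>n. \<exists>N. negligible N \<and> (\<forall>s\<in>{a..b} - N. 0 \<le> f n s)"
    and fw: "\<And>g. g \<in> borel_measurable (lebesgue_on {a..b}) \<Longrightarrow> bounded (g ` {a..b}) \<Longrightarrow>
      (\<lambda>n. integral {a..b} (\<lambda>s. f n s * g s)) \<longlonglongrightarrow> integral {a..b} (\<lambda>s. fl s * g s)"
    and hc: "\<And>n. continuous_on {a..b} (h n)" and hlc: "continuous_on {a..b} hl"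
    and unif: "\<And>e. e > 0 \<Longrightarrow> \<forall>\<^sub>F n in sequentially. \<forall>s\<in>{a..b}. \<bar>h n s - hl s\<bar> < e"
  shows "(\<lambda>n. integral {a..b} (\<lambda>s. f n s * h n s)) \<longlonglongrightarrow> integral {a..b} (\<lambda>s. fl s * hl s)"
proof -
  have one: "(\<lambda>_::real. 1::real) \<in> borel_measurable (lebesgue_on {a..b})" "bounded ((\<lambda>_::real. 1::real) ` {a..b})"
    by (auto intro!: boundedI[of _ 1])
  have lim1: "(\<lambda>n. integral {a..b} (f n)) \<longlonglongrightarrow> integral {a..b} fl" using fw[OF one] by simp
  obtain B where B: "\<And>n. \<bar>integral {a..b} (f n)\<bar> \<le> B" "B > 0"
    using convergent_imp_Bseq[OF convergentI[OF lim1]] unfolding Bseq_def by auto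
  have "(\<lambda>n. integral {a..b} (\<lambda>s. f n s * h n s) - integral {a..b} (\<lambda>s. f n s * hl s)) \<longlonglongrightarrow> 0"
  proof (rule tendstoI)
    fix e :: real assume e: "e > 0"
    then have "e / (2 * B) > 0" using B(2) by simp
    from unif[OF this] show "\<forall>\<^sub>F n in sequentially. dist (integral {a..b} (\<lambda>s. f n s * h n s) - integral {a..b} (\<lambda>s. f n s * hl s)) 0 < e"
    proof eventually_elim
      case (elim n)
      obtain N where N: "negligible N" "\<forall>s\<in>{a..b} - N. 0 \<le> f n s" using f0 by blast
      have 1: "(\<lambda>s. f n s * h n s) integrable_on {a..b}" "(\<lambda>s. f n s * hl s) integrable_on {a..b}" "f n integrable_on {a..b}"
        using abs_int_bounded_times[OF fi continuous_measurable_bounded[OF hc]] abs_int_bounded_times[OF fi continuous_measurable_bounded[OF hlc]] fi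
        by (auto simp: set_lebesgue_integral_eq_integral(1))
      have "integral {a..b} (\<lambda>s. f n s * h n s) - integral {a..b} (\<lambda>s. f n s * hl s) = integral {a..b} (\<lambda>s. f n s * h n s - f n s * hl s)"
        using Henstock_Kurzweil_Integration.integral_diff[OF 1(1,2)] by simp
      also have "\<bar>\<dots>\<bar> \<le> integral {a..b} (\<lambda>s. e / (2 * B) * f n s)"
      proof (rule integral_bound_off_negligible[OF integrable_diff[OF 1(1,2)] integrable_on_mult_right[OF 1(3)] N(1)])
        fix s assume s: "s \<in> {a..b} - N"
        have "\<bar>f n s * h n s - f n s * hl s\<bar> = \<bar>h n s - hl s\<bar> * \<bar>f n s\<bar>" by (simp add: algebra_simps flip: abs_mult)
        moreover have "\<bar>h n s - hl s\<bar> * \<bar>f n s\<bar> \<le> e / (2 * B) * \<bar>f n s\<bar>"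
          by (rule mult_right_mono) (use elim s in \<open>simp_all add: less_imp_le del: times_divide_eq_left\<close>)
        moreover have "0 \<le> f n s" using N(2) s by blast
        ultimately show "\<bar>f n s * h n s - f n s * hl s\<bar> \<le> e / (2 * B) * f n s" by simp
      qed
      also have "\<dots> = e / (2 * B) * integral {a..b} (f n)" by simp
      also have "\<dots> \<le> e / (2 * B) * B" using B e by (intro mult_left_mono) (auto simp: abs_le_iff)
      also have "\<dots> < e" using B(2) e by simp
      finally show ?case by (simp add: dist_real_def)
    qed
  qed
  from tendsto_add[OF this fw[OF continuous_measurable_bounded[OF hlc]]] show ?thesis by simp
qed

section \<open>Uniform convergence along curves\<close>

context finsler_space
begin

text \<open>The function is continuous but not uniformly so. Around each point of the limit curve it
  varies little on a product neighbourhood; patching over the compact parameter interval replaces a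
  uniform modulus.\<close>

lemma uniform_composition:
  fixes f :: "real \<Rightarrow> 'q \<Rightarrow> real" and a b :: real
  assumes f: "continuous_on ({0..T} \<times> UNIV) (\<lambda>(t, q). f t q)" and ab: "a \<le> b"
    and t: "continuous_on {a..b} t" and q: "continuous_on {a..b} q"
    and tT: "t ` {a..b} \<subseteq> {0..T}" and tnT: "\<And>n. tn n ` {a..b} \<subseteq> {0..T}"
    and tu: "\<And>e. e > 0 \<Longrightarrow> \<forall>\<^sub>F n in sequentially. \<forall>s\<in>{a..b}. \<bar>tn n s - t s\<bar> < e"
    and qu: "\<And>e. e > 0 \<Longrightarrow> \<forall>\<^sub>F n in sequentially. \<forall>s\<in>{a..b}. d (qn n s) (q s) < e" and e: "e > 0"
  shows "\<forall>\<^sub>F n in sequentially. \<forall>s\<in>{a..b}. \<bar>f (tn n s) (qn n s) - f (t s) (q s)\<bar> < e"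
proof (rule interval_patching[OF ab, where P = "\<lambda>u v. \<forall>\<^sub>F n in sequentially. \<forall>s\<in>{u..v}. \<bar>f (tn n s) (qn n s) - f (t s) (q s)\<bar> < e"])
  fix u v w
  assume "u \<le> v" "v \<le> w" "\<forall>\<^sub>F n in sequentially. \<forall>s\<in>{u..v}. \<bar>f (tn n s) (qn n s) - f (t s) (q s)\<bar> < e"
    "\<forall>\<^sub>F n in sequentially. \<forall>s\<in>{v..w}. \<bar>f (tn n s) (qn n s) - f (t s) (q s)\<bar> < e"
  from this(3,4) show "\<forall>\<^sub>F n in sequentially. \<forall>s\<in>{u..w}. \<bar>f (tn n s) (qn n s) - f (t s) (q s)\<bar> < e"
    by eventually_elim (metis atLeastAtMost_iff linorder_linear)
next
  fix x assume "a \<le> x" "x \<le> b"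
  then have x: "x \<in> {a..b}" by simp
  let ?f = "\<lambda>(t, q). f t q"
  have "t x \<in> {0..T}" using tT x by blast
  then have tx: "(t x, q x) \<in> {0..T} \<times> UNIV" by simp
  have "(?f \<longlongrightarrow> ?f (t x, q x)) (at (t x, q x) within {0..T} \<times> UNIV)" using f tx unfolding continuous_on_def by blast
  then have "\<forall>\<^sub>F p in at (t x, q x) within {0..T} \<times> UNIV. dist (?f p) (?f (t x, q x)) < e/2" using e by (intro tendstoD) auto
  then obtain S where S: "open S" "(t x, q x) \<in> S" "\<And>p. p \<in> S \<Longrightarrow> p \<noteq> (t x, q x) \<Longrightarrow> p \<in> {0..T} \<times> UNIV \<Longrightarrow> dist (?f p) (?f (t x, q x)) < e/2"
    unfolding eventually_at_topological by blast
  obtain U V where UV: "open U" "open V" "t x \<in> U" "q x \<in> V" "U \<times> V \<subseteq> S"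
    using open_prod_elim[OF S(1,2)] by (metis mem_Sigma_iff)
  obtain \<rho>1 where \<rho>1: "\<rho>1 > 0" "\<And>r. dist r (t x) < \<rho>1 \<Longrightarrow> r \<in> U" using UV(1,3) unfolding open_dist by blast
  obtain \<rho>2 where \<rho>2: "\<rho>2 > 0" "\<And>p. d (q x) p < \<rho>2 \<Longrightarrow> p \<in> V" using UV(2,4) unfolding open_iff_d by blast
  have close: "\<bar>f r p - f (t x) (q x)\<bar> < e/2" if "dist r (t x) < \<rho>1" "d (q x) p < \<rho>2" "r \<in> {0..T}" for r p
  proof (cases "(r, p) = (t x, q x)")
    case False
    have "(r, p) \<in> S" using \<rho>1(2)[OF that(1)] \<rho>2(2)[OF that(2)] UV(5) by auto
    then show ?thesis using S(3)[OF _ False] that(3) by (simp add: dist_real_def)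
  qed (use e in simp)
  have "\<rho>1/2 > 0" using \<rho>1 by simp
  then obtain d1 where d1: "d1 > 0" "\<forall>s\<in>{a..b}. dist s x < d1 \<longrightarrow> dist (t s) (t x) < \<rho>1/2"
    using t x unfolding continuous_on_iff by blast
  have "((\<lambda>s. d (q s) (q x)) \<longlongrightarrow> 0) (at x within {a..b})"
    using q x unfolding continuous_on_def tendsto_iff_d by blast
  then have "\<forall>\<^sub>F s in at x within {a..b}. dist (d (q s) (q x)) 0 < \<rho>2/2" using \<rho>2(1) by (intro tendstoD) auto
  then obtain d2 where d2: "d2 > 0" "\<forall>s\<in>{a..b}. s \<noteq> x \<and> dist s x < d2 \<longrightarrow> dist (d (q s) (q x)) 0 < \<rho>2/2"
    unfolding eventually_at by blast
  show "\<exists>\<delta>>0. \<forall>u v. a \<le> u \<and> u \<le> x \<and> x \<le> v \<and> v \<le> b \<and> v - u < \<delta> \<longrightarrow>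
    (\<forall>\<^sub>F n in sequentially. \<forall>s\<in>{u..v}. \<bar>f (tn n s) (qn n s) - f (t s) (q s)\<bar> < e)"
  proof (rule exI[of _ "min d1 d2"], intro conjI allI impI)
    show "0 < min d1 d2" using d1 d2 by simp
    fix u v assume uv: "a \<le> u \<and> u \<le> x \<and> x \<le> v \<and> v \<le> b \<and> v - u < min d1 d2"
    have 1: "dist (t s) (t x) < \<rho>1/2" "d (q x) (q s) < \<rho>2/2" if "s \<in> {u..v}" for s
    proof -
      have s: "s \<in> {a..b}" "dist s x < d1" "dist s x < d2" using that uv by (auto simp: dist_real_def)
      then show "dist (t s) (t x) < \<rho>1/2" using d1(2) by blast
      show "d (q x) (q s) < \<rho>2/2"
      proof (cases "s = x")
        case True
        then show ?thesis using \<rho>2(1) d_refl by simp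
      next
        case False
        then have "dist (d (q s) (q x)) 0 < \<rho>2/2" using d2(2) s by blast
        then show ?thesis using d_sym[of "q x" "q s"] by (simp add: dist_real_def)
      qed
    qed
    have "\<forall>\<^sub>F n in sequentially. \<forall>s\<in>{a..b}. \<bar>tn n s - t s\<bar> < \<rho>1/2" "\<forall>\<^sub>F n in sequentially. \<forall>s\<in>{a..b}. d (qn n s) (q s) < \<rho>2/2"
      by (rule tu[OF half_gt_zero[OF \<rho>1(1)]], rule qu[OF half_gt_zero[OF \<rho>2(1)]])
    then show "\<forall>\<^sub>F n in sequentially. \<forall>s\<in>{u..v}. \<bar>f (tn n s) (qn n s) - f (t s) (q s)\<bar> < e"
    proof eventually_elim
      case (elim n)
      show ?case
      proof
        fix s assume s: "s \<in> {u..v}"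
        then have sab: "s \<in> {a..b}" using uv by auto
        have T1: "t s \<in> {0..T}" "tn n s \<in> {0..T}" using tT tnT sab by blast+
        have A: "\<bar>f (t s) (q s) - f (t x) (q x)\<bar> < e/2"
          using 1[OF s] \<rho>1(1) \<rho>2(1) T1 by (intro close) auto
        have a1: "\<bar>tn n s - t s\<bar> < \<rho>1/2" "d (qn n s) (q s) < \<rho>2/2" using elim sab by blast+
        have "dist (tn n s) (t x) < \<rho>1" using a1(1) 1(1)[OF s] unfolding dist_real_def by linarith
        moreover have "d (q x) (qn n s) < \<rho>2"
          using d_triangle[of "q x" "qn n s" "q s"] d_sym[of "q s" "qn n s"] a1(2) 1(2)[OF s] by linarith
        ultimately have "\<bar>f (tn n s) (qn n s) - f (t x) (q x)\<bar> < e/2" using T1 by (intro close)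
        then show "\<bar>f (tn n s) (qn n s) - f (t s) (q s)\<bar> < e" using A by linarith
      qed
    qed
  qed
qed

lemma ac_curve_cong:
  assumes y: "ac_curve A a b y" and eq: "\<And>s. s \<in> {a..b} \<Longrightarrow> y s = z s"
  shows "ac_curve A a b z"
proof -
  have cont: "continuous_on {a..b} z"
    using y eq unfolding ac_curve_def by (metis (mono_tags, lifting) continuous_on_cong)
  show ?thesis
  unfolding ac_curve_def
proof (intro conjI cont ballI allI impI, elim conjE)
  fix c u v assume c: "c \<in> A" "a \<le> u" "u \<le> v" "v \<le> b" "z ` {u..v} \<subseteq> chart_dom c"
  have "y ` {u..v} \<subseteq> chart_dom c" using c eq by (auto simp: image_subset_iff)
  then have "abs_cont_on u v (chart_map c \<circ> y)" using ac_curve_in_chart[OF y c(1) _ c(2-4)] by blast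
  then show "abs_cont_on u v (chart_map c \<circ> z)"
    using c eq by (subst abs_cont_on_cong[where g = "chart_map c \<circ> y"]) auto
qed
qed

text \<open>Both components of the curve are controlled by one density, the one whose weak
  convergence is assumed. Equicontinuity of times and positions follows from it at once.\<close>

lemma arc_bounds:
  assumes h: "mono_ac a b h" and y: "ac_curve A a b y"
  shows "\<exists>N. negligible N \<and> (\<forall>s\<in>{a..b} - N. 0 \<le> deriv h s + speed A R y s)"
    and "(\<lambda>s. deriv h s + speed A R y s) absolutely_integrable_on {a..b}"
    and "\<lbrakk>a \<le> u; u \<le> v; v \<le> b\<rbrakk> \<Longrightarrow> \<bar>h u - h v\<bar> \<le> integral {u..v} (\<lambda>s. deriv h s + speed A R y s)"
    and "\<lbrakk>a \<le> u; u \<le> v; v \<le> b\<rbrakk> \<Longrightarrow> d (y u) (y v) \<le> integral {u..v} (\<lambda>s. deriv h s + speed A R y s)"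
proof -
  interpret h: mono_ac a b h by (rule h)
  obtain N1 where N1: "negligible N1" "\<forall>s\<in>{a..b} - N1. 0 \<le> deriv h s"
    using h.deriv_nonneg by (elim exE conjE)
  obtain N2 where N2: "negligible N2" "\<forall>s\<in>{a..b} - N2. velocity A y s \<in> tangent_space A (y s) \<and> 0 \<le> speed A R y s"
    using speed_nonneg[OF y h.ab] by (elim exE conjE)
  let ?N = "N1 \<union> N2"
  have N: "negligible ?N" using N1(1) N2(1) by simp
  have nn: "0 \<le> deriv h s" "0 \<le> speed A R y s" if "s \<in> {a..b} - ?N" for s
    using bspec[OF N1(2), of s] bspec[OF N2(2), of s] that by simp_all
  show "\<exists>N. negligible N \<and> (\<forall>s\<in>{a..b} - N. 0 \<le> deriv h s + speed A R y s)"
    by (rule exI[of _ ?N]) (use N nn in \<open>simp add: add_nonneg_nonneg\<close>)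
  show ai: "(\<lambda>s. deriv h s + speed A R y s) absolutely_integrable_on {a..b}"
    by (rule set_integral_add[OF h.deriv_absolutely_integrable speed_integrable[OF y h.ab]])
  assume uv: "a \<le> u" "u \<le> v" "v \<le> b"
  have sub: "s \<in> {a..b} - ?N" if "s \<in> {u..v} - ?N" for s using that uv by auto
  have i: "(\<lambda>s. deriv h s + speed A R y s) integrable_on {u..v}"
    by (rule set_lebesgue_integral_eq_integral(1)[OF absolutely_integrable_on_subinterval[OF ai]]) (use uv in auto)
  have hi: "(deriv h has_integral (h v - h u)) {u..v}" by (rule h.deriv_has_integral[OF uv])
  have "h v - h u \<le> integral {u..v} (\<lambda>s. deriv h s + speed A R y s)"
    unfolding integral_unique[OF hi, symmetric]
    by (rule integral_le_off_negligible[OF has_integral_integrable[OF hi] i N]) (use nn[OF sub] in simp)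
  moreover have "h u \<le> h v" using mono_onD[OF h.mono, of u v] uv by auto
  ultimately show "\<bar>h u - h v\<bar> \<le> integral {u..v} (\<lambda>s. deriv h s + speed A R y s)" by simp
  have "d (y u) (y v) \<le> integral {u..v} (speed A R y)"
    by (rule d_le_length[OF ac_curve_subinterval[OF y uv(1,3)] uv(2)])
  also have "\<dots> \<le> integral {u..v} (\<lambda>s. deriv h s + speed A R y s)"
    by (rule integral_le_off_negligible[OF speed_integrable_on[OF y uv] i N]) (use nn[OF sub] in simp)
  finally show "d (y u) (y v) \<le> integral {u..v} (\<lambda>s. deriv h s + speed A R y s)" .
qed

end

section \<open>Passage to the vanishing viscosity limit\<close>

lemma negligible_of_integral_le_0:
  fixes f :: "real \<Rightarrow> real"
  assumes f: "f absolutely_integrable_on S" and nn: "\<exists>N. negligible N \<and> (\<forall>s\<in>S - N. 0 \<le> f s)" and 0: "integral S f \<le> 0"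
  shows "\<exists>N. negligible N \<and> (\<forall>s\<in>S - N. f s = 0)"
proof -
  obtain N where N: "negligible N" "\<forall>s\<in>S - N. 0 \<le> f s" using nn by blast
  have a: "(\<lambda>s. \<bar>f s\<bar>) absolutely_integrable_on S" using absolutely_integrable_norm[OF f] by (simp add: o_def)
  have "integral S (\<lambda>s. \<bar>f s\<bar>) = integral S f"
    by (rule integral_spike[OF N(1)]) (use N(2) in simp)
  moreover have "0 \<le> integral S (\<lambda>s. \<bar>f s\<bar>)" by (rule integral_nonneg) (use a in \<open>auto simp: set_lebesgue_integral_eq_integral(1)\<close>)
  ultimately have "integral S (\<lambda>s. \<bar>f s\<bar>) = 0" using 0 by simp
  then have "negligible {s\<in>S. \<bar>f s\<bar> \<noteq> 0}" by (intro integral_nonneg_eq_0_imp_negligible[OF a]) auto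
  then show ?thesis by (intro exI[of _ "{s\<in>S. \<bar>f s\<bar> \<noteq> 0}"]) auto
qed

text \<open>The linear part of \<open>psi\<close> provides the term \<nu>. For
  \<open>x = max 0 (\<xi> - 1)\<close> the two quadratic parts exceed \<open>\<nu> * x\<close> by a
  square divided by \<open>2 * \<epsilon>\<close>, so the bound does not degenerate as \<epsilon>
  tends to 0.\<close>

lemma psi_ge: "0 < \<epsilon> \<Longrightarrow> 0 \<le> \<nu> \<Longrightarrow> \<nu> * max 1 \<xi> \<le> psi \<epsilon> \<nu> + psi_star \<epsilon> \<xi>"
proof -
  assume e: "0 < \<epsilon>" and n: "0 \<le> \<nu>"
  define x where "x = max 0 (\<xi> - 1)"
  have m: "max 1 \<xi> = 1 + x" unfolding x_def by simp
  have "\<epsilon> / 2 * \<nu>\<^sup>2 + 1 / (2 * \<epsilon>) * x\<^sup>2 - \<nu> * x = (\<epsilon> * \<nu> - x)\<^sup>2 / (2 * \<epsilon>)"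
    using e by (simp add: field_simps power2_eq_square)
  moreover have "0 \<le> (\<epsilon> * \<nu> - x)\<^sup>2 / (2 * \<epsilon>)" using e by simp
  ultimately have "\<nu> * x \<le> \<epsilon> / 2 * \<nu>\<^sup>2 + 1 / (2 * \<epsilon>) * x\<^sup>2" by linarith
  then show ?thesis unfolding psi_def psi_star_def m x_def[symmetric] by (simp add: distrib_left)
qed

lemma psi_nonneg: "0 < \<epsilon> \<Longrightarrow> 0 \<le> \<nu> \<Longrightarrow> 0 \<le> psi \<epsilon> \<nu>"
  by (simp add: psi_def)

context finsler_energy
begin

lemma composition_continuous:
  fixes f :: "real \<Rightarrow> 'q \<Rightarrow> real" and a b :: real
  assumes f: "continuous_on ({0..T} \<times> UNIV) (\<lambda>(t, q). f t q)"
    and t: "continuous_on {a..b} t" "t ` {a..b} \<subseteq> {0..T}" and q: "continuous_on {a..b} q"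
  shows "continuous_on {a..b} (\<lambda>s. f (t s) (q s))"
proof -
  have "continuous_on {a..b} (\<lambda>s. (\<lambda>(t, q). f t q) (t s, q s))"
    by (rule continuous_on_compose2[OF f continuous_on_Pair[OF t(1) q]]) (use t(2) in blast)
  then show ?thesis by simp
qed

text \<open>Two relaxations of the same inequality: \<open>?A\<close> uses \<open>psi_ge\<close> and
  keeps a dissipation independent of \<epsilon>, while \<open>?B\<close> discards \<open>psi\<close>
  and keeps \<open>psi_star\<close>, whose factor \<open>1 / \<epsilon>\<close> penalizes slopes
  above 1.\<close>

lemma viscous_estimate:
  assumes eps: "0 < \<epsilon>" and y: "ac_curve A 0 T y"
    and ineq: "AE \<tau>\<in>{0<..<T} in lebesgue.
         \<exists>e'. ((\<lambda>\<tau>. E \<tau> (y \<tau>)) has_real_derivative e') (at \<tau>) \<and>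
           e' \<le> time_deriv T E \<tau> (y \<tau>) - psi \<epsilon> (speed A R y \<tau>) - psi_star \<epsilon> (slope A R E \<tau> (y \<tau>))"
    and h: "mono_ac s0 s1 h" and h0: "0 \<le> h s0" and h1: "h s1 = T"
  defines "z \<equiv> y \<circ> h"
  shows "E T (z s1) - E (h s0) (z s0) \<le> integral {s0..s1} (\<lambda>s. deriv h s * time_deriv T E (h s) (z s))
      - integral {s0..s1} (\<lambda>s. speed A R z s * max 1 (slope A R E (h s) (z s)))" (is ?A)
    and "E T (z s1) - E (h s0) (z s0) \<le> integral {s0..s1} (\<lambda>s. deriv h s * time_deriv T E (h s) (z s))
      - integral {s0..s1} (\<lambda>s. deriv h s * psi_star \<epsilon> (slope A R E (h s) (z s)))" (is ?B)
proof -
  interpret h: mono_ac s0 s1 h by (rule h)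
  let ?t0 = "h s0"
  have t0T: "?t0 \<le> T" using mono_onD[OF h.mono, of s0 s1] h.ab h1 by auto
  have y0: "ac_curve A ?t0 T y" by (rule ac_curve_subinterval[OF y h0 order.refl])
  have yc: "continuous_on {?t0..T} y" using y0 unfolding ac_curve_def by blast
  have idm: "mono_ac ?t0 T (\<lambda>\<tau>. 1 * \<tau> + 0)" using t0T by (intro mono_ac_affine) auto
  have idac: "abs_cont_on ?t0 T (\<lambda>\<tau>. \<tau>)" using mono_ac.ac[OF idm] by simp
  have idim: "(\<lambda>\<tau>. \<tau>) ` {?t0..T} \<subseteq> {0..T}" using h0 by auto
  define e' where "e' \<tau> = time_deriv T E \<tau> (y \<tau>) + space_diff A E \<tau> (y \<tau>) (velocity A y \<tau>)" for \<tau>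
  have eI: "(e' has_integral (E T (y T) - E ?t0 (y ?t0))) {?t0..T}"
    using energy_integral[OF idac idim y0 t0T] unfolding e'_def by simp
  obtain N1 where N1: "negligible N1" "\<forall>\<tau>\<in>{?t0<..<T} - N1. ((\<lambda>r. E r (y r)) has_real_derivative e' \<tau>) (at \<tau>)"
    using energy_derivative[OF idac idim y0 t0T] unfolding e'_def by auto
  obtain N2 where N2: "negligible N2" "\<forall>\<tau>. \<tau> \<notin> N2 \<longrightarrow> \<tau> \<in> {0<..<T} \<longrightarrow>
      (\<exists>e'. ((\<lambda>\<tau>. E \<tau> (y \<tau>)) has_real_derivative e') (at \<tau>) \<and>
           e' \<le> time_deriv T E \<tau> (y \<tau>) - psi \<epsilon> (speed A R y \<tau>) - psi_star \<epsilon> (slope A R E \<tau> (y \<tau>)))"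
    using ineq unfolding AE_lebesgue_iff by blast
  obtain N3 where N3: "negligible N3" "\<forall>\<tau>\<in>{?t0..T} - N3. velocity A y \<tau> \<in> tangent_space A (y \<tau>) \<and> 0 \<le> speed A R y \<tau>"
    using speed_nonneg[OF y0 t0T] by blast
  let ?N = "N1 \<union> N2 \<union> N3 \<union> {?t0, T}"
  have negN: "negligible ?N" using N1(1) N2(1) N3(1) by simp
  let ?D = "\<lambda>\<tau>. time_deriv T E \<tau> (y \<tau>)" and ?S = "\<lambda>\<tau>. slope A R E \<tau> (y \<tau>)"
  have bound: "e' \<tau> \<le> ?D \<tau> - psi \<epsilon> (speed A R y \<tau>) - psi_star \<epsilon> (?S \<tau>)" "0 \<le> speed A R y \<tau>" if \<tau>: "\<tau> \<in> {?t0..T} - ?N" for \<tau>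
  proof -
    have 1: "\<tau> \<in> {?t0<..<T} - N1" "\<tau> \<in> {0<..<T}" "\<tau> \<notin> N2" "\<tau> \<in> {?t0..T} - N3" using \<tau> h0 by auto
    obtain e'' where e'': "((\<lambda>\<tau>. E \<tau> (y \<tau>)) has_real_derivative e'') (at \<tau>)"
      "e'' \<le> ?D \<tau> - psi \<epsilon> (speed A R y \<tau>) - psi_star \<epsilon> (?S \<tau>)" using N2(2) 1 by blast
    have "((\<lambda>r. E r (y r)) has_real_derivative e' \<tau>) (at \<tau>)" using N1(2) 1 by blast
    \<comment> \<open>The derivative in the hypothesis is only asserted to exist at each time.
      Uniqueness identifies it with the chain rule expression, which is integrable and integrates to
      the energy difference.\<close>
    then have "e'' = e' \<tau>" by (rule DERIV_unique[OF e''(1)])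
    then show "e' \<tau> \<le> ?D \<tau> - psi \<epsilon> (speed A R y \<tau>) - psi_star \<epsilon> (?S \<tau>)" using e''(2) by simp
    show "0 \<le> speed A R y \<tau>" using N3(2) 1 by blast
  qed
  have Dc: "continuous_on {?t0..T} ?D"
    by (rule composition_continuous[OF time_deriv_continuous continuous_on_id idim yc])
  have Sc: "continuous_on {?t0..T} ?S"
    by (rule composition_continuous[OF slope_continuous continuous_on_id idim yc])
  have mc: "continuous_on {?t0..T} (\<lambda>\<tau>. max 1 (?S \<tau>))" by (intro continuous_intros Sc)
  have pc: "continuous_on {?t0..T} (\<lambda>\<tau>. psi_star \<epsilon> (?S \<tau>))" unfolding psi_star_def by (intro continuous_intros Sc)
  have Da: "?D absolutely_integrable_on {?t0..T}" by (rule absolutely_integrable_continuous_real[OF Dc])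
  have pa: "(\<lambda>\<tau>. psi_star \<epsilon> (?S \<tau>)) absolutely_integrable_on {?t0..T}" by (rule absolutely_integrable_continuous_real[OF pc])
  have sa: "(\<lambda>\<tau>. speed A R y \<tau> * max 1 (?S \<tau>)) absolutely_integrable_on {?t0..T}"
    by (rule abs_int_bounded_times[OF speed_integrable[OF y0 t0T] continuous_measurable_bounded[OF mc]])
  note cov = h.change_of_variables(2)[unfolded h1]
  have D_eq: "integral {?t0..T} ?D = integral {s0..s1} (\<lambda>s. deriv h s * time_deriv T E (h s) (z s))"
    using cov[OF Da] by (simp add: z_def)
  have p_eq: "integral {?t0..T} (\<lambda>\<tau>. psi_star \<epsilon> (?S \<tau>)) = integral {s0..s1} (\<lambda>s. deriv h s * psi_star \<epsilon> (slope A R E (h s) (z s)))"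
    using cov[OF pa] by (simp add: z_def)
  have yh: "ac_curve A (h s0) (h s1) y" using y0 h1 by simp
  obtain N4 where N4: "negligible N4" "\<forall>s\<in>{s0<..<s1} - N4. speed A R z s = deriv h s * speed A R y (h s)"
    using ac_curve_compose(2)[OF h yh] unfolding z_def by blast
  have neg4: "negligible (N4 \<union> {s0, s1})" using N4(1) by simp
  have s_eq: "integral {?t0..T} (\<lambda>\<tau>. speed A R y \<tau> * max 1 (?S \<tau>)) = integral {s0..s1} (\<lambda>s. speed A R z s * max 1 (slope A R E (h s) (z s)))"
  proof -
    have "integral {s0..s1} (\<lambda>s. deriv h s *\<^sub>R (speed A R y (h s) * max 1 (?S (h s)))) =
      integral {s0..s1} (\<lambda>s. speed A R z s * max 1 (slope A R E (h s) (z s)))"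
      by (rule integral_spike[OF neg4]) (use N4(2) in \<open>auto simp: z_def\<close>)
    then show ?thesis using cov[OF sa] by simp
  qed
  have eint: "integral {?t0..T} e' = E T (z s1) - E ?t0 (z s0)" using eI h1 by (simp add: integral_unique z_def)
  have ei: "e' integrable_on {?t0..T}" using eI by (auto simp: integrable_on_def)
  have Di: "?D integrable_on {?t0..T}" and pi: "(\<lambda>\<tau>. psi_star \<epsilon> (?S \<tau>)) integrable_on {?t0..T}"
    and si: "(\<lambda>\<tau>. speed A R y \<tau> * max 1 (?S \<tau>)) integrable_on {?t0..T}"
    using Da pa sa by (simp_all add: set_lebesgue_integral_eq_integral(1))
  have "integral {?t0..T} e' \<le> integral {?t0..T} (\<lambda>\<tau>. ?D \<tau> - speed A R y \<tau> * max 1 (?S \<tau>))"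
  proof (rule integral_le_off_negligible[OF ei integrable_diff[OF Di si] negN])
    fix \<tau> assume \<tau>: "\<tau> \<in> {?t0..T} - ?N"
    show "e' \<tau> \<le> ?D \<tau> - speed A R y \<tau> * max 1 (?S \<tau>)"
      using bound(1)[OF \<tau>] psi_ge[OF eps bound(2)[OF \<tau>], of "?S \<tau>"] by linarith
  qed
  then show ?A using eint Henstock_Kurzweil_Integration.integral_diff[OF Di si] D_eq s_eq by simp
  have "integral {?t0..T} e' \<le> integral {?t0..T} (\<lambda>\<tau>. ?D \<tau> - psi_star \<epsilon> (?S \<tau>))"
  proof (rule integral_le_off_negligible[OF ei integrable_diff[OF Di pi] negN])
    fix \<tau> assume \<tau>: "\<tau> \<in> {?t0..T} - ?N"
    show "e' \<tau> \<le> ?D \<tau> - psi_star \<epsilon> (?S \<tau>)"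
      using bound(1)[OF \<tau>] psi_nonneg[OF eps bound(2)[OF \<tau>]] by linarith
  qed
  then show ?B using eint Henstock_Kurzweil_Integration.integral_diff[OF Di pi] D_eq p_eq by simp
qed

text \<open>Everything that holds once the curves converge uniformly. The last claim also records
  that time derivative plus speed equals \<open>m\<close> almost everywhere, which is what decides
  nondegeneracy.\<close>

lemma limit_passage:
  fixes \<epsilon> :: "nat \<Rightarrow> real" and te :: "nat \<Rightarrow> real \<Rightarrow> real" and qe qh :: "nat \<Rightarrow> real \<Rightarrow> 'q" and m t :: "real \<Rightarrow> real" and q :: "real \<Rightarrow> 'q"
  assumes s01: "s0 < s1" and eps: "\<And>n. 0 < \<epsilon> n" "\<epsilon> \<longlonglongrightarrow> 0"
    and qe: "\<And>n. ac_curve A 0 T (qe n)"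
    and ineq: "\<And>n. AE \<tau>\<in>{0<..<T} in lebesgue.
         \<exists>e'. ((\<lambda>\<tau>. E \<tau> (qe n \<tau>)) has_real_derivative e') (at \<tau>) \<and>
           e' \<le> time_deriv T E \<tau> (qe n \<tau>) - psi (\<epsilon> n) (speed A R (qe n) \<tau>) - psi_star (\<epsilon> n) (slope A R E \<tau> (qe n \<tau>))"
    and te: "\<And>n. mono_ac s0 s1 (te n)" and te0: "\<And>n. 0 \<le> te n s0" and te1: "\<And>n. te n s1 = T"
    and qh: "\<And>n. \<forall>s\<in>{s0..s1}. qh n s = qe n (te n s)"
    and maj: "weak_majorant s0 s1 (\<lambda>n s. deriv (te n) s + speed A R (qh n) s) m"
    and tu: "\<forall>e>0. \<forall>\<^sub>F n in sequentially. \<forall>s\<in>{s0..s1}. \<bar>te n s - t s\<bar> < e"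
    and qu: "\<forall>e>0. \<forall>\<^sub>F n in sequentially. \<forall>s\<in>{s0..s1}. d (qh n s) (q s) < e"
  shows "mono_ac s0 s1 t" and "t ` {s0..s1} \<subseteq> {0..T}" and "ac_curve A s0 s1 q"
    and "weak_L1_limit s0 s1 (\<lambda>n s. (deriv (te n) s, speed A R (qh n) s)) (\<lambda>s. (deriv t s, speed A R q s)) sequentially"
    and "(\<lambda>n. integral {te n s0..T} (speed A R (qe n))) \<longlonglongrightarrow> integral {s0..s1} (speed A R q)"
    and "\<exists>N. negligible N \<and> (\<forall>s\<in>{s0<..<s1} - N.
      ((\<lambda>r. E (t r) (q r)) has_real_derivative
        (time_deriv T E (t s) (q s) * deriv t s - speed A R q s * slope A R E (t s) (q s))) (at s) \<and>
      (deriv t s, speed A R q s, slope A R E (t s) (q s)) \<in> Xi_set \<and>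
      0 \<le> deriv t s \<and> 0 \<le> speed A R q s \<and> 0 \<le> slope A R E (t s) (q s) \<and> deriv t s + speed A R q s = m s)"
proof -
  interpret W: weak_majorant s0 s1 "\<lambda>n s. deriv (te n) s + speed A R (qh n) s" m by (rule maj)
  have sle: "s0 \<le> s1" using s01 by simp
  define z where "z n = qe n \<circ> te n" for n
  have temono: "te n u \<le> te n v" if "s0 \<le> u" "u \<le> v" "v \<le> s1" for n u v
    using mono_onD[OF mono_ac.mono[OF te], of u v] that by auto
  have teT: "te n ` {s0..s1} \<subseteq> {0..T}" for n
  proof (rule image_subsetI)
    fix s assume s: "s \<in> {s0..s1}"
    then show "te n s \<in> {0..T}" using temono[of s0 s n] temono[of s s1 n] te0[of n] te1[of n] by auto
  qed
  have qen: "ac_curve A (te n s0) (te n s1) (qe n)" for n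
    using ac_curve_subinterval[OF qe te0] te1 by simp
  have acz: "ac_curve A s0 s1 (z n)" for n unfolding z_def by (rule ac_curve_compose(1)[OF te qen])
  have qz: "qh n s = z n s" if "s \<in> {s0..s1}" for n s using bspec[OF qh that] by (simp add: z_def)
  have acqh: "ac_curve A s0 s1 (qh n)" for n by (rule ac_curve_cong[OF acz]) (simp add: qz)
  \<comment> \<open>\<open>qh n\<close> is prescribed on the closed interval only, so at its
    endpoints the two-sided derivatives may differ from those of \<open>z n\<close>.\<close>
  have spz: "speed A R (qh n) s = speed A R (z n) s" if "s \<in> {s0<..<s1}" for n s
  proof (rule speed_cong)
    have "\<forall>\<^sub>F r in nhds s. r \<in> {s0<..<s1}" using that by (intro eventually_nhds_in_open) auto
    then show "\<forall>\<^sub>F r in nhds s. qh n r = z n r" by eventually_elim (simp add: qz)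
  qed
  have tec: "continuous_on {s0..s1} (te n)" for n by (rule abs_cont_on_imp_continuous[OF mono_ac.ac[OF te]])
  have zc: "continuous_on {s0..s1} (z n)" for n using acz unfolding ac_curve_def by blast
  have dta: "deriv (te n) absolutely_integrable_on {s0..s1}" for n by (rule mono_ac.deriv_absolutely_integrable[OF te])
  have dti: "deriv (te n) integrable_on {u..v}" "integral {u..v} (deriv (te n)) = te n v - te n u" if "s0 \<le> u" "u \<le> v" "v \<le> s1" for n u v
    using mono_ac.deriv_has_integral[OF te that] by (auto simp: integrable_on_def integral_unique)
  have dt0: "\<exists>N. negligible N \<and> (\<forall>s\<in>{s0..s1} - N. 0 \<le> deriv (te n) s)" for n by (rule mono_ac.deriv_nonneg[OF te])
  have spa: "speed A R (qh n) absolutely_integrable_on {s0..s1}" for n by (rule speed_integrable[OF acqh sle])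
  have sp0: "\<exists>N. negligible N \<and> (\<forall>s\<in>{s0..s1} - N. 0 \<le> speed A R (qh n) s)" for n
  proof -
    obtain N where N: "negligible N" "\<forall>s\<in>{s0..s1} - N. velocity A (qh n) s \<in> tangent_space A (qh n s) \<and> 0 \<le> speed A R (qh n) s"
      using speed_nonneg[OF acqh[of n] sle] by (elim exE conjE)
    show ?thesis by (rule exI[of _ N]) (simp add: N)
  qed
  have tlim: "(\<lambda>n. te n s) \<longlonglongrightarrow> t s" if "s \<in> {s0..s1}" for s
  proof (rule tendstoI)
    fix e :: real assume "e > 0"
    from tu[rule_format, OF this] show "\<forall>\<^sub>F n in sequentially. dist (te n s) (t s) < e"
      by eventually_elim (use that in \<open>simp add: dist_real_def\<close>)
  qed
  have qlim: "(\<lambda>n. d (qh n s) (q s)) \<longlonglongrightarrow> 0" if "s \<in> {s0..s1}" for s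
  proof (rule tendstoI)
    fix e :: real assume "e > 0"
    from qu[rule_format, OF this] show "\<forall>\<^sub>F n in sequentially. dist (d (qh n s) (q s)) 0 < e"
      by eventually_elim (use that d_nonneg in \<open>simp add: dist_real_def\<close>)
  qed
  show tT: "t ` {s0..s1} \<subseteq> {0..T}"
  proof (rule image_subsetI)
    fix s assume s: "s \<in> {s0..s1}"
    have "te n s \<in> {0..T}" for n by (rule subsetD[OF teT imageI[OF s]])
    then have "0 \<le> te n s" "te n s \<le> T" for n by simp_all
    then have "0 \<le> t s" "t s \<le> T"
      using LIMSEQ_le_const[OF tlim[OF s], of 0] LIMSEQ_le_const2[OF tlim[OF s], of T] by simp_all
    then show "t s \<in> {0..T}" by simp
  qed
  have tmono: "t u \<le> t v" if "s0 \<le> u" "u \<le> v" "v \<le> s1" for u v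
  proof (rule LIMSEQ_le[OF tlim tlim])
    show "u \<in> {s0..s1}" "v \<in> {s0..s1}" using that by simp_all
    show "\<exists>N. \<forall>n\<ge>N. te n u \<le> te n v" using temono[OF that] by (intro exI[of _ 0] allI impI)
  qed
  have tbound: "t v - t u \<le> integral {u..v} m" if uv: "s0 \<le> u" "u \<le> v" "v \<le> s1" for u v
  proof (rule LIMSEQ_le)
    show "(\<lambda>n. te n v - te n u) \<longlonglongrightarrow> t v - t u" by (intro tendsto_intros tlim) (use uv in auto)
    show "(\<lambda>n. integral {u..v} (\<lambda>s. deriv (te n) s + speed A R (qh n) s)) \<longlonglongrightarrow> integral {u..v} m"
      by (rule W.m_interval_limit[OF uv(1,3)])
    have "te n v - te n u \<le> integral {u..v} (\<lambda>s. deriv (te n) s + speed A R (qh n) s)" for n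
      using arc_bounds(3)[OF te[of n] acqh[of n] uv] by linarith
    then show "\<exists>N. \<forall>n\<ge>N. te n v - te n u \<le> integral {u..v} (\<lambda>s. deriv (te n) s + speed A R (qh n) s)" by blast
  qed
  show tm: "mono_ac s0 s1 t"
  proof
    show "abs_cont_on s0 s1 t"
      by (rule abs_cont_onI_integral[OF W.mli]) (use tmono tbound in simp)
    show "mono_on {s0..s1} t" using tmono by (intro mono_onI) auto
  qed (rule sle)
  interpret t: mono_ac s0 s1 t by (rule tm)
  have tc: "continuous_on {s0..s1} t" by (rule abs_cont_on_imp_continuous[OF t.ac])
  have t'a: "deriv t absolutely_integrable_on {s0..s1}" by (rule t.deriv_absolutely_integrable)
  obtain Nt where Nt: "negligible Nt" "\<forall>s\<in>{s0..s1} - Nt. 0 \<le> deriv t s" using t.deriv_nonneg by (elim exE conjE)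
  \<comment> \<open>The primitive of \<open>m\<close> minus \<open>t\<close> is nondecreasing by
    \<open>tbound\<close>, so its density is nonnegative. This dominates the derivative of
    \<open>t\<close> by \<open>m\<close> and makes \<nu> below nonnegative.\<close>
  obtain Nm where Nm: "negligible Nm" "\<forall>s\<in>{s0<..<s1} - Nm. 0 \<le> m s - deriv t s"
  proof -
    define F where "F s = integral {s0..s} m" for s
    have FI: "integral {u..v} m = F v - F u" if "s0 \<le> u" "u \<le> v" "v \<le> s1" for u v
      using Henstock_Kurzweil_Integration.integral_combine[OF that(1,2) W.ml_integrable[OF order.refl that(3)]] unfolding F_def by linarith
    have "((\<lambda>s. m s - deriv t s) has_integral (F v - t v - (F u - t u))) {u..v}" if uv: "s0 \<le> u" "u \<le> v" "v \<le> s1" for u v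
    proof -
      have "(m has_integral (F v - F u)) {u..v}" using integrable_integral[OF W.ml_integrable[OF uv(1,3)]] FI[OF uv] by simp
      from has_integral_diff[OF this t.deriv_has_integral[OF uv]] show ?thesis by (simp add: algebra_simps)
    qed
    moreover have "F u - t u \<le> F v - t v" if uv: "s0 \<le> u" "u \<le> v" "v \<le> s1" for u v
      using tbound[OF uv] FI[OF uv] by simp
    ultimately show ?thesis using density_nonneg[of s0 s1 "\<lambda>s. m s - deriv t s" "\<lambda>s. F s - t s"] sle that by blast
  qed
  have weak_t: "(\<lambda>n. integral {s0..s1} (\<lambda>s. deriv (te n) s * g s)) \<longlonglongrightarrow> integral {s0..s1} (\<lambda>s. deriv t s * g s)"
    if g: "g \<in> borel_measurable (lebesgue_on {s0..s1})" "bounded (g ` {s0..s1})" for g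
  proof -
    \<comment> \<open>\<open>weak_limit_bounded\<close> requires a bound at every real number,
      whereas \<open>g\<close> is bounded on the interval only.\<close>
    define g' where "g' s = (if s \<in> {s0..s1} then g s else 0)" for s
    obtain C where C: "\<forall>x\<in>g ` {s0..s1}. \<bar>x\<bar> \<le> C" using g(2) by (auto simp: bounded_iff)
    have g'm: "g' \<in> borel_measurable (lebesgue_on {s0..s1})"
      by (rule measurable_cong[THEN iffD1, OF _ g(1)]) (simp add: g'_def)
    have g'C: "\<bar>g' s\<bar> \<le> \<bar>C\<bar>" for s
    proof (cases "s \<in> {s0..s1}")
      case True
      then have "\<bar>g s\<bar> \<le> C" using C by blast
      then show ?thesis using True abs_ge_self[of C] by (simp add: g'_def)
    next
      case False
      then show ?thesis unfolding g'_def by (simp only: if_False abs_zero abs_ge_zero)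
    qed
    have "(\<lambda>n. integral {s0..s1} (\<lambda>s. deriv (te n) s * g' s)) \<longlonglongrightarrow> integral {s0..s1} (\<lambda>s. deriv t s * g' s)"
    proof (rule W.weak_limit_bounded[OF dta t'a _ _ _ g'm g'C])
      fix n
      obtain N1 where N1: "negligible N1" "\<forall>s\<in>{s0..s1} - N1. 0 \<le> deriv (te n) s" using dt0 by blast
      obtain N2 where N2: "negligible N2" "\<forall>s\<in>{s0..s1} - N2. 0 \<le> speed A R (qh n) s" using sp0 by blast
      show "\<exists>N. negligible N \<and> (\<forall>s\<in>{s0..s1} - N. \<bar>deriv (te n) s\<bar> \<le> deriv (te n) s + speed A R (qh n) s)"
        by (rule exI[of _ "N1 \<union> N2"]) (use N1 N2 in auto)
    next
      show "\<exists>N. negligible N \<and> (\<forall>s\<in>{s0..s1} - N. \<bar>deriv t s\<bar> \<le> m s)"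
        by (rule exI[of _ "Nt \<union> Nm \<union> {s0, s1}"]) (use Nt Nm in force)
    next
      fix u v assume uv: "s0 \<le> u" "u \<le> v" "v \<le> s1"
      have "integral {u..v} (deriv t) = t v - t u" using t.deriv_has_integral[OF uv] by (rule integral_unique)
      moreover have "(\<lambda>n. te n v - te n u) \<longlonglongrightarrow> t v - t u" by (intro tendsto_intros tlim) (use uv in auto)
      ultimately show "(\<lambda>n. integral {u..v} (deriv (te n))) \<longlonglongrightarrow> integral {u..v} (deriv t)" using dti(2)[OF uv] by simp
    qed
    moreover have "integral {s0..s1} (\<lambda>s. k s * g' s) = integral {s0..s1} (\<lambda>s. k s * g s)" for k
      by (rule integral_cong) (simp add: g'_def)
    ultimately show ?thesis by simp
  qed
  define \<nu> where "\<nu> s = m s - deriv t s" for s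
  have \<nu>a: "\<nu> absolutely_integrable_on {s0..s1}" unfolding \<nu>_def by (rule set_integral_diff[OF W.mli t'a])
  have weak_\<nu>: "(\<lambda>n. integral {s0..s1} (\<lambda>s. speed A R (qh n) s * g s)) \<longlonglongrightarrow> integral {s0..s1} (\<lambda>s. \<nu> s * g s)"
    if g: "g \<in> borel_measurable (lebesgue_on {s0..s1})" "bounded (g ` {s0..s1})" for g
  proof -
    have i: "(\<lambda>s. k s * g s) integrable_on {s0..s1}" if "k absolutely_integrable_on {s0..s1}" for k
      using abs_int_bounded_times[OF that g] by (simp add: set_lebesgue_integral_eq_integral(1))
    have 1: "integral {s0..s1} (\<lambda>s. speed A R (qh n) s * g s) =
      integral {s0..s1} (\<lambda>s. (deriv (te n) s + speed A R (qh n) s) * g s) - integral {s0..s1} (\<lambda>s. deriv (te n) s * g s)" for n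
      using Henstock_Kurzweil_Integration.integral_diff[OF i[OF W.mi, of n] i[OF dta, of n]] by (simp add: algebra_simps)
    have 2: "integral {s0..s1} (\<lambda>s. \<nu> s * g s) = integral {s0..s1} (\<lambda>s. m s * g s) - integral {s0..s1} (\<lambda>s. deriv t s * g s)"
      using Henstock_Kurzweil_Integration.integral_diff[OF i[OF W.mli] i[OF t'a]] by (simp add: \<nu>_def algebra_simps)
    show ?thesis unfolding 1 2 by (intro tendsto_diff W.mw weak_t g)
  qed
  \<comment> \<open>Lower semicontinuity of length in metric form: the distances follow the uniform
    limit, the lengths follow the weak limit of the speeds.\<close>
  have dq: "d (q u) (q v) \<le> integral {u..v} \<nu>" if uv: "s0 \<le> u" "u \<le> v" "v \<le> s1" for u v
  proof (rule LIMSEQ_le_const)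
    have um: "u \<in> {s0..s1}" "v \<in> {s0..s1}" using uv by auto
    have "(\<lambda>n. integral {s0..s1} (\<lambda>s. speed A R (qh n) s * indicator {u..v} s)) \<longlonglongrightarrow> integral {s0..s1} (\<lambda>s. \<nu> s * indicator {u..v} s)"
      by (rule weak_\<nu>[OF indicator_measurable_bounded])
    then have "(\<lambda>n. integral {u..v} (speed A R (qh n))) \<longlonglongrightarrow> integral {u..v} \<nu>"
      by (simp add: integral_times_indicator[OF uv(1,3)])
    from tendsto_add[OF tendsto_add[OF qlim[OF um(1)] this] qlim[OF um(2)]]
    show "(\<lambda>n. d (qh n u) (q u) + integral {u..v} (speed A R (qh n)) + d (qh n v) (q v)) \<longlonglongrightarrow> integral {u..v} \<nu>" by simp
    have "d (q u) (q v) \<le> d (qh n u) (q u) + integral {u..v} (speed A R (qh n)) + d (qh n v) (q v)" for n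
    proof -
      have "d (qh n u) (qh n v) \<le> integral {u..v} (speed A R (qh n))"
        by (rule d_le_length[OF ac_curve_subinterval[OF acqh uv(1,3)] uv(2)])
      then show ?thesis
        using d_triangle[of "q u" "q v" "qh n u"] d_triangle[of "qh n u" "q v" "qh n v"] d_sym[of "q u" "qh n u"] by linarith
    qed
    then show "\<exists>N. \<forall>n\<ge>N. d (q u) (q v) \<le> d (qh n u) (q u) + integral {u..v} (speed A R (qh n)) + d (qh n v) (q v)" by blast
  qed
  show acq: "ac_curve A s0 s1 q" by (rule ac_curve_of_dist[OF \<nu>a sle dq])
  obtain Nq where Nq: "negligible Nq" "\<forall>s\<in>{s0<..<s1} - Nq. speed A R q s \<le> \<nu> s"
    using speed_le_of_dist[OF \<nu>a sle dq] by blast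
  have qc: "continuous_on {s0..s1} q" using acq unfolding ac_curve_def by blast
  let ?\<xi> = "\<lambda>s. slope A R E (t s) (q s)"
  have cont_max: "continuous_on ({0..T} \<times> UNIV) (\<lambda>(t, q). max 1 (slope A R E t q))"
  proof -
    have "continuous_on ({0..T} \<times> UNIV) (\<lambda>p. max 1 ((\<lambda>(t, q). slope A R E t q) p))"
      by (intro continuous_on_max continuous_on_const slope_continuous)
    then show ?thesis by (simp add: case_prod_unfold)
  qed
  have cont_sq: "continuous_on ({0..T} \<times> UNIV) (\<lambda>(t, q). (max 0 (slope A R E t q - 1))\<^sup>2)"
  proof -
    have "continuous_on ({0..T} \<times> UNIV) (\<lambda>p. (max 0 ((\<lambda>(t, q). slope A R E t q) p - 1))\<^sup>2)"
      by (intro continuous_on_power continuous_on_max continuous_on_diff continuous_on_const slope_continuous)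
    then show ?thesis by (simp add: case_prod_unfold)
  qed
  have zu: "\<forall>\<^sub>F n in sequentially. \<forall>s\<in>{s0..s1}. d (z n s) (q s) < e" if "e > 0" for e
    using qu[rule_format, OF that] by eventually_elim (simp add: qz)
  have unif: "\<forall>\<^sub>F n in sequentially. \<forall>s\<in>{s0..s1}. \<bar>f (te n s) (z n s) - f (t s) (q s)\<bar> < e"
    if f: "continuous_on ({0..T} \<times> UNIV) (\<lambda>(t, q). f t q)" and e: "e > 0" for f :: "real \<Rightarrow> 'q \<Rightarrow> real" and e
    by (rule uniform_composition[OF f sle tc qc tT teT tu[rule_format] zu e])
  note cn = composition_continuous[OF _ tec teT zc] and cl = composition_continuous[OF _ tc tT qc]
  have spint: "integral {s0..s1} (\<lambda>s. speed A R (qh n) s * k s) = integral {s0..s1} (\<lambda>s. speed A R (z n) s * k s)" for n k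
  proof (rule integral_spike[of "{s0, s1}"])
    fix s assume "s \<in> {s0..s1} - {s0, s1}"
    then have "s \<in> {s0<..<s1}" by auto
    then show "speed A R (z n) s * k s = speed A R (qh n) s * k s" using spz by simp
  qed simp
  have limD: "(\<lambda>n. integral {s0..s1} (\<lambda>s. deriv (te n) s * time_deriv T E (te n s) (z n s))) \<longlonglongrightarrow>
    integral {s0..s1} (\<lambda>s. deriv t s * time_deriv T E (t s) (q s))"
    by (rule weak_times_uniform[OF dta dt0 weak_t cn[OF time_deriv_continuous] cl[OF time_deriv_continuous] unif[OF time_deriv_continuous]])
  have limP: "(\<lambda>n. integral {s0..s1} (\<lambda>s. deriv (te n) s * (max 0 (slope A R E (te n s) (z n s) - 1))\<^sup>2)) \<longlonglongrightarrow>
    integral {s0..s1} (\<lambda>s. deriv t s * (max 0 (?\<xi> s - 1))\<^sup>2)"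
    by (rule weak_times_uniform[OF dta dt0 weak_t cn[OF cont_sq] cl[OF cont_sq] unif[OF cont_sq]])
  have limS: "(\<lambda>n. integral {s0..s1} (\<lambda>s. speed A R (z n) s * max 1 (slope A R E (te n s) (z n s)))) \<longlonglongrightarrow>
    integral {s0..s1} (\<lambda>s. \<nu> s * max 1 (?\<xi> s))"
    unfolding spint[symmetric]
    by (rule weak_times_uniform[OF spa sp0 weak_\<nu> cn[OF cont_max] cl[OF cont_max] unif[OF cont_max]])
  have limE: "(\<lambda>n. E (te n s) (z n s)) \<longlonglongrightarrow> E (t s) (q s)" if "s \<in> {s0..s1}" for s
  proof (rule tendstoI)
    fix e :: real assume "e > 0"
    from unif[OF energy_continuous this] show "\<forall>\<^sub>F n in sequentially. dist (E (te n s) (z n s)) (E (t s) (q s)) < e"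
      by eventually_elim (use that in \<open>simp add: dist_real_def\<close>)
  qed
  have limL: "(\<lambda>n. E T (z n s1) - E (te n s0) (z n s0)) \<longlonglongrightarrow> E (t s1) (q s1) - E (t s0) (q s0)"
    using tendsto_diff[OF limE limE, of s1 s0] sle by (simp add: te1)
  have visc: "E T (z n s1) - E (te n s0) (z n s0) \<le> integral {s0..s1} (\<lambda>s. deriv (te n) s * time_deriv T E (te n s) (z n s))
      - integral {s0..s1} (\<lambda>s. speed A R (z n) s * max 1 (slope A R E (te n s) (z n s)))"
    "E T (z n s1) - E (te n s0) (z n s0) \<le> integral {s0..s1} (\<lambda>s. deriv (te n) s * time_deriv T E (te n s) (z n s))
      - integral {s0..s1} (\<lambda>s. deriv (te n) s * psi_star (\<epsilon> n) (slope A R E (te n s) (z n s)))" for n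
    unfolding z_def
    by (rule viscous_estimate[OF eps(1)[of n] qe[of n] ineq[of n] te[of n] te0[of n] te1[of n]])+
  have ineqA: "E (t s1) (q s1) - E (t s0) (q s0) \<le> integral {s0..s1} (\<lambda>s. deriv t s * time_deriv T E (t s) (q s))
      - integral {s0..s1} (\<lambda>s. \<nu> s * max 1 (?\<xi> s))"
    by (rule LIMSEQ_le[OF limL tendsto_diff[OF limD limS]]) (use visc(1) in blast)
  have intP: "integral {s0..s1} (\<lambda>s. deriv t s * (max 0 (?\<xi> s - 1))\<^sup>2) \<le> 0"
  proof (rule LIMSEQ_le[OF limP])
    let ?L = "\<lambda>n. integral {s0..s1} (\<lambda>s. deriv (te n) s * time_deriv T E (te n s) (z n s)) - (E T (z n s1) - E (te n s0) (z n s0))"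
    \<comment> \<open>The factor \<open>2 * \<epsilon> n\<close> cancels the denominator of
      \<open>psi_star\<close>; since \<open>?L n\<close> converges, the product tends to 0.\<close>
    have "(\<lambda>n. 2 * \<epsilon> n * ?L n) \<longlonglongrightarrow> 2 * 0 * (integral {s0..s1} (\<lambda>s. deriv t s * time_deriv T E (t s) (q s)) - (E (t s1) (q s1) - E (t s0) (q s0)))"
      by (intro tendsto_mult tendsto_const eps(2) tendsto_diff limD limL)
    then show "(\<lambda>n. 2 * \<epsilon> n * ?L n) \<longlonglongrightarrow> 0" by simp
    have "integral {s0..s1} (\<lambda>s. deriv (te n) s * (max 0 (slope A R E (te n s) (z n s) - 1))\<^sup>2) \<le> 2 * \<epsilon> n * ?L n" for n
    proof -
      let ?P = "\<lambda>s. deriv (te n) s * (max 0 (slope A R E (te n s) (z n s) - 1))\<^sup>2"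
      have eq: "(\<lambda>s. deriv (te n) s * psi_star (\<epsilon> n) (slope A R E (te n s) (z n s))) = (\<lambda>s. 1 / (2 * \<epsilon> n) * ?P s)"
        by (simp add: psi_star_def fun_eq_iff)
      have "1 / (2 * \<epsilon> n) * integral {s0..s1} ?P \<le> ?L n"
        using visc(2)[of n] unfolding eq by simp
      then have "2 * \<epsilon> n * (1 / (2 * \<epsilon> n) * integral {s0..s1} ?P) \<le> 2 * \<epsilon> n * ?L n"
        using eps(1)[of n] by (intro mult_left_mono) auto
      then show ?thesis using eps(1)[of n] by simp
    qed
    then show "\<exists>N. \<forall>n\<ge>N. integral {s0..s1} (\<lambda>s. deriv (te n) s * (max 0 (slope A R E (te n s) (z n s) - 1))\<^sup>2) \<le> 2 * \<epsilon> n * ?L n" by blast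
  qed
  have "\<exists>N. negligible N \<and> (\<forall>s\<in>{s0..s1} - N. deriv t s * (max 0 (?\<xi> s - 1))\<^sup>2 = 0)"
  proof (rule negligible_of_integral_le_0[OF _ _ intP])
    show "(\<lambda>s. deriv t s * (max 0 (?\<xi> s - 1))\<^sup>2) absolutely_integrable_on {s0..s1}"
      by (rule abs_int_bounded_times[OF t'a continuous_measurable_bounded[OF cl[OF cont_sq]]])
    show "\<exists>N. negligible N \<and> (\<forall>s\<in>{s0..s1} - N. 0 \<le> deriv t s * (max 0 (?\<xi> s - 1))\<^sup>2)"
      by (rule exI[of _ "Nt \<union> {s0, s1}"]) (use Nt in auto)
  qed
  then obtain NP where NP: "negligible NP" "\<forall>s\<in>{s0..s1} - NP. deriv t s * (max 0 (?\<xi> s - 1))\<^sup>2 = 0" by blast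
  define e' where "e' s = time_deriv T E (t s) (q s) * deriv t s + space_diff A E (t s) (q s) (velocity A q s)" for s
  note en = energy_derivative[OF t.ac tT acq sle, folded e'_def] energy_integrable[OF t.ac tT acq sle, folded e'_def]
    energy_integral[OF t.ac tT acq sle, folded e'_def]
  obtain Ne where Ne: "negligible Ne" "\<forall>s\<in>{s0<..<s1} - Ne. ((\<lambda>r. E (t r) (q r)) has_real_derivative e' s) (at s)"
    using en(1) by blast
  obtain Ns where Ns: "negligible Ns" "\<forall>s\<in>{s0..s1} - Ns. velocity A q s \<in> tangent_space A (q s) \<and> 0 \<le> speed A R q s"
    using speed_nonneg[OF acq sle] by blast
  have tmem: "t s \<in> {0..T}" if "s \<in> {s0..s1}" for s using tT that by blast
  \<comment> \<open>The defect in the limiting energy inequality. The chain rule and the slope bound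
    make it nonnegative pointwise, while the limit of the estimates makes its integral nonpositive,
    so it vanishes almost everywhere.\<close>
  define I where "I s = e' s - deriv t s * time_deriv T E (t s) (q s) + \<nu> s * max 1 (?\<xi> s)" for s
  let ?Nz = "Nt \<union> Nm \<union> Nq \<union> Ns \<union> {s0, s1}"
  have N0: "negligible ?Nz" using Nt(1) Nm(1) Nq(1) Ns(1) by simp
  have Db: "(\<lambda>s. deriv t s * time_deriv T E (t s) (q s)) absolutely_integrable_on {s0..s1}"
    by (rule abs_int_bounded_times[OF t'a continuous_measurable_bounded[OF cl[OF time_deriv_continuous]]])
  have Vb: "(\<lambda>s. \<nu> s * max 1 (?\<xi> s)) absolutely_integrable_on {s0..s1}"
    by (rule abs_int_bounded_times[OF \<nu>a continuous_measurable_bounded[OF cl[OF cont_max]]])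
  have facts: "0 \<le> deriv t s" "0 \<le> \<nu> s" "speed A R q s \<le> \<nu> s" "0 \<le> speed A R q s" "0 \<le> ?\<xi> s"
    "- (?\<xi> s * speed A R q s) \<le> space_diff A E (t s) (q s) (velocity A q s)"
    "I s = space_diff A E (t s) (q s) (velocity A q s) + \<nu> s * max 1 (?\<xi> s)" if s: "s \<in> {s0..s1} - ?Nz" for s
  proof -
    have 1: "s \<in> {s0..s1} - Nt" "s \<in> {s0<..<s1} - Nm" "s \<in> {s0<..<s1} - Nq" "s \<in> {s0..s1} - Ns" "s \<in> {s0..s1}" using s by auto
    show "0 \<le> deriv t s" "speed A R q s \<le> \<nu> s" using Nt(2) Nq(2) 1 by blast+
    show "0 \<le> \<nu> s" unfolding \<nu>_def using Nm(2) 1 by blast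
    have v: "velocity A q s \<in> tangent_space A (q s)" "0 \<le> speed A R q s" using Ns(2) 1 by blast+
    show "0 \<le> speed A R q s" by (rule v(2))
    show "0 \<le> ?\<xi> s" "- (?\<xi> s * speed A R q s) \<le> space_diff A E (t s) (q s) (velocity A q s)"
      using slope_bound(2,3)[OF tmem[OF 1(5)] v(1)] by (simp_all add: speed_def)
    show "I s = space_diff A E (t s) (q s) (velocity A q s) + \<nu> s * max 1 (?\<xi> s)" unfolding I_def e'_def by simp
  qed
  have key: "\<xi> * w \<le> \<nu>' * max 1 \<xi>" if "0 \<le> w" "w \<le> \<nu>'" "0 \<le> \<xi>" for \<xi> w \<nu>' :: real
  proof -
    have "\<xi> * w \<le> max 1 \<xi> * \<nu>'" using that by (intro mult_mono) auto
    then show ?thesis by (simp add: mult.commute)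
  qed
  have "\<exists>N. negligible N \<and> (\<forall>s\<in>{s0..s1} - N. I s = 0)"
  proof (rule negligible_of_integral_le_0)
    show "I absolutely_integrable_on {s0..s1}" unfolding I_def by (intro set_integral_add set_integral_diff en(2) Db Vb)
    show "\<exists>N. negligible N \<and> (\<forall>s\<in>{s0..s1} - N. 0 \<le> I s)"
    proof (intro exI[of _ ?Nz] conjI N0 ballI)
      fix s assume s: "s \<in> {s0..s1} - ?Nz"
      show "0 \<le> I s" using facts(6,7)[OF s] key[OF facts(4)[OF s] facts(3)[OF s] facts(5)[OF s]] by linarith
    qed
    have "(I has_integral (E (t s1) (q s1) - E (t s0) (q s0) - integral {s0..s1} (\<lambda>s. deriv t s * time_deriv T E (t s) (q s))
      + integral {s0..s1} (\<lambda>s. \<nu> s * max 1 (?\<xi> s)))) {s0..s1}"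
      unfolding I_def using Db Vb
      by (intro has_integral_add has_integral_diff en(3) integrable_integral) (simp_all add: set_lebesgue_integral_eq_integral(1))
    then show "integral {s0..s1} I \<le> 0" using ineqA by (simp add: integral_unique)
  qed
  then obtain NI where NI: "negligible NI" "\<forall>s\<in>{s0..s1} - NI. I s = 0" by blast
  let ?N = "?Nz \<union> NP \<union> NI \<union> Ne"
  have negN: "negligible ?N" using N0 NP(1) NI(1) Ne(1) by simp
  have concl: "speed A R q s = \<nu> s" "\<nu> s = 0 \<or> 1 \<le> ?\<xi> s" "deriv t s = 0 \<or> ?\<xi> s \<le> 1"
    "space_diff A E (t s) (q s) (velocity A q s) = - (speed A R q s * ?\<xi> s)" if s: "s \<in> {s0..s1} - ?N" for s
  proof -
    have s0: "s \<in> {s0..s1} - ?Nz" "s \<in> {s0..s1} - NI" "s \<in> {s0..s1} - NP" using s by auto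
    note f = facts[OF s0(1)]
    have I0: "space_diff A E (t s) (q s) (velocity A q s) = - (\<nu> s * max 1 (?\<xi> s))" using NI(2) s0(2) f(7) by fastforce
    then have le: "\<nu> s * max 1 (?\<xi> s) \<le> ?\<xi> s * speed A R q s" using f(6) by linarith
    have "speed A R q s = \<nu> s \<and> (\<nu> s = 0 \<or> 1 \<le> ?\<xi> s)"
    proof (cases "\<nu> s = 0")
      case True
      then show ?thesis using f(3,4) by simp
    next
      case False
      then have pos: "0 < \<nu> s" using f(2) by simp
      \<comment> \<open>For positive \<nu>, cancelling \<nu> gives
        \<open>max 1 \<xi> \<le> \<xi>\<close>, that is, a slope of at least 1. Then \<xi> can be
        cancelled too, and no speed has been lost in the limit.\<close>
      have "?\<xi> s * speed A R q s \<le> ?\<xi> s * \<nu> s" using f(3,5) by (rule mult_left_mono)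
      then have "max 1 (?\<xi> s) * \<nu> s \<le> ?\<xi> s * \<nu> s" using le by (simp add: mult.commute)
      then have "max 1 (?\<xi> s) \<le> ?\<xi> s" using pos by simp
      then have 1: "1 \<le> ?\<xi> s" "max 1 (?\<xi> s) = ?\<xi> s" by auto
      then have "?\<xi> s * \<nu> s \<le> ?\<xi> s * speed A R q s" using le by (simp add: mult.commute)
      then have "\<nu> s \<le> speed A R q s" using 1(1) by simp
      then show ?thesis using f(3) 1 by simp
    qed
    then show r: "speed A R q s = \<nu> s" "\<nu> s = 0 \<or> 1 \<le> ?\<xi> s" by blast+
    show "deriv t s = 0 \<or> ?\<xi> s \<le> 1" 
    proof (rule disjCI)
      assume "\<not> ?\<xi> s \<le> 1"
      then have "(max 0 (?\<xi> s - 1))\<^sup>2 \<noteq> 0" by simp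
      then show "deriv t s = 0" using bspec[OF NP(2) s0(3)] by (simp only: mult_eq_0_iff simp_thms)
    qed
    show "space_diff A E (t s) (q s) (velocity A q s) = - (speed A R q s * ?\<xi> s)"
      using I0 r by (auto simp: max_absorb2)
  qed
  show "\<exists>N. negligible N \<and> (\<forall>s\<in>{s0<..<s1} - N.
      ((\<lambda>r. E (t r) (q r)) has_real_derivative
        (time_deriv T E (t s) (q s) * deriv t s - speed A R q s * ?\<xi> s)) (at s) \<and>
      (deriv t s, speed A R q s, ?\<xi> s) \<in> Xi_set \<and>
      0 \<le> deriv t s \<and> 0 \<le> speed A R q s \<and> 0 \<le> ?\<xi> s \<and> deriv t s + speed A R q s = m s)"
  proof (rule exI[of _ ?N], rule conjI[OF negN], rule ballI)
    fix s assume s: "s \<in> {s0<..<s1} - ?N"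
    have s1': "s \<in> {s0..s1} - ?N" and s2: "s \<in> {s0..s1} - ?Nz" and s3: "s \<in> {s0<..<s1} - Ne" using s by auto
    note f = facts[OF s2] and c = concl[OF s1']
    have "((\<lambda>r. E (t r) (q r)) has_real_derivative e' s) (at s)" using Ne(2) s3 by blast
    moreover have "e' s = time_deriv T E (t s) (q s) * deriv t s - speed A R q s * ?\<xi> s" unfolding e'_def using c(4) by simp
    moreover have "(deriv t s, speed A R q s, ?\<xi> s) \<in> Xi_set"
    proof -
      \<comment> \<open>The three pieces of \<open>Xi_set\<close>: a slope below 1 forces rest, time
        may stand still with slope at least 1, and if time runs with slope at least 1, the slope is
        exactly 1.\<close>
      consider "speed A R q s = 0" "?\<xi> s < 1" | "deriv t s = 0" "1 \<le> ?\<xi> s" | "0 < deriv t s" "?\<xi> s = 1"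
        using c f(1) by fastforce
      then show ?thesis using f(1,4,5) unfolding Xi_set_def by cases auto
    qed
    moreover have "deriv t s + speed A R q s = m s" using c(1) by (simp add: \<nu>_def)
    ultimately show "((\<lambda>r. E (t r) (q r)) has_real_derivative
        (time_deriv T E (t s) (q s) * deriv t s - speed A R q s * ?\<xi> s)) (at s) \<and>
      (deriv t s, speed A R q s, ?\<xi> s) \<in> Xi_set \<and>
      0 \<le> deriv t s \<and> 0 \<le> speed A R q s \<and> 0 \<le> ?\<xi> s \<and> deriv t s + speed A R q s = m s"
      using f(1,4,5) by simp
  qed
  \<comment> \<open>The identification of \<nu> with the speed of the limit turns the weak limit of
    the speeds into the asserted one and yields convergence of the lengths.\<close>
  have sq_eq: "integral {s0..s1} (\<lambda>s. \<nu> s * g s) = integral {s0..s1} (\<lambda>s. speed A R q s * g s)" for g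
    by (rule integral_spike[OF negN]) (use concl(1) in simp)
  have sqa: "speed A R q absolutely_integrable_on {s0..s1}" by (rule speed_integrable[OF acq sle])
  show "(\<lambda>n. integral {te n s0..T} (speed A R (qe n))) \<longlonglongrightarrow> integral {s0..s1} (speed A R q)"
  proof -
    have one: "(\<lambda>_::real. 1::real) \<in> borel_measurable (lebesgue_on {s0..s1})" "bounded ((\<lambda>_::real. 1::real) ` {s0..s1})"
      by (auto intro!: boundedI[of _ 1])
    have "(\<lambda>n. integral {s0..s1} (speed A R (z n))) \<longlonglongrightarrow> integral {s0..s1} (speed A R q)"
      using weak_\<nu>[OF one] unfolding sq_eq spint by simp
    moreover have "integral {s0..s1} (speed A R (z n)) = integral {te n s0..T} (speed A R (qe n))" for n
      using length_compose[OF te qen, of n] unfolding z_def te1 .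
    ultimately show ?thesis by simp
  qed
  show "weak_L1_limit s0 s1 (\<lambda>n s. (deriv (te n) s, speed A R (qh n) s)) (\<lambda>s. (deriv t s, speed A R q s)) sequentially"
  proof -
    have pair: "(\<lambda>s. (f s, k s)) absolutely_integrable_on {s0..s1}"
      if "f absolutely_integrable_on {s0..s1}" "k absolutely_integrable_on {s0..s1}" for f k :: "real \<Rightarrow> real"
    proof -
      have "(\<lambda>s. f s *\<^sub>R (1::real, 0::real) + k s *\<^sub>R (0::real, 1::real)) absolutely_integrable_on {s0..s1}"
        by (intro set_integral_add absolutely_integrable_scaleR_right that)
      then show ?thesis by simp
    qed
    have conv: "(\<lambda>n. integral {s0..s1} (\<lambda>s. (deriv (te n) s, speed A R (qh n) s) \<bullet> g s)) \<longlonglongrightarrow> integral {s0..s1} (\<lambda>s. (deriv t s, speed A R q s) \<bullet> g s)"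
      if g: "g \<in> borel_measurable (lebesgue_on {s0..s1})" and C: "AE s in lebesgue_on {s0..s1}. norm (g s) \<le> C" for g :: "real \<Rightarrow> real \<times> real" and C
    proof -
      obtain N where N: "negligible N" "\<forall>s\<in>{s0..s1} - N. norm (g s) \<le> C" using C by (subst (asm) AE_lebesgue_on_iff) auto
      \<comment> \<open>An essential bound on a vector-valued test function becomes a bound at every
        point for both components; outside the null set \<open>N\<close> clipping changes nothing.
        \<open>\<bar>C\<bar>\<close> is used because \<open>C\<close> may be negative when the
        interval carries no information.\<close>
      define clip where "clip x = max (- \<bar>C\<bar>) (min \<bar>C\<bar> x)" for x :: real
      let ?g1 = "\<lambda>s. clip (fst (g s))" and ?g2 = "\<lambda>s. clip (snd (g s))"
      have clipb: "\<bar>clip x\<bar> \<le> \<bar>C\<bar>" for x unfolding clip_def by (auto simp: abs_le_iff)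
      have m1: "?g1 \<in> borel_measurable (lebesgue_on {s0..s1})" "?g2 \<in> borel_measurable (lebesgue_on {s0..s1})"
        unfolding clip_def by (rule measurable_compose[OF g borel_measurable_continuous_onI], intro continuous_intros)+
      have b1: "bounded (?g1 ` {s0..s1})" "bounded (?g2 ` {s0..s1})" using clipb by (auto intro!: boundedI[of _ "\<bar>C\<bar>"])
      have eq: "integral {s0..s1} (\<lambda>s. (f s, k s) \<bullet> g s) = integral {s0..s1} (\<lambda>s. f s * ?g1 s) + integral {s0..s1} (\<lambda>s. k s * ?g2 s)"
        if fk: "f absolutely_integrable_on {s0..s1}" "k absolutely_integrable_on {s0..s1}" for f k
      proof -
        have "integral {s0..s1} (\<lambda>s. (f s, k s) \<bullet> g s) = integral {s0..s1} (\<lambda>s. f s * ?g1 s + k s * ?g2 s)"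
        proof (rule integral_spike[OF N(1)])
          fix s assume s: "s \<in> {s0..s1} - N"
          then have n: "norm (g s) \<le> \<bar>C\<bar>" using bspec[OF N(2) s] abs_ge_self[of C] by linarith
          have "\<bar>fst (g s)\<bar> \<le> \<bar>C\<bar>" "\<bar>snd (g s)\<bar> \<le> \<bar>C\<bar>"
            using norm_fst_le[of "fst (g s)" "snd (g s)"] norm_snd_le[of "snd (g s)" "fst (g s)"] n by auto
          then have "clip (fst (g s)) = fst (g s)" "clip (snd (g s)) = snd (g s)" unfolding clip_def by (auto simp: abs_le_iff)
          then show "f s * ?g1 s + k s * ?g2 s = (f s, k s) \<bullet> g s" by (simp add: inner_prod_def)
        qed
        also have "\<dots> = integral {s0..s1} (\<lambda>s. f s * ?g1 s) + integral {s0..s1} (\<lambda>s. k s * ?g2 s)"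
          using abs_int_bounded_times[OF fk(1) m1(1) b1(1)] abs_int_bounded_times[OF fk(2) m1(2) b1(2)]
          by (intro Henstock_Kurzweil_Integration.integral_add) (simp_all add: set_lebesgue_integral_eq_integral(1))
        finally show ?thesis .
      qed
      show ?thesis
        unfolding eq[OF dta spa] eq[OF t'a sqa] sq_eq[symmetric]
        by (intro tendsto_add weak_t weak_\<nu> m1 b1)
    qed
    show ?thesis
      unfolding weak_L1_limit_def
    proof (intro conjI always_eventually allI impI)
      show "(\<lambda>s. (deriv (te n) s, speed A R (qh n) s)) absolutely_integrable_on {s0..s1}" for n by (rule pair[OF dta spa])
      show "(\<lambda>s. (deriv t s, speed A R q s)) absolutely_integrable_on {s0..s1}" by (rule pair[OF t'a sqa])
    qed (elim conjE exE, rule conv)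
  qed
qed

end

section \<open>Extraction of a convergent subsequence\<close>

context finsler_space
begin

text \<open>The times lie in a compact interval. For the positions only the starting points are
  known to be relatively compact, and equicontinuity has to spread this along the curves. The two
  extractions are made one after the other, so the subsequences are composed.\<close>

lemma arc_compactness:
  fixes te :: "nat \<Rightarrow> real \<Rightarrow> real" and qh :: "nat \<Rightarrow> real \<Rightarrow> 'q"
  assumes comp: mcomplete
    and maj: "weak_majorant a b (\<lambda>n s. deriv (te n) s + speed A R (qh n) s) m"
    and te: "\<And>n. mono_ac a b (te n)" and teT: "\<And>n. te n ` {a..b} \<subseteq> {0..T}"
    and qh: "\<And>n. ac_curve A a b (qh n)" and start: "(\<lambda>n. qh n a) \<longlonglongrightarrow> q0"
  obtains r t q where "strict_mono r"
    "\<forall>e>0. \<forall>\<^sub>F n in sequentially. \<forall>s\<in>{a..b}. \<bar>te (r n) s - t s\<bar> < e"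
    "\<forall>e>0. \<forall>\<^sub>F n in sequentially. \<forall>s\<in>{a..b}. d (qh (r n) s) (q s) < e"
proof -
  interpret W: weak_majorant a b "\<lambda>n s. deriv (te n) s + speed A R (qh n) s" m by (rule maj)
  have equi: "\<exists>\<delta>>0. \<forall>\<^sub>F n in sequentially. \<forall>s\<in>{a..b}. \<forall>s'\<in>{a..b}. \<bar>s - s'\<bar> < \<delta> \<longrightarrow>
      dist (te n s) (te n s') < e \<and> d (qh n s) (qh n s') < e" if e: "e > 0" for e
  proof -
    obtain \<delta> where \<delta>: "\<delta> > 0" "\<forall>\<^sub>F n in sequentially. \<forall>u v. a \<le> u \<longrightarrow> u \<le> v \<longrightarrow> v \<le> b \<longrightarrow> v - u < \<delta> \<longrightarrow>
        integral {u..v} (\<lambda>s. deriv (te n) s + speed A R (qh n) s) < e" using W.m_equicontinuous[OF e] by (elim exE conjE)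
    from \<delta>(2) have "\<forall>\<^sub>F n in sequentially. \<forall>s\<in>{a..b}. \<forall>s'\<in>{a..b}. \<bar>s - s'\<bar> < \<delta> \<longrightarrow>
      dist (te n s) (te n s') < e \<and> d (qh n s) (qh n s') < e"
    proof eventually_elim
      case (elim n)
      have 1: "\<bar>te n u - te n v\<bar> < e \<and> d (qh n u) (qh n v) < e" if uv: "a \<le> u" "u \<le> v" "v \<le> b" "v - u < \<delta>" for u v
        using arc_bounds(3,4)[OF te[of n] qh[of n] uv(1-3)] elim[rule_format, OF uv] by simp
      show ?case
      proof (intro ballI impI)
        fix s s' assume s: "s \<in> {a..b}" "s' \<in> {a..b}" "\<bar>s - s'\<bar> < \<delta>"
        show "dist (te n s) (te n s') < e \<and> d (qh n s) (qh n s') < e"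
        proof (cases "s \<le> s'")
          case True
          then show ?thesis using 1[of s s'] s by (simp add: dist_real_def)
        next
          case False
          then show ?thesis using 1[of s' s] s d_sym[of "qh n s"] by (simp add: dist_real_def abs_minus_commute)
        qed
      qed
    qed
    then show ?thesis using \<delta>(1) by (intro exI[of _ \<delta>] conjI)
  qed
  have equit: "\<exists>\<delta>>0. \<forall>\<^sub>F n in sequentially. \<forall>s\<in>{a..b}. \<forall>s'\<in>{a..b}. \<bar>s - s'\<bar> < \<delta> \<longrightarrow> dist (te n s) (te n s') < e"
    and equiq: "\<exists>\<delta>>0. \<forall>\<^sub>F n in sequentially. \<forall>s\<in>{a..b}. \<forall>s'\<in>{a..b}. \<bar>s - s'\<bar> < \<delta> \<longrightarrow> d (qh n s) (qh n s') < e" if e: "e > 0" for e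
  proof -
    obtain \<delta> where \<delta>: "\<delta> > 0" and ev: "\<forall>\<^sub>F n in sequentially. \<forall>s\<in>{a..b}. \<forall>s'\<in>{a..b}. \<bar>s - s'\<bar> < \<delta> \<longrightarrow>
      dist (te n s) (te n s') < e \<and> d (qh n s) (qh n s') < e" using equi[OF e] by (elim exE conjE)
    show "\<exists>\<delta>>0. \<forall>\<^sub>F n in sequentially. \<forall>s\<in>{a..b}. \<forall>s'\<in>{a..b}. \<bar>s - s'\<bar> < \<delta> \<longrightarrow> dist (te n s) (te n s') < e"
      by (rule exI[of _ \<delta>], rule conjI[OF \<delta>], rule eventually_mono[OF ev]) blast
    show "\<exists>\<delta>>0. \<forall>\<^sub>F n in sequentially. \<forall>s\<in>{a..b}. \<forall>s'\<in>{a..b}. \<bar>s - s'\<bar> < \<delta> \<longrightarrow> d (qh n s) (qh n s') < e"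
      by (rule exI[of _ \<delta>], rule conjI[OF \<delta>], rule eventually_mono[OF ev]) blast
  qed
  have "limitin mtopology (\<lambda>n. qh n a) q0 sequentially" unfolding mtopology_euclidean using start by simp
  then have "MCauchy (\<lambda>n. qh n a)" by (intro convergent_imp_MCauchy) auto
  then have startb: "mtotally_bounded (range (\<lambda>n. qh n a))" by (rule mtotally_bounded_cauchy_sequence)
  have tb: "mtotally_bounded (range (\<lambda>n. qh n s))" if s: "s \<in> {a..b}" for s
    by (rule equicontinuous_mtotally_bounded[OF comp equiq startb s])
  obtain r1 q where r1: "strict_mono r1" and q: "\<forall>e>0. \<forall>\<^sub>F n in sequentially. \<forall>s\<in>{a..b}. d (qh (r1 n) s) (q s) < e"
    by (rule equicontinuous_subsequence[OF comp W.ab tb equiq])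
  have compR: "Met_TC.mcomplete TYPE(real)" unfolding mcomplete_iff_complete by (rule complete_UNIV)
  have tbt: "Met_TC.mtotally_bounded (range (\<lambda>n. te (r1 n) s))" if s: "s \<in> {a..b}" for s
  proof (rule Met_TC.mtotally_bounded_subset[OF Met_TC.compactin_imp_mtotally_bounded])
    show "compactin Met_TC.mtopology {0..T}" by simp
    show "range (\<lambda>n. te (r1 n) s) \<subseteq> {0..T}" using teT s by blast
  qed
  have equit1: "\<exists>\<delta>>0. \<forall>\<^sub>F n in sequentially. \<forall>s\<in>{a..b}. \<forall>s'\<in>{a..b}. \<bar>s - s'\<bar> < \<delta> \<longrightarrow> dist (te (r1 n) s) (te (r1 n) s') < e" if e: "e > 0" for e
  proof -
    obtain \<delta> where \<delta>: "\<delta> > 0" and ev: "\<forall>\<^sub>F n in sequentially. \<forall>s\<in>{a..b}. \<forall>s'\<in>{a..b}. \<bar>s - s'\<bar> < \<delta> \<longrightarrow> dist (te n s) (te n s') < e"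
      using equit[OF e] by (elim exE conjE)
    show ?thesis by (rule exI[of _ \<delta>], rule conjI[OF \<delta> eventually_subseq[OF r1 ev]])
  qed
  obtain r2 t where r2: "strict_mono r2" and t: "\<forall>e>0. \<forall>\<^sub>F n in sequentially. \<forall>s\<in>{a..b}. dist (te (r1 (r2 n)) s) (t s) < e"
    by (rule Met_TC.equicontinuous_subsequence[OF compR W.ab tbt equit1])
  show ?thesis
  proof (rule that[of "r1 \<circ> r2" t q])
    show "strict_mono (r1 \<circ> r2)" by (rule strict_mono_o[OF r1 r2])
    show "\<forall>e>0. \<forall>\<^sub>F n in sequentially. \<forall>s\<in>{a..b}. \<bar>te ((r1 \<circ> r2) n) s - t s\<bar> < e"
      using t by (simp add: dist_real_def)
    show "\<forall>e>0. \<forall>\<^sub>F n in sequentially. \<forall>s\<in>{a..b}. d (qh ((r1 \<circ> r2) n) s) (q s) < e"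
      using q eventually_subseq[OF r2] by (auto simp: o_def)
  qed
qed

end

theorem theorem3p8:
  fixes A :: "('q::{second_countable_topology,t2_space}, 'e::euclidean_space) chart set"
    and R :: "'q \<Rightarrow> ('q, 'e) tvec \<Rightarrow> real"
    and T :: real
    and E :: "real \<Rightarrow> 'q \<Rightarrow> real"
    and M :: "real \<times> real \<times> real \<Rightarrow> ennreal"
    and q_eps :: "real \<Rightarrow> real \<Rightarrow> 'q"
    and s0 s1 :: real
    and t0_eps :: "real \<Rightarrow> real"
    and that_eps :: "real \<Rightarrow> real \<Rightarrow> real"
    and qhat_eps :: "real \<Rightarrow> real \<Rightarrow> 'q"
    and q0 :: 'q
    and m :: "real \<Rightarrow> real"
  assumes "T > 0"
    and "smooth_atlas A"
    and "finsler_structure A R"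
    and "\<And>x y. connecting_lengths A R x y \<noteq> {}"
    and "Metric_space.mcomplete UNIV (finsler_dist A R)"
    and "C1_energy A T E"
    and "admissible_M M"
    and "\<And>\<epsilon>. \<epsilon> > 0 \<Longrightarrow> ac_curve A 0 T (q_eps \<epsilon>)"
    and "\<And>\<epsilon>. \<epsilon> > 0 \<Longrightarrow>
      (AE t\<in>{0<..<T} in lebesgue.
         \<exists>e'. ((\<lambda>\<tau>. E \<tau> (q_eps \<epsilon> \<tau>)) has_real_derivative e') (at t) \<and>
           e' \<le> time_deriv T E t (q_eps \<epsilon> t) - psi \<epsilon> (speed A R (q_eps \<epsilon>) t)
                 - psi_star \<epsilon> (slope A R E t (q_eps \<epsilon> t)))"
    and "s0 < s1"
    and "\<And>\<epsilon>. \<epsilon> > 0 \<Longrightarrow>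
      0 \<le> t0_eps \<epsilon> \<and> abs_cont_on s0 s1 (that_eps \<epsilon>) \<and> mono_on {s0..s1} (that_eps \<epsilon>) \<and>
      that_eps \<epsilon> ` {s0..s1} = {t0_eps \<epsilon>..T}"
    and "\<And>\<epsilon> s. \<epsilon> > 0 \<Longrightarrow> s \<in> {s0..s1} \<Longrightarrow> qhat_eps \<epsilon> s = q_eps \<epsilon> (that_eps \<epsilon> s)"
    and "(t0_eps \<longlongrightarrow> 0) (at_right 0)"
    and "((\<lambda>\<epsilon>. qhat_eps \<epsilon> s0) \<longlongrightarrow> q0) (at_right 0)"
    and "weak_L1_limit s0 s1 (\<lambda>\<epsilon> s. deriv (that_eps \<epsilon>) s + speed A R (qhat_eps \<epsilon>) s) m (at_right 0)"
  shows "\<exists>(\<epsilon> :: nat \<Rightarrow> real) (that :: real \<Rightarrow> real) (qhat :: real \<Rightarrow> 'q).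
    (\<forall>k. \<epsilon> k > 0) \<and> strict_antimono_on UNIV \<epsilon> \<and> \<epsilon> \<longlonglongrightarrow> 0 \<and>
    abs_cont_on s0 s1 that \<and> that ` {s0..s1} \<subseteq> {0..T} \<and> ac_curve A s0 s1 qhat \<and>
    that s0 = 0 \<and> qhat s0 = q0 \<and>
    uniform_limit {s0..s1} (\<lambda>k. that_eps (\<epsilon> k)) that sequentially \<and>
    (\<forall>\<eta>>0. \<forall>\<^sub>F k in sequentially. \<forall>s\<in>{s0..s1}.
       finsler_dist A R (qhat_eps (\<epsilon> k) s) (qhat s) < \<eta>) \<and>
    weak_L1_limit s0 s1
      (\<lambda>k s. (deriv (that_eps (\<epsilon> k)) s, speed A R (qhat_eps (\<epsilon> k)) s))
      (\<lambda>s. (deriv that s, speed A R qhat s)) sequentially \<and>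
    (\<lambda>k. integral {t0_eps (\<epsilon> k)..T} (speed A R (q_eps (\<epsilon> k))))
      \<longlonglongrightarrow> integral {s0..s1} (speed A R qhat) \<and>
    degenerate_param_solution A R T E M s0 s1 that qhat \<and>
    ((AE s\<in>{s0<..<s1} in lebesgue. m s > 0) \<longrightarrow> param_solution A R T E M s0 s1 that qhat)"
proof -
  interpret finsler_energy A R T E
    by unfold_locales (use assms(1-6) in auto)
  \<comment> \<open>A strictly decreasing null sequence, so that every subsequence of it is again
    strictly decreasing.\<close>
  define es where "es n = 1 / real (Suc n)" for n
  have es0: "0 < es n" for n by (simp add: es_def)
  have es_lim: "es \<longlonglongrightarrow> 0" unfolding es_def by (rule LIMSEQ_Suc[OF lim_1_over_n])
  have es_right: "filterlim es (at_right 0) sequentially"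
    unfolding filterlim_at using es_lim es0 by (simp add: less_imp_neq[OF es0, symmetric])
  have sle: "s0 \<le> s1" using \<open>s0 < s1\<close> by simp
  note par = assms(11)
  have te: "mono_ac s0 s1 (that_eps e)" if "e > 0" for e using par[OF that] sle by (intro mono_ac.intro) auto
  have img: "that_eps e ` {s0..s1} = {t0_eps e..T}" "0 \<le> t0_eps e" if "e > 0" for e using par[OF that] by auto
  have mon: "that_eps e u \<le> that_eps e v" if "e > 0" "u \<in> {s0..s1}" "v \<in> {s0..s1}" "u \<le> v" for e u v
    using mono_onD[OF mono_ac.mono[OF te[OF that(1)]] that(2,3,4)] .
  \<comment> \<open>A monotone map onto the interval attains both of its bounds somewhere and
    therefore also at the ends of the parameter interval.\<close>
  have ends: "that_eps e s0 = t0_eps e" "that_eps e s1 = T" if e: "e > 0" for e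
  proof -
    have m: "s0 \<in> {s0..s1}" "s1 \<in> {s0..s1}" using sle by auto
    have "{t0_eps e..T} \<noteq> {}" using img(1)[OF e] m by blast
    then have 1: "t0_eps e \<in> that_eps e ` {s0..s1}" "T \<in> that_eps e ` {s0..s1}" using img(1)[OF e] by auto
    have 2: "that_eps e s0 \<in> {t0_eps e..T}" "that_eps e s1 \<in> {t0_eps e..T}" using img(1)[OF e] m by blast+
    obtain u v where "u \<in> {s0..s1}" "t0_eps e = that_eps e u" "v \<in> {s0..s1}" "T = that_eps e v" using 1 by blast
    then show "that_eps e s0 = t0_eps e" "that_eps e s1 = T"
      using mon[OF e m(1), of u] mon[OF e _ m(2), of v] 2 by auto
  qed
  have teT: "that_eps e ` {s0..s1} \<subseteq> {0..T}" if "e > 0" for e using img[OF that] by auto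
  have qh: "ac_curve A s0 s1 (qhat_eps e)" if e: "e > 0" for e
  proof (rule ac_curve_cong)
    have "ac_curve A (that_eps e s0) (that_eps e s1) (q_eps e)"
      using ac_curve_subinterval[OF assms(8)[OF e]] ends[OF e] img(2)[OF e] by simp
    then show "ac_curve A s0 s1 (q_eps e \<circ> that_eps e)" by (rule ac_curve_compose(1)[OF te[OF e]])
    show "(q_eps e \<circ> that_eps e) s = qhat_eps e s" if "s \<in> {s0..s1}" for s using assms(12)[OF e that] by simp
  qed
  \<comment> \<open>Stated for an arbitrary divergent index sequence because it is used twice: with
    the identity for compactness, and with the extracted indices for the passage to the
    limit.\<close>
  have maj: "weak_majorant s0 s1 (\<lambda>n s. deriv (that_eps (es (k n))) s + speed A R (qhat_eps (es (k n))) s) m"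
    if k: "filterlim k sequentially sequentially" for k
  proof (rule weak_majorantI[OF sle])
    show "weak_L1_limit s0 s1 (\<lambda>n s. deriv (that_eps (es (k n))) s + speed A R (qhat_eps (es (k n))) s) m sequentially"
      by (rule weak_L1_limit_filterlim[OF assms(15) filterlim_compose[OF es_right k]])
  qed (rule arc_bounds(2,1)[OF te[OF es0] qh[OF es0]])+
  have start: "(\<lambda>n. qhat_eps (es n) s0) \<longlonglongrightarrow> q0" by (rule filterlim_compose[OF assms(14) es_right])
  obtain r t q where r: "strict_mono r"
    and tu: "\<forall>e>0. \<forall>\<^sub>F n in sequentially. \<forall>s\<in>{s0..s1}. \<bar>that_eps (es (r n)) s - t s\<bar> < e"
    and qu: "\<forall>e>0. \<forall>\<^sub>F n in sequentially. \<forall>s\<in>{s0..s1}. d (qhat_eps (es (r n)) s) (q s) < e"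
    by (rule arc_compactness[OF assms(5) maj[OF filterlim_ident] te[OF es0] teT[OF es0] qh[OF es0] start])
  let ?e = "\<lambda>k. es (r k)"
  have r_lim: "filterlim r sequentially sequentially" by (rule filterlim_subseq[OF r])
  have e_lim: "?e \<longlonglongrightarrow> 0" by (rule filterlim_compose[OF es_lim r_lim])
  have te0: "0 \<le> that_eps (?e n) s0" for n using ends(1)[OF es0] img(2)[OF es0] by simp
  have qh_eq: "\<forall>s\<in>{s0..s1}. qhat_eps (?e n) s = q_eps (?e n) (that_eps (?e n) s)" for n using assms(12)[OF es0] by blast
  note lim = limit_passage[OF \<open>s0 < s1\<close> es0 e_lim assms(8)[OF es0] assms(9)[OF es0] te[OF es0] te0 ends(2)[OF es0]
    qh_eq maj[OF r_lim] tu qu]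
  interpret t: mono_ac s0 s1 t by (rule lim(1))
  have s0m: "s0 \<in> {s0..s1}" using sle by simp
  have t0: "t s0 = 0"
  proof (rule LIMSEQ_unique)
    show "(\<lambda>n. that_eps (?e n) s0) \<longlonglongrightarrow> 0"
      unfolding ends(1)[OF es0] by (rule filterlim_compose[OF assms(13) filterlim_compose[OF es_right r_lim]])
    show "(\<lambda>n. that_eps (?e n) s0) \<longlonglongrightarrow> t s0"
    proof (rule tendstoI)
      fix e :: real assume "e > 0"
      with tu have "\<forall>\<^sub>F n in sequentially. \<forall>s\<in>{s0..s1}. \<bar>that_eps (?e n) s - t s\<bar> < e" by blast
      then show "\<forall>\<^sub>F n in sequentially. dist (that_eps (?e n) s0) (t s0) < e"
        by eventually_elim (use s0m in \<open>simp add: dist_real_def\<close>)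
    qed
  qed
  have q0: "q s0 = q0"
  proof (rule LIMSEQ_unique)
    show "(\<lambda>n. qhat_eps (?e n) s0) \<longlonglongrightarrow> q0" by (rule filterlim_compose[OF start r_lim])
    show "(\<lambda>n. qhat_eps (?e n) s0) \<longlonglongrightarrow> q s0"
      unfolding tendsto_iff_d
    proof (rule tendstoI)
      fix e :: real assume "e > 0"
      with qu have "\<forall>\<^sub>F n in sequentially. \<forall>s\<in>{s0..s1}. d (qhat_eps (?e n) s) (q s) < e" by blast
      then show "\<forall>\<^sub>F n in sequentially. dist (d (qhat_eps (?e n) s0) (q s0)) 0 < e"
        by eventually_elim (use s0m d_nonneg in \<open>simp add: dist_real_def\<close>)
    qed
  qed
  obtain N where N: "negligible N" "\<forall>s\<in>{s0<..<s1} - N.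
      ((\<lambda>r. E (t r) (q r)) has_real_derivative
        (time_deriv T E (t s) (q s) * deriv t s - speed A R q s * slope A R E (t s) (q s))) (at s) \<and>
      (deriv t s, speed A R q s, slope A R E (t s) (q s)) \<in> Xi_set \<and>
      0 \<le> deriv t s \<and> 0 \<le> speed A R q s \<and> 0 \<le> slope A R E (t s) (q s) \<and> deriv t s + speed A R q s = m s"
    using lim(6) by (elim exE conjE)
  have deg: "degenerate_param_solution A R T E M s0 s1 t q"
    unfolding degenerate_param_solution_def
  proof (intro conjI t.ac t.mono lim(2,3))
    show "AE s\<in>{s0<..<s1} in lebesgue. \<exists>e'. ((\<lambda>r. E (t r) (q r)) has_real_derivative e') (at s) \<and>
          ereal (e' - time_deriv T E (t s) (q s) * deriv t s)
            \<le> - enn2ereal (M (deriv t s, speed A R q s, slope A R E (t s) (q s)))"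
      unfolding AE_lebesgue_iff
    proof (intro exI[of _ N] conjI N(1) allI impI)
      fix s assume "s \<notin> N" "s \<in> {s0<..<s1}"
      then have s: "s \<in> {s0<..<s1} - N" by simp
      note f = bspec[OF N(2) s]
      let ?\<xi> = "slope A R E (t s) (q s)"
      \<comment> \<open>Membership in \<open>Xi_set\<close> determines the value of
        \<open>M\<close>, in particular that it is finite, so the inequality in the extended reals
        becomes the identity obtained in the limit.\<close>
      have "M (deriv t s, speed A R q s, ?\<xi>) = ennreal (speed A R q s * ?\<xi>)"
        using \<open>admissible_M M\<close> f unfolding admissible_M_def by blast
      then have "- enn2ereal (M (deriv t s, speed A R q s, ?\<xi>)) = ereal (- (speed A R q s * ?\<xi>))"
        using f by simp
      then show "\<exists>e'. ((\<lambda>r. E (t r) (q r)) has_real_derivative e') (at s) \<and>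
          ereal (e' - time_deriv T E (t s) (q s) * deriv t s) \<le> - enn2ereal (M (deriv t s, speed A R q s, ?\<xi>))"
        using f by (intro exI[of _ "time_deriv T E (t s) (q s) * deriv t s - speed A R q s * ?\<xi>"]) simp
    qed
  qed
  have nondeg: "param_solution A R T E M s0 s1 t q" if "AE s\<in>{s0<..<s1} in lebesgue. m s > 0"
    unfolding param_solution_def
  proof (intro conjI deg)
    have "AE s in lebesgue. s \<notin> N" unfolding AE_lebesgue_iff using N(1) by blast
    with that show "AE s\<in>{s0<..<s1} in lebesgue. deriv t s + speed A R q s > 0"
      by eventually_elim (use N(2) in auto)
  qed
  have anti: "strict_antimono_on UNIV ?e"
    by (rule monotone_onI) (use strict_monoD[OF r] in \<open>simp add: es_def frac_less2\<close>)
  have unif: "uniform_limit {s0..s1} (\<lambda>k. that_eps (?e k)) t sequentially"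
    unfolding uniform_limit_iff dist_real_def by (rule tu)
  show ?thesis
  proof (intro exI[of _ ?e] exI[of _ t] exI[of _ q] conjI)
    show "(\<lambda>k. integral {t0_eps (?e k)..T} (speed A R (q_eps (?e k)))) \<longlonglongrightarrow> integral {s0..s1} (speed A R q)"
      using lim(5) unfolding ends(1)[OF es0] .
  qed (use es0 anti e_lim t.ac lim(2,3,4) t0 q0 unif qu deg nondeg in blast)+
qed

end
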